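(* Let $\delta>1$, $k>0$, $w\in A_s$, let $\mathcal A$ satisfy the structural conditions listed in the context, and let $f\ge0$, $f\not\equiv0$, satisfy: $f\in L^{(p_s^* )'}(\Omega)$ if $1\le p_s<N$; $f\in L^m(\Omega)$ for some $m>1$ if $p_s=N$; $f\in L^1(\Omega)$ if $p_s>N$. Let $v$ be a super-solution (see context) of $$-\operatorname{div}(\mathcal A(x,\nabla u))=\frac{f(x)}{u^\delta}\ \text{in }\Omega,\qquad u>0\ \text{in }\Omega,\qquad u=0\ \text{on }\partial\Omega,$$ and set $\mathbb K=\{\phi\in X:0\le\phi\le v\text{ a.e. in }\Omega\}$, where $X=W^{1,p}_0(\Omega,w)$. Let $g_k(t)=\min\{t^{-\delta},k\}$ for $t>0$ and $g_k(t)=k$ for $t\le0$. Then there exists $z\in\mathbb K$ such that for every nonnegative $\phi\in C_c^1(\Omega)$, $$\int_\Omega\mathcal A(x,\nabla z)\cdot\nabla\phi\,dx\ge\int_\Omega f(x)\,g_k(z)\,\phi\,dx.$$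
   Context: Setting: $N\ge 2$, $\Omega\subset\mathbb R^N$ is a bounded smooth domain, $1<p<\infty$. Weights: a locally integrable $w:\mathbb R^N\to(0,\infty)$ (with $0<w<\infty$ a.e.) belongs to $A_p$ if there is $c_{p,w}>0$ such that $\left(\frac1{|B|}\int_B w\,dx\right)\left(\frac1{|B|}\int_B w^{-\frac1{p-1}}dx\right)^{p-1}\le c_{p,w}$ for all balls $B\subset\mathbb R^N$. Fix $s\in[\frac1{p-1},\infty)\cap(\frac Np,\infty)$; $w\in A_s$ means $w\in A_p$ and $w^{-s}\in L^1(\Omega)$. Set $p_s=\frac{ps}{s+1}\in[1,p)$ and, if $p_s<N$, $p_s^*=\frac{Np_s}{N-p_s}$. For an exponent $r$, $r'$ is the Hölder conjugate. Spaces: $W^{1,p}(\Omega,w)$ is the space of (weakly differentiable) measurable $u$ with $\|u\|_{1,p,w}=(\int_\Omega|u|^pw\,dx)^{1/p}+(\int_\Omega|\nabla u|^pw\,dx)^{1/p}<\infty$; $X=W^{1,p}_0(\Omega,w)$ is the closure of $C_c^\infty(\Omega)$ in it, and $\left(\int_\Omega|\nabla u|^pw\,dx\right)^{1/p}$ is an equivalent norm on $X$. $u\in W^{1,p}_{loc}(\Omega,w)$ means $u\in W^{1,p}(\Omega',w)$ for every $\Omega'\Subset\Omega$. Operator: $\mathcal A:\Omega\times\mathbb R^N\to\mathbb R^N$ is Carathéodory ($\mathcal A(\cdot,\zeta)$ measurable for every $\zeta$; $\mathcal A(x,\cdot)$ continuous for a.e. $x$), and for a.e. $x\in\Omega$ and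 all vectors in $\mathbb R^N$: (growth) $|\mathcal A(x,\zeta)|\le|\zeta|^{p-1}w(x)$; (degeneracy) $\mathcal A(x,\zeta)\cdot\zeta\ge|\zeta|^pw(x)$; (homogeneity) $\mathcal A(x,t\zeta)=t|t|^{p-2}\mathcal A(x,\zeta)$ for $t\in\mathbb R\setminus\{0\}$; (strong monotonicity) with $\gamma=\max\{p,2\}$ and some constant $c>0$, for $\zeta_1\ne\zeta_2$, $\langle\mathcal A(x,\zeta_1)-\mathcal A(x,\zeta_2),\zeta_1-\zeta_2\rangle\ge c|\zeta_1-\zeta_2|^\gamma\{\overline{\mathcal A}(x,\zeta_1,\zeta_2)\}^{1-\frac\gamma p}w(x)$, where $\overline{\mathcal A}(x,\zeta_1,\zeta_2)=\frac1{w(x)}(\langle\mathcal A(x,\zeta_1),\zeta_1\rangle+\langle\mathcal A(x,\zeta_2),\zeta_2\rangle)$. Super-solution: a function $v\in W^{1,p}_{loc}(\Omega,w)$, $v>0$, such that for every $K\Subset\Omega$ there is $c_K>0$ with $v\ge c_K$ in $K$, and for every nonnegative $\phi\in C_c^1(\Omega)$, $\int_\Omega\mathcal A(x,\nabla v)\cdot\nabla\phi\,dx\ge\int_\Omega\frac{f}{v^\delta}\phi\,dx$. *)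

theory Defs
  imports "HOL-Analysis.Analysis"
begin

section \<open>Smooth functions, test functions and domains\<close>

definition partial_deriv :: "'n::finite \<Rightarrow> (real^'n \<Rightarrow> real) \<Rightarrow> real^'n \<Rightarrow> real" where
  "partial_deriv i f x = frechet_derivative f (at x) (axis i 1)"

definition grad :: "(real^'n::finite \<Rightarrow> real) \<Rightarrow> real^'n \<Rightarrow> real^'n" where
  "grad f x = (\<chi> i. partial_deriv i f x)"

primrec Ck :: "nat \<Rightarrow> (real^'n::finite \<Rightarrow> real) \<Rightarrow> bool" where
  "Ck 0 f \<longleftrightarrow> continuous_on UNIV f"
| "Ck (Suc m) f \<longleftrightarrow> (\<forall>x. f differentiable (at x)) \<and> (\<forall>i. Ck m (partial_deriv i f))"

definition smooth :: "(real^'n::finite \<Rightarrow> real) \<Rightarrow> bool" where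
  "smooth f \<longleftrightarrow> (\<forall>m. Ck m f)"

definition compactly_contained :: "'a::topological_space set \<Rightarrow> 'a set \<Rightarrow> bool"
    (infix "\<Subset>" 50) where
  "S \<Subset> \<Omega> \<longleftrightarrow> compact (closure S) \<and> closure S \<subseteq> \<Omega>"

text \<open>Test functions on \<open>\<Omega>\<close> are represented by their extension by zero to the whole space.\<close>

definition Cc1 :: "(real^'n::finite) set \<Rightarrow> (real^'n \<Rightarrow> real) set" where
  "Cc1 \<Omega> = {\<phi>. Ck 1 \<phi> \<and> {x. \<phi> x \<noteq> 0} \<Subset> \<Omega>}"

definition Cc_inf :: "(real^'n::finite) set \<Rightarrow> (real^'n \<Rightarrow> real) set" where
  "Cc_inf \<Omega> = {\<phi>. smooth \<phi> \<and> {x. \<phi> x \<noteq> 0} \<Subset> \<Omega>}"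

text \<open>Near each boundary point, in suitably rotated coordinates, the set is the region above the
  graph of a smooth function.  A function of the remaining \<open>N - 1\<close> coordinates is a function on
  the whole space that is invariant under translation in the \<open>i\<close>-th coordinate.\<close>

definition smooth_boundary :: "(real^'n::finite) set \<Rightarrow> bool" where
  "smooth_boundary \<Omega> \<longleftrightarrow>
     (\<forall>x0\<in>frontier \<Omega>. \<exists>r>0. \<exists>(T :: real^'n \<Rightarrow> real^'n) i h.
        orthogonal_transformation T \<and> smooth h \<and> (\<forall>y c. h (y + c *\<^sub>R axis i 1) = h y) \<and>
        \<Omega> \<inter> ball x0 r = {x \<in> ball x0 r. T x $ i > h (T x)})"

definition smooth_bounded_domain :: "(real^'n::finite) set \<Rightarrow> bool" where
  "smooth_bounded_domain \<Omega> \<longleftrightarrow>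
     open \<Omega> \<and> connected \<Omega> \<and> \<Omega> \<noteq> {} \<and> bounded \<Omega> \<and> smooth_boundary \<Omega>"

section \<open>Integrability classes and weights\<close>

definition locally_integrable ::
    "'a::euclidean_space set \<Rightarrow> ('a \<Rightarrow> 'b::{banach, second_countable_topology}) \<Rightarrow> bool" where
  "locally_integrable S f \<longleftrightarrow> (\<forall>K. compact K \<and> K \<subseteq> S \<longrightarrow> integrable (lebesgue_on K) f)"

definition Lspace :: "real \<Rightarrow> 'a::euclidean_space set \<Rightarrow> ('a \<Rightarrow> real) set" where
  "Lspace q \<Omega> = {f \<in> borel_measurable (lebesgue_on \<Omega>).
                   integrable (lebesgue_on \<Omega>) (\<lambda>x. \<bar>f x\<bar> powr q)}"

text \<open>The integrability of \<open>w powr (- 1 / (p - 1))\<close> over balls is the finiteness implicit in the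
  \<open>A\<^sub>p\<close> inequality; it has to be stated since the Bochner integral of a non-integrable function
  is 0.\<close>

definition Ap_weight :: "real \<Rightarrow> ('a::euclidean_space \<Rightarrow> real) \<Rightarrow> bool" where
  "Ap_weight p w \<longleftrightarrow>
     locally_integrable UNIV w \<and> (AE x in lebesgue. 0 < w x) \<and>
     (\<exists>c>0. \<forall>a. \<forall>r>0.
        integrable (lebesgue_on (ball a r)) (\<lambda>x. w x powr (- 1 / (p - 1))) \<and>
        (1 / measure lebesgue (ball a r) * (\<integral>x. w x \<partial>lebesgue_on (ball a r))) *
        (1 / measure lebesgue (ball a r) *
           (\<integral>x. w x powr (- 1 / (p - 1)) \<partial>lebesgue_on (ball a r))) powr (p - 1) \<le> c)"

definition As_weight :: "real \<Rightarrow> real \<Rightarrow> 'a::euclidean_space set \<Rightarrow> ('a \<Rightarrow> real) \<Rightarrow> bool" where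
  "As_weight p s \<Omega> w \<longleftrightarrow>
     Ap_weight p w \<and> integrable (lebesgue_on \<Omega>) (\<lambda>x. w x powr (- s))"

definition p_sub :: "real \<Rightarrow> real \<Rightarrow> real" where
  "p_sub p s = p * s / (s + 1)"

definition sobolev_exp :: "real \<Rightarrow> real \<Rightarrow> real" where
  "sobolev_exp N q = N * q / (N - q)"

definition conj_exp :: "real \<Rightarrow> real" where
  "conj_exp r = r / (r - 1)"

section \<open>Weighted Sobolev spaces\<close>

text \<open>Sobolev functions are represented by arbitrary representatives on the whole space; their
  values outside \<open>\<Omega>\<close> are irrelevant.  The weak gradient is unique up to null sets.\<close>

definition has_weak_grad ::
    "(real^'n::finite) set \<Rightarrow> (real^'n \<Rightarrow> real) \<Rightarrow> (real^'n \<Rightarrow> real^'n) \<Rightarrow> bool" where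
  "has_weak_grad \<Omega> u g \<longleftrightarrow>
     locally_integrable \<Omega> u \<and> locally_integrable \<Omega> g \<and>
     (\<forall>\<phi>\<in>Cc_inf \<Omega>. \<forall>i.
        (\<integral>x. u x * partial_deriv i \<phi> x \<partial>lebesgue_on \<Omega>) =
        - (\<integral>x. g x $ i * \<phi> x \<partial>lebesgue_on \<Omega>))"

definition weak_grad :: "(real^'n::finite) set \<Rightarrow> (real^'n \<Rightarrow> real) \<Rightarrow> real^'n \<Rightarrow> real^'n" where
  "weak_grad \<Omega> u = (SOME g. has_weak_grad \<Omega> u g)"

definition W1p :: "real \<Rightarrow> (real^'n::finite \<Rightarrow> real) \<Rightarrow> (real^'n) set \<Rightarrow> (real^'n \<Rightarrow> real) set" where
  "W1p p w \<Omega> =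
     {u. (\<exists>g. has_weak_grad \<Omega> u g) \<and>
         integrable (lebesgue_on \<Omega>) (\<lambda>x. \<bar>u x\<bar> powr p * w x) \<and>
         integrable (lebesgue_on \<Omega>) (\<lambda>x. norm (weak_grad \<Omega> u x) powr p * w x)}"

definition W1p_norm ::
    "real \<Rightarrow> (real^'n::finite \<Rightarrow> real) \<Rightarrow> (real^'n) set \<Rightarrow> (real^'n \<Rightarrow> real) \<Rightarrow> real" where
  "W1p_norm p w \<Omega> u =
     (\<integral>x. \<bar>u x\<bar> powr p * w x \<partial>lebesgue_on \<Omega>) powr (1 / p) +
     (\<integral>x. norm (weak_grad \<Omega> u x) powr p * w x \<partial>lebesgue_on \<Omega>) powr (1 / p)"

definition W1p_0 :: "real \<Rightarrow> (real^'n::finite \<Rightarrow> real) \<Rightarrow> (real^'n) set \<Rightarrow> (real^'n \<Rightarrow> real) set" where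
  "W1p_0 p w \<Omega> =
     {u \<in> W1p p w \<Omega>. \<forall>\<epsilon>>0. \<exists>\<phi>\<in>Cc_inf \<Omega>. W1p_norm p w \<Omega> (\<lambda>x. u x - \<phi> x) < \<epsilon>}"

definition W1p_loc :: "real \<Rightarrow> (real^'n::finite \<Rightarrow> real) \<Rightarrow> (real^'n) set \<Rightarrow> (real^'n \<Rightarrow> real) set" where
  "W1p_loc p w \<Omega> = {u. \<forall>\<Omega>'. open \<Omega>' \<and> \<Omega>' \<Subset> \<Omega> \<longrightarrow> u \<in> W1p p w \<Omega>'}"

section \<open>The operator and super-solutions\<close>

definition caratheodory :: "(real^'n::finite) set \<Rightarrow> (real^'n \<Rightarrow> real^'n \<Rightarrow> real^'n) \<Rightarrow> bool" where
  "caratheodory \<Omega> A \<longleftrightarrow>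
     (\<forall>\<zeta>. (\<lambda>x. A x \<zeta>) \<in> borel_measurable (lebesgue_on \<Omega>)) \<and>
     (AE x in lebesgue_on \<Omega>. continuous_on UNIV (A x))"

definition A_bar :: "(real^'n::finite \<Rightarrow> real) \<Rightarrow> (real^'n \<Rightarrow> real^'n \<Rightarrow> real^'n) \<Rightarrow>
    real^'n \<Rightarrow> real^'n \<Rightarrow> real^'n \<Rightarrow> real" where
  "A_bar w A x \<zeta>1 \<zeta>2 = 1 / w x * (A x \<zeta>1 \<bullet> \<zeta>1 + A x \<zeta>2 \<bullet> \<zeta>2)"

text \<open>In the last condition the base of the power is positive for almost every \<open>x\<close> by
  degeneracy, so that for \<open>p \<ge> 2\<close> the convention \<open>0 powr 0 = 0\<close> plays no role.\<close>

definition structural_conditions :: "real \<Rightarrow> (real^'n::finite \<Rightarrow> real) \<Rightarrow> (real^'n) set \<Rightarrow>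
    (real^'n \<Rightarrow> real^'n \<Rightarrow> real^'n) \<Rightarrow> bool" where
  "structural_conditions p w \<Omega> A \<longleftrightarrow>
     caratheodory \<Omega> A \<and>
     (AE x in lebesgue_on \<Omega>. \<forall>\<zeta>. norm (A x \<zeta>) \<le> norm \<zeta> powr (p - 1) * w x) \<and>
     (AE x in lebesgue_on \<Omega>. \<forall>\<zeta>. A x \<zeta> \<bullet> \<zeta> \<ge> norm \<zeta> powr p * w x) \<and>
     (AE x in lebesgue_on \<Omega>. \<forall>\<zeta> t. t \<noteq> 0 \<longrightarrow>
        A x (t *\<^sub>R \<zeta>) = (t * \<bar>t\<bar> powr (p - 2)) *\<^sub>R A x \<zeta>) \<and>
     (\<exists>c>0. AE x in lebesgue_on \<Omega>. \<forall>\<zeta>1 \<zeta>2. \<zeta>1 \<noteq> \<zeta>2 \<longrightarrow>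
        (A x \<zeta>1 - A x \<zeta>2) \<bullet> (\<zeta>1 - \<zeta>2) \<ge>
          c * norm (\<zeta>1 - \<zeta>2) powr (max p 2) *
            A_bar w A x \<zeta>1 \<zeta>2 powr (1 - max p 2 / p) * w x)"

definition super_solution :: "real \<Rightarrow> real \<Rightarrow> (real^'n::finite \<Rightarrow> real) \<Rightarrow> (real^'n) set \<Rightarrow>
    (real^'n \<Rightarrow> real^'n \<Rightarrow> real^'n) \<Rightarrow> (real^'n \<Rightarrow> real) \<Rightarrow> (real^'n \<Rightarrow> real) \<Rightarrow> bool" where
  "super_solution p \<delta> w \<Omega> A f v \<longleftrightarrow>
     v \<in> W1p_loc p w \<Omega> \<and> (AE x in lebesgue_on \<Omega>. 0 < v x) \<and>
     (\<forall>K. K \<Subset> \<Omega> \<longrightarrow> (\<exists>c>0. AE x in lebesgue_on \<Omega>. x \<in> K \<longrightarrow> c \<le> v x)) \<and>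
     (\<forall>\<phi>\<in>Cc1 \<Omega>. (\<forall>x. 0 \<le> \<phi> x) \<longrightarrow>
        (\<integral>x. A x (weak_grad \<Omega> v x) \<bullet> grad \<phi> x \<partial>lebesgue_on \<Omega>) \<ge>
        (\<integral>x. f x / v x powr \<delta> * \<phi> x \<partial>lebesgue_on \<Omega>))"

definition K_set :: "real \<Rightarrow> (real^'n::finite \<Rightarrow> real) \<Rightarrow> (real^'n) set \<Rightarrow> (real^'n \<Rightarrow> real) \<Rightarrow>
    (real^'n \<Rightarrow> real) set" where
  "K_set p w \<Omega> v = {\<phi> \<in> W1p_0 p w \<Omega>. AE x in lebesgue_on \<Omega>. 0 \<le> \<phi> x \<and> \<phi> x \<le> v x}"

definition g_trunc :: "real \<Rightarrow> real \<Rightarrow> real \<Rightarrow> real" where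
  "g_trunc \<delta> k t = (if t > 0 then min (t powr (- \<delta>)) k else k)"

end

theory Submission
 imports Defs
begin

text \<open>For the truncated data \<open>f\<^sub>j = min f j\<close> the monotone operator
 \<open>(u, \<nabla>u) \<mapsto> (- f\<^sub>j g\<^sub>k u, \<A>(x, \<nabla>u))\<close> has a solution \<open>u\<^sub>j\<close> of the variational inequality over the
 nonnegative cone of \<open>X\<close>.  Testing with \<open>0\<close> bounds the energy by \<open>(k + 1) \<integral> f\<close> since
 \<open>t g\<^sub>k t \<le> k + 1\<close> for \<open>\<delta> > 1\<close>, and comparing two solutions yields
 \<open>\<integral> (\<A>(x, \<nabla>u\<^sub>i) - \<A>(x, \<nabla>u\<^sub>j)) \<bullet> (\<nabla>u\<^sub>i - \<nabla>u\<^sub>j) \<le> (k + 1) \<integral> \<bar>f\<^sub>i - f\<^sub>j\<bar>\<close>, so \<open>u\<^sub>j\<close> converges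
 strongly by strong monotonicity and the Poincare inequality.  Testing with a regularization of
 \<open>(\<phi> - v)\<^sub>+\<close> for test functions \<open>\<phi> \<rightarrow> u\<^sub>j\<close> gives \<open>u\<^sub>j \<le> v\<close>.  Elements of \<open>X\<close> are handled as \<open>L\<^sup>p\<close>
 limits of pairs \<open>(\<phi>, \<nabla>\<phi>)\<close> of test functions, and the variational inequality is solved without
 weak topologies: finitely many of Minty's inequalities hold approximately at a mixed strategy of
 a matrix game, and uniform convexity makes near-minimizers of the norm under these constraints
 a Cauchy sequence.\<close>

text \<open>The hypotheses on \<open>f\<close> give integrability over the bounded domain in all
  three cases. An \<open>L^1\<close> source does not pair with \<open>X\<close> by Hoelder, hence
  the truncation: a bounded \<open>f_j\<close> does, because \<open>w powr (- 1 / (p - 1))\<close>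
  is integrable on bounded sets and \<open>L^p(w)\<close> therefore embeds in \<open>L^1\<close>
  there. The bound on \<open>t g_k(t)\<close> makes the energy and the distance of two solutions
  depend on \<open>L^1\<close> norms of the sources alone, so the truncation can be removed. The
  cone serves as constraint set instead of the order interval below \<open>v\<close> because it
  absorbs the addition of nonnegative test functions: the required inequality is then immediate and
  only the upper bound remains. The obstacle there is that \<open>v\<close> is only locally in the
  Sobolev space, so \<open>(u - v)_+\<close> is not visibly in \<open>X\<close>. For a test function
  \<open>phi\<close> the function \<open>(phi - v)_+\<close> sees \<open>v\<close> only on the
  support of \<open>phi\<close>, and an approximation \<open>q\<close> with
  \<open>0 <= q <= phi\<close> keeps \<open>phi - q\<close> in the cone; the price is an error that
  vanishes as \<open>phi\<close> tends to \<open>u\<close>.\<close>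

text \<open>The unqualified names denote the facts about the gauge integral.\<close>

lemmas B_integrable_add = Bochner_Integration.integrable_add
 and B_integrable_bound = Bochner_Integration.integrable_bound
 and B_integrable_diff = Bochner_Integration.integrable_diff
 and B_integrable_sum = Bochner_Integration.integrable_sum
 and B_integral_add = Bochner_Integration.integral_add
 and B_integral_cong = Bochner_Integration.integral_cong
 and B_integral_diff = Bochner_Integration.integral_diff
 and B_integral_minus = Bochner_Integration.integral_minus
 and B_integral_norm_bound_integral = Bochner_Integration.integral_norm_bound_integral
 and B_integral_sum = Bochner_Integration.integral_sum
 and B_integral_zero = Bochner_Integration.integral_zero

abbreviation Lmeas :: "'a::euclidean_space set => ('a => 'b::topological_space) set" where
 "Lmeas S \<equiv> borel_measurable (lebesgue_on S)"

section \<open>Inequalities for powers\<close>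

text \<open>Dichotomy at \<open>t = e * s\<close>: on either side one of the two terms already
  dominates, which replaces the sharp constants and the conjugate exponent of Young's inequality.
  The small factor on \<open>s powr p\<close> is what later allows error terms to be
  absorbed.\<close>

lemma powr_young_eps:
 fixes s t e p :: real
 assumes "0 \<le> s" "0 \<le> t" "1 < p" "0 < e"
 shows "s powr (p - 1) * t \<le> e * s powr p + e powr (1 - p) * t powr p"
proof (cases "t \<le> e * s")
 case True
 then have "s powr (p - 1) * t \<le> s powr (p - 1) * (e * s)"
  by (intro mult_left_mono) auto
 also have "\<dots> = e * s powr p"
  using assms by (cases "s = 0") (auto simp: powr_diff)
 finally show ?thesis by (smt (verit, best) mult_nonneg_nonneg powr_ge_zero)
next
 case False
 then have "s \<le> t / e" using assms by (simp add: field_simps)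
 then have "s powr (p - 1) * t \<le> (t / e) powr (p - 1) * t"
  using assms by (intro mult_right_mono powr_mono2) auto
 also have "\<dots> = e powr (1 - p) * t powr p"
  using assms False by (cases "t = 0") (auto simp: powr_diff powr_divide field_simps)
 finally show ?thesis using assms
  by (smt (verit, best) mult_nonneg_nonneg powr_ge_zero)
qed

lemma powr_young:
 fixes s t p :: real
 assumes "0 \<le> s" "0 \<le> t" "1 < p"
 shows "s powr (p - 1) * t \<le> s powr p + t powr p"
 using powr_young_eps[OF assms, of 1] by simp

lemma powr_add_le:
 fixes s t p :: real
 assumes "0 \<le> s" "0 \<le> t" "0 \<le> p"
 shows "(s + t) powr p \<le> 2 powr p * (s powr p + t powr p)"
proof -
 have "(s + t) powr p \<le> (2 * max s t) powr p"
  using assms by (intro powr_mono2) auto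
 also have "\<dots> = 2 powr p * max s t powr p"
  using assms by (simp add: powr_mult)
 also have "\<dots> \<le> 2 powr p * (s powr p + t powr p)"
  by (intro mult_left_mono) (auto simp: max_def)
 finally show ?thesis .
qed

lemma norm_add_powr_le:
 fixes a b :: "'a::real_normed_vector"
 assumes "0 \<le> p"
 shows "norm (a + b) powr p \<le> 2 powr p * (norm a powr p + norm b powr p)"
 using assms by (intro order.trans[OF _ powr_add_le] powr_mono2 norm_triangle_ineq) auto

lemma norm_diff_powr_le:
 fixes a b :: "'a::real_normed_vector"
 assumes "0 \<le> p"
 shows "norm (a - b) powr p \<le> 2 powr p * (norm a powr p + norm b powr p)"
 using norm_add_powr_le[OF assms, of a "-b"] by simp

lemma norm_Pair_powr_le:
 assumes "0 \<le> p"
 shows "norm (a, b) powr p \<le> 2 powr p * (norm a powr p + norm b powr p)"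
 using assms by (intro order.trans[OF _ powr_add_le] powr_mono2 norm_Pair_le) auto

text \<open>Strict convexity of the power through the mean value theorem and the strict growth of
  the derivative. The point \<open>x = 0\<close> is separate because the derivative is only taken at
  positive points; there the tangent has the negative value
  \<open>(1 - p) * c powr p\<close>.\<close>

lemma powr_tangent_strict:
 fixes x c p :: real
 assumes "1 < p" "0 < c" "0 \<le> x" "x \<noteq> c"
 shows "c powr p + p * c powr (p - 1) * (x - c) < x powr p"
proof (cases "x = 0")
 case True
 have "c powr p + p * c powr (p - 1) * (x - c) = (1 - p) * c powr p"
  using assms True by (auto simp: powr_diff field_simps)
 also have "\<dots> < 0" using assms by (simp add: mult_less_0_iff)
 finally show ?thesis using True by simp
next
 case False
 then have x: "0 < x" using assms by simp
 have der: "((\<lambda>x. x powr p) has_real_derivative p * y powr (p - 1)) (at y)" if "0 < y" for y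
  using that by (auto intro!: derivative_eq_intros simp: powr_diff)
 show ?thesis
 proof (cases "c < x")
  case True
  obtain z where z: "c < z" "z < x" "x powr p - c powr p = (x - c) * (p * z powr (p - 1))"
   using MVT2[OF True, of "\<lambda>x. x powr p" "\<lambda>y. p * y powr (p - 1)"] der assms by auto
  have "c powr (p - 1) < z powr (p - 1)"
   using z assms by (intro powr_less_mono2) auto
  then have "(x - c) * (p * c powr (p - 1)) < (x - c) * (p * z powr (p - 1))"
   using True assms by simp
  then show ?thesis using z by (simp add: mult_ac)
 next
  case False
  then have lt: "x < c" using assms by simp
  obtain z where z: "x < z" "z < c" "c powr p - x powr p = (c - x) * (p * z powr (p - 1))"
   using MVT2[OF lt, of "\<lambda>x. x powr p" "\<lambda>y. p * y powr (p - 1)"] der assms x by auto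
  have "z powr (p - 1) < c powr (p - 1)"
   using z x assms by (intro powr_less_mono2) auto
  then have "(c - x) * (p * z powr (p - 1)) < (c - x) * (p * c powr (p - 1))"
   using lt assms by simp
  then show ?thesis using z(3) by (simp add: algebra_simps)
 qed
qed

lemma powr_tangent:
 fixes x c p :: real
 assumes "1 < p" "0 \<le> c" "0 \<le> x"
 shows "c powr p + p * c powr (p - 1) * (x - c) \<le> x powr p"
 using powr_tangent_strict[of p c x] assms
 by (cases "c = 0"; cases "x = c") (auto intro: less_imp_le)

text \<open>The tangent inequalities at the convex combination are added with weights
  \<open>1 - t\<close> and \<open>t\<close>; the linear terms cancel because the weighted deviations
  from the combination sum to zero.\<close>

lemma powr_convex_comb:
 fixes a b t p :: real
 assumes "1 < p" "0 \<le> a" "0 \<le> b" "0 \<le> t" "t \<le> 1"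
 shows "((1 - t) * a + t * b) powr p \<le> (1 - t) * a powr p + t * b powr p"
proof -
 let ?c = "(1 - t) * a + t * b"
 have c: "0 \<le> ?c" using assms by auto
 have "?c powr p = (1 - t) * (?c powr p + p * ?c powr (p - 1) * (a - ?c))
   + t * (?c powr p + p * ?c powr (p - 1) * (b - ?c))"
  by algebra
 also have "\<dots> \<le> (1 - t) * a powr p + t * b powr p"
  using assms c by (intro add_mono mult_left_mono powr_tangent) auto
 finally show ?thesis .
qed

lemma norm_powr_convex_comb:
 fixes a b :: "'a::real_normed_vector"
 assumes "1 < p" "0 \<le> t" "t \<le> 1"
 shows "norm ((1 - t) *\<^sub>R a + t *\<^sub>R b) powr p \<le> (1 - t) * norm a powr p + t * norm b powr p"
proof -
 have "norm ((1 - t) *\<^sub>R a + t *\<^sub>R b) \<le> (1 - t) * norm a + t * norm b"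
  using assms norm_triangle_ineq[of "(1 - t) *\<^sub>R a" "t *\<^sub>R b"] by simp
 then have "norm ((1 - t) *\<^sub>R a + t *\<^sub>R b) powr p \<le> ((1 - t) * norm a + t * norm b) powr p"
  using assms by (intro powr_mono2) auto
 also have "\<dots> \<le> (1 - t) * norm a powr p + t * norm b powr p"
  using assms by (intro powr_convex_comb) auto
 finally show ?thesis .
qed

text \<open>Distinct vectors differ in one of two ways. With equal norms the parallelogram law makes
  the midpoint strictly shorter; with different norms strict convexity of the power at the mean of
  the norms gives the gap.\<close>

lemma norm_powr_strict_midpoint:
 fixes a b :: "'a::real_inner"
 assumes "1 < p" "a \<noteq> b"
 shows "2 * norm ((1/2) *\<^sub>R (a + b)) powr p < norm a powr p + norm b powr p"
proof (cases "norm a = norm b")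
 case True
 have "norm (a + b) ^ 2 + norm (a - b) ^ 2 = 4 * norm a ^ 2"
  using True by (simp add: power2_norm_eq_inner inner_simps norm_eq inner_commute)
 moreover have "0 < norm (a - b) ^ 2" using assms by simp
 moreover have "(2 * norm a) ^ 2 = 4 * norm a ^ 2" by (simp add: power2_eq_square)
 ultimately have "norm (a + b) ^ 2 < (2 * norm a) ^ 2" by linarith
 then have "norm (a + b) < 2 * norm a" by (rule power_less_imp_less_base) simp
 then have "norm ((1/2) *\<^sub>R (a + b)) powr p < norm a powr p"
  using assms by (intro powr_less_mono2) auto
 then show ?thesis using True by simp
next
 case False
 let ?c = "(norm a + norm b) / 2"
 have c: "0 < ?c" using assms by (smt (verit) False half_gt_zero_iff norm_ge_zero)
 have "norm ((1/2) *\<^sub>R (a + b)) \<le> ?c" using norm_triangle_ineq[of a b] by simp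
 then have "2 * norm ((1/2) *\<^sub>R (a + b)) powr p \<le> 2 * ?c powr p"
  using assms by (intro mult_left_mono powr_mono2) auto
 also have "\<dots> = (?c powr p + p * ?c powr (p - 1) * (norm a - ?c))
   + (?c powr p + p * ?c powr (p - 1) * (norm b - ?c))"
  by (simp add: field_simps)
 also have "\<dots> < norm a powr p + norm b powr p"
  using assms c False by (intro add_strict_mono powr_tangent_strict) (auto simp: field_simps)
 finally show ?thesis .
qed

lemma continuous_on_norm_powr:
 fixes f :: "'a::topological_space => 'b::real_normed_vector"
 assumes "continuous_on S f" "0 < p"
 shows "continuous_on S (\<lambda>x. norm (f x) powr p)"
 using assms by (intro continuous_on_powr' continuous_on_norm continuous_on_const) auto

text \<open>By homogeneity it suffices to consider pairs on the unit sphere of the product space, where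
 the defect of midpoint convexity is bounded below on the compact set of pairs that are far
 apart.\<close>

lemma norm_powr_uniform_convex:
 fixes p e :: real
 assumes p: "1 < p" and e: "0 < e"
 obtains C where "0 \<le> C"
  "\<forall>a b :: 'a::euclidean_space. norm (a - b) powr p \<le> e * (norm a powr p + norm b powr p)
    + C * (norm a powr p + norm b powr p - 2 * norm ((1/2) *\<^sub>R (a + b)) powr p)"
proof -
 define S where "S = (\<lambda>z :: 'a \<times> 'a. norm (fst z) powr p + norm (snd z) powr p)"
 define D where "D = (\<lambda>z :: 'a \<times> 'a. S z - 2 * norm ((1/2) *\<^sub>R (fst z + snd z)) powr p)"
 define E where "E = (\<lambda>z :: 'a \<times> 'a. norm (fst z - snd z) powr p)"
 have contS: "continuous_on UNIV S" and contD: "continuous_on UNIV D" and contE: "continuous_on UNIV E"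
  unfolding S_def D_def E_def using p
  by (intro continuous_on_add continuous_on_diff continuous_on_mult_left continuous_on_norm_powr
    continuous_on_scaleR continuous_on_const continuous_on_fst continuous_on_snd continuous_on_id; simp)+
 \<comment> \<open>\<open>T\<close> collects the normalized pairs for which the term with
   \<open>e\<close> may fail to suffice. Such a pair has distinct components, so the defect
   \<open>D\<close> is positive on it and the maximum of \<open>E / D\<close> over \<open>T\<close>
   can serve as \<open>C\<close>.\<close>
 define T where "T = sphere (0::'a \<times> 'a) 1 \<inter> {z. e * S z \<le> E z}"
 have "closed {z. e * S z \<le> E z}"
  by (intro closed_Collect_le continuous_intros contS contE)
 then have T: "compact T" unfolding T_def by (intro compact_Int_closed compact_sphere)
 have D0: "0 \<le> D z" for z
  using norm_powr_strict_midpoint[OF p, of "fst z" "snd z"]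
  by (cases "fst z = snd z") (auto simp: D_def S_def simp flip: scaleR_2)
 have Dpos: "0 < D z" if "z \<in> T" for z
 proof -
  have "z \<noteq> 0" using that by (auto simp: T_def)
  then have "0 < S z" by (cases z) (auto simp: S_def zero_prod_def add_pos_nonneg add_nonneg_pos)
  then have "0 < E z" using that e unfolding T_def by (smt (verit) IntD2 mem_Collect_eq mult_pos_pos)
  then have "fst z \<noteq> snd z" by (auto simp: E_def)
  then show ?thesis using norm_powr_strict_midpoint[OF p] by (simp add: D_def S_def)
 qed
 obtain C where C: "0 \<le> C" "!!z. z \<in> T ==> E z \<le> C * D z"
 proof (cases "T = {}")
  case True
  then show ?thesis using that[of 0] by simp
 next
  case False
  have "continuous_on T (\<lambda>z. E z / D z)"
   using Dpos by (intro continuous_intros continuous_on_subset[OF contE] continuous_on_subset[OF contD]) force+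
  from continuous_attains_sup[OF T False this] obtain z0 where z0: "z0 \<in> T"
   "!!z. z \<in> T ==> E z / D z \<le> E z0 / D z0" by blast
  show ?thesis
  proof (rule that[of "E z0 / D z0"])
   show "0 \<le> E z0 / D z0" using D0 by (simp add: E_def)
   fix z assume "z \<in> T"
   from z0(2)[OF this] Dpos[OF this] show "E z \<le> E z0 / D z0 * D z"
    by (simp add: divide_le_eq)
  qed
 qed
 have main: "E z \<le> e * S z + C * D z" for z
 proof (cases "z = 0")
  case True then show ?thesis by (simp add: E_def S_def D_def)
 next
  case False
  define r where "r = norm z"
  define y where "y = (1 / r) *\<^sub>R z"
  have r: "0 < r" using False by (simp add: r_def)
  have zy: "z = r *\<^sub>R y" using r by (simp add: y_def)
  have y: "y \<in> sphere 0 1" using r by (simp add: y_def r_def)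
  have sc: "S z = r powr p * S y" "E z = r powr p * E y"
   using r by (simp_all add: zy S_def E_def powr_mult distrib_left flip: scaleR_right_diff_distrib)
  have "(1/2) *\<^sub>R (fst z + snd z) = r *\<^sub>R ((1/2) *\<^sub>R (fst y + snd y))"
   by (simp add: zy scaleR_add_right)
  then have "norm ((1/2) *\<^sub>R (fst z + snd z)) powr p = r powr p * norm ((1/2) *\<^sub>R (fst y + snd y)) powr p"
   using r by (simp only: norm_scaleR) (simp add: powr_mult powr_divide)
  then have sc': "D z = r powr p * D y"
   by (simp add: D_def sc algebra_simps)
  have "E y \<le> e * S y + C * D y"
  proof (cases "y \<in> T")
   case True
   then show ?thesis using C(2)[OF True] e by (smt (verit, best) S_def mult_nonneg_nonneg powr_ge_zero)
  next
   case False
   then have "E y \<le> e * S y" using y by (auto simp: T_def)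
   then show ?thesis using C(1) D0[of y] by (smt (verit, best) mult_nonneg_nonneg)
  qed
  then have "r powr p * E y \<le> r powr p * (e * S y + C * D y)"
   by (intro mult_left_mono) auto
  then show ?thesis unfolding sc sc' by (simp add: algebra_simps)
 qed
 show thesis
  by (rule that[OF C(1)], intro allI) (use main[of "(_, _)"] in \<open>simp add: E_def S_def D_def\<close>)
qed

section \<open>Convergence in \<open>L\<^sup>p\<close>\<close>

text \<open>Convergence in \<open>L^p\<close> gives pointwise convergence and a majorant only along
  subsequences; this principle returns from there to the full sequence of integrals.\<close>

lemma LIMSEQ_subseq_subseq:
 fixes X :: "nat => 'a::metric_space"
 assumes "!!r. strict_mono (r::nat => nat) ==> \<exists>s. strict_mono (s::nat => nat) \<and> (\<lambda>n. X (r (s n))) \<longlonglongrightarrow> L"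
 shows "X \<longlonglongrightarrow> L"
proof (rule ccontr)
 assume "\<not> X \<longlonglongrightarrow> L"
 then obtain e where e: "0 < e" "\<exists>\<^sub>F n in sequentially. \<not> dist (X n) L < e"
  unfolding tendsto_iff by (auto simp: not_eventually)
 then have "infinite {n. \<not> dist (X n) L < e}"
  by (simp add: frequently_cofinite cofinite_eq_sequentially[symmetric])
 from infinite_enumerate[OF this] obtain r :: "nat => nat" where
  r: "strict_mono r" "!!n. \<not> dist (X (r n)) L < e" by auto
 from assms[OF r(1)] obtain s :: "nat => nat" where "(\<lambda>n. X (r (s n))) \<longlonglongrightarrow> L" by auto
 from tendstoD[OF this e(1)] have "eventually (\<lambda>n. dist (X (r (s n))) L < e) sequentially" .
 then show False using r(2) by (auto dest: eventually_happens)
qed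

lemma AE_summable_of_summable_integral:
 fixes d :: "nat => 'a => real"
 assumes int: "!!n. integrable M (d n)" and nn: "!!n x. 0 \<le> d n x"
  and sm: "summable (\<lambda>n. LINT x|M. d n x)"
 shows "AE x in M. summable (\<lambda>n. d n x)"
proof -
 have [measurable]: "d n \<in> borel_measurable M" for n using int by auto
 have "(\<integral>\<^sup>+x. (\<Sum>n. ennreal (d n x)) \<partial>M) = (\<Sum>n. \<integral>\<^sup>+x. ennreal (d n x) \<partial>M)"
  by (rule nn_integral_suminf) simp
 also have "\<dots> = (\<Sum>n. ennreal (LINT x|M. d n x))"
  using int nn by (simp add: nn_integral_eq_integral)
 also have "\<dots> = ennreal (\<Sum>n. LINT x|M. d n x)"
  using sm nn by (intro suminf_ennreal2) (auto intro: integral_nonneg_AE)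
 finally have "(\<integral>\<^sup>+x. (\<Sum>n. ennreal (d n x)) \<partial>M) \<noteq> \<infinity>" by simp
 from nn_integral_PInf_AE[OF _ this] have "AE x in M. (\<Sum>n. ennreal (d n x)) \<noteq> \<infinity>" by simp
 then show ?thesis
  by eventually_elim (use nn in \<open>auto intro: summable_suminf_not_top\<close>)
qed

text \<open>A partial converse of dominated convergence: along a subsequence with integrals below
  \<open>(1/2)^n\<close> the sum of the series is an integrable majorant, and the terms tend to zero
  wherever the series converges.\<close>

lemma L1_null_subseq_dominated:
 fixes d :: "nat => 'a => real"
 assumes int: "!!n. integrable M (d n)" and nn: "!!n x. 0 \<le> d n x"
  and lim: "(\<lambda>n. LINT x|M. d n x) \<longlonglongrightarrow> 0"
 obtains r H where "strict_mono (r :: nat => nat)" "integrable M H"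
  "AE x in M. \<forall>n. d (r n) x \<le> H x" "AE x in M. (\<lambda>n. d (r n) x) \<longlonglongrightarrow> 0"
proof -
 have ex: "\<exists>m>n. (LINT x|M. d m x) < e" if "0 < e" for n e
 proof -
  have "eventually (\<lambda>m. n < m \<and> (LINT x|M. d m x) < e) sequentially"
   using order_tendstoD(2)[OF lim that] eventually_gt_at_top[of n] by eventually_elim auto
  then show ?thesis by (auto dest: eventually_happens)
 qed
 have "\<exists>r. \<forall>n. (LINT x|M. d (r n) x) < (1/2)^n \<and> r n < r (Suc n)"
  by (rule dependent_nat_choice) (use ex[of "1" 0] ex[of "(1/2)^Suc _"] in auto)
 then obtain r where r: "!!n. (LINT x|M. d (r n) x) < (1/2)^n" "!!n. r n < r (Suc n)" by blast
 have mono: "strict_mono r" using r(2) by (simp add: strict_mono_Suc_iff)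
 have i0: "0 \<le> (LINT x|M. d n x)" for n using nn by (simp add: integral_nonneg_AE)
 have sm: "summable (\<lambda>n. LINT x|M. d (r n) x)"
  by (rule summable_comparison_test'[of "\<lambda>n. (1/2::real)^n" 0])
   (use r(1) i0 in \<open>auto intro: less_imp_le summable_geometric\<close>)
 have AEs: "AE x in M. summable (\<lambda>n. d (r n) x)"
  by (rule AE_summable_of_summable_integral) (use int nn sm in auto)
 show thesis
 proof (rule that[OF mono])
  show "integrable M (\<lambda>x. \<Sum>n. d (r n) x)"
   by (rule integrable_suminf) (use int nn sm AEs in auto)
  show "AE x in M. \<forall>n. d (r n) x \<le> (\<Sum>n. d (r n) x)"
   using AEs
  proof eventually_elim
   case (elim x)
   show ?case
   proof
    fix n show "d (r n) x \<le> (\<Sum>n. d (r n) x)"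
     using sum_le_suminf[OF elim, of "{n}"] nn by auto
   qed
  qed
  show "AE x in M. (\<lambda>n. d (r n) x) \<longlonglongrightarrow> 0"
   using AEs by eventually_elim (rule summable_LIMSEQ_zero)
 qed
qed

text \<open>Genuine functions instead of classes modulo null sets. Values in an arbitrary Euclidean
  space allow a function and its gradient to be treated as one pair.\<close>

definition Lp :: "real => 'a measure => ('a => 'b::euclidean_space) set" where
 "Lp p M = {f \<in> borel_measurable M. integrable M (\<lambda>x. norm (f x) powr p)}"

abbreviation Lp_int :: "real => 'a measure => ('a => 'b::euclidean_space) => real" where
 "Lp_int p M f \<equiv> (LINT x|M. norm (f x) powr p)"

text \<open>The \<open>p\<close>-th power of the distance.\<close>

abbreviation Lp_dist :: "real => 'a measure => ('a => 'b::euclidean_space) => ('a => 'b) => real" where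
 "Lp_dist p M f g \<equiv> (LINT x|M. norm (f x - g x) powr p)"

abbreviation Lp_lim :: "real => 'a measure => (nat => 'a => 'b::euclidean_space) => ('a => 'b) => bool" where
 "Lp_lim p M F f \<equiv> (\<lambda>n. Lp_dist p M (F n) f) \<longlonglongrightarrow> 0"

lemma Lp_measurable: "f \<in> Lp p M ==> f \<in> borel_measurable M"
 by (simp add: Lp_def)

lemma Lp_integrable: "f \<in> Lp p M ==> integrable M (\<lambda>x. norm (f x) powr p)"
 by (simp add: Lp_def)

lemma LpI_bound:
 assumes "f \<in> borel_measurable M" "integrable M h" "AE x in M. norm (f x) powr p \<le> h x"
 shows "f \<in> Lp p M"
proof -
 have [measurable]: "f \<in> borel_measurable M" by fact
 have "integrable M (\<lambda>x. norm (f x) powr p)"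
  by (rule B_integrable_bound[OF assms(2)]) (use assms(3) in \<open>auto simp: measurable\<close>)
 then show ?thesis using assms by (simp add: Lp_def)
qed

lemma Lp_add:
 assumes "0 < p" "f \<in> Lp p M" "g \<in> Lp p M"
 shows "(\<lambda>x. f x + g x) \<in> Lp p M"
 by (rule LpI_bound[where h = "\<lambda>x. 2 powr p * (norm (f x) powr p + norm (g x) powr p)"])
  (use assms in \<open>auto simp: Lp_measurable Lp_integrable intro!: norm_add_powr_le borel_measurable_add\<close>)

lemma Lp_diff:
 assumes "0 < p" "f \<in> Lp p M" "g \<in> Lp p M"
 shows "(\<lambda>x. f x - g x) \<in> Lp p M"
 by (rule LpI_bound[where h = "\<lambda>x. 2 powr p * (norm (f x) powr p + norm (g x) powr p)"])
  (use assms in \<open>auto simp: Lp_measurable Lp_integrable intro!: norm_diff_powr_le borel_measurable_diff\<close>)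

lemma Lp_scaleR:
 assumes "f \<in> Lp p M"
 shows "(\<lambda>x. c *\<^sub>R f x) \<in> Lp p M"
 using assms by (auto simp: Lp_def powr_mult)

lemma Lp_zero [simp]: "(\<lambda>x. 0) \<in> Lp p M"
 by (auto simp: Lp_def)

lemma Lp_Pair:
 assumes "0 < p" "f \<in> Lp p M" "g \<in> Lp p M"
 shows "(\<lambda>x. (f x, g x)) \<in> Lp p M"
 by (rule LpI_bound[where h = "\<lambda>x. 2 powr p * (norm (f x) powr p + norm (g x) powr p)"])
  (use assms in \<open>auto simp: Lp_measurable Lp_integrable intro!: norm_Pair_powr_le borel_measurable_Pair\<close>)

lemma Lp_diff_integrable:
 assumes "0 < p" "f \<in> Lp p M" "g \<in> Lp p M"
 shows "integrable M (\<lambda>x. norm (f x - g x) powr p)"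
 using Lp_integrable[OF Lp_diff[OF assms]] .

lemma Lp_dist_nonneg: "0 \<le> Lp_dist p M f g"
 by (simp add: integral_nonneg_AE)

lemma Lp_dist_commute: "Lp_dist p M f g = Lp_dist p M g f"
 by (simp add: norm_minus_commute)

lemma Lp_dist_triangle:
 assumes "0 < p" "f \<in> Lp p M" "g \<in> Lp p M" "h \<in> Lp p M"
 shows "Lp_dist p M f h \<le> 2 powr p * (Lp_dist p M f g + Lp_dist p M g h)"
proof -
 note [simp] = Lp_diff_integrable[OF assms(1)] assms(2-4)
 have "Lp_dist p M f h \<le> (LINT x|M. 2 powr p * (norm (f x - g x) powr p + norm (g x - h x) powr p))"
 proof (rule integral_mono)
  fix x show "norm (f x - h x) powr p \<le> 2 powr p * (norm (f x - g x) powr p + norm (g x - h x) powr p)"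
   using norm_add_powr_le[of p "f x - g x" "g x - h x"] assms(1) by simp
 qed simp_all
 then show ?thesis by simp
qed

lemma Lp_dist_Pair:
 assumes "0 < p" "f \<in> Lp p M" "f' \<in> Lp p M" "g \<in> Lp p M" "g' \<in> Lp p M"
 shows "Lp_dist p M (\<lambda>x. (f x, g x)) (\<lambda>x. (f' x, g' x)) \<le> 2 powr p * (Lp_dist p M f f' + Lp_dist p M g g')"
proof -
 note [simp] = Lp_diff_integrable[OF assms(1)] Lp_Pair[OF assms(1)] assms(2-5)
 have "Lp_dist p M (\<lambda>x. (f x, g x)) (\<lambda>x. (f' x, g' x))
   \<le> (LINT x|M. 2 powr p * (norm (f x - f' x) powr p + norm (g x - g' x) powr p))"
 proof (rule integral_mono)
  show "integrable M (\<lambda>x. norm ((f x, g x) - (f' x, g' x)) powr p)"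
   using Lp_diff_integrable[OF assms(1) Lp_Pair[OF assms(1,2,4)] Lp_Pair[OF assms(1,3,5)]] .
  fix x show "norm ((f x, g x) - (f' x, g' x)) powr p
    \<le> 2 powr p * (norm (f x - f' x) powr p + norm (g x - g' x) powr p)"
   using norm_Pair_powr_le[of p "f x - f' x" "g x - g' x"] assms(1) by simp
 qed simp_all
 then show ?thesis by simp
qed

lemma Lp_tendsto_Pair:
 assumes "0 < p" "!!n. F n \<in> Lp p M" "f \<in> Lp p M" "!!n. G n \<in> Lp p M" "g \<in> Lp p M"
  and "Lp_lim p M F f" "Lp_lim p M G g"
 shows "(\<lambda>n. Lp_dist p M (\<lambda>x. (F n x, G n x)) (\<lambda>x. (f x, g x))) \<longlonglongrightarrow> 0"
proof (rule tendsto_sandwich[OF _ _ tendsto_const])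
 show "(\<lambda>n. 2 powr p * (Lp_dist p M (F n) f + Lp_dist p M (G n) g)) \<longlonglongrightarrow> 0"
  by (rule tendsto_eq_intros assms refl | simp)+
 show "\<forall>\<^sub>F n in sequentially. Lp_dist p M (\<lambda>x. (F n x, G n x)) (\<lambda>x. (f x, g x))
   \<le> 2 powr p * (Lp_dist p M (F n) f + Lp_dist p M (G n) g)"
  by (intro always_eventually allI Lp_dist_Pair assms)
qed (simp add: Lp_dist_nonneg)

lemma Lp_tendsto_add:
 assumes "0 < p" "!!n. F n \<in> Lp p M" "f \<in> Lp p M" "!!n. G n \<in> Lp p M" "g \<in> Lp p M"
  and "Lp_lim p M F f" "Lp_lim p M G g"
 shows "(\<lambda>n. Lp_dist p M (\<lambda>x. F n x + G n x) (\<lambda>x. f x + g x)) \<longlonglongrightarrow> 0"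
proof (rule tendsto_sandwich[OF _ _ tendsto_const])
 show "(\<lambda>n. 2 powr p * (Lp_dist p M (F n) f + Lp_dist p M (G n) g)) \<longlonglongrightarrow> 0"
  by (rule tendsto_eq_intros assms refl | simp)+
 have "Lp_dist p M (\<lambda>x. F n x + G n x) (\<lambda>x. f x + g x)
   \<le> (LINT x|M. 2 powr p * (norm (F n x - f x) powr p + norm (G n x - g x) powr p))" for n
 proof (rule integral_mono)
  show "integrable M (\<lambda>x. norm (F n x + G n x - (f x + g x)) powr p)"
   by (intro Lp_diff_integrable Lp_add assms)
  show "integrable M (\<lambda>x. 2 powr p * (norm (F n x - f x) powr p + norm (G n x - g x) powr p))"
   by (intro integrable_mult_right B_integrable_add Lp_diff_integrable assms)
  fix x show "norm (F n x + G n x - (f x + g x)) powr p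
    \<le> 2 powr p * (norm (F n x - f x) powr p + norm (G n x - g x) powr p)"
   using norm_add_powr_le[of p "F n x - f x" "G n x - g x"] assms(1) by (simp add: algebra_simps)
 qed
 then show "\<forall>\<^sub>F n in sequentially. Lp_dist p M (\<lambda>x. F n x + G n x) (\<lambda>x. f x + g x)
   \<le> 2 powr p * (Lp_dist p M (F n) f + Lp_dist p M (G n) g)"
  using B_integral_add[OF Lp_diff_integrable[OF assms(1,2,3)] Lp_diff_integrable[OF assms(1,4,5)]]
  by simp
qed (simp add: Lp_dist_nonneg)

lemma Lp_tendsto_scaleR:
 assumes "0 < p" "Lp_lim p M F f"
 shows "(\<lambda>n. Lp_dist p M (\<lambda>x. c *\<^sub>R F n x) (\<lambda>x. c *\<^sub>R f x)) \<longlonglongrightarrow> 0"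
proof -
 have "Lp_dist p M (\<lambda>x. c *\<^sub>R F n x) (\<lambda>x. c *\<^sub>R f x) = \<bar>c\<bar> powr p * Lp_dist p M (F n) f" for n
  by (simp add: powr_mult flip: scaleR_right_diff_distrib)
 then show ?thesis using tendsto_mult_right_zero[OF assms(2)] by simp
qed

lemma Lp_subseq_dominated:
 fixes U :: "nat => 'a => 'b::euclidean_space"
 assumes "0 < p" "!!n. U n \<in> Lp p M" "V \<in> Lp p M" "Lp_lim p M U V"
 obtains r H where "strict_mono (r :: nat => nat)" "integrable M H"
  "AE x in M. \<forall>n. norm (U (r n) x - V x) powr p \<le> H x" "AE x in M. (\<lambda>n. U (r n) x) \<longlonglongrightarrow> V x"
proof -
 obtain r H where r: "strict_mono (r :: nat => nat)" "integrable M H"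
  "AE x in M. \<forall>n. norm (U (r n) x - V x) powr p \<le> H x"
  "AE x in M. (\<lambda>n. norm (U (r n) x - V x) powr p) \<longlonglongrightarrow> 0"
  by (rule L1_null_subseq_dominated[of M "\<lambda>n x. norm (U n x - V x) powr p"])
   (simp_all add: assms Lp_diff_integrable[OF assms(1)])
 have "AE x in M. (\<lambda>n. U (r n) x) \<longlonglongrightarrow> V x"
  using r(4)
 proof eventually_elim
  case (elim x)
  have "(\<lambda>n. (norm (U (r n) x - V x) powr p) powr (1 / p)) \<longlonglongrightarrow> 0 powr (1 / p)"
   using assms(1) by (intro tendsto_powr' elim tendsto_const) auto
  then have "(\<lambda>n. norm (U (r n) x - V x)) \<longlonglongrightarrow> 0"
   using assms(1) by (simp add: powr_powr)
  then show ?case by (simp add: tendsto_norm_zero_iff LIM_zero_iff)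
 qed
 with r show thesis using that by blast
qed

text \<open>Continuity of a superposition operator from \<open>L^p\<close> to \<open>L^1\<close>.
  Every subsequence has a further one with an integrable majorant for the \<open>p\<close>-th
  powers, and the growth of order \<open>p\<close> turns it into a majorant for the composed
  functions.\<close>

lemma Lp_nemytskii_tendsto:
 fixes \<Phi> :: "'a => 'b::euclidean_space => 'c::{banach,second_countable_topology}"
 assumes p: "0 < p" and U: "!!n. U n \<in> Lp p M" and V: "V \<in> Lp p M"
  and lim: "Lp_lim p M U V"
  and meas: "!!W. W \<in> borel_measurable M ==> (\<lambda>x. \<Phi> x (W x)) \<in> borel_measurable M"
  and cont: "AE x in M. continuous_on UNIV (\<Phi> x)"
  and bd: "AE x in M. \<forall>xi. norm (\<Phi> x xi) \<le> C * norm xi powr p + h x" and h: "integrable M h" and C: "0 \<le> C"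
 shows "(\<lambda>n. LINT x|M. \<Phi> x (U n x)) \<longlonglongrightarrow> (LINT x|M. \<Phi> x (V x))"
proof (rule LIMSEQ_subseq_subseq)
 fix r :: "nat => nat" assume r: "strict_mono r"
 have lim': "(\<lambda>n. Lp_dist p M (U (r n)) V) \<longlonglongrightarrow> 0"
  using LIMSEQ_subseq_LIMSEQ[OF lim r] by (simp add: o_def)
 obtain s H where s: "strict_mono (s :: nat => nat)" "integrable M H"
  "AE x in M. \<forall>n. norm (U (r (s n)) x - V x) powr p \<le> H x" "AE x in M. (\<lambda>n. U (r (s n)) x) \<longlonglongrightarrow> V x"
  by (rule Lp_subseq_dominated[of p "\<lambda>n. U (r n)" M V]) (use p U V lim' in auto)
 have "(\<lambda>n. LINT x|M. \<Phi> x (U (r (s n)) x)) \<longlonglongrightarrow> (LINT x|M. \<Phi> x (V x))"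
 proof (rule integral_dominated_convergence[where w = "\<lambda>x. C * (2 powr p * (H x + norm (V x) powr p)) + h x"])
  show "integrable M (\<lambda>x. C * (2 powr p * (H x + norm (V x) powr p)) + h x)"
   using s(2) h Lp_integrable[OF V] by auto
  show "AE x in M. (\<lambda>n. \<Phi> x (U (r (s n)) x)) \<longlonglongrightarrow> \<Phi> x (V x)"
   using s(4) cont by eventually_elim (auto intro: continuous_on_tendsto_compose)
  show "AE x in M. norm (\<Phi> x (U (r (s n)) x)) \<le> C * (2 powr p * (H x + norm (V x) powr p)) + h x" for n
   using s(3) bd
  proof eventually_elim
   case (elim x)
   have "norm (U (r (s n)) x) powr p \<le> 2 powr p * (norm (U (r (s n)) x - V x) powr p + norm (V x) powr p)"
    using norm_add_powr_le[of p "U (r (s n)) x - V x" "V x"] p by simp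
   also have "\<dots> \<le> 2 powr p * (H x + norm (V x) powr p)"
    using elim(1) by (intro mult_left_mono) auto
   finally have "C * norm (U (r (s n)) x) powr p \<le> C * (2 powr p * (H x + norm (V x) powr p))"
    using C by (rule mult_left_mono)
   then show ?case using elim(2) by (smt (verit))
  qed
 qed (intro meas Lp_measurable[OF U] Lp_measurable[OF V])+
 then show "\<exists>s. strict_mono (s::nat => nat) \<and> (\<lambda>n. LINT x|M. \<Phi> x (U (r (s n)) x)) \<longlonglongrightarrow> (LINT x|M. \<Phi> x (V x))"
  using s(1) by blast
qed

lemma Lp_complete:
 fixes U :: "nat => 'a => 'b::euclidean_space"
 assumes p: "0 < p" and U: "!!n. U n \<in> Lp p M"
  and Cauchy: "!!e. 0 < e ==> \<exists>N. \<forall>m\<ge>N. \<forall>n\<ge>N. Lp_dist p M (U m) (U n) < e"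
 obtains V where "V \<in> Lp p M" "Lp_lim p M U V"
proof -
 note [measurable] = Lp_measurable[OF U]
 \<comment> \<open>The factor \<open>(2 powr (-p))^k\<close> compensates the weight
   \<open>(2 powr p)^k\<close> put on the differences in \<open>d\<close>. Mere boundedness of
   \<open>d\<close> at a point then forces the norms of the differences to decay like
   \<open>(1/2)^k\<close>.\<close>
 define e where "e k = (1/2)^k * (2 powr (-p))^k" for k :: nat
 have e: "0 < e k" for k by (simp add: e_def)
 have "\<exists>r. \<forall>k. (\<forall>m\<ge>r k. \<forall>n\<ge>r k. Lp_dist p M (U m) (U n) < e k) \<and> r k < r (Suc k)"
 proof (rule dependent_nat_choice)
  show "\<exists>x. \<forall>m\<ge>x. \<forall>n\<ge>x. Lp_dist p M (U m) (U n) < e 0" using Cauchy[OF e] .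
  fix x k
  obtain N where N: "\<forall>m\<ge>N. \<forall>n\<ge>N. Lp_dist p M (U m) (U n) < e (Suc k)" using Cauchy[OF e] by blast
  show "\<exists>y. (\<forall>m\<ge>y. \<forall>n\<ge>y. Lp_dist p M (U m) (U n) < e (Suc k)) \<and> x < y"
   by (rule exI[of _ "N + Suc x"]) (use N in auto)
 qed
 then obtain r where r: "!!k m n. r k \<le> m ==> r k \<le> n ==> Lp_dist p M (U m) (U n) < e k"
  "!!k. r k < r (Suc k)" by blast
 have mono: "strict_mono r" using r(2) by (simp add: strict_mono_Suc_iff)
 define d where "d k x = (2 powr p)^k * norm (U (r (Suc k)) x - U (r k) x) powr p" for k x
 have dint: "(LINT x|M. d k x) \<le> (1/2)^k" for k
 proof -
  have "(LINT x|M. d k x) = (2 powr p)^k * Lp_dist p M (U (r (Suc k))) (U (r k))"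
   by (simp add: d_def)
  also have "\<dots> \<le> (2 powr p)^k * e k"
   using r(1)[of k "r (Suc k)" "r k"] r(2)[of k] by (intro mult_left_mono less_imp_le) auto
  also have "\<dots> = (1/2)^k" by (simp add: e_def powr_minus field_simps)
  finally show ?thesis .
 qed
 have "AE x in M. summable (\<lambda>k. d k x)"
 proof (rule AE_summable_of_summable_integral)
  show "summable (\<lambda>k. LINT x|M. d k x)"
  proof (rule summable_comparison_test'[of "\<lambda>n. (1/2::real)^n" 0])
   fix n show "norm (LINT x|M. d n x) \<le> (1/2)^n"
    using dint[of n] integral_nonneg_AE[of "d n" M] by (simp add: d_def)
  qed (auto intro: summable_geometric)
 qed (use Lp_diff_integrable[OF p U U] in \<open>auto simp: d_def\<close>)
 then have conv: "AE x in M. convergent (\<lambda>k. U (r k) x)"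
 proof eventually_elim
  case (elim x)
  from summable_LIMSEQ_zero[OF elim] have "Bseq (\<lambda>k. d k x)"
   by (intro convergent_imp_Bseq) (auto simp: convergent_def)
  then obtain K where K: "0 < K" "!!k. norm (d k x) \<le> K" by (auto elim: BseqE)
  have bd: "norm (U (r (Suc k)) x - U (r k) x) \<le> K powr (1/p) * (1/2)^k" for k
  proof -
   have "norm (U (r (Suc k)) x - U (r k) x) powr p * (2 powr p)^k \<le> K"
    using K(2)[of k] by (simp add: d_def mult.commute)
   then have "norm (U (r (Suc k)) x - U (r k) x) powr p \<le> K * (1/2 powr p)^k"
    by (simp add: field_simps power_divide)
   then have "(norm (U (r (Suc k)) x - U (r k) x) powr p) powr (1/p) \<le> (K * (1/2 powr p)^k) powr (1/p)"
    using p by (intro powr_mono2) auto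
   moreover have "(1/2 powr p)^k = ((1/2)^k) powr p"
    by (simp add: powr_divide powr_power powr_powr mult.commute flip: powr_realpow)
   ultimately show ?thesis using p K(1) by (simp add: powr_powr powr_mult)
  qed
  have "summable (\<lambda>k. U (r (Suc k)) x - U (r k) x)"
   by (rule summable_norm_cancel, rule summable_comparison_test'[of "\<lambda>k. K powr (1/p) * (1/2)^k" 0])
    (use bd in \<open>auto intro: summable_geometric summable_mult\<close>)
  then have "convergent (\<lambda>n. \<Sum>k<n. U (r (Suc k)) x - U (r k) x)"
   by (simp add: summable_iff_convergent)
  then have "convergent (\<lambda>n. U (r n) x - U (r 0) x)"
   by (simp add: sum_lessThan_telescope[of "\<lambda>k. U (r k) x"])
  then obtain L where "(\<lambda>n. U (r n) x - U (r 0) x) \<longlonglongrightarrow> L" by (auto simp: convergent_def)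
  from tendsto_add[OF this tendsto_const[of "U (r 0) x"]] show ?case by (auto simp: convergent_def)
 qed
 define V where "V x = lim (\<lambda>k. U (r k) x)" for x
 have [measurable]: "V \<in> borel_measurable M" unfolding V_def by measurable
 \<comment> \<open>Fatou's lemma along the subsequence carries the Cauchy estimate over to the
   limit.\<close>
 have bound: "(\<integral>\<^sup>+x. ennreal (norm (U m x - V x) powr p) \<partial>M) \<le> e K" if "r K \<le> m" for m K
 proof -
  have "(\<integral>\<^sup>+x. ennreal (norm (U m x - V x) powr p) \<partial>M)
    \<le> (\<integral>\<^sup>+x. liminf (\<lambda>k. ennreal (norm (U m x - U (r k) x) powr p)) \<partial>M)"
  proof (rule nn_integral_mono_AE)
   show "AE x in M. ennreal (norm (U m x - V x) powr p) \<le> liminf (\<lambda>k. ennreal (norm (U m x - U (r k) x) powr p))"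
    using conv
   proof eventually_elim
    case (elim x)
    then have l: "(\<lambda>k. U (r k) x) \<longlonglongrightarrow> V x" unfolding V_def by (simp add: convergent_LIMSEQ_iff)
    have "(\<lambda>k. ennreal (norm (U m x - U (r k) x) powr p)) \<longlonglongrightarrow> ennreal (norm (U m x - V x) powr p)"
     using p by (intro tendsto_ennrealI tendsto_powr' tendsto_norm tendsto_diff tendsto_const l) auto
    then show ?case by (rule eq_refl[OF lim_imp_Liminf[OF sequentially_bot, symmetric]])
   qed
  qed
  also have "\<dots> \<le> liminf (\<lambda>k. \<integral>\<^sup>+x. ennreal (norm (U m x - U (r k) x) powr p) \<partial>M)"
   by (rule nn_integral_liminf) measurable
  also have "\<dots> \<le> e K"
  proof (rule Liminf_le)
   have "(\<integral>\<^sup>+x. ennreal (norm (U m x - U (r k) x) powr p) \<partial>M) \<le> e K" if "K \<le> k" for k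
   proof -
    have "r K \<le> r k" using strict_mono_less_eq[OF mono] that by simp
    from r(1)[OF \<open>r K \<le> m\<close> this] show ?thesis
     using Lp_diff_integrable[OF p U U, of m "r k"] e[of K]
     by (subst nn_integral_eq_integral) (auto intro!: ennreal_leI)
   qed
   then show "\<forall>\<^sub>F k in sequentially. (\<integral>\<^sup>+x. ennreal (norm (U m x - U (r k) x) powr p) \<partial>M) \<le> e K"
    by (auto simp: eventually_at_top_linorder)
  qed simp
  finally show ?thesis .
 qed
 have int: "integrable M (\<lambda>x. norm (U m x - V x) powr p)" if "r 0 \<le> m" for m
  by (rule integrableI_bounded) (use bound[OF that] in \<open>auto simp: order.strict_trans1\<close>)
 have "V \<in> Lp p M"
 proof -
  have "(\<lambda>x. U (r 0) x - V x) \<in> Lp p M" using int[of "r 0"] by (simp add: Lp_def)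
  from Lp_diff[OF p U[of "r 0"] this] show ?thesis by simp
 qed
 moreover have "Lp_lim p M U V"
 proof (rule LIMSEQ_I)
  fix eps :: real assume "0 < eps"
  have "2 powr - p \<le> 2 powr (0::real)" using p by (intro powr_mono) auto
  then have "(\<lambda>k. e k) \<longlonglongrightarrow> 0"
   unfolding e_def power_mult_distrib[symmetric] by (intro LIMSEQ_power_zero) simp
  from order_tendstoD(2)[OF this \<open>0 < eps\<close>] obtain K where K: "e K < eps" by (auto dest: eventually_happens)
  have "Lp_dist p M (U n) V < eps" if "r K \<le> n" for n
  proof -
   have "r 0 \<le> n" using strict_mono_less_eq[OF mono, of 0 K] that by simp
   then have "ennreal (Lp_dist p M (U n) V) \<le> e K"
    using bound[OF that] int by (subst (asm) nn_integral_eq_integral) auto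
   then show ?thesis using K e[of K] by (simp add: ennreal_le_iff)
  qed
  then show "\<exists>N. \<forall>n\<ge>N. norm (Lp_dist p M (U n) V - 0) < eps"
   using Lp_dist_nonneg by (intro exI[of _ "r K"]) auto
 qed
 ultimately show thesis by (rule that)
qed

section \<open>Monotone variational inequalities\<close>

text \<open>The sum of squared constraint violations can be decreased by moving towards the mixture
 weighted by the violations themselves, because the symmetric part of the matrix is
 nonnegative.\<close>

lemma nonneg_symmetric_part_approx_strategy:
 fixes A :: "'i => 'i => real"
 assumes I: "finite I" "I \<noteq> {}" and sym: "!!i j. i \<in> I ==> j \<in> I ==> 0 \<le> A i j + A j i"
  and e: "0 < e"
 obtains l where "\<forall>i\<in>I. 0 \<le> l i" "sum l I = 1" "\<forall>i\<in>I. - e \<le> (\<Sum>j\<in>I. l j * A i j)"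
proof -
 define S where "S = {l. (\<forall>i\<in>I. 0 \<le> l i) \<and> sum l I = (1::real)}"
 define row where "row l i = (\<Sum>j\<in>I. l j * A i j)" for l i
 define r where "r l i = max 0 (- row l i)" for l i
 define phi where "phi l = (\<Sum>i\<in>I. (r l i)\<^sup>2)" for l
 define K where "K = (\<Sum>i\<in>I. \<Sum>j\<in>I. \<bar>A i j\<bar>)"
 define C where "C = (\<Sum>i\<in>I. (2 * K)\<^sup>2)"
 have C0: "0 \<le> C" unfolding C_def by (simp add: sum_nonneg)
 have phi0: "0 \<le> phi l" for l by (simp add: phi_def sum_nonneg)
 have Sne: "S \<noteq> {}"
 proof -
  from I obtain i0 where "i0 \<in> I" by auto
  then have "(\<lambda>i. if i = i0 then 1 else 0) \<in> S" using I by (simp add: S_def sum.delta)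
  then show ?thesis by auto
 qed
 have rowK: "\<bar>row l i\<bar> \<le> K" if "l \<in> S" "i \<in> I" for l i
 proof -
  have l1: "l j \<le> 1" if "j \<in> I" for j
   using \<open>l \<in> S\<close> that I member_le_sum[of j I l] by (auto simp: S_def)
  have "\<bar>row l i\<bar> \<le> (\<Sum>j\<in>I. \<bar>l j * A i j\<bar>)" unfolding row_def by (rule sum_abs)
  also have "\<dots> \<le> (\<Sum>j\<in>I. \<bar>A i j\<bar>)"
  proof (rule sum_mono)
   fix j assume "j \<in> I"
   then have "0 \<le> l j" "l j \<le> 1" using \<open>l \<in> S\<close> l1 by (auto simp: S_def)
   then show "\<bar>l j * A i j\<bar> \<le> \<bar>A i j\<bar>" by (simp add: abs_mult mult_left_le_one_le)
  qed
  also have "\<dots> \<le> K" unfolding K_def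
   using I that(2) by (intro member_le_sum[of i I "\<lambda>i. \<Sum>j\<in>I. \<bar>A i j\<bar>"]) (auto intro: sum_nonneg)
  finally show ?thesis .
 qed
 have step: "\<exists>l'\<in>S. phi l' \<le> phi l - 2 * s * phi l + s\<^sup>2 * C" if l: "l \<in> S" and pos: "0 < phi l" and s: "0 \<le> s" "s \<le> 1" for l s
 proof -
  define \<rho> where "\<rho> = (\<Sum>i\<in>I. r l i)"
  have r0: "0 \<le> r l i" for i by (simp add: r_def)
  have \<rho>: "0 < \<rho>"
  proof (rule ccontr)
   assume "\<not> 0 < \<rho>"
   then have "\<rho> = 0" using r0 by (simp add: \<rho>_def sum_nonneg order.antisym not_less)
   then have "\<forall>i\<in>I. r l i = 0" using I r0 by (simp add: \<rho>_def sum_nonneg_eq_0_iff)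
   then show False using pos by (simp add: phi_def)
  qed
  define \<mu> where "\<mu> i = r l i / \<rho>" for i
  have \<mu>: "\<mu> \<in> S" using \<rho> r0 by (auto simp: S_def \<mu>_def simp flip: sum_divide_distrib) (simp add: \<rho>_def)
  define l' where "l' i = (1 - s) * l i + s * \<mu> i" for i
  have l': "l' \<in> S" using l \<mu> s by (auto simp: S_def l'_def sum.distrib simp flip: sum_distrib_left)
  define d where "d i = row \<mu> i - row l i" for i
  have row': "row l' i = row l i + s * d i" for i
   by (simp add: row_def d_def l'_def sum.distrib sum_distrib_left algebra_simps sum_subtractf)
  \<comment> \<open>The quadratic form of \<open>A\<close> at the violations is half that of its
    symmetrization, hence nonnegative; this bounds the contribution of \<open>\<mu>\<close>. The
    contribution of \<open>l\<close> is exactly \<open>- phi l\<close>, since \<open>r\<close> is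
    the negative part of \<open>row\<close>.\<close>
  have rd: "phi l \<le> (\<Sum>i\<in>I. r l i * d i)"
  proof -
   have "0 \<le> (\<Sum>i\<in>I. \<Sum>j\<in>I. r l i * r l j * (A i j + A j i))"
    using r0 sym by (intro sum_nonneg mult_nonneg_nonneg) auto
   also have "\<dots> = (\<Sum>i\<in>I. \<Sum>j\<in>I. r l i * r l j * A i j) + (\<Sum>i\<in>I. \<Sum>j\<in>I. r l i * r l j * A j i)"
    by (simp add: algebra_simps sum.distrib)
   also have "(\<Sum>i\<in>I. \<Sum>j\<in>I. r l i * r l j * A j i) = (\<Sum>i\<in>I. \<Sum>j\<in>I. r l i * r l j * A i j)"
    by (subst sum.swap) (simp add: mult_ac)
   finally have "0 \<le> (\<Sum>i\<in>I. \<Sum>j\<in>I. r l i * r l j * A i j)" by simp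
   moreover have "(\<Sum>i\<in>I. r l i * row \<mu> i) = (\<Sum>i\<in>I. \<Sum>j\<in>I. r l i * r l j * A i j) / \<rho>"
    by (simp add: row_def \<mu>_def sum_distrib_left sum_divide_distrib mult_ac)
   ultimately have 1: "0 \<le> (\<Sum>i\<in>I. r l i * row \<mu> i)" using \<rho> by simp
   have "r l i * row l i = - (r l i)\<^sup>2" for i by (auto simp: r_def max_def power2_eq_square)
   then have "(\<Sum>i\<in>I. r l i * row l i) = - phi l" by (simp add: phi_def sum_negf)
   then show ?thesis using 1 by (simp add: d_def algebra_simps sum_subtractf)
  qed
  have "phi l' \<le> (\<Sum>i\<in>I. (r l i - s * d i)\<^sup>2)"
   unfolding phi_def
  proof (rule sum_mono)
   fix i
   \<comment> \<open>\<open>r l i\<close> is at least \<open>- row l i\<close>, and the positive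
     part of a number is at most its absolute value.\<close>
   have "\<bar>r l' i\<bar> \<le> \<bar>r l i - s * d i\<bar>"
    unfolding r_def row' by (auto simp: max_def)
   then show "(r l' i)\<^sup>2 \<le> (r l i - s * d i)\<^sup>2" by (rule abs_le_square_iff[THEN iffD1])
  qed
  also have "\<dots> = phi l - 2 * s * (\<Sum>i\<in>I. r l i * d i) + s\<^sup>2 * (\<Sum>i\<in>I. (d i)\<^sup>2)"
   by (simp add: phi_def power2_diff sum.distrib sum_subtractf sum_distrib_left power_mult_distrib mult_ac)
  also have "\<dots> \<le> phi l - 2 * s * phi l + s\<^sup>2 * C"
  proof -
   have "(\<Sum>i\<in>I. (d i)\<^sup>2) \<le> C" unfolding C_def
   proof (rule sum_mono)
    fix i assume "i \<in> I"
    then have "\<bar>d i\<bar> \<le> 2 * K" using rowK[OF l] rowK[OF \<mu>] unfolding d_def by fastforce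
    then show "(d i)\<^sup>2 \<le> (2 * K)\<^sup>2" by (metis abs_le_square_iff abs_ge_self order_trans)
   qed
   then have "s\<^sup>2 * (\<Sum>i\<in>I. (d i)\<^sup>2) \<le> s\<^sup>2 * C" by (intro mult_left_mono) auto
   moreover have "2 * s * phi l \<le> 2 * s * (\<Sum>i\<in>I. r l i * d i)" using rd s by (intro mult_left_mono) auto
   ultimately show ?thesis by linarith
  qed
  finally show ?thesis using l' by blast
 qed
 define m where "m = Inf (phi ` S)"
 have bdd: "bdd_below (phi ` S)" using phi0 by (auto intro: bdd_belowI[of _ 0])
 have mle: "m \<le> phi l" if "l \<in> S" for l unfolding m_def using that bdd by (intro cInf_lower) auto
 have mge: "0 \<le> m" unfolding m_def using Sne phi0 by (intro cInf_greatest) auto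
 have near: "\<exists>l\<in>S. phi l < m + eta" if "0 < eta" for eta
  using cInf_lessD[of "phi ` S" "m + eta"] Sne that by (auto simp: m_def)
 have "m = 0"
 proof (rule ccontr)
  assume "m \<noteq> 0"
  then have m: "0 < m" using mge by simp
  \<comment> \<open>Chosen so small that the quadratic term \<open>s^2 * C\<close> stays below the
    linear gain \<open>2 * s * m\<close>. A point within \<open>s * m / 2\<close> of the infimum
    would then be improved to a value below it.\<close>
  define s where "s = min (1/2) (m / (C + 1))"
  have "0 < s" using m C0 by (simp add: s_def)
  moreover have "s \<le> 1/2" unfolding s_def by (rule min.cobounded1)
  moreover have "s \<le> m / (C + 1)" unfolding s_def by (rule min.cobounded2)
  ultimately have s: "0 < s" "s \<le> 1/2" "s \<le> m / (C + 1)" by auto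
  then have sC: "s * (C + 1) \<le> m" using C0 by (simp add: pos_le_divide_eq)
  obtain l where l: "l \<in> S" "phi l < m + s * m / 2" using near[of "s * m / 2"] s m by auto
  obtain l' where l': "l' \<in> S" "phi l' \<le> phi l - 2 * s * phi l + s\<^sup>2 * C"
   using step[of l s] l mle[of l] m s by force
  have "m \<le> phi l * (1 - 2 * s) + s\<^sup>2 * C" using mle[OF l'(1)] l'(2) by (simp add: algebra_simps)
  also have "phi l * (1 - 2 * s) \<le> (m + s * m / 2) * (1 - 2 * s)" using l s by (intro mult_right_mono) auto
  also have "\<dots> \<le> m + s * m / 2 - 2 * s * m" using s m by (simp add: algebra_simps)
  finally have "s * (3 / 2 * m) \<le> s * (s * C)" by (simp add: power2_eq_square algebra_simps)
  then have "3 / 2 * m \<le> s * C" using s by simp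
  then show False using s sC m by (simp add: algebra_simps)
 qed
 then obtain l where l: "l \<in> S" "phi l < e\<^sup>2" using near[of "e\<^sup>2"] e by auto
 have "- e \<le> (\<Sum>j\<in>I. l j * A i j)" if i: "i \<in> I" for i
 proof -
  have "(r l i)\<^sup>2 \<le> phi l" unfolding phi_def using I i by (intro member_le_sum[of i I "\<lambda>i. (r l i)\<^sup>2"]) auto
  then have "(r l i)\<^sup>2 < e\<^sup>2" using l by simp
  then have "r l i < e" using e by (simp add: power_less_imp_less_base)
  then show ?thesis by (auto simp: r_def row_def)
 qed
 then show thesis using that[of l] l by (auto simp: S_def)
qed

text \<open>This replaces weak compactness: near-minimizers of a uniformly convex functional over a
 directed family of convex sets form a Cauchy sequence whose limit lies in the closure of each
 of them.\<close>

lemma directed_near_minimizers: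
 fixes S :: "'i => 'a set" and D :: "'a set" and J :: "'a => real" and d :: "'a => 'a => real"
 assumes fip: "!!E. finite E ==> D \<inter> (\<Inter>i\<in>E. S i) \<noteq> {}"
  and midD: "!!u v. u \<in> D ==> v \<in> D ==> mid u v \<in> D"
  and midS: "!!u v i. u \<in> D \<inter> S i ==> v \<in> D \<inter> S i ==> mid u v \<in> S i"
  and J0: "!!u. u \<in> D ==> 0 \<le> J u" and JR: "!!u. u \<in> D ==> J u \<le> R"
  and uc: "!!e. 0 < e ==> \<exists>eta>0. \<forall>u\<in>D. \<forall>v\<in>D. J u + J v - 2 * J (mid u v) \<le> eta --> d u v < e"
 obtains U :: "nat => 'a" where "\<forall>n. U n \<in> D"
  "\<forall>e>0. \<exists>N. \<forall>m\<ge>N. \<forall>n\<ge>N. d (U m) (U n) < e"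
  "\<forall>i. \<exists>U'. (\<forall>n. U' n \<in> D \<inter> S i) \<and> (\<forall>e>0. \<exists>N. \<forall>n\<ge>N. d (U' n) (U n) < e)"
proof -
 define C where "C E = D \<inter> (\<Inter>i\<in>E. S i)" for E
 define m where "m E = Inf (J ` C E)" for E
 have CD: "C E \<subseteq> D" for E by (auto simp: C_def)
 have Cne: "C E \<noteq> {}" if "finite E" for E using fip[OF that] by (simp add: C_def)
 have bdd: "bdd_below (J ` C E)" for E using J0 CD by (intro bdd_belowI[of _ 0]) auto
 have mle: "m E \<le> J u" if "u \<in> C E" for E u unfolding m_def using that bdd by (intro cInf_lower) auto
 have near: "\<exists>u\<in>C E. J u < m E + eta" if "finite E" "0 < eta" for E eta
  using cInf_lessD[of "J ` C E" "m E + eta"] Cne[OF that(1)] that(2) by (auto simp: m_def)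
 have mR: "m E \<le> R" if "finite E" for E
  using Cne[OF that] mle JR CD by (meson all_not_in_conv order_trans subsetD)
 have mmono: "m E \<le> m E'" if "E \<subseteq> E'" "finite E'" for E E'
  unfolding m_def using Cne[OF that(2)] bdd that(1) by (intro cInf_superset_mono image_mono) (auto simp: C_def)
 \<comment> \<open>The constrained infimum grows with the set of constraints; \<open>ms\<close> is
   its limit over all finite sets.\<close>
 define ms where "ms = Sup (m ` {E. finite E})"
 have bdda: "bdd_above (m ` {E. finite E})" using mR by (intro bdd_aboveI[of _ R]) auto
 have ms: "m E \<le> ms" if "finite E" for E unfolding ms_def using that bdda by (intro cSup_upper) auto
 have "\<exists>E. finite E \<and> ms - 1 / real (Suc n) < m E" for n
 proof -
  have "ms - 1 / real (Suc n) < ms" by simp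
  from less_cSupD[OF _ this[unfolded ms_def]] show ?thesis unfolding ms_def by auto
 qed
 then obtain E where E: "!!n. finite (E n)" "!!n. ms - 1 / real (Suc n) < m (E n)" by metis
 \<comment> \<open>Unions of the near-optimal sets of constraints make the constraint sets nested
   while keeping their infima near \<open>ms\<close>.\<close>
 define F where "F n = (\<Union>k\<le>n. E k)" for n :: nat
 have F: "finite (F n)" "ms - 1 / real (Suc n) < m (F n)" for n
 proof -
  show fin: "finite (F n)" using E by (auto simp: F_def)
  have "m (E n) \<le> m (F n)" by (rule mmono) (use fin in \<open>auto simp: F_def\<close>)
  then show "ms - 1 / real (Suc n) < m (F n)" using E(2)[of n] by simp
 qed
 have Fmono: "F n \<subseteq> F k" if "n \<le> k" for n k using that by (force simp: F_def)
 have "\<exists>u\<in>C (F n). J u < m (F n) + 1 / real (Suc n)" for n by (rule near) (auto simp: F)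
 then obtain U where U: "!!n. U n \<in> C (F n)" "!!n. J (U n) < m (F n) + 1 / real (Suc n)" by metis
 have JU: "J (U n) < ms + 1 / real (Suc n)" for n using U(2)[of n] ms[OF F(1), of n] by simp
 have midC: "mid u v \<in> C E" if "u \<in> C E" "v \<in> C E" for u v E
  using that midD midS unfolding C_def by (auto; blast)
 have close: "\<exists>N. \<forall>n\<ge>N. \<forall>u\<in>C (F N). \<forall>v\<in>C (F N). J u \<le> ms + 1 / real (Suc N) -->
   J v \<le> ms + 1 / real (Suc N) --> d u v < e" if e: "0 < e" for e
 proof -
  obtain eta where eta: "0 < eta" "!!u v. u \<in> D ==> v \<in> D ==> J u + J v - 2 * J (mid u v) \<le> eta ==> d u v < e"
   using uc[OF e] by blast
  obtain N :: nat where N: "4 / eta < real N" using reals_Archimedean2 by blast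
  have N': "4 / real (Suc N) \<le> eta" using N eta(1) by (simp add: field_simps)
  show ?thesis
  proof (intro exI[of _ N] allI ballI impI)
   fix u v assume uv: "u \<in> C (F N)" "v \<in> C (F N)"
    "J u \<le> ms + 1 / real (Suc N)" "J v \<le> ms + 1 / real (Suc N)"
   have "ms - 1 / real (Suc N) < J (mid u v)" using mle[OF midC[OF uv(1,2)]] F(2)[of N] by linarith
   \<comment> \<open>The two values exceed \<open>ms\<close> by at most \<open>1 / Suc N\<close>
     each, and the midpoint, still admissible, falls short of it by less than
     \<open>1 / Suc N\<close>; doubled, this adds up to four such units.\<close>
   then have "J u + J v - 2 * J (mid u v) \<le> 4 / real (Suc N)" using uv by (simp add: field_simps)
   then show "d u v < e" using eta(2) uv(1,2) CD N' by (meson order_trans subsetD)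
  qed
 qed
 have le1: "1 / real (Suc n) \<le> 1 / real (Suc N)" if "N \<le> n" for n N using that by (simp add: frac_le)
 have CF: "C (F n) \<subseteq> C (F N)" if "N \<le> n" for n N using Fmono[OF that] by (auto simp: C_def)
 show thesis
 proof (rule that; intro allI impI)
  show "U n \<in> D" for n using U(1) CD by blast
  show "\<exists>N. \<forall>m\<ge>N. \<forall>n\<ge>N. d (U m) (U n) < e" if "0 < e" for e
  proof -
   obtain N where N: "\<forall>u\<in>C (F N). \<forall>v\<in>C (F N). J u \<le> ms + 1 / real (Suc N) -->
     J v \<le> ms + 1 / real (Suc N) --> d u v < e" using close[OF \<open>0 < e\<close>] by blast
   show ?thesis
   proof (intro exI[of _ N] allI impI)
    fix m n assume mn: "N \<le> m" "N \<le> n"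
    show "d (U m) (U n) < e"
     using N U(1)[of m] U(1)[of n] CF[OF mn(1)] CF[OF mn(2)] JU[of m] JU[of n] le1[OF mn(1)] le1[OF mn(2)]
     by (smt (verit) subsetD)
   qed
  qed
  fix i
  \<comment> \<open>Even with the extra constraint \<open>i\<close> the infimum is at most
    \<open>ms\<close>, so near-minimizers that also obey \<open>i\<close> are near-minimizers for
    \<open>F n\<close>. Uniform convexity keeps them close to \<open>U n\<close>.\<close>
  have "\<exists>u\<in>C (insert i (F n)). J u < m (insert i (F n)) + 1 / real (Suc n)" for n
   by (rule near) (auto simp: F)
  then obtain U' where U': "!!n. U' n \<in> C (insert i (F n))"
   "!!n. J (U' n) < m (insert i (F n)) + 1 / real (Suc n)" by metis
  have JU': "J (U' n) < ms + 1 / real (Suc n)" for n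
   using U'(2)[of n] ms[of "insert i (F n)"] F(1)[of n] by simp
  have U'F: "U' n \<in> C (F n)" "U' n \<in> D \<inter> S i" for n using U'(1)[of n] by (auto simp: C_def)
  have "\<exists>N. \<forall>n\<ge>N. d (U' n) (U n) < e" if "0 < e" for e
  proof -
   obtain N where N: "\<forall>u\<in>C (F N). \<forall>v\<in>C (F N). J u \<le> ms + 1 / real (Suc N) -->
     J v \<le> ms + 1 / real (Suc N) --> d u v < e" using close[OF \<open>0 < e\<close>] by blast
   show ?thesis
   proof (intro exI[of _ N] allI impI)
    fix n assume n: "N \<le> n"
    show "d (U' n) (U n) < e"
     using N U(1)[of n] U'F(1)[of n] CF[OF n] JU[of n] JU'[of n] le1[OF n]
     by (smt (verit) subsetD)
   qed
  qed
  then show "\<exists>U'. (\<forall>n. U' n \<in> D \<inter> S i) \<and> (\<forall>e>0. \<exists>N. \<forall>n\<ge>N. d (U' n) (U n) < e)"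
   using U'F by blast
 qed
qed

lemma lim_inverse_Suc: "(\<lambda>n. 1 / real (Suc n)) \<longlonglongrightarrow> 0"
 using LIMSEQ_inverse_real_of_nat by (simp add: inverse_eq_divide)

lemma measurable_fst_snd:
 fixes U :: "'a => 'b::euclidean_space \<times> 'c::euclidean_space"
 assumes "U \<in> borel_measurable N"
 shows "(\<lambda>x. fst (U x)) \<in> borel_measurable N" "(\<lambda>x. snd (U x)) \<in> borel_measurable N"
 by (intro borel_measurable_continuous_on[OF _ assms] continuous_intros)+

lemma finite_convex_combination_mem:
 fixes D :: "('a => 'b::real_vector) set"
 assumes conv: "!!U V t. U \<in> D ==> V \<in> D ==> 0 \<le> t ==> t \<le> 1 ==> (\<lambda>x. (1 - t) *\<^sub>R U x + t *\<^sub>R V x) \<in> D"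
  and "finite I" "I \<noteq> {}" "!!i. i \<in> I ==> F i \<in> D" "!!i. i \<in> I ==> 0 \<le> l i" "sum l I = (1::real)"
 shows "(\<lambda>x. \<Sum>i\<in>I. l i *\<^sub>R F i x) \<in> D"
 using assms(2-)
proof (induction I arbitrary: l rule: finite_ne_induct)
 case (singleton i)
 then show ?case by simp
next
 case (insert i I)
 have s: "l i + sum l I = 1" using insert by simp
 have nn: "0 \<le> sum l I" using insert by (intro sum_nonneg) auto
 show ?case
 proof (cases "sum l I = 0")
  case True
  then have "\<forall>j\<in>I. l j = 0" using insert by (subst (asm) sum_nonneg_eq_0_iff) auto
  then show ?thesis using insert s True by simp
 next
  case False
  define t where "t = sum l I"
  have t: "0 < t" "t \<le> 1" using False nn s insert.prems(2)[of i] by (auto simp: t_def)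
  have "(\<lambda>x. \<Sum>j\<in>I. (l j / t) *\<^sub>R F j x) \<in> D"
   using insert t by (intro insert.IH) (auto simp: t_def simp flip: sum_divide_distrib)
  from conv[OF insert.prems(1)[of i] this, of t]
  have "(\<lambda>x. (1 - t) *\<^sub>R F i x + t *\<^sub>R (\<Sum>j\<in>I. (l j / t) *\<^sub>R F j x)) \<in> D" using t by simp
  moreover have "1 - t = l i" using s by (simp add: t_def)
  moreover have "t *\<^sub>R (\<Sum>j\<in>I. (l j / t) *\<^sub>R F j x) = (\<Sum>j\<in>I. l j *\<^sub>R F j x)" for x
   using t by (simp add: scaleR_sum_right)
  ultimately show ?thesis using insert by simp
 qed
qed

text \<open>The growth condition is imposed on the pairing, so that no dual exponent appears. The
  integrable \<open>h\<close> makes room for a source term whose size is governed by the dual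
  weight.\<close>

locale monotone_operator =
 fixes M :: "'a measure" and p :: real and B :: "'a => 'b::euclidean_space => 'b"
  and C :: real and h :: "'a => real"
 assumes p: "1 < p"
  and meas: "!!W. W \<in> borel_measurable M ==> (\<lambda>x. B x (W x)) \<in> borel_measurable M"
  and cont: "AE x in M. continuous_on UNIV (B x)"
  and bound: "AE x in M. \<forall>xi eta. \<bar>B x xi \<bullet> eta\<bar> \<le> C * (norm xi powr p + norm eta powr p) + h x"
  and C: "0 \<le> C" and h: "integrable M h"
  and mono: "AE x in M. \<forall>xi eta. 0 \<le> (B x xi - B x eta) \<bullet> (xi - eta)"
begin

lemma p0: "0 < p" using p by simp

lemma pairing_integrable:
 assumes "U \<in> Lp p M" "V \<in> Lp p M"
 shows "integrable M (\<lambda>x. B x (U x) \<bullet> V x)"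
proof (rule B_integrable_bound)
 show "integrable M (\<lambda>x. C * (norm (U x) powr p + norm (V x) powr p) + h x)"
  by (intro B_integrable_add integrable_mult_right Lp_integrable assms h)
 show "AE x in M. norm (B x (U x) \<bullet> V x) \<le> norm (C * (norm (U x) powr p + norm (V x) powr p) + h x)"
  using bound by eventually_elim (smt (verit) real_norm_def)
qed (rule borel_measurable_inner[OF meas[OF Lp_measurable[OF assms(1)]] Lp_measurable[OF assms(2)]])

text \<open>Both arguments are bundled into one pair; the pairing is then a single superposition
  operator of growth \<open>p\<close>, continuous under strong convergence.\<close>

lemma pairing_tendsto:
 assumes "!!n. U n \<in> Lp p M" "U0 \<in> Lp p M" "!!n. V n \<in> Lp p M" "V0 \<in> Lp p M"
  and "Lp_lim p M U U0" "Lp_lim p M V V0"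
 shows "(\<lambda>n. LINT x|M. B x (U n x) \<bullet> V n x) \<longlonglongrightarrow> (LINT x|M. B x (U0 x) \<bullet> V0 x)"
proof -
 have "(\<lambda>n. LINT x|M. (\<lambda>x xi. B x (fst xi) \<bullet> snd xi) x (U n x, V n x))
   \<longlonglongrightarrow> (LINT x|M. (\<lambda>x xi. B x (fst xi) \<bullet> snd xi) x (U0 x, V0 x))"
 proof (rule Lp_nemytskii_tendsto[OF p0, where C = "2 * C" and h = h
    and \<Phi> = "\<lambda>x xi. B x (fst xi) \<bullet> snd xi" and U = "\<lambda>n x. (U n x, V n x)" and V = "\<lambda>x. (U0 x, V0 x)"])
  show "(\<lambda>n. Lp_dist p M (\<lambda>x. (U n x, V n x)) (\<lambda>x. (U0 x, V0 x))) \<longlonglongrightarrow> 0"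
   by (intro Lp_tendsto_Pair p0 assms)
  show "(\<lambda>x. B x (fst (W x)) \<bullet> snd (W x)) \<in> borel_measurable M" if W: "W \<in> borel_measurable M" for W
  proof -
   have "(\<lambda>x. fst (W x)) \<in> borel_measurable M" "(\<lambda>x. snd (W x)) \<in> borel_measurable M"
    by (rule measurable_fst_snd[OF W])+
   then show ?thesis by (intro borel_measurable_inner meas)
  qed
  show "AE x in M. continuous_on UNIV (\<lambda>xi. B x (fst xi) \<bullet> snd xi)"
   using cont
  proof eventually_elim
   case (elim x)
   show ?case
    by (intro continuous_on_inner continuous_on_compose2[OF elim]
      continuous_on_fst continuous_on_snd continuous_on_id) auto
  qed
  show "AE x in M. \<forall>xi. norm (B x (fst xi) \<bullet> snd xi) \<le> 2 * C * norm xi powr p + h x"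
   using bound
  proof eventually_elim
   case (elim x)
   show ?case
   proof
    fix xi :: "'b \<times> 'b"
    have "norm (fst xi) powr p \<le> norm xi powr p" "norm (snd xi) powr p \<le> norm xi powr p"
     using p norm_fst_le[of "fst xi" "snd xi"] norm_snd_le[of "snd xi" "fst xi"]
     by (auto intro!: powr_mono2)
    then have "C * (norm (fst xi) powr p + norm (snd xi) powr p) \<le> C * (2 * norm xi powr p)"
     using C by (intro mult_left_mono) auto
    then show "norm (B x (fst xi) \<bullet> snd xi) \<le> 2 * C * norm xi powr p + h x"
     using elim[rule_format, of "fst xi" "snd xi"] by simp
   qed
  qed
 qed (use assms C h in \<open>auto intro: Lp_Pair[OF p0]\<close>)
 then show ?thesis by simp
qed

lemma pairing_mono:
 assumes "U \<in> Lp p M" "V \<in> Lp p M"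
 shows "0 \<le> (LINT x|M. B x (U x) \<bullet> (U x - V x)) - (LINT x|M. B x (V x) \<bullet> (U x - V x))"
proof -
 have "0 \<le> (LINT x|M. B x (U x) \<bullet> (U x - V x) - B x (V x) \<bullet> (U x - V x))"
  using mono by (intro integral_nonneg_AE) (auto simp: inner_diff_left elim!: eventually_mono)
 also have "\<dots> = (LINT x|M. B x (U x) \<bullet> (U x - V x)) - (LINT x|M. B x (V x) \<bullet> (U x - V x))"
  by (intro B_integral_diff pairing_integrable Lp_diff p0 assms)
 finally show ?thesis .
qed

text \<open>\<open>D\<close> is bounded and convex but not assumed closed, which suits a set of jets
  of test functions: the solution is a strong limit of elements of \<open>D\<close> and is tested
  against elements of \<open>D\<close> only.\<close>

theorem variational_inequality_exists:
 fixes D :: "('a => 'b) set"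
 assumes ne: "D \<noteq> {}" and DL: "D \<subseteq> Lp p M"
  and conv: "!!U V t. U \<in> D ==> V \<in> D ==> 0 \<le> t ==> t \<le> 1 ==> (\<lambda>x. (1 - t) *\<^sub>R U x + t *\<^sub>R V x) \<in> D"
  and R: "!!U. U \<in> D ==> Lp_int p M U \<le> R"
 obtains Us U where "!!n. Us n \<in> D" "U \<in> Lp p M" "Lp_lim p M Us U"
  "!!V. V \<in> D ==> 0 \<le> (LINT x|M. B x (U x) \<bullet> (V x - U x))"
proof -
 define m where "m V U = (LINT x|M. B x (V x) \<bullet> (V x - U x))" for V U
 define J where "J U = Lp_int p M U" for U :: "'a => 'b"
 define mid where "mid u v = (\<lambda>x. (1/2) *\<^sub>R (u x + v x))" for u v :: "'a => 'b"
 \<comment> \<open>Minty's inequality for the test element \<open>fst i\<close> with slack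
   \<open>snd i\<close>. The slack is there because the matrix game yields only approximate
   strategies; indices with a foreign element or a slack that is not positive impose
   nothing.\<close>
 define S where "S i = {U. fst i \<in> D \<and> 0 < snd i --> - snd i \<le> m (fst i) U}" for i :: "('a => 'b) \<times> real"
 have L: "U \<in> Lp p M" if "U \<in> D" for U using that DL by auto
 have m_sum: "m V (\<lambda>x. \<Sum>i\<in>I. l i *\<^sub>R F i x) = (\<Sum>i\<in>I. l i * m V (F i))"
  if "finite I" "sum l I = 1" "V \<in> D" "!!i. i \<in> I ==> F i \<in> D" for I l V and F :: "'i => 'a => 'b"
 proof -
  have eq: "V x - (\<Sum>i\<in>I. l i *\<^sub>R F i x) = (\<Sum>i\<in>I. l i *\<^sub>R (V x - F i x))" for x
   using that(2) by (simp add: scaleR_diff_right sum_subtractf flip: scaleR_sum_left)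
  have "m V (\<lambda>x. \<Sum>i\<in>I. l i *\<^sub>R F i x) = (LINT x|M. (\<Sum>i\<in>I. l i * (B x (V x) \<bullet> (V x - F i x))))"
   unfolding m_def eq by (simp add: inner_sum_right)
  also have "\<dots> = (\<Sum>i\<in>I. l i * m V (F i))"
   unfolding m_def
   by (subst B_integral_sum)
    (use that L in \<open>auto intro!: integrable_mult_right pairing_integrable Lp_diff[OF p0]\<close>)
  finally show ?thesis .
 qed
 have midD: "mid u v \<in> D" if "u \<in> D" "v \<in> D" for u v
  using conv[OF that, of "1/2"] by (simp add: mid_def scaleR_add_right)
 have m_mid: "m V (mid u v) = (m V u + m V v) / 2" if "V \<in> D" "u \<in> D" "v \<in> D" for V u v
  using m_sum[of "UNIV::bool set" "\<lambda>_. 1/2" V "\<lambda>b. if b then u else v"] that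
  by (simp add: UNIV_bool mid_def scaleR_add_right add.commute)
 define Q where "Q U \<longleftrightarrow> (\<forall>n. U n \<in> D) \<and> (\<forall>e>0. \<exists>N. \<forall>m\<ge>N. \<forall>n\<ge>N. Lp_dist p M (U m) (U n) < e)
   \<and> (\<forall>i. \<exists>U'. (\<forall>n. U' n \<in> D \<inter> S i) \<and> (\<forall>e>0. \<exists>N. \<forall>n\<ge>N. Lp_dist p M (U' n) (U n) < e))" for U :: "nat => 'a => 'b"
 have "\<exists>U. Q U"
 proof (rule directed_near_minimizers[of D S mid J R "Lp_dist p M"])
  fix E :: "(('a => 'b) \<times> real) set" assume "finite E"
  define E' where "E' = {i\<in>E. fst i \<in> D \<and> 0 < snd i}"
  have E': "finite E'" using \<open>finite E\<close> by (simp add: E'_def)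
  show "D \<inter> \<Inter> (S ` E) \<noteq> {}"
  proof (cases "E' = {}")
   case True
   then have "D \<inter> \<Inter> (S ` E) = D" by (auto simp: E'_def S_def)
   then show ?thesis using ne by simp
  next
   case False
   define e where "e = Min (snd ` E')"
   have e: "0 < e" "!!i. i \<in> E' ==> e \<le> snd i" using E' False by (auto simp: e_def E'_def)
   \<comment> \<open>Monotonicity of the operator is precisely nonnegativity of the symmetric part
     of the payoff matrix \<open>m (fst i) (fst j)\<close>.\<close>
   have sym: "0 \<le> m (fst i) (fst j) + m (fst j) (fst i)" if "i \<in> E'" "j \<in> E'" for i j
   proof -
    have ij: "fst i \<in> Lp p M" "fst j \<in> Lp p M" using that L by (auto simp: E'_def)
    have "m (fst j) (fst i) = (LINT x|M. - (B x (fst j x) \<bullet> (fst i x - fst j x)))"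
     unfolding m_def by (simp only: inner_diff_right minus_diff_eq)
    also have "\<dots> = - (LINT x|M. B x (fst j x) \<bullet> (fst i x - fst j x))"
     by (rule B_integral_minus)
    finally have "m (fst j) (fst i) = - (LINT x|M. B x (fst j x) \<bullet> (fst i x - fst j x))" .
    then show ?thesis using pairing_mono[OF ij] unfolding m_def by linarith
   qed
   obtain l where l: "\<forall>i\<in>E'. 0 \<le> l i" "sum l E' = 1"
    "\<forall>i\<in>E'. - e \<le> (\<Sum>j\<in>E'. l j * m (fst i) (fst j))"
    by (rule nonneg_symmetric_part_approx_strategy[where A = "\<lambda>i j. m (fst i) (fst j)", OF E' False sym e(1)])
   define W where "W = (\<lambda>x. \<Sum>j\<in>E'. l j *\<^sub>R fst j x)"
   have "W \<in> D" unfolding W_def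
    by (rule finite_convex_combination_mem[OF conv E' False]) (use l in \<open>auto simp: E'_def\<close>)
   moreover have "W \<in> S i" if "i \<in> E" for i
   proof (cases "i \<in> E'")
    case True
    have "m (fst i) W = (\<Sum>j\<in>E'. l j * m (fst i) (fst j))"
     unfolding W_def by (rule m_sum) (use True E' l in \<open>auto simp: E'_def\<close>)
    then show ?thesis using bspec[OF l(3) True] e(2)[OF True] by (simp add: S_def)
   qed (use that in \<open>auto simp: S_def E'_def\<close>)
   ultimately show ?thesis by auto
  qed
 next
  fix u v i assume "u \<in> D \<inter> S i" "v \<in> D \<inter> S i"
  then show "mid u v \<in> S i" using m_mid[of "fst i" u v] by (auto simp: S_def)
 next
  fix e :: real assume e: "0 < e"
  \<comment> \<open>Two members of \<open>D\<close> have total energy at most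
    \<open>2 * \<bar>R\<bar>\<close>, so this share contributes at most \<open>e / 2\<close>; the
    defect of convexity contributes at most \<open>e / 4\<close>.\<close>
  define e' where "e' = e / (4 * (\<bar>R\<bar> + 1))"
  have e': "0 < e'" using e by (simp add: e'_def)
  obtain K where K: "0 \<le> K" "\<forall>a b :: 'b. norm (a - b) powr p \<le> e' * (norm a powr p + norm b powr p)
    + K * (norm a powr p + norm b powr p - 2 * norm ((1/2) *\<^sub>R (a + b)) powr p)"
   by (rule norm_powr_uniform_convex[OF p e'])
  show "\<exists>eta>0. \<forall>u\<in>D. \<forall>v\<in>D. J u + J v - 2 * J (mid u v) \<le> eta --> Lp_dist p M u v < e"
  proof (intro exI[of _ "e / (4 * (K + 1))"] conjI ballI impI)
   show "0 < e / (4 * (K + 1))" using e K by simp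
   fix u v assume uv: "u \<in> D" "v \<in> D" and le: "J u + J v - 2 * J (mid u v) \<le> e / (4 * (K + 1))"
   note i[simp] = Lp_integrable[OF L[OF uv(1)]] Lp_integrable[OF L[OF uv(2)]]
    Lp_integrable[OF L[OF midD[OF uv]]] Lp_diff_integrable[OF p0 L[OF uv(1)] L[OF uv(2)]]
   have "Lp_dist p M u v \<le> (LINT x|M. e' * (norm (u x) powr p + norm (v x) powr p)
     + K * (norm (u x) powr p + norm (v x) powr p - 2 * norm (mid u v x) powr p))"
   proof (rule integral_mono)
    fix x
    show "norm (u x - v x) powr p \<le> e' * (norm (u x) powr p + norm (v x) powr p)
     + K * (norm (u x) powr p + norm (v x) powr p - 2 * norm (mid u v x) powr p)"
     using K(2) by (auto simp: mid_def simp del: norm_scaleR)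
   qed simp_all
   also have "\<dots> = e' * (J u + J v) + K * (J u + J v - 2 * J (mid u v))"
    by (simp add: J_def)
   also have "\<dots> \<le> e' * (2 * \<bar>R\<bar>) + K * (e / (4 * (K + 1)))"
    using R[OF uv(1)] R[OF uv(2)] le K(1) e'
    by (intro add_mono mult_left_mono) (auto simp: J_def)
   also have "\<dots> \<le> e / 2 + e / 4"
    using e K(1) by (intro add_mono) (auto simp: e'_def field_simps)
   also have "\<dots> < e" using e by simp
   finally show "Lp_dist p M u v < e" .
  qed
 next
  fix U :: "nat => 'a => 'b" assume "\<forall>n. U n \<in> D" "\<forall>e>0. \<exists>N. \<forall>m\<ge>N. \<forall>n\<ge>N. Lp_dist p M (U m) (U n) < e"
   "\<forall>i. \<exists>U'. (\<forall>n. U' n \<in> D \<inter> S i) \<and> (\<forall>e>0. \<exists>N. \<forall>n\<ge>N. Lp_dist p M (U' n) (U n) < e)"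
  then have "Q U" unfolding Q_def by blast
  then show "\<exists>U. Q U" by blast
 qed (use midD R in \<open>auto simp: J_def\<close>)
 then obtain U where QU: "Q U" by blast
 note U = QU[unfolded Q_def, THEN conjunct1] QU[unfolded Q_def, THEN conjunct2, THEN conjunct1]
  QU[unfolded Q_def, THEN conjunct2, THEN conjunct2]
 note U1 = U(1)[rule_format]
 obtain V0 where V0: "V0 \<in> Lp p M" "Lp_lim p M U V0"
  by (rule Lp_complete[OF p0 L[OF U1] U(2)[rule_format]])
 \<comment> \<open>For each slack \<open>e\<close> there are elements that obey the constraint for
   \<open>V\<close> and share the limit \<open>V0\<close>; continuity of the pairing passes the
   constraint to \<open>V0\<close>, and \<open>e\<close> is arbitrary.\<close>
 have minty: "0 \<le> m V V0" if V: "V \<in> D" for V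
 proof (rule field_le_epsilon)
  fix e :: real assume e: "0 < e"
  obtain U' where "(\<forall>n. U' n \<in> D \<inter> S (V, e)) \<and> (\<forall>e>0. \<exists>N. \<forall>n\<ge>N. Lp_dist p M (U' n) (U n) < e)"
   using spec[OF U(3), of "(V, e)"] by (rule exE)
  note U' = this[THEN conjunct1, rule_format] this[THEN conjunct2, rule_format]
  have U'L: "U' n \<in> Lp p M" for n using U'(1) L by auto
  have d: "(\<lambda>n. Lp_dist p M (U' n) (U n)) \<longlonglongrightarrow> 0"
   using U'(2) by (intro LIMSEQ_I) (simp add: Lp_dist_nonneg)
  have "(\<lambda>n. Lp_dist p M (\<lambda>x. (U' n x - U n x) + U n x) (\<lambda>x. 0 + V0 x)) \<longlonglongrightarrow> 0"
   using d by (intro Lp_tendsto_add p0 Lp_diff Lp_zero U'L L[OF U1] V0) simp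
  then have lim: "(\<lambda>n. Lp_dist p M (U' n) V0) \<longlonglongrightarrow> 0" by simp
  have "(\<lambda>n. LINT x|M. B x (V x) \<bullet> (V x + (-1) *\<^sub>R U' n x)) \<longlonglongrightarrow> (LINT x|M. B x (V x) \<bullet> (V x + (-1) *\<^sub>R V0 x))"
   by (intro pairing_tendsto Lp_add Lp_scaleR Lp_tendsto_add Lp_tendsto_scaleR p0 L[OF V] U'L V0 lim) auto
  then have "(\<lambda>n. m V (U' n)) \<longlonglongrightarrow> m V V0" by (simp add: m_def)
  moreover have "- e \<le> m V (U' n)" for n using U'(1)[of n] V e by (auto simp: S_def)
  ultimately have "- e \<le> m V V0" by (intro LIMSEQ_le_const) auto
  then show "0 \<le> m V V0 + e" by simp
 qed
 show thesis
 proof (rule that[of U V0])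
  show "U n \<in> D" for n by (rule U1)
  fix W assume W: "W \<in> D"
  note WL = L[OF W]
  \<comment> \<open>Minty's device: the inequality is tested at a point between \<open>V0\<close>
    and \<open>W\<close> and divided by \<open>t\<close>. Since \<open>V0\<close> need not lie in
    \<open>D\<close>, the point is approached by mixtures of \<open>U n\<close> and
    \<open>W\<close>, which do.\<close>
  have key: "0 \<le> (LINT x|M. B x ((1 - t) *\<^sub>R V0 x + t *\<^sub>R W x) \<bullet> (W x - V0 x))" if t: "0 < t" "t \<le> 1" for t
  proof -
   define V where "V n x = (1 - t) *\<^sub>R U n x + t *\<^sub>R W x" for n x
   define Vl where "Vl x = (1 - t) *\<^sub>R V0 x + t *\<^sub>R W x" for x
   have VD: "V n \<in> D" for n unfolding V_def using conv[OF U1 W] t by simp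
   have VlL: "Vl \<in> Lp p M" unfolding Vl_def by (intro Lp_add Lp_scaleR p0 WL V0)
   have Vlim: "Lp_lim p M V Vl" unfolding V_def Vl_def
    by (intro Lp_tendsto_add Lp_tendsto_scaleR Lp_scaleR p0 L[OF U1] V0 WL) auto
   have "(\<lambda>n. LINT x|M. B x (V n x) \<bullet> (V n x + (-1) *\<^sub>R V0 x)) \<longlonglongrightarrow> (LINT x|M. B x (Vl x) \<bullet> (Vl x + (-1) *\<^sub>R V0 x))"
    by (intro pairing_tendsto Lp_add Lp_scaleR Lp_tendsto_add Vlim VlL L[OF VD] p0 V0) auto
   then have "(\<lambda>n. m (V n) V0) \<longlonglongrightarrow> (LINT x|M. B x (Vl x) \<bullet> (Vl x - V0 x))" by (simp add: m_def)
   then have "0 \<le> (LINT x|M. B x (Vl x) \<bullet> (Vl x - V0 x))"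
    using minty[OF VD] by (intro LIMSEQ_le_const) auto
   moreover have "Vl x - V0 x = t *\<^sub>R (W x - V0 x)" for x by (simp add: Vl_def algebra_simps)
   ultimately have "0 \<le> t * (LINT x|M. B x (Vl x) \<bullet> (W x - V0 x))" by simp
   then show ?thesis using t by (simp add: Vl_def zero_le_mult_iff)
  qed
  define t where "t n = 1 / real (Suc n)" for n
  have t0: "t \<longlonglongrightarrow> 0" unfolding t_def by (rule lim_inverse_Suc)
  define Vn where "Vn n x = V0 x + t n *\<^sub>R (W x - V0 x)" for n x
  have VnL: "Vn n \<in> Lp p M" for n unfolding Vn_def by (intro Lp_add Lp_scaleR Lp_diff p0 V0 WL)
  have "Lp_lim p M Vn V0"
  proof -
   have "Lp_dist p M (Vn n) V0 = \<bar>t n\<bar> powr p * Lp_dist p M W V0" for n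
    by (simp add: Vn_def powr_mult)
   moreover have "(\<lambda>n. \<bar>t n\<bar> powr p) \<longlonglongrightarrow> \<bar>0\<bar> powr p"
    using p0 by (intro tendsto_powr' tendsto_rabs t0 tendsto_const) auto
   ultimately show ?thesis using tendsto_mult_left_zero[of "\<lambda>n. \<bar>t n\<bar> powr p"] p0 by simp
  qed
  then have "(\<lambda>n. LINT x|M. B x (Vn n x) \<bullet> (W x - V0 x)) \<longlonglongrightarrow> (LINT x|M. B x (V0 x) \<bullet> (W x - V0 x))"
   by (intro pairing_tendsto VnL V0 Lp_diff p0 WL) auto
  moreover have "0 \<le> (LINT x|M. B x (Vn n x) \<bullet> (W x - V0 x))" for n
   using key[of "t n"] by (simp add: Vn_def t_def algebra_simps)
  ultimately show "0 \<le> (LINT x|M. B x (V0 x) \<bullet> (W x - V0 x))"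
   by (intro LIMSEQ_le_const) auto
 qed (use V0 in auto)
qed

end

section \<open>Mollifiers\<close>

text \<open>The case \<open>k = 0\<close> is the classical flat function
  \<open>exp (- 1 / t)\<close>. The negative powers of \<open>t\<close> are included because the
  family is then closed, up to linear combinations, under differentiation.\<close>

definition bump_profile :: "nat => real => real" where
 "bump_profile k t = (if t > 0 then (1 / t) ^ k * exp (- 1 / t) else 0)"

lemma bump_profile_nonneg: "0 \<le> bump_profile k t"
 by (simp add: bump_profile_def)

lemma tendsto_bump_profile_0: "(bump_profile k \<longlongrightarrow> 0) (at 0)"
proof -
 have "((\<lambda>t. inverse t ^ k / exp (inverse t)) \<longlongrightarrow> 0) (at_right (0::real))"
  by (rule filterlim_compose[OF tendsto_power_div_exp_0 filterlim_inverse_at_top_right])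
 then have "(bump_profile k \<longlongrightarrow> 0) (at_right 0)"
  by (rule Lim_transform_eventually)
   (auto simp: eventually_at_right_field bump_profile_def exp_minus inverse_eq_divide divide_simps intro!: exI[of _ 1])
 moreover have "(bump_profile k \<longlongrightarrow> 0) (at_left 0)"
  by (rule Lim_transform_eventually[OF tendsto_const])
   (auto simp: eventually_at_left_field bump_profile_def intro!: exI[of _ "-1"])
 ultimately show ?thesis by (simp add: filterlim_split_at)
qed

lemma bump_profile_has_derivative:
 "(bump_profile k has_real_derivative (bump_profile (k + 2) t - real k * bump_profile (k + 1) t)) (at t)"
proof -
 consider "t > 0" | "t < 0" | "t = 0" by linarith
 then show ?thesis
 proof cases
  case 1
  have "((\<lambda>t. (1 / t) ^ k * exp (- 1 / t)) has_real_derivative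
    (bump_profile (k + 2) t - real k * bump_profile (k + 1) t)) (at t)"
   using 1 by (auto intro!: derivative_eq_intros simp: bump_profile_def power2_eq_square)
    (cases k; simp add: field_simps)
  then show ?thesis
   by (rule has_field_derivative_transform_within_open[of _ _ _ "{0<..}"])
    (use 1 in \<open>auto simp: bump_profile_def\<close>)
 next
  case 2
  have "((\<lambda>t. 0) has_real_derivative (bump_profile (k + 2) t - real k * bump_profile (k + 1) t)) (at t)"
   using 2 by (simp add: bump_profile_def)
  then show ?thesis
   by (rule has_field_derivative_transform_within_open[of _ _ _ "{..<0}"])
    (use 2 in \<open>auto simp: bump_profile_def\<close>)
 next
  case 3
  \<comment> \<open>At the origin the difference quotient of the profile \<open>k\<close> is the
    profile \<open>Suc k\<close>, whose limit there is zero.\<close>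
  have "((\<lambda>h. (bump_profile k (0 + h) - bump_profile k 0) / h) \<longlongrightarrow> 0) (at 0)"
   by (rule Lim_transform_eventually[OF tendsto_bump_profile_0[of "Suc k"]])
    (auto simp: eventually_at_filter bump_profile_def intro!: always_eventually)
  then show ?thesis using 3 by (simp add: DERIV_def bump_profile_def)
 qed
qed

text \<open>The parameter \<open>a\<close> scales the support, which is the ball of radius \<open>1 / sqrt a\<close>.\<close>

inductive_set bump_class :: "real => (real^'n::finite => real) set" for a where
 base: "(\<lambda>x. bump_profile k (1 - a * (x \<bullet> x))) \<in> bump_class a"
| scale: "f \<in> bump_class a ==> (\<lambda>x. c * f x) \<in> bump_class a"
| coord: "f \<in> bump_class a ==> (\<lambda>x. x $ i * f x) \<in> bump_class a"
| add: "f \<in> bump_class a ==> g \<in> bump_class a ==> (\<lambda>x. f x + g x) \<in> bump_class a"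

lemma bump_class_eq_0: "f \<in> bump_class a ==> 1 \<le> a * (x \<bullet> x) ==> f x = 0"
 by (induction rule: bump_class.induct) (auto simp: bump_profile_def)

text \<open>Closure of the class under partial derivatives is proved along its generation.
  Smoothness then follows by iteration, and all derivatives vanish outside the same ball.\<close>

lemma bump_class_has_derivative:
 fixes f :: "real^'n::finite => real"
 assumes "f \<in> bump_class a"
 shows "\<exists>G. (\<forall>i. G i \<in> bump_class a) \<and> (\<forall>x. (f has_derivative (\<lambda>z. z \<bullet> (\<chi> i. G i x))) (at x))"
 using assms
proof induction
 case (base k)
 define G where "G i = (\<lambda>x::real^'n. (- 2 * a) * (x $ i * bump_profile (k + 2) (1 - a * (x \<bullet> x)))
   + (2 * a * real k) * (x $ i * bump_profile (k + 1) (1 - a * (x \<bullet> x))))" for i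
 have "((\<lambda>x. bump_profile k (1 - a * (x \<bullet> x))) has_derivative (\<lambda>z. z \<bullet> (\<chi> i. G i x))) (at x)" for x
 proof -
  have "((\<lambda>x. bump_profile k (1 - a * (x \<bullet> x))) has_derivative
    (\<lambda>z. (- (a * (x \<bullet> z + z \<bullet> x))) * (bump_profile (k + 2) (1 - a * (x \<bullet> x))
     - real k * bump_profile (k + 1) (1 - a * (x \<bullet> x))))) (at x)"
   by (rule has_derivative_eq_rhs, rule DERIV_compose_FDERIV[OF bump_profile_has_derivative])
    (auto intro!: derivative_eq_intros)
  moreover have "(\<chi> i. G i x) = (- 2 * a * (bump_profile (k + 2) (1 - a * (x \<bullet> x))
     - real k * bump_profile (k + 1) (1 - a * (x \<bullet> x)))) *\<^sub>R x"
   by (simp add: vec_eq_iff G_def algebra_simps)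
  ultimately show ?thesis by (simp add: inner_commute mult_ac)
 qed
 moreover have "G i \<in> bump_class a" for i unfolding G_def by (intro bump_class.intros)
 ultimately show ?case by blast
next
 case (scale f c)
 then obtain G where G: "!!i. G i \<in> bump_class a" "!!x. (f has_derivative (\<lambda>z. z \<bullet> (\<chi> i. G i x))) (at x)" by blast
 have "((\<lambda>x. c * f x) has_derivative (\<lambda>z. z \<bullet> (\<chi> i. c * G i x))) (at x)" for x
  by (rule has_derivative_eq_rhs, rule has_derivative_mult_right[OF G(2)])
   (simp add: inner_vec_def sum_distrib_left mult_ac)
 then show ?case using G(1) by (intro exI[of _ "\<lambda>i x. c * G i x"]) (auto intro: bump_class.intros)
next
 case (coord f j)
 then obtain G where G: "!!i. G i \<in> bump_class a" "!!x. (f has_derivative (\<lambda>z. z \<bullet> (\<chi> i. G i x))) (at x)" by blast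
 have "((\<lambda>x. x $ j * f x) has_derivative (\<lambda>z. z \<bullet> (\<chi> i. (if i = j then 1 else 0) * f x + x $ j * G i x))) (at x)" for x
  by (rule has_derivative_eq_rhs, rule has_derivative_mult[OF bounded_linear.has_derivative[OF bounded_linear_vec_nth has_derivative_ident] G(2)])
   (auto simp: inner_vec_def sum_distrib_left sum.distrib algebra_simps fun_eq_iff if_distrib[of "\<lambda>t. t * _"] if_distrib[of "\<lambda>t. _ * t"] sum.delta cong: if_cong)
 then show ?case using G(1) coord.hyps
  by (intro exI[of _ "\<lambda>i x. (if i = j then 1 else 0) * f x + x $ j * G i x"] conjI allI
    bump_class.add bump_class.scale bump_class.coord)
next
 case (add f g)
 then obtain G H where G: "!!i. G i \<in> bump_class a" "!!x. (f has_derivative (\<lambda>z. z \<bullet> (\<chi> i. G i x))) (at x)"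
  and H: "!!i. H i \<in> bump_class a" "!!x. (g has_derivative (\<lambda>z. z \<bullet> (\<chi> i. H i x))) (at x)" by blast
 have "((\<lambda>x. f x + g x) has_derivative (\<lambda>z. z \<bullet> (\<chi> i. G i x + H i x))) (at x)" for x
  by (rule has_derivative_eq_rhs, rule has_derivative_add[OF G(2) H(2)])
   (simp add: inner_vec_def sum.distrib algebra_simps)
 then show ?case using G(1) H(1) by (intro exI[of _ "\<lambda>i x. G i x + H i x"]) (auto intro: bump_class.intros)
qed

lemma grad_eq:
 assumes "(f has_derivative (\<lambda>z. z \<bullet> g)) (at x)"
 shows "grad f x = g" "partial_deriv i f x = g $ i"
proof -
 have *: "partial_deriv i f x = g $ i" for i
  unfolding partial_deriv_def frechet_derivative_at[OF assms, symmetric]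
  by (simp add: inner_axis' )
 show "grad f x = g" by (simp add: grad_def * vec_eq_iff)
 show "partial_deriv i f x = g $ i" by (rule *)
qed

lemma grad_nth: "grad f x $ i = partial_deriv i f x"
 by (simp add: grad_def)

lemma has_derivative_grad:
 fixes f :: "real^'n::finite => real"
 assumes "f differentiable (at x)"
 shows "(f has_derivative (\<lambda>z. z \<bullet> grad f x)) (at x)"
proof -
 let ?D = "frechet_derivative f (at x)"
 have D: "(f has_derivative ?D) (at x)" using assms frechet_derivative_works by blast
 then have lin: "linear ?D" using has_derivative_linear by blast
 have "?D z = z \<bullet> grad f x" for z
 proof -
  have "?D z = ?D (\<Sum>i\<in>UNIV. (z $ i) *\<^sub>R axis i 1)"
   using basis_expansion[of z] by (simp add: scalar_mult_eq_scaleR)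
  also have "\<dots> = (\<Sum>i\<in>UNIV. z $ i * ?D (axis i 1))"
   by (simp add: linear_sum[OF lin] linear_cmul[OF lin])
  finally show ?thesis by (simp add: inner_vec_def grad_def partial_deriv_def)
 qed
 then have "?D = (\<lambda>z. z \<bullet> grad f x)" by auto
 then show ?thesis using D by simp
qed

lemma bump_class_continuous:
 assumes "f \<in> bump_class a" shows "continuous_on S f"
proof -
 obtain G where "\<forall>x. (f has_derivative (\<lambda>z. z \<bullet> (\<chi> i. G i x))) (at x)"
  using bump_class_has_derivative[OF assms] by blast
 then have "continuous (at x) f" for x by (meson has_derivative_continuous)
 then show ?thesis by (simp add: continuous_at_imp_continuous_on)
qed

lemma bump_class_bounded:
 assumes f: "f \<in> bump_class a" and a: "0 < a"
 shows "\<exists>L. \<forall>x. \<bar>f x\<bar> \<le> L"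
proof -
 let ?B = "cball 0 (1 / sqrt a) :: (real^'a) set"
 have "compact (f ` ?B)" by (intro compact_continuous_image bump_class_continuous[OF f]) auto
 then obtain L where L: "!!x. x \<in> ?B ==> \<bar>f x\<bar> \<le> L"
  using compact_imp_bounded bounded_iff by (metis imageI real_norm_def)
 have L0: "0 \<le> L" using L[of 0] a by (smt (verit) centre_in_cball divide_nonneg_nonneg real_sqrt_ge_zero)
 have "\<bar>f x\<bar> \<le> L" for x
 proof (cases "x \<in> ?B")
  case False
  then have "1 / sqrt a < norm x" by simp
  then have "1 < sqrt a * norm x" using a by (simp add: field_simps)
  then have "1 < (sqrt a * norm x)\<^sup>2" by (simp add: one_less_power)
  then have "1 \<le> a * (x \<bullet> x)" using a by (simp add: power_mult_distrib power2_norm_eq_inner)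
  then show ?thesis using bump_class_eq_0[OF f] L0 by simp
 qed (use L in auto)
 then show ?thesis by blast
qed

definition convolution :: "(real^'n::finite => real) => (real^'n => 'b::euclidean_space) => real^'n => 'b" where
 "convolution K h x = (LINT y|lebesgue. K (x - y) *\<^sub>R h y)"

lemma borel_measurable_lebesgue_continuous:
 fixes f :: "'a::euclidean_space => 'b::topological_space"
 assumes "continuous_on UNIV f" shows "f \<in> borel_measurable lebesgue"
 using borel_measurable_continuous_onI[OF assms] by (intro measurable_completion) simp

lemma convolution_integrable:
 fixes h :: "real^'n::finite => 'b::euclidean_space"
 assumes "integrable lebesgue h" "continuous_on UNIV K" "!!x. \<bar>K x\<bar> \<le> L"
 shows "integrable lebesgue (\<lambda>y. K (x - y) *\<^sub>R h y)"
proof (rule B_integrable_bound)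
 show "integrable lebesgue (\<lambda>y. L * norm (h y))" using assms(1) by auto
 have "(\<lambda>y. K (x - y)) \<in> borel_measurable lebesgue"
  by (intro borel_measurable_lebesgue_continuous continuous_on_compose2[OF assms(2)] continuous_intros) auto
 then show "(\<lambda>y. K (x - y) *\<^sub>R h y) \<in> borel_measurable lebesgue"
  using assms(1) by (intro borel_measurable_scaleR) auto
 show "AE y in lebesgue. norm (K (x - y) *\<^sub>R h y) \<le> norm (L * norm (h y))"
  using assms(3) by (auto simp: abs_mult intro!: AE_I2 mult_right_mono order.trans[OF assms(3) abs_ge_self])
qed

text \<open>Differentiation under the integral: the bound on \<open>G\<close> makes \<open>K\<close>
  Lipschitz, so the remainder quotient is at most \<open>2 * L\<close>, and dominated convergence
  applies with a multiple of \<open>\<bar>h\<bar>\<close>.\<close>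

lemma convolution_has_derivative:
 fixes h :: "real^'n::finite => real"
 assumes h: "integrable lebesgue h"
  and K: "!!x. (K has_derivative (\<lambda>z. z \<bullet> G x)) (at x)"
  and G: "continuous_on UNIV G" "!!x. norm (G x) \<le> L" and Kb: "!!x. \<bar>K x\<bar> \<le> L'"
 shows "(convolution K h has_derivative (\<lambda>z. z \<bullet> (LINT y|lebesgue. h y *\<^sub>R G (x - y)))) (at x)"
proof -
 have Kc: "continuous_on UNIV K" using K by (auto intro!: continuous_at_imp_continuous_on has_derivative_continuous)
 have [measurable]: "h \<in> borel_measurable lebesgue" using h by auto
 have Gm: "(\<lambda>y. G (x - y)) \<in> borel_measurable lebesgue"
  by (intro borel_measurable_lebesgue_continuous continuous_on_compose2[OF G(1)] continuous_intros) auto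
 have Km: "(\<lambda>y. K (z - y)) \<in> borel_measurable lebesgue" for z
  by (intro borel_measurable_lebesgue_continuous continuous_on_compose2[OF Kc] continuous_intros) auto
 have iG: "integrable lebesgue (\<lambda>y. h y *\<^sub>R G (x - y))"
 proof (rule B_integrable_bound)
  show "integrable lebesgue (\<lambda>y. L * norm (h y))" using h by auto
  show "AE y in lebesgue. norm (h y *\<^sub>R G (x - y)) \<le> norm (L * norm (h y))"
   using G(2) by (auto intro!: AE_I2 simp: abs_mult mult.commute[of "\<bar>h _\<bar>"] intro!: mult_right_mono order.trans[OF G(2) abs_ge_self])
 qed (use Gm in \<open>intro borel_measurable_scaleR; simp\<close>)
 have iK: "integrable lebesgue (\<lambda>y. K (z - y) * h y)" for z
  using convolution_integrable[OF h Kc Kb, of z] by simp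
 have lip: "\<bar>K (z + u) - K z\<bar> \<le> L * norm u" for z u
 proof -
  have "onorm (\<lambda>z. z \<bullet> G x) \<le> L" for x
  proof (rule onorm_le)
   fix z show "norm (z \<bullet> G x) \<le> L * norm z"
    using Cauchy_Schwarz_ineq2[of z "G x"] mult_left_mono[OF G(2)[of x], of "norm z"]
    by (simp add: mult.commute)
  qed
  then show ?thesis
   using differentiable_bound[of UNIV K "\<lambda>x z. z \<bullet> G x" L "z + u" z] K by simp
 qed
 define g where "g = (LINT y|lebesgue. h y *\<^sub>R G (x - y))"
 define q where "q u y = (K (x + u - y) - K (x - y) - u \<bullet> G (x - y)) / norm u" for u y
 have eq: "(convolution K h (x + u) - convolution K h x - u \<bullet> g) /\<^sub>R norm u = (LINT y|lebesgue. h y * q u y)" for u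
 proof -
  have "u \<bullet> g = (LINT y|lebesgue. u \<bullet> (h y *\<^sub>R G (x - y)))"
   unfolding g_def by (rule integral_inner_right[symmetric]) (use iG in auto)
  moreover have "integrable lebesgue (\<lambda>y. u \<bullet> (h y *\<^sub>R G (x - y)))"
   using iG by (intro integrable_inner_right) auto
  ultimately have "convolution K h (x + u) - convolution K h x - u \<bullet> g
    = (LINT y|lebesgue. K (x + u - y) * h y - K (x - y) * h y - u \<bullet> (h y *\<^sub>R G (x - y)))"
   using iK[of x] iK[of "x + u"] iG unfolding convolution_def by simp
  then show ?thesis
   by (simp add: q_def divide_inverse algebra_simps flip: integral_mult_right_zero)
 qed
 have "((\<lambda>u. (convolution K h (x + u) - convolution K h x - u \<bullet> g) /\<^sub>R norm u) \<longlongrightarrow> 0) (at 0)"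
  unfolding eq tendsto_at_iff_sequentially
 proof (intro allI impI)
  fix u :: "nat => real^'n" assume u: "\<forall>i. u i \<in> UNIV - {0}" "u \<longlonglongrightarrow> 0"
  have "(\<lambda>n. LINT y|lebesgue. h y * q (u n) y) \<longlonglongrightarrow> (LINT y|(lebesgue :: (real^'n) measure). 0)"
  proof (rule integral_dominated_convergence[where w = "\<lambda>y. \<bar>h y\<bar> * (2 * L)"])
   show "(\<lambda>y. h y * q (u n) y) \<in> borel_measurable lebesgue" for n
    unfolding q_def using Km[of "x + u n"] Km[of x] Gm by measurable
   show "integrable lebesgue (\<lambda>y. \<bar>h y\<bar> * (2 * L))" using h by auto
   show "AE y in lebesgue. (\<lambda>n. h y * q (u n) y) \<longlonglongrightarrow> 0"
   proof (rule AE_I2)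
    fix y
    have "((\<lambda>u. (K (x - y + u) - K (x - y) - u \<bullet> G (x - y)) /\<^sub>R norm u) \<longlongrightarrow> 0) (at 0)"
     using K[of "x - y"] unfolding has_derivative_at_within by (simp add: has_derivative_at has_derivative_def LIM_offset_zero_iff)
    then have "((\<lambda>u. (K (x - y + u) - K (x - y) - u \<bullet> G (x - y)) /\<^sub>R norm u) \<circ> u) \<longlonglongrightarrow> 0"
     using u unfolding tendsto_at_iff_sequentially by blast
    then have "(\<lambda>n. q (u n) y) \<longlonglongrightarrow> 0"
     by (simp add: q_def o_def divide_inverse mult.commute algebra_simps)
    then show "(\<lambda>n. h y * q (u n) y) \<longlonglongrightarrow> 0" by (rule tendsto_mult_right_zero)
   qed
   show "AE y in lebesgue. norm (h y * q (u n) y) \<le> \<bar>h y\<bar> * (2 * L)" for n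
   proof (rule AE_I2)
    fix y
    have "\<bar>K (x + u n - y) - K (x - y)\<bar> \<le> L * norm (u n)" using lip[of "x - y" "u n"] by (simp add: algebra_simps)
    moreover have "\<bar>u n \<bullet> G (x - y)\<bar> \<le> norm (u n) * L"
     using Cauchy_Schwarz_ineq2[of "u n" "G (x - y)"] G(2)[of "x - y"] by (meson mult_left_mono norm_ge_zero order_trans)
    ultimately have "\<bar>K (x + u n - y) - K (x - y) - u n \<bullet> G (x - y)\<bar> \<le> 2 * L * norm (u n)" by (simp add: algebra_simps)
    then have "\<bar>q (u n) y\<bar> \<le> 2 * L" using u(1) by (simp add: q_def divide_le_eq)
    then show "norm (h y * q (u n) y) \<le> \<bar>h y\<bar> * (2 * L)" by (simp add: abs_mult mult_left_mono)
   qed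
  qed auto
  then show "((\<lambda>u. LINT y|lebesgue. h y * q u y) \<circ> u) \<longlonglongrightarrow> 0" by (simp add: o_def)
 qed
 from tendsto_norm_zero[OF this]
 have "((\<lambda>u. norm (convolution K h (x + u) - convolution K h x - u \<bullet> g) / norm u) \<longlongrightarrow> 0) (at 0)"
  by (simp add: divide_inverse mult.commute abs_mult)
 then show ?thesis
  unfolding g_def[symmetric] has_derivative_at using bounded_linear_inner_left by blast
qed

section \<open>Muckenhoupt weights\<close>

text \<open>Hoelder's inequality up to a constant: integrate the pointwise bound
 \<open>h \<le> l h^p w + l^(-1/(p-1)) w^(-1/(p-1))\<close> and optimize in \<open>l\<close>.\<close>

lemma weight_young:
 fixes t w l p :: real
 assumes "1 < p" "0 \<le> t" "0 < w" "0 < l"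
 shows "t \<le> l * (t powr p * w) + l powr (- 1 / (p - 1)) * w powr (- 1 / (p - 1))"
proof (cases "t \<le> (l * w) powr (- 1 / (p - 1))")
 case True
 then have "t \<le> l powr (- 1 / (p - 1)) * w powr (- 1 / (p - 1))"
  using assms by (simp add: powr_mult)
 then show ?thesis using assms by (smt (verit) mult_nonneg_nonneg powr_ge_zero)
next
 case False
 then have t: "(l * w) powr (- 1 / (p - 1)) < t" by simp
 then have t0: "0 < t" using powr_ge_zero[of "l * w"] by (smt (verit))
 have "((l * w) powr (- 1 / (p - 1))) powr (p - 1) \<le> t powr (p - 1)"
  using assms t by (intro powr_mono2) auto
 moreover have "((l * w) powr (- 1 / (p - 1))) powr (p - 1) = (l * w) powr (- 1)"
  unfolding powr_powr using assms by simp
 ultimately have "(l * w) powr (- 1) \<le> t powr (p - 1)" by argo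
 then have "1 \<le> (l * w) * t powr (p - 1)"
  using assms by (simp add: powr_minus field_simps)
 then have "t * 1 \<le> t * ((l * w) * t powr (p - 1))" using t0 by (intro mult_left_mono) auto
 also have "\<dots> = l * (t powr p * w)" using t0 by (simp add: powr_diff)
 finally show ?thesis by (smt (verit) assms mult_nonneg_nonneg powr_ge_zero)
qed

text \<open>The parameter \<open>(T / P) powr ((p - 1) / p)\<close> balances the two terms of the
  weighted Young inequality; both become the product that appears in Hoelder's inequality.\<close>

lemma holder_optimal_parameter:
 fixes P T p :: real
 assumes p: "1 < p" and P: "0 < P" and T: "0 < T"
 shows "(T / P) powr ((p - 1) / p) * P = P powr (1 / p) * T powr ((p - 1) / p)"
  "((T / P) powr ((p - 1) / p)) powr (- 1 / (p - 1)) * T = P powr (1 / p) * T powr ((p - 1) / p)"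
proof -
 have 1: "(p - 1) / p = 1 - 1 / p" using p by (simp add: diff_divide_distrib)
 have "(T / P) powr ((p - 1) / p) * P = T powr ((p - 1) / p) * (P / P powr ((p - 1) / p))"
  using P T by (simp add: powr_divide)
 also have "P / P powr ((p - 1) / p) = P powr (1 / p)"
  using P unfolding 1 by (simp add: powr_diff)
 finally show "(T / P) powr ((p - 1) / p) * P = P powr (1 / p) * T powr ((p - 1) / p)" by simp
 have "((T / P) powr ((p - 1) / p)) powr (- 1 / (p - 1)) = (T / P) powr (- (1 / p))"
  unfolding powr_powr using p by simp
 also have "\<dots> = P powr (1 / p) / T powr (1 / p)"
  using P T by (simp add: powr_divide powr_minus inverse_eq_divide)
 finally show "((T / P) powr ((p - 1) / p)) powr (- 1 / (p - 1)) * T = P powr (1 / p) * T powr ((p - 1) / p)"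
  using T unfolding 1 by (simp add: powr_diff)
qed

lemma weighted_holder:
 fixes h w :: "'a => real"
 assumes p: "1 < p" and h: "!!x. 0 \<le> h x" "h \<in> borel_measurable N" and w: "AE x in N. 0 < w x"
  and P: "integrable N (\<lambda>x. h x powr p * w x)" and T: "integrable N (\<lambda>x. w x powr (- 1 / (p - 1)))"
 shows "integrable N h"
  "(LINT x|N. h x) powr p \<le> 2 powr p * (LINT x|N. h x powr p * w x) * (LINT x|N. w x powr (- 1 / (p - 1))) powr (p - 1)"
proof -
 let ?P = "(LINT x|N. h x powr p * w x)" and ?T = "(LINT x|N. w x powr (- 1 / (p - 1)))"
 have pw: "AE x in N. h x \<le> l * (h x powr p * w x) + l powr (- 1 / (p - 1)) * w x powr (- 1 / (p - 1))"
  if "0 < l" for l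
  using w by eventually_elim (rule weight_young[OF p h(1) _ that])
 have "integrable N (\<lambda>x. 1 * (h x powr p * w x) + 1 powr (- 1 / (p - 1)) * w x powr (- 1 / (p - 1)))"
  using P T by auto
 then show ih: "integrable N h"
  by (rule B_integrable_bound) (use h pw[of 1] in \<open>auto elim!: eventually_mono\<close>)
 define H where "H = (LINT x|N. h x)"
 have H: "H \<le> l * ?P + l powr (- 1 / (p - 1)) * ?T" if "0 < l" for l
 proof -
  have "H \<le> (LINT x|N. l * (h x powr p * w x) + l powr (- 1 / (p - 1)) * w x powr (- 1 / (p - 1)))"
   unfolding H_def by (rule integral_mono_AE[OF ih _ pw[OF that]]) (use P T in auto)
  then show ?thesis using P T by simp
 qed
 have H0: "0 \<le> H" unfolding H_def using h by (intro integral_nonneg_AE) auto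
 have P0: "0 \<le> ?P" using w by (intro integral_nonneg_AE) (auto elim!: eventually_mono)
 have T0: "0 \<le> ?T" by (intro integral_nonneg_AE) auto
 consider "H = 0" | "0 < H" "?P = 0" | "0 < H" "0 < ?P" "?T = 0" | "0 < ?P" "0 < ?T"
  using H0 P0 T0 by linarith
 then have "H powr p \<le> 2 powr p * ?P * ?T powr (p - 1)"
 proof cases
  case 1
  then show ?thesis using P0 by simp
 next
  case 2
  \<comment> \<open>With vanishing first integral the remaining term is
    \<open>?T / K = H * ?T / (2 * (?T + 1)) < H\<close>, which contradicts the estimate of
    \<open>H\<close>.\<close>
  define K where "K = 2 * (?T + 1) / H"
  have K: "0 < K" using 2 T0 by (simp add: K_def add_nonneg_pos)
  define l where "l = K powr (p - 1)"
  have l: "0 < l" using K by (simp add: l_def)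
  have "l powr (- 1 / (p - 1)) = K powr (- 1)"
   unfolding l_def powr_powr using p by simp
  then have "H \<le> inverse K * ?T" using H[OF l] 2 K by (simp add: powr_minus)
  also have "\<dots> = H * (?T / (2 * (?T + 1)))" by (simp add: K_def)
  also have "\<dots> < H * 1"
  proof (rule mult_strict_left_mono[OF _ 2(1)])
   have "t / (2 * (t + 1)) < 1" if "0 \<le> t" for t :: real using that by (simp add: divide_less_eq)
   then show "?T / (2 * (?T + 1)) < 1" using T0 .
  qed
  finally show ?thesis by simp
 next
  case 3
  \<comment> \<open>With vanishing dual integral this choice of the parameter gives
    \<open>H \<le> H / 2\<close>, impossible for positive \<open>H\<close>.\<close>
  have "H \<le> H / (2 * ?P) * ?P" using H[of "H / (2 * ?P)"] 3 by simp
  then show ?thesis using 3 by simp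
 next
  case 4
  define l where "l = (?T / ?P) powr ((p - 1) / p)"
  have l: "0 < l" using 4 by (simp add: l_def)
  note l1 = holder_optimal_parameter[OF p 4, folded l_def]
  have "H \<le> 2 * (?P powr (1 / p) * ?T powr ((p - 1) / p))" using H[OF l] unfolding l1 by simp
  then have "H powr p \<le> (2 * (?P powr (1 / p) * ?T powr ((p - 1) / p))) powr p"
   using H0 p by (intro powr_mono2) auto
  also have "\<dots> = 2 powr p * ?P * ?T powr (p - 1)"
   using p 4 by (simp add: powr_mult powr_powr)
  finally show ?thesis .
 qed
 then show "(LINT x|N. h x) powr p \<le> 2 powr p * ?P * ?T powr (p - 1)" by (simp add: H_def)
qed

section \<open>Fubini and measurability for the completed Lebesgue measure\<close>

lemma sigma_finite_lebesgue: "sigma_finite_measure (lebesgue :: 'a::euclidean_space measure)"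
proof
 obtain A :: "'a set set" where A: "countable A" "A \<subseteq> sets lborel" "\<Union> A = space lborel"
  "!!a. a \<in> A ==> emeasure lborel a \<noteq> \<infinity>"
  using sigma_finite_measure.sigma_finite_countable[OF sigma_finite_lborel] by metis
 show "\<exists>A :: 'a set set. countable A \<and> A \<subseteq> sets lebesgue \<and> \<Union> A = space lebesgue \<and>
   (\<forall>a\<in>A. emeasure lebesgue a \<noteq> \<infinity>)"
  using A by (intro exI[of _ A]) (auto simp: subset_eq)
qed

interpretation lebesgue: sigma_finite_measure "lebesgue :: 'a::euclidean_space measure"
 by (rule sigma_finite_lebesgue)

text \<open>Products of the completed measure are used because the weight is only Lebesgue
  measurable.\<close>

lemma pair_sigma_finite_lebesgue:
 "pair_sigma_finite (lebesgue :: 'a::euclidean_space measure) (lebesgue :: 'b::euclidean_space measure)"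
 by (intro pair_sigma_finite.intro sigma_finite_lebesgue)

lemma integrable_lebesgue_on_iff:
 fixes f :: "'a::euclidean_space => 'b::{banach,second_countable_topology}"
 shows "S \<in> sets lebesgue ==> integrable (lebesgue_on S) f \<longleftrightarrow> integrable lebesgue (\<lambda>x. indicator S x *\<^sub>R f x)"
 by (simp add: integrable_restrict_space)

lemma integrable_lebesgue_on_subset:
 fixes f :: "'a::euclidean_space => 'b::{banach,second_countable_topology}"
 assumes "integrable (lebesgue_on T) f" "S \<subseteq> T" "S \<in> sets lebesgue" "T \<in> sets lebesgue"
 shows "integrable (lebesgue_on S) f"
proof -
 have "integrable lebesgue (\<lambda>x. indicator S x *\<^sub>R (indicator T x *\<^sub>R f x))"
  by (rule integrable_mult_indicator) (use assms in \<open>simp_all add: integrable_lebesgue_on_iff\<close>)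
 also have "(\<lambda>x. indicator S x *\<^sub>R (indicator T x *\<^sub>R f x)) = (\<lambda>x. indicator S x *\<^sub>R f x)"
  using assms(2) by (auto simp: indicator_def fun_eq_iff)
 finally show ?thesis using assms(3) by (simp add: integrable_lebesgue_on_iff)
qed

lemma measurable_id_lebesgue: "(\<lambda>x. x) \<in> borel_measurable (lebesgue :: 'a::euclidean_space measure)"
 by (intro borel_measurable_lebesgue_continuous continuous_on_id)

lemma measurable_dist_less_pair:
 "Measurable.pred ((lebesgue :: 'a::euclidean_space measure) \<Otimes>\<^sub>M lebesgue) (\<lambda>z. dist (fst z) (snd z) < r)"
proof -
 have "(\<lambda>z. fst z) \<in> borel_measurable ((lebesgue :: 'a measure) \<Otimes>\<^sub>M (lebesgue :: 'a measure))"
  "(\<lambda>z. snd z) \<in> borel_measurable ((lebesgue :: 'a measure) \<Otimes>\<^sub>M (lebesgue :: 'a measure))"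
  using measurable_compose[OF measurable_fst measurable_id_lebesgue]
   measurable_compose[OF measurable_snd measurable_id_lebesgue] by auto
 then show ?thesis by measurable
qed

lemma measurable_dist_less [measurable]:
 "Measurable.pred (lebesgue :: 'a::euclidean_space measure) (\<lambda>y. dist x y < r)"
 "Measurable.pred (lebesgue :: 'a::euclidean_space measure) (\<lambda>y. dist y x < r)"
proof -
 have "{y. dist x y < r} = ball x r" "{y. dist y x < r} = ball x r" by (auto simp: dist_commute)
 then show "Measurable.pred (lebesgue :: 'a measure) (\<lambda>y. dist x y < r)"
  "Measurable.pred (lebesgue :: 'a measure) (\<lambda>y. dist y x < r)"
  by (simp_all add: pred_def)
qed

lemma borel_measurable_integral_ball:
 fixes f :: "'a::euclidean_space => real"
 assumes [measurable]: "f \<in> borel_measurable lebesgue"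
 shows "(\<lambda>x. LINT y|lebesgue_on (ball x r). f y) \<in> borel_measurable lebesgue"
proof -
 have [measurable]: "Measurable.pred ((lebesgue :: 'a measure) \<Otimes>\<^sub>M lebesgue) (\<lambda>z. dist (fst z) (snd z) < r)"
  by (rule measurable_dist_less_pair)
 have "(\<lambda>z. (if dist (fst z) (snd z) < r then f (snd z) else 0)) \<in> borel_measurable (lebesgue \<Otimes>\<^sub>M lebesgue)"
  by measurable
 then have "(\<lambda>x. LINT y|lebesgue. (if dist x y < r then f y else 0)) \<in> borel_measurable lebesgue"
  by (intro lebesgue.borel_measurable_lebesgue_integral) (simp add: split_beta)
 moreover have "(LINT y|lebesgue_on (ball x r). f y) = (LINT y|lebesgue. (if dist x y < r then f y else 0))" for x
  by (subst integral_restrict_space) (auto simp: indicator_def intro!: B_integral_cong)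
 ultimately show ?thesis by simp
qed

locale muckenhoupt =
 fixes p :: real and w :: "'a::euclidean_space => real"
 assumes p: "1 < p" and Ap: "Ap_weight p w"
begin

lemma weight_locally_integrable: "compact K ==> integrable (lebesgue_on K) w"
 using Ap by (simp add: Ap_weight_def locally_integrable_def)

lemma weight_pos: "AE x in lebesgue. 0 < w x"
 using Ap by (simp add: Ap_weight_def)

text \<open>The definition of the weight class has no separate measurability clause; integrability
  on growing balls supplies it, and the cut-off weights converge pointwise.\<close>

lemma weight_measurable [measurable]: "w \<in> borel_measurable lebesgue"
proof (rule borel_measurable_LIMSEQ_real)
 fix n :: nat
 show "(\<lambda>x. indicator (cball 0 (real n)) x * w x) \<in> borel_measurable lebesgue"
  using borel_measurable_integrable[of lebesgue "\<lambda>x. indicator (cball 0 (real n)) x *\<^sub>R w x"]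
   weight_locally_integrable[of "cball 0 (real n)"] by (simp add: integrable_lebesgue_on_iff)
next
 fix x :: 'a
 obtain N :: nat where N: "norm x \<le> real N" using real_arch_simple by blast
 have "\<forall>\<^sub>F n in sequentially. indicator (cball 0 (real n)) x * w x = w x"
  using eventually_ge_at_top[of N] by eventually_elim (use N in auto)
 then show "(\<lambda>n. indicator (cball 0 (real n)) x * w x) \<longlonglongrightarrow> w x" by (rule tendsto_eventually)
qed

abbreviation dual_weight :: "'a => real" where
 "dual_weight x \<equiv> w x powr (- 1 / (p - 1))"

lemma dual_weight_integrable_ball: "integrable (lebesgue_on (ball a r)) dual_weight"
proof (cases "0 < r")
 case True
 from Ap[unfolded Ap_weight_def, THEN conjunct2, THEN conjunct2] show ?thesis
  by - (erule exE, elim conjE, drule spec[of _ a], drule spec[of _ r], drule mp[OF _ True], erule conjunct1)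
next
 case False then show ?thesis by (simp add: ball_empty)
qed

lemma weight_integrable_bounded:
 assumes "bounded S" "S \<in> sets lebesgue"
 shows "integrable (lebesgue_on S) w"
proof -
 from bounded_subset_ballD[OF assms(1), of 0] obtain r where "S \<subseteq> ball 0 r" by (elim exE conjE)
 then have "S \<subseteq> cball 0 r" using ball_subset_cball by (rule subset_trans)
 then show ?thesis
  by (rule integrable_lebesgue_on_subset[OF weight_locally_integrable[OF compact_cball]]) (use assms in auto)
qed

lemma dual_weight_integrable_bounded:
 assumes "bounded S" "S \<in> sets lebesgue"
 shows "integrable (lebesgue_on S) dual_weight"
proof -
 from bounded_subset_ballD[OF assms(1), of 0] obtain r where "S \<subseteq> ball 0 r" by (elim exE conjE)
 then show ?thesis
  by (rule integrable_lebesgue_on_subset[OF dual_weight_integrable_ball]) (use assms in auto)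
qed

lemma Ap_balls:
 obtains c where "0 < c" "\<forall>a r. 0 < r --> (LINT x|lebesgue_on (ball a r). w x) *
   (LINT x|lebesgue_on (ball a r). dual_weight x) powr (p - 1) \<le> c * measure lebesgue (ball a r) powr p"
proof -
 obtain c where c: "0 < c" and c': "\<forall>a. \<forall>r>0. integrable (lebesgue_on (ball a r)) dual_weight \<and>
    (1 / measure lebesgue (ball a r) * (LINT x|lebesgue_on (ball a r). w x)) *
    (1 / measure lebesgue (ball a r) * (LINT x|lebesgue_on (ball a r). dual_weight x)) powr (p - 1) \<le> c"
  by (rule exE[OF Ap[unfolded Ap_weight_def, THEN conjunct2, THEN conjunct2]]) (elim conjE, rule that)
 have "(LINT x|lebesgue_on (ball a r). w x) * (LINT x|lebesgue_on (ball a r). dual_weight x) powr (p - 1)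
   \<le> c * measure lebesgue (ball a r) powr p" if r: "0 < r" for a r
 proof -
  define V where "V = measure lebesgue (ball a r)"
  define W where "W = (LINT x|lebesgue_on (ball a r). w x)"
  define T where "T = (LINT x|lebesgue_on (ball a r). dual_weight x)"
  have V: "0 < V" using r by (simp add: V_def content_ball_pos)
  have T: "0 \<le> T" unfolding T_def by (intro integral_nonneg_AE) auto
  have "(1 / V * W) * (1 / V * T) powr (p - 1) \<le> c" 
   using c'[rule_format, OF r, of a, THEN conjunct2] by (simp only: V_def W_def T_def)
  moreover have "(1 / V * W) * (1 / V * T) powr (p - 1) = W * T powr (p - 1) / V powr p"
  proof -
   have "V powr p = V * V powr (p - 1)" using V by (simp add: powr_diff)
   then show ?thesis using V T by (simp add: powr_divide)
  qed
  ultimately have "W * T powr (p - 1) / V powr p \<le> c" by simp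
  then have "W * T powr (p - 1) \<le> c * V powr p" using V by (simp add: divide_le_eq)
  then show ?thesis unfolding V_def W_def T_def .
 qed
 then show thesis by - (rule that[OF c], intro allI impI)
qed

text \<open>Averages over balls of one radius are bounded on \<open>L^p(w)\<close>, uniformly in the
  radius, without the maximal function. Hoelder on \<open>ball x r\<close> produces a dual integral
  there; it is enlarged to \<open>ball y (2 * r)\<close> so that it depends on \<open>y\<close>
  alone. After Fubini the integral of \<open>w\<close> over the \<open>x\<close> near
  \<open>y\<close> meets this factor, and the \<open>A_p\<close> condition on the doubled ball
  bounds the product. The doubled radius is the source of \<open>2 powr N\<close> in
  \<open>C\<close>.\<close>

lemma ball_average_bound:
 obtains C where "0 < C" "\<forall>h r. (\<forall>x. 0 \<le> h x) --> integrable lebesgue (\<lambda>x. h x powr p * w x) -->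
  h \<in> borel_measurable lebesgue --> 0 < r -->
  (\<integral>\<^sup>+x. ennreal (w x) * ennreal ((LINT y|lebesgue_on (ball x r). h y) powr p) \<partial>lebesgue)
   \<le> ennreal (C * measure lebesgue (ball (0::'a) r) powr p * (LINT x|lebesgue. h x powr p * w x))"
proof -
 obtain c where c: "0 < c" "\<forall>a r. 0 < r --> (LINT x|lebesgue_on (ball a r). w x) *
   (LINT x|lebesgue_on (ball a r). dual_weight x) powr (p - 1) \<le> c * measure lebesgue (ball a r) powr p"
  by (rule Ap_balls)
 define N where "N = real DIM('a)"
 define C where "C = 2 powr p * (c * (2 powr N) powr p)"
 have main: "(\<integral>\<^sup>+x. ennreal (w x) * ennreal ((LINT y|lebesgue_on (ball x r). h y) powr p) \<partial>lebesgue)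
   \<le> ennreal (C * measure lebesgue (ball (0::'a) r) powr p * (LINT x|lebesgue. h x powr p * w x))"
  if h: "\<forall>x. 0 \<le> h x" "integrable lebesgue (\<lambda>x. h x powr p * w x)" "h \<in> borel_measurable lebesgue" and r: "0 < r" for h r
 proof -
  note [measurable] = h(3)
  define V where "V = measure lebesgue (ball (0::'a) r)"
  define P where "P x = (LINT y|lebesgue_on (ball x r). h y powr p * w y)" for x
  define T where "T x = (LINT y|lebesgue_on (ball x (2 * r)). dual_weight y)" for x
  have [measurable]: "T \<in> borel_measurable lebesgue" unfolding T_def by (rule borel_measurable_integral_ball) measurable
  have [measurable]: "Measurable.pred ((lebesgue :: 'a measure) \<Otimes>\<^sub>M lebesgue) (\<lambda>z. dist (fst z) (snd z) < r)"
   by (rule measurable_dist_less_pair)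
  have w_on: "AE x in lebesgue_on S. 0 < w x" if "S \<in> sets lebesgue" for S
   using weight_pos that by (subst AE_restrict_space_iff) auto
  have hp_on: "integrable (lebesgue_on (ball x r)) (\<lambda>y. h y powr p * w y)" for x
   using integrable_mult_indicator[OF _ h(2), of "ball x r"] by (simp add: integrable_lebesgue_on_iff)
  have Pnn: "ennreal (P x) = (\<integral>\<^sup>+y. (if dist x y < r then ennreal (h y powr p * w y) else 0) \<partial>lebesgue)" for x
  proof -
   have "ennreal (P x) = (\<integral>\<^sup>+y. ennreal (h y powr p * w y) \<partial>lebesgue_on (ball x r))"
    unfolding P_def using hp_on w_on[of "ball x r"]
    by (intro nn_integral_eq_integral[symmetric]) (auto elim!: eventually_mono)
   then show ?thesis
    by (simp add: nn_integral_restrict_space) (auto intro!: nn_integral_cong simp: indicator_def)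
  qed
  have step: "ennreal (w x) * ennreal ((LINT y|lebesgue_on (ball x r). h y) powr p)
    \<le> (\<integral>\<^sup>+y. ennreal (2 powr p) * (if dist x y < r then ennreal (w x) * ennreal (T y powr (p - 1)) * ennreal (h y powr p * w y) else 0) \<partial>lebesgue)" for x
  proof -
   define Tx where "Tx = (LINT y|lebesgue_on (ball x r). dual_weight y)"
   \<comment> \<open>If \<open>y\<close> is within \<open>r\<close> of \<open>x\<close>, the ball
     around \<open>x\<close> lies in the doubled ball around \<open>y\<close>; the dependence on
     \<open>x\<close> is traded for one on \<open>y\<close> before integrals are exchanged.\<close>
   have TxT: "Tx \<le> T y" if "dist x y < r" for y
   proof -
    have sub: "ball x r \<subseteq> ball y (2 * r)" using that
     by (auto simp: subset_eq) (smt (verit) dist_commute dist_triangle)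
    have "Tx = (LINT z|lebesgue. indicator (ball x r) z *\<^sub>R dual_weight z)"
     unfolding Tx_def by (rule integral_restrict_space) auto
    also have "\<dots> \<le> (LINT z|lebesgue. indicator (ball y (2*r)) z *\<^sub>R dual_weight z)"
    proof (rule integral_mono)
     show "integrable lebesgue (\<lambda>z. indicator (ball x r) z *\<^sub>R dual_weight z)"
      using dual_weight_integrable_ball[of x r] by (simp add: integrable_lebesgue_on_iff)
     show "integrable lebesgue (\<lambda>z. indicator (ball y (2*r)) z *\<^sub>R dual_weight z)"
      using dual_weight_integrable_ball[of y "2*r"] by (simp add: integrable_lebesgue_on_iff)
    qed (use sub in \<open>auto simp: indicator_def\<close>)
    also have "\<dots> = T y" unfolding T_def by (rule integral_restrict_space[symmetric]) auto
    finally show ?thesis .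
   qed
   have Tx0: "0 \<le> Tx" unfolding Tx_def by (intro integral_nonneg_AE) auto
   have P0: "0 \<le> P x" unfolding P_def using w_on[of "ball x r"] by (intro integral_nonneg_AE) (auto elim!: eventually_mono)
   have "(LINT y|lebesgue_on (ball x r). h y) powr p \<le> 2 powr p * P x * Tx powr (p - 1)"
    unfolding P_def Tx_def
    by (rule weighted_holder[OF p]) (use h w_on hp_on dual_weight_integrable_ball in \<open>auto intro!: measurable_restrict_space1\<close>)
   then have "ennreal ((LINT y|lebesgue_on (ball x r). h y) powr p) \<le> ennreal (2 powr p * Tx powr (p - 1)) * ennreal (P x)"
    using P0 by (simp add: ennreal_mult'[symmetric] mult_ac ennreal_leI)
   also have "\<dots> = (\<integral>\<^sup>+y. ennreal (2 powr p * Tx powr (p - 1)) * (if dist x y < r then ennreal (h y powr p * w y) else 0) \<partial>lebesgue)"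
    unfolding Pnn by (rule nn_integral_cmult[symmetric]) measurable
   finally have "ennreal (w x) * ennreal ((LINT y|lebesgue_on (ball x r). h y) powr p)
     \<le> ennreal (w x) * (\<integral>\<^sup>+y. ennreal (2 powr p * Tx powr (p - 1)) * (if dist x y < r then ennreal (h y powr p * w y) else 0) \<partial>lebesgue)"
    by (rule mult_left_mono) simp
   also have "\<dots> = (\<integral>\<^sup>+y. ennreal (w x) * (ennreal (2 powr p * Tx powr (p - 1)) * (if dist x y < r then ennreal (h y powr p * w y) else 0)) \<partial>lebesgue)"
    by (rule nn_integral_cmult[symmetric]) measurable
   also have "\<dots> \<le> (\<integral>\<^sup>+y. ennreal (2 powr p) * (if dist x y < r then ennreal (w x) * ennreal (T y powr (p - 1)) * ennreal (h y powr p * w y) else 0) \<partial>lebesgue)"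
   proof (rule nn_integral_mono)
    fix y
    show "ennreal (w x) * (ennreal (2 powr p * Tx powr (p - 1)) * (if dist x y < r then ennreal (h y powr p * w y) else 0))
     \<le> ennreal (2 powr p) * (if dist x y < r then ennreal (w x) * ennreal (T y powr (p - 1)) * ennreal (h y powr p * w y) else 0)"
    proof (cases "dist x y < r")
     case True
     have "Tx powr (p - 1) \<le> T y powr (p - 1)" using TxT[OF True] Tx0 p by (intro powr_mono2) auto
     then have "ennreal (2 powr p * Tx powr (p - 1)) \<le> ennreal (2 powr p) * ennreal (T y powr (p - 1))"
      by (simp add: ennreal_mult'[symmetric] ennreal_leI)
     then have "ennreal (w x) * ennreal (h y powr p * w y) * ennreal (2 powr p * Tx powr (p - 1))
      \<le> ennreal (w x) * ennreal (h y powr p * w y) * (ennreal (2 powr p) * ennreal (T y powr (p - 1)))"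
      by (rule mult_left_mono) simp
     then show ?thesis using True by (simp add: mult_ac)
    qed simp
   qed
   finally show ?thesis .
  qed
  have "(\<integral>\<^sup>+x. ennreal (w x) * ennreal ((LINT y|lebesgue_on (ball x r). h y) powr p) \<partial>lebesgue)
    \<le> (\<integral>\<^sup>+x. (\<integral>\<^sup>+y. ennreal (2 powr p) * (if dist x y < r then ennreal (w x) * ennreal (T y powr (p - 1)) * ennreal (h y powr p * w y) else 0) \<partial>lebesgue) \<partial>lebesgue)"
   by (rule nn_integral_mono) (rule step)
  also have "\<dots> = (\<integral>\<^sup>+y. (\<integral>\<^sup>+x. ennreal (2 powr p) * (if dist x y < r then ennreal (w x) * ennreal (T y powr (p - 1)) * ennreal (h y powr p * w y) else 0) \<partial>lebesgue) \<partial>lebesgue)"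
  proof (rule pair_sigma_finite.Fubini'[OF pair_sigma_finite_lebesgue, symmetric])
   have "(\<lambda>z. ennreal (2 powr p) * (if dist (fst z) (snd z) < r then ennreal (w (fst z)) * ennreal (T (snd z) powr (p - 1)) * ennreal (h (snd z) powr p * w (snd z)) else 0))
     \<in> borel_measurable (lebesgue \<Otimes>\<^sub>M lebesgue)" by measurable
   then show "(\<lambda>(x, y). ennreal (2 powr p) * (if dist x y < r then ennreal (w x) * ennreal (T y powr (p - 1)) * ennreal (h y powr p * w y) else 0))
     \<in> borel_measurable (lebesgue \<Otimes>\<^sub>M lebesgue)" by (simp add: split_beta)
  qed
  also have "\<dots> \<le> (\<integral>\<^sup>+y. ennreal (C * V powr p) * ennreal (h y powr p * w y) \<partial>lebesgue)"
  proof (rule nn_integral_mono)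
   fix y
   have "(\<integral>\<^sup>+x. ennreal (2 powr p) * (if dist x y < r then ennreal (w x) * ennreal (T y powr (p - 1)) * ennreal (h y powr p * w y) else 0) \<partial>lebesgue)
     \<le> (\<integral>\<^sup>+x. ennreal (2 powr p) * ennreal (T y powr (p - 1)) * ennreal (h y powr p * w y) * (ennreal (w x) * indicator (ball y (2 * r)) x) \<partial>lebesgue)"
    using r by (intro nn_integral_mono) (auto simp: mult_ac dist_commute)
   also have "\<dots> = ennreal (2 powr p) * ennreal (T y powr (p - 1)) * ennreal (h y powr p * w y) * (\<integral>\<^sup>+x. ennreal (w x) * indicator (ball y (2 * r)) x \<partial>lebesgue)"
    by (rule nn_integral_cmult) (intro borel_measurable_times_ennreal borel_measurable_indicator; simp)
   also have "(\<integral>\<^sup>+x. ennreal (w x) * indicator (ball y (2 * r)) x \<partial>lebesgue) = ennreal (LINT x|lebesgue_on (ball y (2 * r)). w x)"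
    using weight_integrable_bounded[of "ball y (2*r)"] w_on[of "ball y (2*r)"]
    by (subst nn_integral_restrict_space[symmetric]) (auto intro!: nn_integral_eq_integral elim!: eventually_mono)
   also have "ennreal (2 powr p) * ennreal (T y powr (p - 1)) * ennreal (h y powr p * w y) * ennreal (LINT x|lebesgue_on (ball y (2 * r)). w x)
     = ennreal (2 powr p * ((LINT x|lebesgue_on (ball y (2 * r)). w x) * T y powr (p - 1))) * ennreal (h y powr p * w y)"
    by (simp add: ennreal_mult'' ennreal_mult' mult_ac)
   also have "\<dots> \<le> ennreal (C * V powr p) * ennreal (h y powr p * w y)"
   proof (intro mult_right_mono ennreal_leI)
    have vol: "measure lebesgue (ball y (2 * r)) = 2 powr N * V"
     using r by (simp add: V_def N_def content_ball powr_realpow power_mult_distrib)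
    have "(LINT x|lebesgue_on (ball y (2 * r)). w x) * T y powr (p - 1) \<le> c * (2 powr N * V) powr p"
     using c(2)[rule_format, of "2 * r" y] r by (simp add: T_def vol)
    then have "2 powr p * ((LINT x|lebesgue_on (ball y (2 * r)). w x) * T y powr (p - 1)) \<le> 2 powr p * (c * (2 powr N * V) powr p)"
     by (intro mult_left_mono) auto
    also have "\<dots> = C * V powr p" by (simp add: C_def V_def powr_mult)
    finally show "2 powr p * ((LINT x|lebesgue_on (ball y (2 * r)). w x) * T y powr (p - 1)) \<le> C * V powr p" .
   qed simp
   finally show "(\<integral>\<^sup>+x. ennreal (2 powr p) * (if dist x y < r then ennreal (w x) * ennreal (T y powr (p - 1)) * ennreal (h y powr p * w y) else 0) \<partial>lebesgue)
     \<le> ennreal (C * V powr p) * ennreal (h y powr p * w y)" .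
  qed
  also have "\<dots> = ennreal (C * V powr p) * (\<integral>\<^sup>+y. ennreal (h y powr p * w y) \<partial>lebesgue)"
   by (rule nn_integral_cmult) measurable
  also have "(\<integral>\<^sup>+y. ennreal (h y powr p * w y) \<partial>lebesgue) = ennreal (LINT y|lebesgue. h y powr p * w y)"
   using h(2) weight_pos by (intro nn_integral_eq_integral) (auto elim!: eventually_mono)
  finally show ?thesis
   unfolding V_def[symmetric] by (subst ennreal_mult') (use c(1) in \<open>auto simp: C_def\<close>)
 qed
 have "0 < C" using c(1) by (simp add: C_def)
 then show thesis by (rule that) (rule allI, rule allI, (rule impI)+, rule main)
qed

end

section \<open>Mollifier kernels: invariance, normalization and pointwise bounds\<close>

lemma integral_lebesgue_affine:
 fixes F :: "'a::euclidean_space => 'b::{banach,second_countable_topology}"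
 assumes F: "continuous_on UNIV F" and c: "\<bar>c\<bar> = (1::real)"
 shows "(LINT y|lebesgue. F (x + c *\<^sub>R y)) = (LINT y|lebesgue. F y)"
proof -
 have Fm: "F \<in> borel_measurable borel" using F by (rule borel_measurable_continuous_onI)
 have Fc: "(\<lambda>y. F (x + c *\<^sub>R y)) \<in> borel_measurable lborel"
 proof -
  have "continuous_on UNIV (\<lambda>y. F (x + c *\<^sub>R y))"
   by (rule continuous_on_compose2[OF F]) (auto intro!: continuous_intros)
  from borel_measurable_continuous_onI[OF this] show ?thesis by simp
 qed
 have "lborel = distr lborel borel (\<lambda>y::'a. x + c *\<^sub>R y)"
  using c by (subst lborel_affine[of c x]) (auto simp: density_1)
 then have "(LINT y|lborel. F y) = (LINT y|distr lborel borel (\<lambda>y. x + c *\<^sub>R y). F y)" by simp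
 also have "\<dots> = (LINT y|lborel. F (x + c *\<^sub>R y))"
  by (rule integral_distr) (use Fm in auto)
 finally show ?thesis using Fm Fc by (simp add: integral_completion)
qed

lemma integral_lebesgue_reflect:
 fixes F :: "'a::euclidean_space => 'b::{banach,second_countable_topology}"
 assumes "continuous_on UNIV F"
 shows "(LINT y|lebesgue. F (x - y)) = (LINT y|lebesgue. F y)"
 using integral_lebesgue_affine[OF assms, of "-1" x] by simp

lemma integral_lebesgue_translate:
 fixes F :: "'a::euclidean_space => 'b::{banach,second_countable_topology}"
 assumes "continuous_on UNIV F"
 shows "(LINT y|lebesgue. F (x + y)) = (LINT y|lebesgue. F y)"
 using integral_lebesgue_affine[OF assms, of 1 x] by simp

definition bump_kernel :: "nat => real^'n::finite => real" where
 "bump_kernel n x = bump_profile 0 (1 - (real (Suc n))\<^sup>2 * (x \<bullet> x))"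

definition mollifier :: "nat => real^'n::finite => real" where
 "mollifier n x = 1 / (LINT y|lebesgue. bump_kernel n (y :: real^'n)) * bump_kernel n x"

abbreviation mollify :: "nat => (real^'n::finite => 'b::euclidean_space) => real^'n => 'b" where
 "mollify n \<equiv> convolution (mollifier n)"

lemma bump_kernel_mem: "bump_kernel n \<in> bump_class ((real (Suc n))\<^sup>2)"
 using bump_class.base[of 0 "(real (Suc n))\<^sup>2"] by (simp add: bump_kernel_def[abs_def])

lemma mollifier_mem: "mollifier n \<in> bump_class ((real (Suc n))\<^sup>2)"
 unfolding mollifier_def[abs_def] by (rule bump_class.scale[OF bump_kernel_mem])

lemma bump_kernel_le: "0 \<le> bump_kernel n x" "bump_kernel n x \<le> indicator (ball 0 (1 / real (Suc n))) x"
proof -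
 show "0 \<le> bump_kernel n x" by (simp add: bump_kernel_def bump_profile_nonneg)
 show "bump_kernel n x \<le> indicator (ball 0 (1 / real (Suc n))) x"
 proof (cases "norm x < 1 / real (Suc n)")
  case True
  then show ?thesis by (auto simp: bump_kernel_def bump_profile_def)
 next
  case False
  then have "1 \<le> real (Suc n) * norm x" by (simp add: field_simps)
  then have "1 \<le> (real (Suc n) * norm x)\<^sup>2" by (simp add: one_le_power)
  then have "1 \<le> (real (Suc n))\<^sup>2 * (x \<bullet> x)" by (simp only: power_mult_distrib power2_norm_eq_inner)
  then show ?thesis using bump_class_eq_0[OF bump_kernel_mem, of n x] by simp
 qed
qed

text \<open>On the ball of half the radius the argument of the profile is at least
  \<open>3 / 4\<close>, whence \<open>exp (- 4 / 3)\<close>. The normalizing integral is thereby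
  comparable with the volume of the support.\<close>

lemma bump_kernel_lower:
 assumes "norm (x :: real^'n::finite) < 1 / real (Suc n) / 2"
 shows "exp (- 4 / 3) \<le> bump_kernel n x"
proof -
 have "real (Suc n) * norm x \<le> 1 / 2" using assms by (simp add: field_simps)
 then have "(real (Suc n) * norm x)\<^sup>2 \<le> (1 / 2)\<^sup>2" by (intro power_mono) auto
 then have "(real (Suc n))\<^sup>2 * (x \<bullet> x) \<le> 1 / 4" by (simp only: power_mult_distrib power2_norm_eq_inner) (simp add: power2_eq_square)
 then have "3 / 4 \<le> 1 - (real (Suc n))\<^sup>2 * (x \<bullet> x)" by linarith
 moreover define t where "t = 1 - (real (Suc n))\<^sup>2 * (x \<bullet> x)"
 ultimately have t: "3 / 4 \<le> t" by simp
 then have "1 / t \<le> 4 / 3" by (simp add: field_simps)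
 then have "exp (- 4 / 3) \<le> exp (- 1 / t)" by simp
 then show ?thesis using t by (simp add: bump_kernel_def bump_profile_def t_def)
qed

lemma bump_kernel_integrable: "integrable lebesgue (bump_kernel n :: real^'n::finite => real)"
proof (rule B_integrable_bound)
 show "integrable lebesgue (indicator (ball 0 (1 / real (Suc n))) :: real^'n => real)"
  by (intro integrable_real_indicator) (auto simp: emeasure_bounded_finite[unfolded infinity_ennreal_def])
 show "bump_kernel n \<in> borel_measurable lebesgue"
  by (intro borel_measurable_lebesgue_continuous bump_class_continuous[OF bump_kernel_mem])
 show "AE x in lebesgue. norm (bump_kernel n x) \<le> norm (indicator (ball 0 (1 / real (Suc n))) x :: real)"
  by (intro AE_I2) (simp add: bump_kernel_le abs_of_nonneg del: of_nat_Suc)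
qed

lemma bump_kernel_integral_lower:
 "exp (- 4 / 3) * measure lebesgue (ball (0::real^'n::finite) (1 / real (Suc n))) / 2 ^ CARD('n)
  \<le> (LINT y|lebesgue. bump_kernel n (y :: real^'n))"
proof -
 let ?B = "ball (0::real^'n) (1 / real (Suc n) / 2)"
 have "exp (- 4 / 3) * measure lebesgue ?B = (LINT x|lebesgue. exp (- 4 / 3) * indicator ?B x)" by simp
 also have "\<dots> \<le> (LINT y|lebesgue. bump_kernel n (y :: real^'n))"
 proof (rule integral_mono[OF _ bump_kernel_integrable])
  show "integrable lebesgue (\<lambda>x. exp (- 4 / 3) * indicator ?B x :: real)"
   by (intro integrable_mult_right integrable_real_indicator) (auto simp: emeasure_bounded_finite[unfolded infinity_ennreal_def])
  show "exp (- 4 / 3) * indicator ?B x \<le> bump_kernel n x" for x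
   using bump_kernel_lower[of x n] bump_kernel_le(1)[of n x] by (auto simp: indicator_def)
 qed
 also have "measure lebesgue ?B = measure lebesgue (ball (0::real^'n) (1 / real (Suc n))) / 2 ^ CARD('n)"
  by (simp add: content_ball power_divide del: of_nat_Suc)
 finally show ?thesis by simp
qed

lemma bump_kernel_integral_pos: "0 < (LINT y|lebesgue. bump_kernel n (y :: real^'n::finite))"
 by (rule less_le_trans[OF _ bump_kernel_integral_lower]) (auto intro!: divide_pos_pos mult_pos_pos content_ball_pos)

lemma mollifier_nonneg: "0 \<le> mollifier n x"
 using bump_kernel_integral_pos[of n, where 'n = 'a] bump_kernel_le(1)[of n x] by (simp add: mollifier_def)

lemma mollifier_eq_0: "1 / real (Suc n) \<le> norm x ==> mollifier n x = 0"
 using bump_kernel_le[of n x] by (simp add: mollifier_def)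

text \<open>The kernel is at most a multiple of the normalized indicator of its ball, with a factor
  independent of \<open>n\<close>; the power of 2 comes from the half radius in the lower bound of
  the normalization. Mollification is thus dominated by a ball average.\<close>

lemma mollifier_le:
 "mollifier n (x :: real^'n::finite) \<le> exp (4 / 3) * 2 ^ CARD('n) / measure lebesgue (ball (0::real^'n::finite) (1 / real (Suc n)))
   * indicator (ball 0 (1 / real (Suc n))) x"
proof -
 let ?V = "measure lebesgue (ball (0::real^'n::finite) (1 / real (Suc n)))"
 let ?I = "(LINT y|lebesgue. bump_kernel n (y :: real^'n))"
 have V: "0 < ?V" by (simp add: content_ball_pos)
 have "1 / ?I \<le> 1 / (exp (- 4 / 3) * ?V / 2 ^ CARD('n))"
  using V by (intro divide_left_mono bump_kernel_integral_lower mult_pos_pos bump_kernel_integral_pos divide_pos_pos) auto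
 also have "\<dots> = exp (4 / 3) * 2 ^ CARD('n) / ?V" by (simp add: exp_minus field_simps)
 finally show ?thesis unfolding mollifier_def
  using bump_kernel_le[of n x] bump_kernel_integral_pos[of n, where 'n = 'n] V
  by (intro mult_mono) auto
qed

lemma mollifier_continuous: "continuous_on S (mollifier n)"
 by (rule bump_class_continuous[OF mollifier_mem])

lemma mollifier_bounded: "\<exists>L. \<forall>x. \<bar>mollifier n x\<bar> \<le> L"
 by (rule bump_class_bounded[OF mollifier_mem]) simp

lemma mollifier_integral: "(LINT y|(lebesgue :: (real^'n::finite) measure). mollifier n (x - y)) = 1"
 using bump_kernel_integral_pos[of n, where 'n = 'n]
 unfolding integral_lebesgue_reflect[OF mollifier_continuous] by (simp add: mollifier_def[abs_def])

text \<open>A function that is not integrable has Bochner integral 0, so the value 1 already implies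
  integrability.\<close>

lemma mollifier_integrable: "integrable lebesgue (\<lambda>y. mollifier n (x - y))"
 using mollifier_integral[of n x] not_integrable_integral_eq by force

lemma convolution_measurable:
 fixes h :: "real^'n::finite => 'b::euclidean_space"
 assumes [measurable]: "h \<in> borel_measurable lebesgue" and K: "continuous_on UNIV K"
 shows "convolution K h \<in> borel_measurable lebesgue"
proof -
 have "(\<lambda>z. fst z) \<in> borel_measurable ((lebesgue :: (real^'n) measure) \<Otimes>\<^sub>M (lebesgue :: (real^'n) measure))"
  "(\<lambda>z. snd z) \<in> borel_measurable ((lebesgue :: (real^'n) measure) \<Otimes>\<^sub>M (lebesgue :: (real^'n) measure))"
  using measurable_compose[OF measurable_fst measurable_id_lebesgue]
   measurable_compose[OF measurable_snd measurable_id_lebesgue] by auto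
 then have "(\<lambda>z. fst z - snd z) \<in> borel_measurable ((lebesgue :: (real^'n) measure) \<Otimes>\<^sub>M lebesgue)"
  by (rule borel_measurable_diff)
 from measurable_compose[OF this borel_measurable_continuous_onI[OF K]]
 have [measurable]: "(\<lambda>z. K (fst z - snd z)) \<in> borel_measurable ((lebesgue :: (real^'n) measure) \<Otimes>\<^sub>M lebesgue)" .
 have "(\<lambda>z. K (fst z - snd z) *\<^sub>R h (snd z)) \<in> borel_measurable (lebesgue \<Otimes>\<^sub>M lebesgue)"
  by measurable
 then show ?thesis unfolding convolution_def
  by (intro lebesgue.borel_measurable_lebesgue_integral) (simp add: split_beta)
qed

lemma mollify_integrable:
 fixes h :: "real^'n::finite => 'b::euclidean_space"
 assumes "integrable lebesgue h"
 shows "integrable lebesgue (\<lambda>y. mollifier n (x - y) *\<^sub>R h y)"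
proof -
 obtain L where "\<forall>x. \<bar>mollifier n (x::real^'n)\<bar> \<le> L" using mollifier_bounded by blast
 then show ?thesis by (intro convolution_integrable[OF assms mollifier_continuous]) auto
qed

lemma mollify_diff:
 fixes h g :: "real^'n::finite => 'b::euclidean_space"
 assumes "integrable lebesgue h" "integrable lebesgue g"
 shows "mollify n (\<lambda>x. h x - g x) x = mollify n h x - mollify n g x"
 unfolding convolution_def scaleR_diff_right
 by (intro B_integral_diff mollify_integrable assms)

lemma mollify_eq_0:
 fixes h :: "real^'n::finite => 'b::euclidean_space"
 assumes "!!y. dist x y < 1 / real (Suc n) ==> h y = 0"
 shows "mollify n h x = 0"
proof -
 have "mollifier n (x - y) *\<^sub>R h y = 0" for y
  using assms[of y] mollifier_eq_0[of n "x - y"] by (cases "dist x y < 1 / real (Suc n)") (auto simp: dist_norm)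
 then show ?thesis by (simp only: convolution_def B_integral_zero)
qed

lemma mollify_close:
 fixes g :: "real^'n::finite => 'b::euclidean_space"
 assumes g: "integrable lebesgue g" and e: "!!y. dist x y < 1 / real (Suc n) ==> norm (g y - c) \<le> e"
 shows "norm (mollify n g x - c) \<le> e"
proof -
 have i: "integrable lebesgue (\<lambda>y. mollifier n (x - y) *\<^sub>R g y)" by (rule mollify_integrable[OF g])
 have ic: "integrable lebesgue (\<lambda>y. mollifier n (x - y) *\<^sub>R c)"
  by (intro integrable_scaleR_left mollifier_integrable)
 have "mollify n g x - c = (LINT y|lebesgue. mollifier n (x - y) *\<^sub>R g y) - (LINT y|lebesgue. mollifier n (x - y) *\<^sub>R c)"
  by (simp add: convolution_def mollifier_integral mollifier_integrable)
 also have "\<dots> = (LINT y|lebesgue. mollifier n (x - y) *\<^sub>R (g y - c))"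
  unfolding scaleR_diff_right by (rule B_integral_diff[symmetric, OF i ic])
 also have "norm \<dots> \<le> (LINT y|lebesgue. mollifier n (x - y) * e)"
 proof (rule B_integral_norm_bound_integral)
  show "integrable lebesgue (\<lambda>y. mollifier n (x - y) *\<^sub>R (g y - c))"
   unfolding scaleR_diff_right by (intro B_integrable_diff i ic)
  show "integrable lebesgue (\<lambda>y. mollifier n (x - y) * e)" by (intro integrable_mult_left mollifier_integrable)
  show "norm (mollifier n (x - y) *\<^sub>R (g y - c)) \<le> mollifier n (x - y) * e" for y
  proof (cases "dist x y < 1 / real (Suc n)")
   case True
   then show ?thesis using e[OF True] mollifier_nonneg[of n "x - y"] by (simp add: mult_left_mono)
  next
   case False
   then show ?thesis using mollifier_eq_0[of n "x - y"] by (simp add: dist_norm)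
  qed
 qed
 also have "\<dots> = e" by (simp add: mollifier_integral)
 finally show ?thesis .
qed

text \<open>Reduces convergence of mollifications in the weighted space to the bound for averages
  over balls.\<close>

lemma mollify_norm_le_ball_integral:
 fixes h :: "real^'n::finite => 'b::euclidean_space"
 assumes h: "integrable lebesgue h"
 shows "norm (mollify n h x) \<le> exp (4 / 3) * 2 ^ CARD('n) / measure lebesgue (ball (0::real^'n) (1 / real (Suc n)))
   * (LINT y|lebesgue_on (ball x (1 / real (Suc n))). norm (h y))"
proof -
 let ?r = "1 / real (Suc n)"
 define c where "c = exp (4 / 3) * 2 ^ CARD('n) / measure lebesgue (ball (0::real^'n) ?r)"
 have ih: "integrable lebesgue (\<lambda>y. indicator (ball x ?r) y *\<^sub>R norm (h y))"
  by (rule integrable_mult_indicator) (use h in auto)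
 have "norm (mollify n h x) \<le> (LINT y|lebesgue. c * (indicator (ball x ?r) y *\<^sub>R norm (h y)))"
  unfolding convolution_def
 proof (rule B_integral_norm_bound_integral[OF mollify_integrable[OF h]])
  show "integrable lebesgue (\<lambda>y. c * (indicator (ball x ?r) y *\<^sub>R norm (h y)))" using ih by (rule integrable_mult_right)
  fix y
  have "norm (mollifier n (x - y) *\<^sub>R h y) = mollifier n (x - y) * norm (h y)" by (simp add: mollifier_nonneg)
  also have "\<dots> \<le> (c * indicator (ball 0 ?r) (x - y)) * norm (h y)"
   unfolding c_def by (intro mult_right_mono mollifier_le) simp
  also have "\<dots> = c * (indicator (ball x ?r) y *\<^sub>R norm (h y))"
   by (simp add: indicator_def dist_norm norm_minus_commute)
  finally show "norm (mollifier n (x - y) *\<^sub>R h y) \<le> c * (indicator (ball x ?r) y *\<^sub>R norm (h y))" .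
 qed
 also have "\<dots> = c * (LINT y|lebesgue_on (ball x ?r). norm (h y))"
  by (simp add: integral_restrict_space)
 finally show ?thesis by (simp add: c_def)
qed

section \<open>The weighted measure and its \<open>L^p\<close> space\<close>

context muckenhoupt
begin

text \<open>The measure \<open>w dx\<close> on \<open>S\<close>. The coercion \<open>ennreal\<close>
  sends negative values to 0, which changes nothing for a weight that is positive almost
  everywhere.\<close>

definition wmeasure :: "'a set => 'a measure" where
 "wmeasure S = density (lebesgue_on S) (\<lambda>x. ennreal (w x))"

lemma weight_measurable_on: "w \<in> Lmeas S"
 by (rule measurable_restrict_space1) (rule weight_measurable)

lemma weight_pos_on: "S \<in> sets lebesgue ==> AE x in lebesgue_on S. 0 < w x"
 using weight_pos by (subst AE_restrict_space_iff) auto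

lemma AE_wmeasure:
 assumes "S \<in> sets lebesgue"
 shows "(AE x in wmeasure S. P x) \<longleftrightarrow> (AE x in lebesgue_on S. P x)"
proof -
 have "(AE x in wmeasure S. P x) \<longleftrightarrow> (AE x in lebesgue_on S. 0 < w x --> P x)"
  unfolding wmeasure_def using weight_measurable_on[of S] by (subst AE_density) auto
 also have "\<dots> \<longleftrightarrow> (AE x in lebesgue_on S. P x)"
  using weight_pos_on[OF assms] by (auto elim: eventually_elim2)
 finally show ?thesis .
qed

lemma measurable_wmeasure: "borel_measurable (wmeasure S) = Lmeas S"
 unfolding wmeasure_def by (rule measurable_cong_sets) simp_all

lemma integrable_wmeasure:
 fixes f :: "'a => 'c::{banach,second_countable_topology}"
 assumes "S \<in> sets lebesgue" "f \<in> Lmeas S"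
 shows "integrable (wmeasure S) f \<longleftrightarrow> integrable (lebesgue_on S) (\<lambda>x. w x *\<^sub>R f x)"
 unfolding wmeasure_def using assms weight_measurable_on weight_pos_on[OF assms(1)]
 by (intro integrable_density) (auto elim!: eventually_mono)

lemma integral_wmeasure:
 fixes f :: "'a => 'c::{banach,second_countable_topology}"
 assumes "S \<in> sets lebesgue" "f \<in> Lmeas S"
 shows "(LINT x|wmeasure S. f x) = (LINT x|lebesgue_on S. w x *\<^sub>R f x)"
 unfolding wmeasure_def using assms weight_measurable_on weight_pos_on[OF assms(1)]
 by (intro integral_density) (auto elim!: eventually_mono)

lemma norm_powr_measurable_on:
 fixes f :: "'a => 'c::euclidean_space"
 shows "f \<in> Lmeas S ==> (\<lambda>x. norm (f x) powr p) \<in> Lmeas S"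
 by measurable

lemma Lp_wmeasure_iff:
 fixes f :: "'a => 'c::euclidean_space"
 assumes "S \<in> sets lebesgue"
 shows "f \<in> Lp p (wmeasure S) \<longleftrightarrow> f \<in> Lmeas S \<and>
  integrable (lebesgue_on S) (\<lambda>x. norm (f x) powr p * w x)"
proof -
 have "integrable (wmeasure S) (\<lambda>x. norm (f x) powr p) \<longleftrightarrow> integrable (lebesgue_on S) (\<lambda>x. norm (f x) powr p * w x)"
  if "f \<in> Lmeas S"
  using integrable_wmeasure[OF assms norm_powr_measurable_on[OF that]] by (simp add: mult.commute)
 then show ?thesis by (auto simp: Lp_def measurable_wmeasure)
qed

lemma norm_powr_integral_wmeasure:
 fixes f :: "'a => 'c::euclidean_space"
 assumes "S \<in> sets lebesgue" "f \<in> Lmeas S"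
 shows "Lp_int p (wmeasure S) f = (LINT x|lebesgue_on S. norm (f x) powr p * w x)"
 using integral_wmeasure[OF assms(1) norm_powr_measurable_on[OF assms(2)]] by (simp add: mult.commute)

lemma Lp_wmeasure_mono:
 fixes f :: "'a => 'c::euclidean_space"
 assumes "S \<subseteq> T" "S \<in> sets lebesgue" "T \<in> sets lebesgue" "f \<in> Lp p (wmeasure T)"
 shows "f \<in> Lp p (wmeasure S)"
  "Lp_int p (wmeasure S) f \<le> Lp_int p (wmeasure T) f"
proof -
 have fT: "f \<in> Lmeas T" "integrable (lebesgue_on T) (\<lambda>x. norm (f x) powr p * w x)"
  using assms Lp_wmeasure_iff by blast+
 have fS: "f \<in> Lmeas S"
  using fT(1) assms(1) by (rule measurable_restrict_mono)
 show *: "f \<in> Lp p (wmeasure S)"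
  using fS integrable_lebesgue_on_subset[OF fT(2) assms(1-3)] Lp_wmeasure_iff[OF assms(2)] by blast
 have "(LINT x|lebesgue_on S. norm (f x) powr p * w x) = (LINT x|lebesgue. indicator S x *\<^sub>R (norm (f x) powr p * w x))"
  using assms by (intro integral_restrict_space) auto
 also have "\<dots> \<le> (LINT x|lebesgue. indicator T x *\<^sub>R (norm (f x) powr p * w x))"
 proof (rule integral_mono_AE)
  show "integrable lebesgue (\<lambda>x. indicator S x *\<^sub>R (norm (f x) powr p * w x))"
   using * assms by (simp add: Lp_wmeasure_iff integrable_lebesgue_on_iff)
  show "integrable lebesgue (\<lambda>x. indicator T x *\<^sub>R (norm (f x) powr p * w x))"
   using fT assms by (simp add: integrable_lebesgue_on_iff)
  show "AE x in lebesgue. indicator S x *\<^sub>R (norm (f x) powr p * w x) \<le> indicator T x *\<^sub>R (norm (f x) powr p * w x)"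
   using weight_pos by eventually_elim (use assms(1) in \<open>auto simp: indicator_def\<close>)
 qed
 also have "\<dots> = (LINT x|lebesgue_on T. norm (f x) powr p * w x)"
  using assms by (intro integral_restrict_space[symmetric]) auto
 finally show "Lp_int p (wmeasure S) f \<le> Lp_int p (wmeasure T) f"
  using fS fT assms by (simp add: norm_powr_integral_wmeasure)
qed

lemma Lp_wmeasure_extend:
 fixes f :: "'a => 'c::euclidean_space"
 assumes "S \<in> sets lebesgue" "f \<in> Lp p (wmeasure S)"
 shows "(\<lambda>x. indicator S x *\<^sub>R f x) \<in> Lp p (wmeasure UNIV)"
proof -
 have f: "f \<in> Lmeas S" "integrable (lebesgue_on S) (\<lambda>x. norm (f x) powr p * w x)"
  using assms Lp_wmeasure_iff by blast+
 have "(\<lambda>x. indicator S x *\<^sub>R f x) \<in> borel_measurable lebesgue"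
  using f(1) assms(1) by (subst (asm) borel_measurable_restrict_space_iff) auto
 moreover have "integrable lebesgue (\<lambda>x. norm (indicator S x *\<^sub>R f x) powr p * w x)"
 proof -
  have "integrable lebesgue (\<lambda>x. indicator S x *\<^sub>R (norm (f x) powr p * w x))"
   using f(2) assms(1) by (simp add: integrable_lebesgue_on_iff)
  also have "(\<lambda>x. indicator S x *\<^sub>R (norm (f x) powr p * w x)) = (\<lambda>x. norm (indicator S x *\<^sub>R f x) powr p * w x)"
   by (auto simp: fun_eq_iff indicator_def)
  finally show ?thesis .
 qed
 ultimately show ?thesis by (simp add: Lp_wmeasure_iff lebesgue_on_UNIV_eq)
qed

lemma Lp_wmeasure_bounded:
 fixes f :: "'a => 'c::euclidean_space"
 assumes "f \<in> borel_measurable lebesgue" "!!x. norm (f x) \<le> L" "bounded S" "S \<in> sets lebesgue" "!!x. x \<notin> S ==> f x = 0"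
 shows "f \<in> Lp p (wmeasure UNIV)"
  "Lp_int p (wmeasure UNIV) f \<le> L powr p * (LINT x|lebesgue_on S. w x)"
proof -
 have iw: "integrable lebesgue (\<lambda>x. L powr p * (indicator S x *\<^sub>R w x))"
  using weight_integrable_bounded[OF assms(3,4)] assms(4) by (simp add: integrable_lebesgue_on_iff)
 have le: "AE x in lebesgue. norm (f x) powr p * w x \<le> L powr p * (indicator S x *\<^sub>R w x)"
  using weight_pos
 proof eventually_elim
  case (elim x)
  have "norm (f x) powr p \<le> L powr p" using assms(2) p by (intro powr_mono2) auto
  then show ?case using elim assms(5)[of x] by (cases "x \<in> S") (auto intro: mult_right_mono)
 qed
 note [measurable] = assms(1)
 have i: "integrable lebesgue (\<lambda>x. norm (f x) powr p * w x)"
  by (rule B_integrable_bound[OF iw])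
   (use le weight_pos in \<open>auto elim!: eventually_elim2\<close>)
 then show "f \<in> Lp p (wmeasure UNIV)" using assms(1) by (simp add: Lp_wmeasure_iff lebesgue_on_UNIV_eq)
 have "Lp_int p (wmeasure UNIV) f = (LINT x|lebesgue. norm (f x) powr p * w x)"
  using assms(1) by (simp add: norm_powr_integral_wmeasure lebesgue_on_UNIV_eq)
 also have "\<dots> \<le> (LINT x|lebesgue. L powr p * (indicator S x *\<^sub>R w x))"
  by (rule integral_mono_AE[OF i iw le])
 also have "\<dots> = L powr p * (LINT x|lebesgue_on S. w x)"
  using assms(4) by (simp add: integral_restrict_space)
 finally show "Lp_int p (wmeasure UNIV) f \<le> L powr p * (LINT x|lebesgue_on S. w x)" .
qed

text \<open>Hoelder against the dual weight, which is integrable on bounded sets. Through this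
  embedding elements of the weighted space can be convolved and have weak gradients.\<close>

lemma Lp_wmeasure_integrable_on_bounded:
 fixes f :: "'a => 'c::euclidean_space"
 assumes "S \<in> sets lebesgue" "bounded S" "f \<in> Lp p (wmeasure S)"
 shows "integrable (lebesgue_on S) f"
proof -
 have f: "f \<in> Lmeas S" "integrable (lebesgue_on S) (\<lambda>x. norm (f x) powr p * w x)"
  using assms Lp_wmeasure_iff by blast+
 have "integrable (lebesgue_on S) (\<lambda>x. norm (f x))"
  by (rule weighted_holder(1)[OF p])
   (use f weight_pos_on[OF assms(1)] dual_weight_integrable_bounded[OF assms(2,1)] in auto)
 then show ?thesis using f(1) by (simp add: integrable_norm_iff)
qed

end

lemma Lp_dist_tendsto_dominated:
 fixes f :: "'a => 'b::euclidean_space"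
 assumes p: "0 < p" and "!!n. F n \<in> borel_measurable M" "f \<in> borel_measurable M"
  and "AE x in M. (\<lambda>n. F n x) \<longlonglongrightarrow> f x" "!!n. AE x in M. norm (F n x - f x) powr p \<le> H x" "integrable M H"
 shows "Lp_lim p M F f"
proof -
 have "(\<lambda>n. LINT x|M. norm (F n x - f x) powr p) \<longlonglongrightarrow> (LINT x|M. 0)"
 proof (rule integral_dominated_convergence[where w = H])
  show "AE x in M. (\<lambda>n. norm (F n x - f x) powr p) \<longlonglongrightarrow> 0"
   using assms(4)
  proof eventually_elim
   case (elim x)
   have "(\<lambda>n. norm (F n x - f x) powr p) \<longlonglongrightarrow> norm (f x - f x) powr p"
    using p by (intro tendsto_powr' tendsto_norm tendsto_diff elim tendsto_const) auto
   then show ?case by simp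
  qed
  show "AE x in M. norm (norm (F n x - f x) powr p) \<le> H x" for n using assms(5) by simp
  show "(\<lambda>x. norm (F n x - f x) powr p) \<in> borel_measurable M" for n
   using assms(2)[of n] assms(3) by measurable
 qed (use assms in auto)
 then show ?thesis by simp
qed

text \<open>The radial projection onto the closed ball of radius \<open>L\<close>, written without a
  case distinction so that continuity, also at the origin, is evident for positive
  \<open>L\<close>.\<close>

definition clamp_norm :: "real => 'a::real_normed_vector => 'a" where
 "clamp_norm L v = (L / max L (norm v)) *\<^sub>R v"

lemma clamp_norm_le: "0 < L ==> norm (clamp_norm L v) \<le> L"
 by (auto simp: clamp_norm_def divide_le_eq max_def)

lemma clamp_norm_id: "0 < L ==> norm v \<le> L ==> clamp_norm L v = v"
 by (simp add: clamp_norm_def max_def)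

lemma clamp_norm_le_norm: "0 < L ==> norm (clamp_norm L v) \<le> norm v"
 by (auto simp: clamp_norm_def max_def divide_le_eq intro!: mult_left_le_one_le)

lemma continuous_clamp_norm: "0 < L ==> continuous_on S (clamp_norm L)"
 unfolding clamp_norm_def by (intro continuous_intros) (auto simp: max_def)

locale muckenhoupt_vec = muckenhoupt p w for p :: real and w :: "real^'n::finite => real"
begin

lemma p0: "0 < p" using p by simp

lemma Lp_bounded_support_integrable:
 fixes h :: "real^'n => 'c::euclidean_space"
 assumes "h \<in> Lp p (wmeasure UNIV)" "bounded S" "!!x. x \<notin> S ==> h x = 0"
 shows "integrable lebesgue h"
proof -
 from bounded_subset_ballD[OF assms(2), of 0] obtain r where r: "S \<subseteq> ball 0 r" by (elim exE conjE)
 have "h \<in> Lp p (wmeasure (ball 0 r))" by (rule Lp_wmeasure_mono(1)[OF _ _ _ assms(1)]) auto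
 then have "integrable (lebesgue_on (ball 0 r)) h"
  by (intro Lp_wmeasure_integrable_on_bounded) auto
 then have "integrable lebesgue (\<lambda>x. indicator (ball 0 r) x *\<^sub>R h x)" by (simp add: integrable_lebesgue_on_iff)
 also have "(\<lambda>x. indicator (ball 0 r) x *\<^sub>R h x) = h"
  using r assms(3) by (force simp: fun_eq_iff indicator_def)
 finally show ?thesis .
qed

text \<open>Uniformity in \<open>n\<close> is the point: the kernel is of size one over the volume
  of its ball, and the \<open>p\<close>-th power of this cancels the volume factor in the bound for
  ball averages.\<close>

lemma mollify_Lp_bound:
 obtains C where "0 < C" "\<forall>(h :: real^'n => 'c::euclidean_space) S n. h \<in> Lp p (wmeasure UNIV) --> bounded S -->
  (\<forall>x. x \<notin> S --> h x = 0) --> mollify n h \<in> Lp p (wmeasure UNIV) \<and>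
  (LINT x|wmeasure UNIV. norm (mollify n h x) powr p) \<le> C * Lp_int p (wmeasure UNIV) h"
proof -
 obtain C where C: "0 < C" "\<forall>h r. (\<forall>x. 0 \<le> h x) --> integrable lebesgue (\<lambda>x. h x powr p * w x) -->
  h \<in> borel_measurable lebesgue --> 0 < r -->
  (\<integral>\<^sup>+x. ennreal (w x) * ennreal ((LINT y|lebesgue_on (ball x r). h y) powr p) \<partial>lebesgue)
   \<le> ennreal (C * measure lebesgue (ball (0::real^'n) r) powr p * (LINT x|lebesgue. h x powr p * w x))"
  by (rule ball_average_bound)
 define K where "K = (exp (4 / 3) * 2 ^ CARD('n)) powr p * C"
 have K: "0 < K" using C by (simp add: K_def)
 have main: "mollify n h \<in> Lp p (wmeasure UNIV) \<and>
  (LINT x|wmeasure UNIV. norm (mollify n h x) powr p) \<le> K * Lp_int p (wmeasure UNIV) h"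
  if h: "h \<in> Lp p (wmeasure UNIV)" "bounded S" "\<forall>x. x \<notin> S --> h x = 0" for h :: "real^'n => 'c" and S n
 proof -
  have hm[measurable]: "h \<in> borel_measurable lebesgue" and hp: "integrable lebesgue (\<lambda>x. norm (h x) powr p * w x)"
   using h(1) by (simp_all add: Lp_wmeasure_iff lebesgue_on_UNIV_eq)
  have ih: "integrable lebesgue h" using Lp_bounded_support_integrable[OF h(1,2)] h(3) by blast
  have mm[measurable]: "mollify n h \<in> borel_measurable lebesgue"
   by (rule convolution_measurable[OF hm mollifier_continuous])
  define r where "r = 1 / real (Suc n)"
  have r: "0 < r" by (simp add: r_def)
  define V where "V = measure lebesgue (ball (0::real^'n) r)"
  have V: "0 < V" using r by (simp add: V_def content_ball_pos)
  define I where "I = (LINT x|lebesgue. norm (h x) powr p * w x)"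
  have I0: "0 \<le> I" unfolding I_def using weight_pos by (intro integral_nonneg_AE) (auto elim!: eventually_mono)
  define d where "d = exp (4 / 3) * 2 ^ CARD('n) / V"
  have d: "0 < d" using V by (simp add: d_def)
  have pw: "norm (mollify n h x) powr p \<le> d powr p * (LINT y|lebesgue_on (ball x r). norm (h y)) powr p" for x
  proof -
   have "norm (mollify n h x) powr p \<le> (d * (LINT y|lebesgue_on (ball x r). norm (h y))) powr p"
    using mollify_norm_le_ball_integral[OF ih, of n x] p0
    by (intro powr_mono2) (auto simp: d_def V_def r_def)
   also have "\<dots> = d powr p * (LINT y|lebesgue_on (ball x r). norm (h y)) powr p"
    using d by (subst powr_mult) (auto intro!: integral_nonneg_AE)
   finally show ?thesis .
  qed
  have "(\<integral>\<^sup>+x. ennreal (norm (mollify n h x) powr p * w x) \<partial>lebesgue)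
    \<le> (\<integral>\<^sup>+x. ennreal (d powr p) * (ennreal (w x) * ennreal ((LINT y|lebesgue_on (ball x r). norm (h y)) powr p)) \<partial>lebesgue)"
  proof (rule nn_integral_mono)
   fix x
   have "ennreal (norm (mollify n h x) powr p * w x) = ennreal (norm (mollify n h x) powr p) * ennreal (w x)"
    by (rule ennreal_mult') simp
   also have "\<dots> \<le> ennreal (d powr p * (LINT y|lebesgue_on (ball x r). norm (h y)) powr p) * ennreal (w x)"
    by (intro mult_right_mono ennreal_leI pw) simp
   also have "\<dots> = ennreal (d powr p) * (ennreal (w x) * ennreal ((LINT y|lebesgue_on (ball x r). norm (h y)) powr p))"
    by (subst ennreal_mult') (simp_all only: powr_ge_zero mult_ac)
   finally show "ennreal (norm (mollify n h x) powr p * w x) \<le> \<dots>" .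
  qed
  also have "\<dots> = ennreal (d powr p) * (\<integral>\<^sup>+x. ennreal (w x) * ennreal ((LINT y|lebesgue_on (ball x r). norm (h y)) powr p) \<partial>lebesgue)"
  proof (rule nn_integral_cmult)
   have [measurable]: "(\<lambda>x. LINT y|lebesgue_on (ball x r). norm (h y)) \<in> borel_measurable lebesgue"
    by (rule borel_measurable_integral_ball) measurable
   show "(\<lambda>x. ennreal (w x) * ennreal ((LINT y|lebesgue_on (ball x r). norm (h y)) powr p)) \<in> borel_measurable lebesgue"
    by measurable
  qed
  also have "\<dots> \<le> ennreal (d powr p) * ennreal (C * V powr p * I)"
   unfolding V_def I_def using hp r
   by (intro mult_left_mono C(2)[rule_format]) auto
  also have "\<dots> = ennreal (K * I)"
  proof -
   have "d powr p * (C * V powr p * I) = K * I"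
    using V by (simp add: d_def K_def powr_divide)
   moreover have "ennreal (d powr p) * ennreal (C * V powr p * I) = ennreal (d powr p * (C * V powr p * I))"
    by (rule ennreal_mult'[symmetric]) simp
   ultimately show ?thesis by (simp only:)
  qed
  finally have nn: "(\<integral>\<^sup>+x. ennreal (norm (mollify n h x) powr p * w x) \<partial>lebesgue) \<le> ennreal (K * I)" .
  have nonneg: "AE x in lebesgue. 0 \<le> norm (mollify n h x) powr p * w x"
   using weight_pos by eventually_elim auto
  have im: "integrable lebesgue (\<lambda>x. norm (mollify n h x) powr p * w x)"
   by (rule integrableI_nonneg[OF _ nonneg]) (use nn in \<open>auto simp: order.strict_trans1\<close>)
  have "ennreal (LINT x|lebesgue. norm (mollify n h x) powr p * w x) \<le> ennreal (K * I)"
   using nn_integral_eq_integral[OF im nonneg] nn by simp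
  then have "(LINT x|lebesgue. norm (mollify n h x) powr p * w x) \<le> K * I"
   using K I0 by (subst (asm) ennreal_le_iff) auto
  then show ?thesis
   using im hm mm by (simp add: Lp_wmeasure_iff lebesgue_on_UNIV_eq norm_powr_integral_wmeasure I_def)
 qed
 show thesis
  by (rule that[OF K]) (rule allI, rule allI, rule allI, (rule impI)+, rule main)
qed

text \<open>Uniform continuity makes the convergence uniform, and the difference lives in a fixed
  ball over which the weight is integrable.\<close>

lemma mollify_tendsto_continuous:
 fixes g :: "real^'n => 'c::euclidean_space"
 assumes g: "continuous_on UNIV g" and R: "!!x. x \<notin> ball 0 R ==> g x = 0"
 shows "(\<lambda>n. Lp_dist p (wmeasure UNIV) (mollify n g) g) \<longlonglongrightarrow> 0"
proof -
 define W where "W = (LINT x|lebesgue_on (ball (0::real^'n) (R + 1)). w x)"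
 have gm: "g \<in> borel_measurable lebesgue" by (rule borel_measurable_lebesgue_continuous[OF g])
 have "compact (g ` cball 0 R)" by (intro compact_continuous_image continuous_on_subset[OF g]) auto
 then obtain L where L: "!!x. x \<in> cball 0 R ==> norm (g x) \<le> L"
  using compact_imp_bounded bounded_iff by (metis imageI)
 have gL: "norm (g x) \<le> max L 0" for x using L[of x] R[of x] by (cases "x \<in> ball 0 R") auto
 have "g \<in> Lp p (wmeasure UNIV)"
  by (rule Lp_wmeasure_bounded(1)[OF gm gL, of "ball 0 R"]) (use R in auto)
 then have gi: "integrable lebesgue g" by (rule Lp_bounded_support_integrable[of _ "ball 0 R"]) (use R in auto)
 \<comment> \<open>One unit of enlargement covers the support of the mollification, the second one
   the points over which it averages there.\<close>
 have uc: "uniformly_continuous_on (cball 0 (R + 2)) g"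
  by (intro compact_uniformly_continuous continuous_on_subset[OF g]) auto
 show ?thesis
 proof (rule LIMSEQ_I)
  fix e :: real assume e: "0 < e"
  \<comment> \<open>Chosen so that \<open>e' powr p\<close>, multiplied by the weight of the ball,
    is at most \<open>e / 2\<close>.\<close>
  define e' where "e' = (e / (2 * (\<bar>W\<bar> + 1))) powr (1 / p)"
  have e': "0 < e'" using e by (simp add: e'_def)
  obtain d where d: "0 < d" "!!x y. x \<in> cball 0 (R + 2) ==> y \<in> cball 0 (R + 2) ==> dist y x < d ==> dist (g y) (g x) < e'"
   using uc e' unfolding uniformly_continuous_on_def by metis
  obtain N :: nat where N: "1 / d < real N" using reals_Archimedean2 by blast
  have "Lp_dist p (wmeasure UNIV) (mollify n g) g < e" if n: "N \<le> n" for n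
  proof -
   have "1 / d < real (Suc n)" using N n by simp
   then have nd: "1 / real (Suc n) < d" using d(1) by (simp add: field_simps del: of_nat_Suc)
   have n1: "1 / real (Suc n) \<le> 1" by simp
   have zero: "mollify n g x - g x = 0" if "x \<notin> ball 0 (R + 1)" for x
   proof -
    have "g y = 0" if "dist x y < 1 / real (Suc n)" for y
    proof (rule R)
     have "R + 1 \<le> norm x" using \<open>x \<notin> ball 0 (R + 1)\<close> by simp
     also have "norm x \<le> norm y + dist x y" by (simp add: dist_norm norm_triangle_sub)
     finally have "R < norm y" using that n1 by linarith
     then show "y \<notin> ball 0 R" by simp
    qed
    then have "mollify n g x = 0" by (rule mollify_eq_0)
    moreover have "g x = 0" using R that by auto
    ultimately show ?thesis by simp
   qed
   have close: "norm (mollify n g x - g x) \<le> e'" for x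
   proof (cases "x \<in> ball 0 (R + 1)")
    case True
    show ?thesis
    proof (rule mollify_close[OF gi])
     fix y assume y: "dist x y < 1 / real (Suc n)"
     have "norm y \<le> norm x + dist x y" by (metis dist_commute dist_norm norm_triangle_sub)
     moreover have "norm x < R + 1" using True by simp
     ultimately have "norm y \<le> R + 2" using y n1 by linarith
     then have "y \<in> cball 0 (R + 2)" by simp
     moreover have "x \<in> cball 0 (R + 2)" using True by simp
     moreover have "dist y x < d" using y nd by (simp add: dist_commute)
     ultimately show "norm (g y - g x) \<le> e'" using d(2)[of x y] by (simp add: dist_norm)
    qed
   next
    case False
    then show ?thesis using zero[OF False] e' by simp
   qed
   have "(LINT x|wmeasure UNIV. norm (mollify n g x - g x) powr p) \<le> e' powr p * (LINT x|lebesgue_on (ball 0 (R + 1)). w x)"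
    by (rule Lp_wmeasure_bounded(2)[OF _ close])
     (use zero gm convolution_measurable[OF gm mollifier_continuous] in auto)
   also have "\<dots> = e / (2 * (\<bar>W\<bar> + 1)) * W"
    using p0 e by (simp add: e'_def powr_powr W_def)
   also have "\<dots> \<le> e / (2 * (\<bar>W\<bar> + 1)) * (\<bar>W\<bar> + 1)" using e by (intro mult_left_mono) auto
   also have "\<dots> = e / 2" by (simp add: field_simps)
   also have "\<dots> < e" using e by simp
   finally show ?thesis .
  qed
  then show "\<exists>N. \<forall>n\<ge>N. norm (Lp_dist p (wmeasure UNIV) (mollify n g) g - 0) < e"
   by (intro exI[of _ N]) (simp add: Lp_dist_nonneg)
 qed
qed

end

context muckenhoupt_vec
begin

text \<open>Two dominated limits: radial truncation makes \<open>h\<close> bounded, and a bounded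
  measurable function is an almost everywhere limit of continuous ones. Clamping and cutting these
  off keeps them under a common bound with common support.\<close>

lemma continuous_dense_Lp:
 fixes h :: "real^'n => 'c::euclidean_space"
 assumes h: "h \<in> Lp p (wmeasure UNIV)" and R: "!!x. x \<notin> ball 0 R ==> h x = 0" and e: "0 < e"
 obtains g where "continuous_on UNIV g" "\<forall>x. x \<notin> ball 0 (R + 1) --> g x = 0" "g \<in> Lp p (wmeasure UNIV)"
  "Lp_dist p (wmeasure UNIV) g h < e"
proof -
 let ?M = "wmeasure (UNIV :: (real^'n) set)"
 have hm[measurable]: "h \<in> borel_measurable lebesgue"
  using h by (simp add: Lp_wmeasure_iff lebesgue_on_UNIV_eq)
 have bmM: "borel_measurable ?M = borel_measurable lebesgue" by (simp add: measurable_wmeasure lebesgue_on_UNIV_eq)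
 define hL where "hL n x = clamp_norm (real (Suc n)) (h x)" for n x
 have hLm: "hL n \<in> borel_measurable lebesgue" for n unfolding hL_def
  by (rule measurable_compose[OF hm borel_measurable_continuous_onI[OF continuous_clamp_norm]]) simp
 have "(\<lambda>n. Lp_dist p ?M (hL n) h) \<longlonglongrightarrow> 0"
 proof (rule Lp_dist_tendsto_dominated[OF p0, where H = "\<lambda>x. 2 powr p * (norm (h x) powr p + norm (h x) powr p)"])
  show "AE x in ?M. (\<lambda>n. hL n x) \<longlonglongrightarrow> h x"
  proof (rule AE_I2)
   fix x
   obtain N :: nat where N: "norm (h x) \<le> real N" using real_arch_simple by blast
   have "\<forall>\<^sub>F n in sequentially. hL n x = h x"
    using eventually_ge_at_top[of N] by eventually_elim (use N in \<open>auto simp: hL_def intro!: clamp_norm_id\<close>)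
   then show "(\<lambda>n. hL n x) \<longlonglongrightarrow> h x" by (rule tendsto_eventually)
  qed
  show "AE x in ?M. norm (hL n x - h x) powr p \<le> 2 powr p * (norm (h x) powr p + norm (h x) powr p)" for n
  proof (rule AE_I2)
   fix x
   have "norm (hL n x) powr p \<le> norm (h x) powr p"
    unfolding hL_def using p0 by (intro powr_mono2 clamp_norm_le_norm) auto
   then have "2 powr p * (norm (hL n x) powr p + norm (h x) powr p) \<le> 2 powr p * (norm (h x) powr p + norm (h x) powr p)"
    by (intro mult_left_mono) auto
   then show "norm (hL n x - h x) powr p \<le> 2 powr p * (norm (h x) powr p + norm (h x) powr p)"
    using norm_diff_powr_le[of p "hL n x" "h x"] p0 by linarith
  qed
  show "integrable ?M (\<lambda>x. 2 powr p * (norm (h x) powr p + norm (h x) powr p))"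
   by (intro integrable_mult_right B_integrable_add Lp_integrable h)
 qed (use hm hLm bmM in auto)
 moreover have "0 < e / (2 * 2 powr p)" using e by simp
 ultimately obtain n where n: "Lp_dist p ?M (hL n) h < e / (2 * 2 powr p)"
  using order_tendstoD(2) eventually_happens by (metis (no_types, lifting) trivial_limit_sequentially)
 define L where "L = real (Suc n)"
 have L: "0 < L" by (simp add: L_def)
 have "hL n measurable_on UNIV"
  using hLm[of n] by (simp add: measurable_on_iff_borel_measurable lebesgue_on_UNIV_eq)
 then obtain N G where G: "negligible N" "!!k. continuous_on UNIV (G k)" "!!x. x \<notin> N ==> (\<lambda>k. G k x) \<longlonglongrightarrow> hL n x"
  unfolding measurable_on_def by auto
 \<comment> \<open>A continuous cut-off, equal to 1 on \<open>ball 0 R\<close> and to 0 outside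
   \<open>ball 0 (R + 1)\<close>; multiplication by it leaves the limit unchanged.\<close>
 define theta where "theta x = max 0 (min 1 (R + 1 - norm x))" for x :: "real^'n"
 define g where "g k x = theta x *\<^sub>R clamp_norm L (G k x)" for k x
 have thetac: "continuous_on UNIV theta" unfolding theta_def by (intro continuous_intros)
 have theta01: "0 \<le> theta x" "theta x \<le> 1" for x by (auto simp: theta_def)
 have gc: "continuous_on UNIV (g k)" for k unfolding g_def
  by (intro continuous_on_scaleR thetac continuous_on_compose2[OF continuous_clamp_norm G(2)] L) auto
 have gm: "g k \<in> borel_measurable lebesgue" for k by (rule borel_measurable_lebesgue_continuous[OF gc])
 have gL: "norm (g k x) \<le> L" for k x
 proof -
  have "norm (g k x) = theta x * norm (clamp_norm L (G k x))" using theta01 by (simp add: g_def)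
  also have "\<dots> \<le> 1 * L" using theta01 L by (intro mult_mono clamp_norm_le) auto
  finally show ?thesis by simp
 qed
 have g0: "g k x = 0" if "x \<notin> ball 0 (R + 1)" for k x using that by (simp add: g_def theta_def)
 have hLL: "norm (hL n x) \<le> L" for x unfolding hL_def L_def by (rule clamp_norm_le) simp
 have hL0: "hL n x = 0" if "x \<notin> ball 0 R" for x using R[OF that] by (simp add: hL_def clamp_norm_def)
 have gLp: "g k \<in> Lp p ?M" for k
  by (rule Lp_wmeasure_bounded(1)[OF gm gL, of "ball 0 (R+1)"]) (use g0 in auto)
 have hLLp: "hL n \<in> Lp p ?M"
  by (rule Lp_wmeasure_bounded(1)[OF hLm hLL, of "ball 0 R"]) (use hL0 in auto)
 have "(\<lambda>k. Lp_dist p ?M (g k) (hL n)) \<longlonglongrightarrow> 0"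
 proof (rule Lp_dist_tendsto_dominated[OF p0, where H = "\<lambda>x. norm ((2 * L) *\<^sub>R (indicator (ball 0 (R + 1)) x :: real)) powr p"])
  have "AE x in lebesgue. x \<notin> N" using G(1) by (simp add: AE_not_in negligible_iff_null_sets)
  then have "AE x in lebesgue_on UNIV. x \<notin> N" by (subst lebesgue_on_UNIV_eq)
  then have "AE x in ?M. x \<notin> N" by (subst AE_wmeasure) auto
  then show "AE x in ?M. (\<lambda>k. g k x) \<longlonglongrightarrow> hL n x"
  proof eventually_elim
   case (elim x)
   have "isCont (clamp_norm L) (hL n x)"
    using continuous_clamp_norm[OF L, of "UNIV :: 'c set"] by (simp add: continuous_on_eq_continuous_at)
   from isCont_tendsto_compose[OF this G(3)[OF elim]]
   have "(\<lambda>k. clamp_norm L (G k x)) \<longlonglongrightarrow> clamp_norm L (hL n x)" .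
   then have "(\<lambda>k. g k x) \<longlonglongrightarrow> theta x *\<^sub>R hL n x"
    unfolding g_def clamp_norm_id[OF L hLL] by (intro tendsto_scaleR tendsto_const)
   moreover have "theta x *\<^sub>R hL n x = hL n x"
    using hL0[of x] by (cases "x \<in> ball 0 R") (auto simp: theta_def)
   ultimately show ?case by simp
  qed
  show "AE x in ?M. norm (g k x - hL n x) powr p \<le> norm ((2 * L) *\<^sub>R (indicator (ball 0 (R + 1)) x :: real)) powr p" for k
  proof (rule AE_I2)
   fix x
   have "norm (g k x - hL n x) \<le> norm ((2 * L) *\<^sub>R (indicator (ball 0 (R + 1)) x :: real))"
   proof (cases "x \<in> ball 0 (R + 1)")
    case True
    then show ?thesis using norm_triangle_ineq4[of "g k x" "hL n x"] gL[of k x] hLL[of x] L by simp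
   next
    case False
    then show ?thesis using g0[OF False] hL0[of x] by simp
   qed
   then show "norm (g k x - hL n x) powr p \<le> norm ((2 * L) *\<^sub>R (indicator (ball 0 (R + 1)) x :: real)) powr p"
    using p0 by (intro powr_mono2) auto
  qed
  have "(\<lambda>x::real^'n. (2 * L) *\<^sub>R (indicator (ball 0 (R + 1)) x :: real)) \<in> Lp p ?M"
  proof (rule Lp_wmeasure_bounded(1)[where L = "2 * L" and S = "ball 0 (R + 1)"])
   show "(\<lambda>x::real^'n. (2 * L) *\<^sub>R (indicator (ball 0 (R + 1)) x :: real)) \<in> borel_measurable lebesgue"
    by (intro borel_measurable_scaleR borel_measurable_const borel_measurable_indicator) simp
  qed (use L in \<open>auto simp: indicator_def\<close>)
  then show "integrable ?M (\<lambda>x. norm ((2 * L) *\<^sub>R (indicator (ball 0 (R + 1)) x :: real)) powr p)"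
   by (rule Lp_integrable)
 qed (use gm hLm bmM in auto)
 moreover have "0 < e / (2 * 2 powr p)" using e by simp
 ultimately obtain k where k: "Lp_dist p ?M (g k) (hL n) < e / (2 * 2 powr p)"
  using order_tendstoD(2) eventually_happens by (metis (no_types, lifting) trivial_limit_sequentially)
 have "Lp_dist p ?M (g k) h \<le> 2 powr p * (Lp_dist p ?M (g k) (hL n) + Lp_dist p ?M (hL n) h)"
  by (rule Lp_dist_triangle[OF p0 gLp hLLp h])
 also have "\<dots> < 2 powr p * (e / (2 * 2 powr p) + e / (2 * 2 powr p))"
  using n k by (intro mult_strict_left_mono) auto
 also have "\<dots> = e" by simp
 finally show thesis using that[OF gc _ gLp] g0 by blast
qed

text \<open>A density argument: convergence is known for continuous \<open>g\<close>, and the bound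
  uniform in \<open>n\<close> controls the mollification of \<open>h - g\<close>. The constant
  \<open>K\<close> gathers the factors \<open>2 powr p\<close> of two uses of the triangle
  inequality.\<close>

theorem mollify_tendsto:
 fixes h :: "real^'n => 'c::euclidean_space"
 assumes h: "h \<in> Lp p (wmeasure UNIV)" and S: "bounded S" "!!x. x \<notin> S ==> h x = 0"
 shows "mollify n h \<in> Lp p (wmeasure UNIV)" "(\<lambda>n. Lp_dist p (wmeasure UNIV) (mollify n h) h) \<longlonglongrightarrow> 0"
proof -
 let ?M = "wmeasure (UNIV :: (real^'n) set)"
 obtain C where C: "0 < C" "\<forall>(h :: real^'n => 'c::euclidean_space) S n. h \<in> Lp p ?M --> bounded S -->
  (\<forall>x. x \<notin> S --> h x = 0) --> mollify n h \<in> Lp p ?M \<and>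
  (LINT x|?M. norm (mollify n h x) powr p) \<le> C * (LINT x|?M. norm (h x) powr p)"
  by (rule mollify_Lp_bound)
 note C1 = C(2)[rule_format, THEN conjunct1] and C2 = C(2)[rule_format, THEN conjunct2]
 from bounded_subset_ballD[OF S(1), of 0] obtain R where R: "S \<subseteq> ball 0 R" by (elim exE conjE)
 have R0: "h x = 0" if "x \<notin> ball 0 R" for x using R S(2) that by blast
 show mh: "mollify n h \<in> Lp p ?M" for n by (rule C1[OF h S])
 show "(\<lambda>n. Lp_dist p ?M (mollify n h) h) \<longlonglongrightarrow> 0"
 proof (rule LIMSEQ_I)
  fix e :: real assume e: "0 < e"
  define K where "K = 2 powr p * (C + 2 powr p * (1 + 1))"
  have K: "0 < K" using C(1) by (simp add: K_def add_pos_pos)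
  define d where "d = e / (2 * K)"
  have d: "0 < d" using e K by (simp add: d_def)
  obtain g where g: "continuous_on UNIV g" "\<forall>x. x \<notin> ball 0 (R + 1) --> g x = 0" "g \<in> Lp p ?M" "Lp_dist p ?M g h < d"
   by (rule continuous_dense_Lp[OF h R0 d])
  have mg: "mollify n g \<in> Lp p ?M" for n by (rule C1[OF g(3), of "ball 0 (R + 1)"]) (use g(2) in auto)
  have "(\<lambda>n. Lp_dist p ?M (mollify n g) g) \<longlonglongrightarrow> 0"
   by (rule mollify_tendsto_continuous[OF g(1), of "R + 1"]) (use g(2) in auto)
  from order_tendstoD(2)[OF this d] obtain N where N: "!!n. N \<le> n ==> Lp_dist p ?M (mollify n g) g < d"
   unfolding eventually_at_top_linorder by blast
  have ih: "integrable lebesgue h" by (rule Lp_bounded_support_integrable[OF h S])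
  have ig: "integrable lebesgue g" by (rule Lp_bounded_support_integrable[OF g(3), of "ball 0 (R + 1)"]) (use g(2) in auto)
  have "Lp_dist p ?M (mollify n h) h < e" if n: "N \<le> n" for n
  proof -
   have "Lp_dist p ?M (mollify n h) (mollify n g) = (LINT x|?M. norm (mollify n (\<lambda>x. h x - g x) x) powr p)"
    by (simp add: mollify_diff[OF ih ig])
   also have "\<dots> \<le> C * Lp_dist p ?M h g"
    by (rule C2[OF Lp_diff[OF p0 h g(3)], of "ball 0 (R + 1)"]) (use g(2) R0 in auto)
   also have "\<dots> \<le> C * d" using g(4) C(1) by (subst Lp_dist_commute) (intro mult_left_mono; simp)
   finally have 1: "Lp_dist p ?M (mollify n h) (mollify n g) \<le> C * d" .
   have "Lp_dist p ?M (mollify n g) h \<le> 2 powr p * (Lp_dist p ?M (mollify n g) g + Lp_dist p ?M g h)"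
    by (rule Lp_dist_triangle[OF p0 mg g(3) h])
   also have "\<dots> \<le> 2 powr p * (d + d)" using N[OF n] g(4) by (intro mult_left_mono) auto
   finally have 2: "Lp_dist p ?M (mollify n g) h \<le> 2 powr p * (d + d)" .
   have "Lp_dist p ?M (mollify n h) h \<le> 2 powr p * (Lp_dist p ?M (mollify n h) (mollify n g) + Lp_dist p ?M (mollify n g) h)"
    by (rule Lp_dist_triangle[OF p0 mh mg h])
   also have "\<dots> \<le> 2 powr p * (C * d + 2 powr p * (d + d))" using 1 2 by (intro mult_left_mono) auto
   also have "\<dots> = K * d" by (simp add: K_def algebra_simps)
   also have "\<dots> = e / 2" using K by (simp add: d_def)
   also have "\<dots> < e" using e by simp
   finally show ?thesis .
  qed
  then show "\<exists>N. \<forall>n\<ge>N. norm (Lp_dist p ?M (mollify n h) h - 0) < e"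
   by (intro exI[of _ N]) (simp add: Lp_dist_nonneg)
 qed
qed

end

section \<open>Smoothness and gradients of mollified functions\<close>

lemma convolution_partial_deriv:
 fixes h :: "real^'n::finite => real"
 assumes h: "integrable lebesgue h" and K: "K \<in> bump_class a" and a: "0 < a"
  and G: "\<forall>i. G i \<in> bump_class a" "\<forall>x. (K has_derivative (\<lambda>z. z \<bullet> (\<chi> i. G i x))) (at x)"
 shows "convolution K h differentiable (at x)" "partial_deriv i (convolution K h) x = convolution (G i) h x"
proof -
 obtain L' where L': "!!x. \<bar>K x\<bar> \<le> L'" using bump_class_bounded[OF K a] by blast
 have "continuous_on UNIV (\<lambda>x. \<chi> i. G i x)"
  using G(1) by (intro continuous_on_vec_lambda bump_class_continuous[of _ a]) auto
 moreover have "\<forall>i. \<exists>L. \<forall>x. \<bar>G i x\<bar> \<le> L" using bump_class_bounded[OF _ a] G(1) by blast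
 then obtain L where L: "!!i x. \<bar>G i x\<bar> \<le> L i" by metis
 have L1: "norm (\<chi> i. G i x) \<le> (\<Sum>i\<in>UNIV. L i)" for x
  by (rule order.trans[OF norm_le_l1_cart]) (auto intro: sum_mono L)
 ultimately have D: "(convolution K h has_derivative (\<lambda>z. z \<bullet> (LINT y|lebesgue. h y *\<^sub>R (\<chi> i. G i (x - y))))) (at x)"
  using G(2) L' by (intro convolution_has_derivative[OF h]) auto
 show "convolution K h differentiable (at x)" using D by (rule differentiableI)
 have "integrable lebesgue (\<lambda>y. h y *\<^sub>R (\<chi> i. G i (x - y)))"
 proof (rule B_integrable_bound)
  show "integrable lebesgue (\<lambda>y. (\<Sum>i\<in>UNIV. L i) * norm (h y))" using h by auto
  have "(\<lambda>y. \<chi> i. G i (x - y)) \<in> borel_measurable lebesgue"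
  proof (rule borel_measurable_lebesgue_continuous, rule continuous_on_vec_lambda)
   fix i show "continuous_on UNIV (\<lambda>y. G i (x - y))"
    by (rule continuous_on_compose2[OF bump_class_continuous[of _ a UNIV]]) (use G(1) in \<open>auto intro!: continuous_intros\<close>)
  qed
  then show "(\<lambda>y. h y *\<^sub>R (\<chi> i. G i (x - y))) \<in> borel_measurable lebesgue"
   using h by (intro borel_measurable_scaleR) auto
  show "AE y in lebesgue. norm (h y *\<^sub>R (\<chi> i. G i (x - y))) \<le> norm ((\<Sum>i\<in>UNIV. L i) * norm (h y))"
  proof (rule AE_I2)
   fix y
   have "\<bar>h y\<bar> * norm (\<chi> i. G i (x - y)) \<le> \<bar>h y\<bar> * (\<Sum>i\<in>UNIV. L i)" by (intro mult_left_mono L1) auto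
   then show "norm (h y *\<^sub>R (\<chi> i. G i (x - y))) \<le> norm ((\<Sum>i\<in>UNIV. L i) * norm (h y))"
    by (simp add: mult.commute)
  qed
 qed
 from integral_bounded_linear[OF bounded_linear_vec_nth this, of i]
 show "partial_deriv i (convolution K h) x = convolution (G i) h x"
  by (simp add: grad_eq(2)[OF D] convolution_def mult.commute)
qed

text \<open>All derivatives fall on the kernel, and partial derivatives of the kernel stay in its
  class; the induction therefore runs over all kernels at once.\<close>

lemma Ck_convolution:
 fixes h :: "real^'n::finite => real"
 assumes h: "integrable lebesgue h" and a: "0 < a"
 shows "K \<in> bump_class a ==> Ck m (convolution K h)"
proof (induction m arbitrary: K)
 case 0
 obtain G where G: "\<forall>i. G i \<in> bump_class a" "\<forall>x. (K has_derivative (\<lambda>z. z \<bullet> (\<chi> i. G i x))) (at x)"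
  using bump_class_has_derivative[OF 0] by blast
 then have "convolution K h differentiable (at x)" for x using convolution_partial_deriv[OF h 0 a] by blast
 then show ?case by (simp add: continuous_at_imp_continuous_on differentiable_imp_continuous_within)
next
 case (Suc m)
 obtain G where G: "\<forall>i. G i \<in> bump_class a" "\<forall>x. (K has_derivative (\<lambda>z. z \<bullet> (\<chi> i. G i x))) (at x)"
  using bump_class_has_derivative[OF Suc.prems] by blast
 have "partial_deriv i (convolution K h) = convolution (G i) h" for i
  using convolution_partial_deriv(2)[OF h Suc.prems a G] by blast
 then show ?case using Suc.IH G(1) convolution_partial_deriv(1)[OF h Suc.prems a G] by simp
qed

lemma smooth_mollify:
 fixes h :: "real^'n::finite => real"
 assumes "integrable lebesgue h"
 shows "smooth (mollify n h)"
 unfolding smooth_def by (intro allI Ck_convolution[OF assms _ mollifier_mem]) simp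

lemma bump_class_reflect:
 fixes K :: "real^'n::finite => real"
 assumes "\<forall>x. (K has_derivative (\<lambda>z. z \<bullet> (\<chi> i. G i x))) (at x)"
 shows "((\<lambda>y. K (x - y)) has_derivative (\<lambda>z. z \<bullet> (\<chi> i. - G i (x - y)))) (at y)"
proof -
 have "((\<lambda>y. K (x - y)) has_derivative (\<lambda>z. (- z) \<bullet> (\<chi> i. G i (x - y)))) (at y)"
  by (rule has_derivative_compose[where f = "\<lambda>y. x - y" and g = K and f' = "\<lambda>z. - z"])
   (use assms in \<open>auto intro!: derivative_eq_intros\<close>)
 then show ?thesis by (simp add: inner_vec_def sum_negf)
qed

lemma Ck_bump_class_reflect:
 fixes K :: "real^'n::finite => real"
 shows "K \<in> bump_class a ==> Ck m (\<lambda>y. K (x - y))"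
proof (induction m arbitrary: K)
 case 0
 have "continuous_on UNIV (\<lambda>y. K (x - y))"
  by (rule continuous_on_compose2[OF bump_class_continuous[OF 0, of UNIV]]) (auto intro!: continuous_intros)
 then show ?case by simp
next
 case (Suc m)
 obtain G where G: "\<forall>i. G i \<in> bump_class a" "\<forall>x. (K has_derivative (\<lambda>z. z \<bullet> (\<chi> i. G i x))) (at x)"
  using bump_class_has_derivative[OF Suc.prems] by blast
 note D = bump_class_reflect[OF G(2)]
 have "partial_deriv i (\<lambda>y. K (x - y)) = (\<lambda>y. (\<lambda>z. (-1) * G i z) (x - y))" for i
  using grad_eq(2)[OF D] by auto
 moreover have "Ck m (\<lambda>y. (\<lambda>z. (-1) * G i z) (x - y))" for i
  by (rule Suc.IH[OF bump_class.scale]) (use G(1) in auto)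
 moreover have "(\<lambda>y. K (x - y)) differentiable (at y)" for y using D by (rule differentiableI)
 ultimately show ?case by simp
qed

lemma mollifier_reflect_Cc_inf:
 assumes "cball x (1 / real (Suc n)) \<subseteq> \<Omega>"
 shows "(\<lambda>y. mollifier n (x - y)) \<in> Cc_inf \<Omega>"
proof -
 have "{y. mollifier n (x - y) \<noteq> 0} \<subseteq> cball x (1 / real (Suc n))"
  using mollifier_eq_0[of n "x - _"] by (force simp: dist_norm)
 then have c: "closure {y. mollifier n (x - y) \<noteq> 0} \<subseteq> cball x (1 / real (Suc n))"
  by (rule closure_minimal) simp
 then have "compact (closure {y. mollifier n (x - y) \<noteq> 0})"
  by (meson bounded_cball bounded_subset closed_closure compact_eq_bounded_closed)
 then show ?thesis using c assms Ck_bump_class_reflect[OF mollifier_mem]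
  by (auto simp: Cc_inf_def smooth_def compactly_contained_def)
qed

text \<open>The reflected kernel is itself an admissible test function as long as its ball stays in
  \<open>K\<close>. The minus sign from the reflection cancels the one in the definition of the weak
  gradient. The cut-off by \<open>K\<close> turns local integrability into global integrability and
  is invisible at \<open>x\<close>.\<close>

lemma mollify_weak_grad:
 fixes v :: "real^'n::finite => real"
 assumes wg: "has_weak_grad \<Omega> v g" and sub: "cball x (1 / real (Suc n)) \<subseteq> K" and K: "K \<subseteq> \<Omega>" "K \<in> sets lebesgue" "\<Omega> \<in> sets lebesgue"
  and iv: "integrable lebesgue (\<lambda>y. indicator K y *\<^sub>R v y)" and ig: "integrable lebesgue (\<lambda>y. indicator K y *\<^sub>R g y)"
 shows "grad (mollify n (\<lambda>y. indicator K y *\<^sub>R v y)) x = mollify n (\<lambda>y. indicator K y *\<^sub>R g y) x"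
proof -
 obtain G where G: "\<forall>i. G i \<in> bump_class ((real (Suc n))\<^sup>2)" "\<forall>x. (mollifier n has_derivative (\<lambda>z. z \<bullet> (\<chi> i. G i x))) (at (x :: real^'n))"
  using bump_class_has_derivative[OF mollifier_mem] by blast
 define psi where "psi y = mollifier n (x - y)" for y
 have psi: "psi \<in> Cc_inf \<Omega>" unfolding psi_def using sub K by (intro mollifier_reflect_Cc_inf) auto
 have dpsi: "partial_deriv i psi y = - G i (x - y)" for i y
  using grad_eq(2)[OF bump_class_reflect[OF G(2)], of i x y] by (simp add: psi_def[abs_def])
 have sq: "norm z < 1 / real (Suc n)" if "(real (Suc n))\<^sup>2 * (z \<bullet> z) < 1" for z :: "real^'n"
 proof (rule ccontr)
  assume "\<not> ?thesis"
  then have "1 \<le> real (Suc n) * norm z" by (simp add: field_simps del: of_nat_Suc)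
  then have "1 \<le> (real (Suc n) * norm z)\<^sup>2" by (simp add: one_le_power del: of_nat_Suc)
  then show False using that by (simp only: power_mult_distrib power2_norm_eq_inner)
 qed
 have Gout: "G i (x - y) = 0" if "y \<notin> K" for i y
 proof -
  have "\<not> norm (x - y) < 1 / real (Suc n)" using that sub by (auto simp: dist_norm subset_eq simp del: of_nat_Suc)
  then show ?thesis using bump_class_eq_0[OF G(1)[rule_format, of i], of "x - y"] sq[of "x - y"] by linarith
 qed
 have psiout: "psi y = 0" if "y \<notin> K" for y
 proof -
  have "1 / real (Suc n) \<le> norm (x - y)" using that sub by (auto simp: dist_norm subset_eq simp del: of_nat_Suc)
  then show ?thesis unfolding psi_def by (rule mollifier_eq_0)
 qed
 have "grad (mollify n (\<lambda>y. indicator K y *\<^sub>R v y)) x $ i = mollify n (\<lambda>y. indicator K y *\<^sub>R g y) x $ i" for i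
 proof -
  have "grad (mollify n (\<lambda>y. indicator K y *\<^sub>R v y)) x $ i = convolution (G i) (\<lambda>y. indicator K y *\<^sub>R v y) x"
   unfolding grad_nth by (rule convolution_partial_deriv(2)[OF iv mollifier_mem _ G]) simp
  also have "\<dots> = (LINT y|lebesgue. indicator \<Omega> y *\<^sub>R (- (v y * partial_deriv i psi y)))"
   unfolding convolution_def dpsi
   by (rule B_integral_cong) (use Gout K(1) in \<open>auto simp: indicator_def\<close>)
  also have "\<dots> = (LINT y|lebesgue_on \<Omega>. - (v y * partial_deriv i psi y))"
   using K(3) by (intro integral_restrict_space[symmetric]) auto
  also have "\<dots> = (LINT y|lebesgue_on \<Omega>. g y $ i * psi y)"
   using wg psi unfolding has_weak_grad_def by simp
  also have "\<dots> = (LINT y|lebesgue. indicator \<Omega> y *\<^sub>R (g y $ i * psi y))"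
   using K(3) by (intro integral_restrict_space) auto
  also have "\<dots> = (LINT y|lebesgue. (mollifier n (x - y) *\<^sub>R (indicator K y *\<^sub>R g y)) $ i)"
   by (rule B_integral_cong) (use psiout K(1) in \<open>auto simp: indicator_def psi_def[symmetric]\<close>)
  also have "\<dots> = mollify n (\<lambda>y. indicator K y *\<^sub>R g y) x $ i"
   unfolding convolution_def by (rule integral_bounded_linear[OF bounded_linear_vec_nth mollify_integrable[OF ig]])
  finally show ?thesis .
 qed
 then show ?thesis by (simp add: vec_eq_iff)
qed

text \<open>Makes the weighted mollification theorem available in the unweighted \<open>L^2\<close>
  space.\<close>

lemma Ap_weight_one: "Ap_weight 2 (\<lambda>_ :: 'a::euclidean_space. 1)"
proof -
 have i: "integrable (lebesgue_on S) (\<lambda>_. 1::real)" if "S \<in> lmeasurable" for S :: "'a set"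
  using that by (simp add: lmeasurable_iff_integrable integrable_lebesgue_on_iff fmeasurableD)
 have "(LINT x|lebesgue_on (ball a r). 1) = measure lebesgue (ball (a::'a) r)" for a r
  by (subst integral_restrict_space) auto
 then show ?thesis
  using i by (auto simp: Ap_weight_def locally_integrable_def content_ball_pos lmeasurable_compact less_imp_neq[symmetric] intro!: exI[of _ 1])
qed

lemma compact_neighbourhood:
 fixes K :: "'a::euclidean_space set"
 assumes "compact K" "open \<Omega>" "K \<subseteq> \<Omega>"
 obtains d where "0 < d" "(\<Union>x\<in>K. cball x d) \<subseteq> \<Omega>" "compact (\<Union>x\<in>K. cball x d)"
proof -
 obtain d where d: "0 < d" "(\<Union>x\<in>K. cball x d) \<subseteq> \<Omega>"
  using compact_subset_open_imp_cball_epsilon_subset[OF assms] by blast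
 have "(\<Union>x\<in>K. cball x d) = {x + y | x y. x \<in> K \<and> y \<in> cball 0 d}"
 proof safe
  fix z x assume "z \<in> cball x d" "x \<in> K"
  then show "\<exists>x y. z = x + y \<and> x \<in> K \<and> y \<in> cball 0 d"
   by (intro exI[of _ x] exI[of _ "z - x"]) (auto simp: dist_norm norm_minus_commute)
 next
  fix x y :: 'a assume "x \<in> K" "y \<in> cball 0 d"
  then show "x + y \<in> (\<Union>x\<in>K. cball x d)" by (intro UN_I[of x]) (auto simp: dist_norm)
 qed
 then have "compact (\<Union>x\<in>K. cball x d)" using compact_sums[OF assms(1) compact_cball, of 0 d] by (simp only:)
 then show thesis using that d by blast
qed

lemma mollify_Cc_inf:
 fixes h :: "real^'n::finite => real"
 assumes h: "integrable lebesgue h" and K: "!!x. x \<notin> K ==> h x = 0"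
  and d: "(\<Union>x\<in>K. cball x d) \<subseteq> \<Omega>" "compact (\<Union>x\<in>K. cball x d)" and n: "1 / real (Suc n) \<le> d"
 shows "mollify n h \<in> Cc_inf \<Omega>" "!!x. x \<notin> (\<Union>x\<in>K. cball x d) ==> mollify n h x = 0"
proof -
 show z: "mollify n h x = 0" if "x \<notin> (\<Union>x\<in>K. cball x d)" for x
 proof (rule mollify_eq_0)
  fix y assume "dist x y < 1 / real (Suc n)"
  then have "dist y x \<le> d" using n by (simp add: dist_commute del: of_nat_Suc)
  then show "h y = 0" using that K[of y] by auto
 qed
 then have "{x. mollify n h x \<noteq> 0} \<subseteq> (\<Union>x\<in>K. cball x d)" by blast
 then have "closure {x. mollify n h x \<noteq> 0} \<subseteq> (\<Union>x\<in>K. cball x d)"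
  using d(2) by (intro closure_minimal compact_imp_closed)
 then show "mollify n h \<in> Cc_inf \<Omega>"
  using smooth_mollify[OF h] d compact_closure compact_imp_bounded bounded_subset[of "\<Union>x\<in>K. cball x d"]
  by (auto simp: Cc_inf_def compactly_contained_def compact_eq_bounded_closed intro: bounded_subset[OF _ closure_subset])
qed

section \<open>Weak gradients\<close>

lemma open_exhaustion:
 fixes S :: "'a::euclidean_space set"
 assumes "open S"
 shows "\<exists>C :: nat => 'a set. (\<forall>n. compact (C n)) \<and> (\<forall>n. C n \<subseteq> S) \<and> (\<forall>n. C n \<subseteq> interior (C (Suc n)))
  \<and> (\<Union>n. C n) = S \<and> (\<forall>K. compact K --> K \<subseteq> S --> (\<exists>N. \<forall>n\<ge>N. K \<subseteq> C n))"
 by (rule open_Union_compact_subsets[OF assms]) blast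

text \<open>Test with mollifications of the sign function of \<open>h\<close>, restricted to a compact set; they
 converge in the unweighted \<open>L^2\<close>.\<close>

lemma fundamental_lemma:
 fixes h :: "real^'n::finite => real"
 assumes op: "open \<Omega>" and h: "locally_integrable \<Omega> h"
  and z: "!!psi. psi \<in> Cc_inf \<Omega> ==> (LINT x|lebesgue_on \<Omega>. h x * psi x) = 0"
 shows "AE x in lebesgue_on \<Omega>. h x = 0"
proof -
 interpret one: muckenhoupt_vec 2 "\<lambda>_ :: real^'n. 1"
  by unfold_locales (simp_all add: Ap_weight_one)
 let ?M = "one.wmeasure (UNIV :: (real^'n) set)"
 have Om: "\<Omega> \<in> sets lebesgue" using op by simp
 have comp: "AE x in lebesgue. x \<in> K --> h x = 0" if K: "compact K" "K \<subseteq> \<Omega>" for K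
 proof -
  obtain d where d: "0 < d" "(\<Union>x\<in>K. cball x d) \<subseteq> \<Omega>" "compact (\<Union>x\<in>K. cball x d)"
   by (rule compact_neighbourhood[OF K(1) op K(2)])
  \<comment> \<open>The mollified signs with small radius are supported in this neighbourhood of
    \<open>K\<close>, so \<open>h\<close> may be replaced by its restriction to it, which is
    globally integrable.\<close>
  define K' where "K' = (\<Union>x\<in>K. cball x d)"
  have KK': "K \<subseteq> K'" using d(1) by (force simp: K'_def)
  have K'm: "K' \<in> sets lebesgue" "K \<in> sets lebesgue" using d(3) K(1) by (auto simp: K'_def compact_imp_closed)
  define hK where "hK x = indicator K' x * h x" for x
  have ihK: "integrable lebesgue hK"
   using h[unfolded locally_integrable_def, rule_format, of K'] d(2,3)[folded K'_def] K'm
   by (simp add: hK_def[abs_def] integrable_lebesgue_on_iff)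
  then have hKm[measurable]: "hK \<in> borel_measurable lebesgue" by auto
  define s where "s x = indicator K x * sgn (hK x)" for x
  have sm: "s \<in> borel_measurable lebesgue" unfolding s_def[abs_def] using K'm(2) by measurable
  have s1: "norm (s x) \<le> 1" for x by (auto simp: s_def indicator_def abs_sgn_eq)
  have s0: "s x = 0" if "x \<notin> K" for x using that by (simp add: s_def)
  have sL: "s \<in> Lp 2 ?M"
   by (rule one.Lp_wmeasure_bounded(1)[OF sm s1 _ K'm(2)]) (use K(1) s0 compact_imp_bounded in auto)
  have Kb: "bounded K" using K(1) by (rule compact_imp_bounded)
  have si: "integrable lebesgue s" by (rule one.Lp_bounded_support_integrable[OF sL Kb s0])
  have lim: "(\<lambda>n. Lp_dist 2 ?M (mollify n s) s) \<longlonglongrightarrow> 0"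
   by (rule one.mollify_tendsto(2)[OF sL Kb s0])
  have mL: "mollify n s \<in> Lp 2 ?M" for n by (rule one.mollify_tendsto(1)[OF sL Kb s0])
  obtain r H where r: "strict_mono (r :: nat => nat)" "AE x in ?M. (\<lambda>n. mollify (r n) s x) \<longlonglongrightarrow> s x"
   by (rule Lp_subseq_dominated[OF _ mL sL lim]) auto
  have AEc: "AE x in lebesgue. (\<lambda>n. mollify (r n) s x) \<longlonglongrightarrow> s x"
  proof -
   have "AE x in lebesgue_on (UNIV :: (real^'n) set). (\<lambda>n. mollify (r n) s x) \<longlonglongrightarrow> s x"
    using r(2) by (subst (asm) one.AE_wmeasure) auto
   then show ?thesis by (subst (asm) lebesgue_on_UNIV_eq)
  qed
  obtain N :: nat where N: "1 / d < real N" using reals_Archimedean2 by blast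
  have nd: "1 / real (Suc n) \<le> d" if "N \<le> n" for n
  proof -
   have "1 / d < real (Suc n)" using N that by simp
   then show ?thesis using d(1) by (simp add: field_simps del: of_nat_Suc)
  qed
  have zero: "(LINT x|lebesgue. hK x * mollify n s x) = 0" if n: "N \<le> n" for n
  proof -
   note m = mollify_Cc_inf[OF si s0 d(2,3) nd[OF n]]
   have "indicator \<Omega> x *\<^sub>R (h x * mollify n s x) = hK x * mollify n s x" for x
    using m(2)[of x] d(2) unfolding K'_def[symmetric] by (auto simp: hK_def indicator_def)
   then have "(LINT x|lebesgue. hK x * mollify n s x) = (LINT x|lebesgue. indicator \<Omega> x *\<^sub>R (h x * mollify n s x))"
    by (simp only:)
   also have "\<dots> = (LINT x|lebesgue_on \<Omega>. h x * mollify n s x)"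
    using Om by (intro integral_restrict_space[symmetric]) auto
   also have "\<dots> = 0" by (rule z[OF m(1)])
   finally show ?thesis .
  qed
  have "(\<lambda>n. LINT x|lebesgue. hK x * mollify (r n) s x) \<longlonglongrightarrow> (LINT x|lebesgue. hK x * s x)"
  proof (rule integral_dominated_convergence[where w = "\<lambda>x. norm (hK x)"])
   show "(\<lambda>x. hK x * s x) \<in> borel_measurable lebesgue" using sm by measurable
   show "(\<lambda>x. hK x * mollify (r n) s x) \<in> borel_measurable lebesgue" for n
    using convolution_measurable[OF sm mollifier_continuous, of "r n"] by measurable
   show "AE x in lebesgue. (\<lambda>n. hK x * mollify (r n) s x) \<longlonglongrightarrow> hK x * s x"
    using AEc by eventually_elim (rule tendsto_mult_left)
   show "AE x in lebesgue. norm (hK x * mollify (r n) s x) \<le> norm (hK x)" for n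
   proof (rule AE_I2)
    fix x
    have "norm (mollify (r n) s x - 0) \<le> 1" by (rule mollify_close[OF si]) (use s1 in auto)
    then show "norm (hK x * mollify (r n) s x) \<le> norm (hK x)"
     by (simp add: abs_mult mult_left_le)
   qed
  qed (use ihK in auto)
  moreover have "\<forall>\<^sub>F n in sequentially. (LINT x|lebesgue. hK x * mollify (r n) s x) = 0"
   using eventually_ge_at_top[of N]
   by eventually_elim (rule zero[OF order_trans[OF _ seq_suble[OF r(1)]]])
  ultimately have "(LINT x|lebesgue. hK x * s x) = 0"
   by (rule LIMSEQ_unique[OF _ tendsto_eventually])
  moreover have "(\<lambda>x. hK x * s x) = (\<lambda>x. indicator K x * \<bar>hK x\<bar>)"
   by (rule ext) (simp add: s_def abs_sgn mult_ac)
  ultimately have 0: "(LINT x|lebesgue. indicator K x * \<bar>hK x\<bar>) = 0" by (simp only:)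
  have "integrable lebesgue (\<lambda>x. indicator K x * \<bar>hK x\<bar>)"
   using integrable_mult_indicator[OF K'm(2) integrable_abs[OF ihK]] by simp
  then have "AE x in lebesgue. indicator K x * \<bar>hK x\<bar> = 0"
   by (rule integral_nonneg_eq_0_iff_AE[THEN iffD1, OF _ _ 0]) (simp add: AE_I2)
  then show ?thesis by eventually_elim (use KK' in \<open>auto simp: hK_def indicator_def split: if_splits\<close>)
 qed
 obtain F :: "nat => (real^'n) set" where F: "\<forall>n. compact (F n)" "\<forall>n. F n \<subseteq> \<Omega>" "(\<Union>n. F n) = \<Omega>"
  using open_exhaustion[OF op] by (elim exE conjE)
 have "AE x in lebesgue. \<forall>n. x \<in> F n --> h x = 0"
  by (subst AE_all_countable) (use comp F in blast)
 then have "AE x in lebesgue. x \<in> \<Omega> --> h x = 0"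
  by eventually_elim (use F(3) in blast)
 then show ?thesis using Om by (subst AE_restrict_space_iff) auto
qed

lemma integrable_mult_bounded:
 fixes f :: "'a => 'b::{banach,second_countable_topology}" and g :: "'a => real"
 assumes "integrable M f" "g \<in> borel_measurable M" "AE x in M. \<bar>g x\<bar> \<le> L"
 shows "integrable M (\<lambda>x. g x *\<^sub>R f x)"
proof (rule B_integrable_bound)
 show "integrable M (\<lambda>x. L * norm (f x))" using assms(1) by auto
 show "AE x in M. norm (g x *\<^sub>R f x) \<le> norm (L * norm (f x))"
  using assms(3)
 proof eventually_elim
  case (elim x)
  have "norm (g x *\<^sub>R f x) \<le> L * norm (f x)" using elim by (simp add: mult_right_mono)
  then show ?case using abs_ge_self[of "L * norm (f x)"] by (simp only: real_norm_def)
 qed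
qed (use assms in auto)

lemma Cc_inf_imp_Cc1: "phi \<in> Cc_inf \<Omega> ==> phi \<in> Cc1 \<Omega>"
 unfolding Cc_inf_def Cc1_def smooth_def by blast

lemma Cc1_D:
 assumes "phi \<in> Cc1 \<Omega>"
 shows "phi differentiable (at x)" "continuous_on S (partial_deriv i phi)" "continuous_on S (grad phi)" "continuous_on S phi"
  "compact (closure {x. phi x \<noteq> 0})" "closure {x. phi x \<noteq> 0} \<subseteq> \<Omega>"
  "x \<notin> closure {x. phi x \<noteq> 0} ==> phi x = 0" "x \<notin> closure {x. phi x \<noteq> 0} ==> grad phi x = 0"
proof -
 have "Ck 1 phi" and cc: "{x. phi x \<noteq> 0} \<Subset> \<Omega>" using assms by (auto simp: Cc1_def)
 then have D: "!!x. phi differentiable (at x)" and C: "!!i. continuous_on UNIV (partial_deriv i phi)" by auto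
 show "phi differentiable (at x)" by (rule D)
 show "continuous_on S (partial_deriv i phi)" using C continuous_on_subset by blast
 show "continuous_on S (grad phi)" unfolding grad_def
  by (intro continuous_on_vec_lambda continuous_on_subset[OF C]) auto
 show "continuous_on S phi" using D by (simp add: continuous_at_imp_continuous_on differentiable_imp_continuous_within)
 show "compact (closure {x. phi x \<noteq> 0})" "closure {x. phi x \<noteq> 0} \<subseteq> \<Omega>" using cc by (auto simp: compactly_contained_def)
 show "phi x = 0" if "x \<notin> closure {x. phi x \<noteq> 0}"
  using that closure_subset[of "{x. phi x \<noteq> 0}"] by auto
 show "grad phi x = 0" if x: "x \<notin> closure {x. phi x \<noteq> 0}"
 proof (rule grad_eq(1))
  have "((\<lambda>_. 0) has_derivative (\<lambda>z. 0)) (at x)" by (rule has_derivative_const)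
  then have "(phi has_derivative (\<lambda>z. 0)) (at x)"
  proof (rule has_derivative_transform_within_open)
   show "open (- closure {x. phi x \<noteq> 0})" by (rule open_Compl[OF closed_closure])
   show "x \<in> - closure {x. phi x \<noteq> 0}" using x by simp
   show "0 = phi y" if "y \<in> - closure {x. phi x \<noteq> 0}" for y
    using that closure_subset[of "{x. phi x \<noteq> 0}"] by auto
  qed
  then show "(phi has_derivative (\<lambda>z. z \<bullet> 0)) (at x)" by simp
 qed
qed

lemma continuous_compact_support_bounded:
 fixes f :: "'a::euclidean_space => 'b::euclidean_space"
 assumes "continuous_on UNIV f" "compact S" "!!x. x \<notin> S ==> f x = 0"
 shows "\<exists>L\<ge>0. \<forall>x. norm (f x) \<le> L"
proof -
 have "bounded (f ` S)" by (intro compact_imp_bounded compact_continuous_image continuous_on_subset[OF assms(1)] assms(2)) auto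
 then obtain L where L: "!!x. x \<in> S ==> norm (f x) \<le> L" unfolding bounded_iff by blast
 have "norm (f x) \<le> max L 0" for x using L[of x] assms(3)[of x] by (cases "x \<in> S") auto
 then show ?thesis by (intro exI[of _ "max L 0"]) auto
qed

lemma continuous_compact_support_integrable:
 fixes f :: "'a::euclidean_space => 'b::euclidean_space"
 assumes "continuous_on UNIV f" "compact S" "!!x. x \<notin> S ==> f x = 0"
 shows "integrable lebesgue f"
proof -
 obtain L where L: "0 \<le> L" "!!x. norm (f x) \<le> L" using continuous_compact_support_bounded[OF assms] by blast
 have S: "S \<in> lmeasurable" by (rule lmeasurable_compact[OF assms(2)])
 show ?thesis
 proof (rule B_integrable_bound)
  show "integrable lebesgue (\<lambda>x. L * indicator S x)"
   using S by (intro integrable_mult_right integrable_real_indicator) (auto simp: fmeasurable_def)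
  show "AE x in lebesgue. norm (f x) \<le> norm (L * indicator S x)"
   using L assms(3) by (intro AE_I2) (auto simp: indicator_def)
 qed (rule borel_measurable_lebesgue_continuous[OF assms(1)])
qed

text \<open>The integral of a difference quotient vanishes by translation invariance.\<close>

lemma integral_partial_deriv_eq_0:
 fixes F :: "real^'n::finite => real"
 assumes "F \<in> Cc1 UNIV"
 shows "(LINT x|lebesgue. partial_deriv i F x) = 0"
proof -
 note F = Cc1_D[OF assms]
 define S where "S = closure {x. F x \<noteq> 0}"
 from bounded_subset_ballD[OF compact_imp_bounded[OF F(5)], of 0] obtain R where R: "S \<subseteq> ball 0 R"
  unfolding S_def by (elim exE conjE)
 have F0: "F x = 0" if "R \<le> norm x" for x using F(7)[of x] R that unfolding S_def by force
 obtain L where L: "0 \<le> L" "!!x. norm (grad F x) \<le> L"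
  using continuous_compact_support_bounded[OF F(3,5,8)] by blast
 define t where "t n = 1 / real (Suc n)" for n
 have t: "0 < t n" "t n \<le> 1" for n by (auto simp: t_def)
 have t0: "t \<longlonglongrightarrow> 0" unfolding t_def by (rule lim_inverse_Suc)
 let ?e = "axis i 1 :: real^'n"
 define q where "q n x = (F (t n *\<^sub>R ?e + x) - F x) / t n" for n x
 have iF: "integrable lebesgue F" by (rule continuous_compact_support_integrable[OF F(4,5,7)])
 have Fc: "continuous_on UNIV (\<lambda>x. F (c + x))" for c
  by (rule continuous_on_compose2[OF F(4)[of UNIV]]) (auto intro!: continuous_intros)
 have iFc: "integrable lebesgue (\<lambda>x. F (t n *\<^sub>R ?e + x))" for n
 proof (rule continuous_compact_support_integrable[OF Fc, of "cball 0 (R + 1)"])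
  fix x :: "real^'n" assume "x \<notin> cball 0 (R + 1)"
  then have "R + 1 < norm x" by simp
  also have "norm x \<le> norm (t n *\<^sub>R ?e + x) + norm (t n *\<^sub>R ?e)" using norm_triangle_ineq4[of "t n *\<^sub>R ?e + x" "t n *\<^sub>R ?e"] by simp
  also have "norm (t n *\<^sub>R ?e) \<le> 1" using t[of n] by simp
  finally show "F (t n *\<^sub>R ?e + x) = 0" by (intro F0) simp
 qed auto
 have q0: "(LINT x|lebesgue. q n x) = 0" for n
  using iF iFc integral_lebesgue_translate[OF F(4), of "t n *\<^sub>R ?e"] by (simp add: q_def)
 have lip: "\<bar>F (z + u) - F z\<bar> \<le> L * norm u" for z u
 proof -
  have "onorm (\<lambda>z. z \<bullet> grad F x) \<le> L" for x
  proof (rule onorm_le)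
   fix z show "norm (z \<bullet> grad F x) \<le> L * norm z"
    using Cauchy_Schwarz_ineq2[of z "grad F x"] mult_left_mono[OF L(2)[of x], of "norm z"]
    by (simp add: mult.commute)
  qed
  then show ?thesis
   using differentiable_bound[of UNIV F "\<lambda>x z. z \<bullet> grad F x" L "z + u" z] has_derivative_grad[OF F(1)] by simp
 qed
 have "(\<lambda>n. LINT x|lebesgue. q n x) \<longlonglongrightarrow> (LINT x|lebesgue. partial_deriv i F x)"
 proof (rule integral_dominated_convergence[where w = "\<lambda>x. L * indicator (cball 0 (R + 1)) x"])
  show "partial_deriv i F \<in> borel_measurable lebesgue" by (rule borel_measurable_lebesgue_continuous[OF F(2)])
  show "q n \<in> borel_measurable lebesgue" for n
   unfolding q_def[abs_def] using iF iFc by (intro borel_measurable_divide borel_measurable_diff) auto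
  show "integrable lebesgue (\<lambda>x. L * indicator (cball (0::real^'n) (R + 1)) x)"
   by (intro integrable_mult_right integrable_real_indicator) (auto simp: emeasure_bounded_finite[unfolded infinity_ennreal_def])
  show "AE x in lebesgue. norm (q n x) \<le> L * indicator (cball 0 (R + 1)) x" for n
  proof (rule AE_I2)
   fix x
   show "norm (q n x) \<le> L * indicator (cball 0 (R + 1)) x"
   proof (cases "x \<in> cball 0 (R + 1)")
    case True
    have "\<bar>F (t n *\<^sub>R ?e + x) - F x\<bar> \<le> L * t n" using lip[of x "t n *\<^sub>R ?e"] t[of n] by (simp add: add.commute)
    then show ?thesis using True t[of n] by (simp add: q_def divide_le_eq)
   next
    case False
    then have x: "R + 1 < norm x" by simp
    also have "norm x \<le> norm (t n *\<^sub>R ?e + x) + norm (t n *\<^sub>R ?e)" using norm_triangle_ineq4[of "t n *\<^sub>R ?e + x" "t n *\<^sub>R ?e"] by simp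
    also have "norm (t n *\<^sub>R ?e) \<le> 1" using t[of n] by simp
    finally have "F (t n *\<^sub>R ?e + x) = 0" by (intro F0) simp
    moreover have "F x = 0" using x by (intro F0) simp
    ultimately show ?thesis using False by (simp add: q_def)
   qed
  qed
  show "AE x in lebesgue. (\<lambda>n. q n x) \<longlonglongrightarrow> partial_deriv i F x"
  proof (rule AE_I2)
   fix x
   have "((\<lambda>s. F (x + s *\<^sub>R ?e)) has_derivative (\<lambda>s. (s *\<^sub>R ?e) \<bullet> grad F x)) (at 0)"
    by (rule has_derivative_compose[where f = "\<lambda>s. x + s *\<^sub>R ?e" and g = F])
     (use has_derivative_grad[OF F(1)[of x]] in \<open>auto intro!: derivative_eq_intros\<close>)
   then have "((\<lambda>s. F (x + s *\<^sub>R ?e)) has_real_derivative (partial_deriv i F x)) (at 0)"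
   proof -
    have "(\<lambda>s. (s *\<^sub>R ?e) \<bullet> grad F x) = (*) (partial_deriv i F x)"
     by (rule ext) (simp add: inner_axis' grad_nth)
    then show ?thesis using \<open>((\<lambda>s. F (x + s *\<^sub>R ?e)) has_derivative (\<lambda>s. (s *\<^sub>R ?e) \<bullet> grad F x)) (at 0)\<close>
     unfolding has_field_derivative_def by (simp only:)
   qed
   then have "((\<lambda>s. (F (x + s *\<^sub>R ?e) - F x) / s) \<longlongrightarrow> partial_deriv i F x) (at 0)"
    by (simp add: DERIV_def)
   then have "((\<lambda>s. (F (x + s *\<^sub>R ?e) - F x) / s) \<circ> t) \<longlonglongrightarrow> partial_deriv i F x"
   proof (rule tendsto_at_iff_sequentially[THEN iffD1, rule_format])
    show "t k \<in> UNIV - {0}" for k using t(1)[of k] by simp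
   qed (rule t0)
   then show "(\<lambda>n. q n x) \<longlonglongrightarrow> partial_deriv i F x" by (simp add: q_def[abs_def] o_def add.commute)
  qed
 qed
 then show ?thesis by (simp add: q0 LIMSEQ_const_iff)
qed

lemma locally_integrable_mult_Cc1:
 fixes f :: "real^'n::finite => 'b::{banach,second_countable_topology}"
 assumes f: "locally_integrable \<Omega> f" and Om: "\<Omega> \<in> sets lebesgue"
  and b: "continuous_on UNIV b" "compact S" "S \<subseteq> \<Omega>" "!!x. x \<notin> S ==> b x = (0::real)"
 shows "integrable (lebesgue_on \<Omega>) (\<lambda>x. b x *\<^sub>R f x)"
proof -
 have S: "S \<in> sets lebesgue" using b(2) by (simp add: compact_imp_closed)
 obtain L where L: "0 \<le> L" "!!x. norm (b x) \<le> L"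
  using continuous_compact_support_bounded[OF b(1,2,4)] by blast
 have "integrable lebesgue (\<lambda>x. indicator S x *\<^sub>R f x)"
  using f[unfolded locally_integrable_def, rule_format, of S] b S by (simp add: integrable_lebesgue_on_iff)
 then have "integrable lebesgue (\<lambda>x. b x *\<^sub>R (indicator S x *\<^sub>R f x))"
  by (rule integrable_mult_bounded) (use L borel_measurable_lebesgue_continuous[OF b(1)] in auto)
 also have "(\<lambda>x. b x *\<^sub>R (indicator S x *\<^sub>R f x)) = (\<lambda>x. indicator \<Omega> x *\<^sub>R (b x *\<^sub>R f x))"
  by (rule ext) (use b(3,4) in \<open>auto simp: indicator_def\<close>)
 finally show ?thesis using Om by (simp add: integrable_lebesgue_on_iff)
qed

lemma locally_integrable_test:
 fixes f :: "real^'n::finite => 'b::{banach,second_countable_topology}"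
 assumes "locally_integrable \<Omega> f" "\<Omega> \<in> sets lebesgue" "psi \<in> Cc1 \<Omega>"
 shows "integrable (lebesgue_on \<Omega>) (\<lambda>x. psi x *\<^sub>R f x)"
  "integrable (lebesgue_on \<Omega>) (\<lambda>x. partial_deriv i psi x *\<^sub>R f x)"
proof -
 note c = Cc1_D[OF assms(3)]
 show "integrable (lebesgue_on \<Omega>) (\<lambda>x. psi x *\<^sub>R f x)"
  by (rule locally_integrable_mult_Cc1[OF assms(1,2) c(4,5,6,7)])
 have "partial_deriv i psi x = 0" if "x \<notin> closure {x. psi x \<noteq> 0}" for x
  using c(8)[OF that] by (simp add: grad_nth[symmetric])
 then show "integrable (lebesgue_on \<Omega>) (\<lambda>x. partial_deriv i psi x *\<^sub>R f x)"
  by (rule locally_integrable_mult_Cc1[OF assms(1,2) c(2,5,6)])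
qed

lemma Cc1_outside:
 assumes "phi \<in> Cc1 \<Omega>" "x \<notin> \<Omega>"
 shows "phi x = 0" "grad phi x = 0" "partial_deriv i phi x = 0"
proof -
 have "x \<notin> closure {x. phi x \<noteq> 0}" using Cc1_D(6)[OF assms(1)] assms(2) by blast
 then show "phi x = 0" "grad phi x = 0" using Cc1_D(7,8)[OF assms(1)] by blast+
 then show "partial_deriv i phi x = 0" unfolding grad_nth[symmetric] by simp
qed

lemma locally_integrable_nth:
 assumes "locally_integrable \<Omega> (g :: real^'n::finite => real^'m::finite)"
 shows "locally_integrable \<Omega> (\<lambda>x. g x $ i)"
 using assms integrable_bounded_linear[OF bounded_linear_vec_nth] unfolding locally_integrable_def by blast

lemma locally_integrable_diff:
 fixes f g :: "'a::euclidean_space => 'b::{banach,second_countable_topology}"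
 assumes "locally_integrable \<Omega> f" "locally_integrable \<Omega> g"
 shows "locally_integrable \<Omega> (\<lambda>x. f x - g x)"
 using assms unfolding locally_integrable_def by auto

lemma has_weak_grad_unique:
 assumes op: "open \<Omega>" and g: "has_weak_grad \<Omega> u g" "has_weak_grad \<Omega> u g'"
 shows "AE x in lebesgue_on \<Omega>. g x = g' x"
proof -
 have Om: "\<Omega> \<in> sets lebesgue" using op by simp
 have "AE x in lebesgue_on \<Omega>. g x $ i - g' x $ i = 0" for i
 proof (rule fundamental_lemma[OF op])
  have l: "locally_integrable \<Omega> (\<lambda>x. g x $ i)" "locally_integrable \<Omega> (\<lambda>x. g' x $ i)"
   using g by (auto simp: has_weak_grad_def intro: locally_integrable_nth)
  then show "locally_integrable \<Omega> (\<lambda>x. g x $ i - g' x $ i)" by (rule locally_integrable_diff)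
  fix psi assume psi: "psi \<in> Cc_inf \<Omega>"
  have "(LINT x|lebesgue_on \<Omega>. psi x *\<^sub>R (g x $ i) - psi x *\<^sub>R (g' x $ i))
    = (LINT x|lebesgue_on \<Omega>. psi x *\<^sub>R (g x $ i)) - (LINT x|lebesgue_on \<Omega>. psi x *\<^sub>R (g' x $ i))"
   by (rule B_integral_diff[OF locally_integrable_test(1)[OF l(1) Om Cc_inf_imp_Cc1[OF psi]]
      locally_integrable_test(1)[OF l(2) Om Cc_inf_imp_Cc1[OF psi]]])
  also have "\<dots> = 0"
  proof -
   have "(LINT x|lebesgue_on \<Omega>. u x * partial_deriv i psi x) = - (LINT x|lebesgue_on \<Omega>. g x $ i * psi x)"
    "(LINT x|lebesgue_on \<Omega>. u x * partial_deriv i psi x) = - (LINT x|lebesgue_on \<Omega>. g' x $ i * psi x)"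
    using g psi unfolding has_weak_grad_def by blast+
   then have "(LINT x|lebesgue_on \<Omega>. g x $ i * psi x) = (LINT x|lebesgue_on \<Omega>. g' x $ i * psi x)" by linarith
   then show ?thesis by (simp add: mult.commute)
  qed
  finally show "(LINT x|lebesgue_on \<Omega>. (g x $ i - g' x $ i) * psi x) = 0"
   by (simp add: algebra_simps)
 qed
 then have "AE x in lebesgue_on \<Omega>. \<forall>i\<in>UNIV. g x $ i - g' x $ i = 0"
  by (subst AE_ball_countable) auto
 then show ?thesis by eventually_elim (simp add: vec_eq_iff)
qed

lemma has_weak_grad_weak_grad: "has_weak_grad \<Omega> u g ==> has_weak_grad \<Omega> u (weak_grad \<Omega> u)"
 unfolding weak_grad_def by (rule someI[where P = "has_weak_grad \<Omega> u"])

lemma weak_grad_AE_eq: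
 "open \<Omega> ==> has_weak_grad \<Omega> u g ==> AE x in lebesgue_on \<Omega>. weak_grad \<Omega> u x = g x"
 using has_weak_grad_unique has_weak_grad_weak_grad by blast

lemma Cc1I:
 assumes D: "!!x. (f has_derivative (\<lambda>z. z \<bullet> G x)) (at x)" and G: "continuous_on UNIV G"
  and S: "compact S" "S \<subseteq> \<Omega>" "!!x. x \<notin> S ==> f x = 0"
 shows "f \<in> Cc1 \<Omega>"
proof -
 have "partial_deriv i f = (\<lambda>x. G x $ i)" for i using grad_eq(2)[OF D] by auto
 then have "continuous_on UNIV (partial_deriv i f)" for i by (simp add: continuous_intros G)
 moreover have "f differentiable (at x)" for x using D by (rule differentiableI)
 moreover have cl: "closure {x. f x \<noteq> 0} \<subseteq> S" using S(3) by (intro closure_minimal compact_imp_closed S(1)) blast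
 moreover have "compact (closure {x. f x \<noteq> 0})"
  using cl S(1) by (meson bounded_subset closed_closure compact_eq_bounded_closed)
 ultimately show ?thesis using S(2) by (auto simp: Cc1_def compactly_contained_def)
qed

lemma Cc1_mult:
 assumes "phi \<in> Cc1 \<Omega>" "psi \<in> Cc1 \<Omega>'"
 shows "(\<lambda>x. phi x * psi x) \<in> Cc1 \<Omega>"
  "grad (\<lambda>x. phi x * psi x) x = phi x *\<^sub>R grad psi x + psi x *\<^sub>R grad phi x"
proof -
 note a = Cc1_D[OF assms(1)] and b = Cc1_D[OF assms(2)]
 have D: "((\<lambda>x. phi x * psi x) has_derivative (\<lambda>z. z \<bullet> (phi x *\<^sub>R grad psi x + psi x *\<^sub>R grad phi x))) (at x)" for x
  by (rule has_derivative_eq_rhs, rule has_derivative_mult[OF has_derivative_grad[OF a(1)] has_derivative_grad[OF b(1)]])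
   (simp add: inner_add_right mult.commute)
 show "grad (\<lambda>x. phi x * psi x) x = phi x *\<^sub>R grad psi x + psi x *\<^sub>R grad phi x" by (rule grad_eq(1)[OF D])
 show "(\<lambda>x. phi x * psi x) \<in> Cc1 \<Omega>"
 proof (rule Cc1I[OF D _ a(5,6)])
  show "continuous_on UNIV (\<lambda>x. phi x *\<^sub>R grad psi x + psi x *\<^sub>R grad phi x)"
   by (intro continuous_on_add continuous_on_scaleR a(3,4) b(3,4))
  show "phi x * psi x = 0" if "x \<notin> closure {x. phi x \<noteq> 0}" for x using a(7)[OF that] by simp
 qed
qed

lemma Cc1_mono: "phi \<in> Cc1 \<Omega> ==> \<Omega> \<subseteq> \<Omega>' ==> phi \<in> Cc1 \<Omega>'"
 by (auto simp: Cc1_def compactly_contained_def)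

lemma Cc_inf_mono: "phi \<in> Cc_inf \<Omega> ==> \<Omega> \<subseteq> \<Omega>' ==> phi \<in> Cc_inf \<Omega>'"
 by (auto simp: Cc_inf_def compactly_contained_def)

lemma continuous_locally_integrable:
 fixes f :: "'a::euclidean_space => 'b::euclidean_space"
 assumes "continuous_on UNIV f"
 shows "locally_integrable S f"
 unfolding locally_integrable_def
proof (intro allI impI)
 fix K :: "'a set" assume K: "compact K \<and> K \<subseteq> S"
 have Km: "K \<in> sets lebesgue" using K by (simp add: compact_imp_closed)
 have "bounded (f ` K)" using K by (intro compact_imp_bounded compact_continuous_image continuous_on_subset[OF assms]) auto
 then obtain L where L: "!!x. x \<in> K ==> norm (f x) \<le> L" unfolding bounded_iff by blast
 have "integrable lebesgue (\<lambda>x. indicator K x *\<^sub>R f x)"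
 proof (rule B_integrable_bound)
  show "integrable lebesgue (\<lambda>x. L * indicator K x)"
   using lmeasurable_compact[of K] K by (intro integrable_mult_right integrable_real_indicator) (auto simp: fmeasurable_def)
  show "(\<lambda>x. indicator K x *\<^sub>R f x) \<in> borel_measurable lebesgue"
   using borel_measurable_lebesgue_continuous[OF assms] Km by (intro borel_measurable_scaleR borel_measurable_indicator)
  show "AE x in lebesgue. norm (indicator K x *\<^sub>R f x) \<le> norm (L * indicator K x)"
  proof (rule AE_I2)
   fix x show "norm (indicator K x *\<^sub>R f x) \<le> norm (L * indicator K x)"
    using L[of x] by (cases "x \<in> K") auto
  qed
 qed
 then show "integrable (lebesgue_on K) f" using Km by (simp add: integrable_lebesgue_on_iff)
qed

text \<open>The product with a test function is again compactly supported and \<open>C^1\<close>, so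
  the integral of its partial derivative vanishes; the product rule splits this into the two
  sides.\<close>

lemma has_weak_grad_Cc1:
 assumes phi: "phi \<in> Cc1 \<Omega>'" and Om: "\<Omega> \<in> sets lebesgue"
 shows "has_weak_grad \<Omega> phi (grad phi)"
 unfolding has_weak_grad_def
proof (intro conjI ballI allI)
 show l: "locally_integrable \<Omega> phi" "locally_integrable \<Omega> (grad phi)"
  by (intro continuous_locally_integrable Cc1_D[OF phi])+
 fix psi i assume psii: "psi \<in> Cc_inf \<Omega>"
 note psi = Cc_inf_imp_Cc1[OF psii]
 let ?F = "\<lambda>x. psi x * phi x"
 have FC: "?F \<in> Cc1 \<Omega>" by (rule Cc1_mult(1)[OF psi phi])
 have pF: "partial_deriv i ?F x = partial_deriv i psi x *\<^sub>R phi x + psi x *\<^sub>R (grad phi x $ i)" for x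
  unfolding grad_nth[symmetric] Cc1_mult(2)[OF psi phi] by simp
 have out: "partial_deriv i ?F x = 0" if "x \<notin> \<Omega>" for x
  by (rule Cc1_outside(3)[OF FC that])
 have "0 = (LINT x|lebesgue. partial_deriv i ?F x)"
  using integral_partial_deriv_eq_0[OF Cc1_mono[OF FC]] by simp
 also have "\<dots> = (LINT x|lebesgue. indicator \<Omega> x *\<^sub>R partial_deriv i ?F x)"
  by (rule B_integral_cong) (use out in \<open>auto simp: indicator_def\<close>)
 also have "\<dots> = (LINT x|lebesgue_on \<Omega>. partial_deriv i ?F x)"
  using Om by (intro integral_restrict_space[symmetric]) auto
 also have "\<dots> = (LINT x|lebesgue_on \<Omega>. partial_deriv i psi x *\<^sub>R phi x) + (LINT x|lebesgue_on \<Omega>. psi x *\<^sub>R (grad phi x $ i))"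
  unfolding pF by (intro B_integral_add locally_integrable_test[OF _ Om psi] l locally_integrable_nth)
 finally show "(LINT x|lebesgue_on \<Omega>. phi x * partial_deriv i psi x) = - (LINT x|lebesgue_on \<Omega>. grad phi x $ i * psi x)"
  by (simp add: mult.commute)
qed

lemma has_weak_grad_diff:
 assumes Om: "\<Omega> \<in> sets lebesgue" and u: "has_weak_grad \<Omega> u g" and v: "has_weak_grad \<Omega> v g'"
 shows "has_weak_grad \<Omega> (\<lambda>x. u x - v x) (\<lambda>x. g x - g' x)"
 unfolding has_weak_grad_def
proof (intro conjI ballI allI)
 have l: "locally_integrable \<Omega> u" "locally_integrable \<Omega> v" "locally_integrable \<Omega> g" "locally_integrable \<Omega> g'"
  using u v by (auto simp: has_weak_grad_def)
 show "locally_integrable \<Omega> (\<lambda>x. u x - v x)" "locally_integrable \<Omega> (\<lambda>x. g x - g' x)"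
  by (intro locally_integrable_diff l)+
 fix psi i assume psi: "psi \<in> Cc_inf \<Omega>"
 note t = locally_integrable_test[OF _ Om Cc_inf_imp_Cc1[OF psi]]
 have "(LINT x|lebesgue_on \<Omega>. partial_deriv i psi x *\<^sub>R u x - partial_deriv i psi x *\<^sub>R v x)
   = (LINT x|lebesgue_on \<Omega>. partial_deriv i psi x *\<^sub>R u x) - (LINT x|lebesgue_on \<Omega>. partial_deriv i psi x *\<^sub>R v x)"
  by (intro B_integral_diff t l)
 moreover have "(LINT x|lebesgue_on \<Omega>. psi x *\<^sub>R (g x $ i) - psi x *\<^sub>R (g' x $ i))
   = (LINT x|lebesgue_on \<Omega>. psi x *\<^sub>R (g x $ i)) - (LINT x|lebesgue_on \<Omega>. psi x *\<^sub>R (g' x $ i))"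
  by (intro B_integral_diff t l locally_integrable_nth)
 moreover have "(LINT x|lebesgue_on \<Omega>. u x * partial_deriv i psi x) = - (LINT x|lebesgue_on \<Omega>. g x $ i * psi x)"
  "(LINT x|lebesgue_on \<Omega>. v x * partial_deriv i psi x) = - (LINT x|lebesgue_on \<Omega>. g' x $ i * psi x)"
  using u v psi by (auto simp: has_weak_grad_def)
 ultimately show "(LINT x|lebesgue_on \<Omega>. (u x - v x) * partial_deriv i psi x) = - (LINT x|lebesgue_on \<Omega>. (g x - g' x) $ i * psi x)"
  by (simp add: algebra_simps)
qed

text \<open>Measurability on compact sets is part of integrability there; an exhaustion by compact
  sets passes it to the open set.\<close>

lemma locally_integrable_measurable:
 fixes f :: "'a::euclidean_space => 'b::{banach,second_countable_topology}"
 assumes op: "open \<Omega>" and f: "locally_integrable \<Omega> f"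
 shows "(\<lambda>x. indicator \<Omega> x *\<^sub>R f x) \<in> borel_measurable lebesgue" "f \<in> Lmeas \<Omega>"
proof -
 obtain C :: "nat => 'a set" where C: "\<forall>n. compact (C n)" "\<forall>n. C n \<subseteq> \<Omega>" "\<forall>n. C n \<subseteq> interior (C (Suc n))" "(\<Union>n. C n) = \<Omega>"
  using open_exhaustion[OF op] by (elim exE conjE)
 have inc: "C m \<subseteq> C n" if "m \<le> n" for m n
  using that by (rule lift_Suc_mono_le[rotated]) (use C(3) interior_subset in blast)
 show 1: "(\<lambda>x. indicator \<Omega> x *\<^sub>R f x) \<in> borel_measurable lebesgue"
 proof (rule borel_measurable_LIMSEQ_metric)
  show "(\<lambda>x. indicator (C n) x *\<^sub>R f x) \<in> borel_measurable lebesgue" for n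
  proof -
   have "C n \<in> sets lebesgue" using C(1) by (simp add: compact_imp_closed)
   moreover have "integrable (lebesgue_on (C n)) f" using f C(1,2) unfolding locally_integrable_def by blast
   ultimately have "integrable lebesgue (\<lambda>x. indicator (C n) x *\<^sub>R f x)" by (simp only: integrable_lebesgue_on_iff)
   then show ?thesis by (rule borel_measurable_integrable)
  qed
  fix x
  have "\<forall>\<^sub>F n in sequentially. indicator (C n) x *\<^sub>R f x = indicator \<Omega> x *\<^sub>R f x"
  proof (cases "x \<in> \<Omega>")
   case True
   then obtain m where "x \<in> C m" using C(4) by blast
   then have xC: "x \<in> C n" if "m \<le> n" for n using inc[OF that] by blast
   show ?thesis
    by (rule eventually_mono[OF eventually_ge_at_top[of m]]) (use True xC in \<open>auto simp: indicator_def\<close>)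
  next
   case False
   then have "x \<notin> C n" for n using C(2) by blast
   then show ?thesis using False by simp
  qed
  then show "(\<lambda>n. indicator (C n) x *\<^sub>R f x) \<longlonglongrightarrow> indicator \<Omega> x *\<^sub>R f x" by (rule tendsto_eventually)
 qed
 show "f \<in> Lmeas \<Omega>"
  using 1 op by (subst borel_measurable_restrict_space_iff) auto
qed

lemma has_weak_grad_subset:
 assumes wg: "has_weak_grad \<Omega> v g" and sub: "\<Omega>' \<subseteq> \<Omega>" and m: "\<Omega> \<in> sets lebesgue" "\<Omega>' \<in> sets lebesgue"
 shows "has_weak_grad \<Omega>' v g"
 unfolding has_weak_grad_def
proof (intro conjI ballI allI)
 show "locally_integrable \<Omega>' v" "locally_integrable \<Omega>' g"
  using wg sub by (auto simp: has_weak_grad_def locally_integrable_def)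
 fix psi i assume psi: "psi \<in> Cc_inf \<Omega>'"
 have out: "psi x = 0" "partial_deriv i psi x = 0" if "x \<notin> \<Omega>'" for x
  using Cc1_outside[OF Cc_inf_imp_Cc1[OF psi] that] by auto
 have r: "(LINT x|lebesgue_on \<Omega>'. F x) = (LINT x|lebesgue_on \<Omega>. F x)" if "!!x. x \<notin> \<Omega>' ==> F x = 0" for F :: "real^'a => real"
 proof -
  have "(LINT x|lebesgue_on \<Omega>'. F x) = (LINT x|lebesgue. indicator \<Omega>' x *\<^sub>R F x)"
   using m by (intro integral_restrict_space) auto
  also have "\<dots> = (LINT x|lebesgue. indicator \<Omega> x *\<^sub>R F x)"
   by (rule B_integral_cong) (use that sub in \<open>auto simp: indicator_def\<close>)
  also have "\<dots> = (LINT x|lebesgue_on \<Omega>. F x)" using m by (intro integral_restrict_space[symmetric]) auto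
  finally show ?thesis .
 qed
 have "(LINT x|lebesgue_on \<Omega>. v x * partial_deriv i psi x) = - (LINT x|lebesgue_on \<Omega>. g x $ i * psi x)"
  using wg Cc_inf_mono[OF psi sub] by (auto simp: has_weak_grad_def)
 then show "(LINT x|lebesgue_on \<Omega>'. v x * partial_deriv i psi x) = - (LINT x|lebesgue_on \<Omega>'. g x $ i * psi x)"
  using out by (simp add: r)
qed

lemma measurable_vec_nth:
 fixes f :: "'a => real^'n::finite"
 assumes "f \<in> borel_measurable M"
 shows "(\<lambda>x. f x $ i) \<in> borel_measurable M"
 by (rule borel_measurable_continuous_on[OF _ assms, of "\<lambda>v. v $ i"]) (intro continuous_intros)

lemma integrable_on_cong_AE:
 fixes f g :: "'a::euclidean_space => 'b::{banach,second_countable_topology}"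
 assumes "integrable (lebesgue_on S) f" "g \<in> Lmeas S" "AE x in lebesgue_on S. f x = g x"
 shows "integrable (lebesgue_on S) g"
 using assms by (subst integrable_cong_AE[of g _ f]) (auto elim!: eventually_mono)

lemma AE_lebesgue_on_subset:
 assumes "AE x in lebesgue_on T. P x" "S \<subseteq> T" "S \<in> sets lebesgue" "T \<in> sets lebesgue"
 shows "AE x in lebesgue_on S. P x"
proof -
 have "AE x in lebesgue. x \<in> T --> P x" using assms by (subst (asm) AE_restrict_space_iff) auto
 then have "AE x in lebesgue. x \<in> S --> P x" by eventually_elim (use assms(2) in blast)
 then show ?thesis using assms by (subst AE_restrict_space_iff) auto
qed

text \<open>Weak gradients on an exhaustion agree on overlaps by uniqueness and are glued together.\<close>

lemma has_weak_grad_glue: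
 fixes v :: "real^'n::finite => real"
 assumes op: "open \<Omega>" and loc: "!!\<Omega>'. open \<Omega>' ==> \<Omega>' \<Subset> \<Omega> ==> \<exists>g. has_weak_grad \<Omega>' v g"
 shows "\<exists>g. has_weak_grad \<Omega> v g"
proof -
 obtain C :: "nat => (real^'n) set" where C: "\<forall>n. compact (C n)" "\<forall>n. C n \<subseteq> \<Omega>" "\<forall>n. C n \<subseteq> interior (C (Suc n))" "(\<Union>n. C n) = \<Omega>"
  "\<forall>K. compact K --> K \<subseteq> \<Omega> --> (\<exists>N. \<forall>n\<ge>N. K \<subseteq> C n)"
  using open_exhaustion[OF op] by (elim exE conjE)
 have inc: "C m \<subseteq> C n" if "m \<le> n" for m n
  using that by (rule lift_Suc_mono_le[rotated]) (use C(3) interior_subset in blast)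
 define O' where "O' n = interior (C n)" for n
 have O': "open (O' n)" "O' n \<in> sets lebesgue" "O' n \<subseteq> \<Omega>" for n
  using C(2) interior_subset[of "C n"] by (auto simp: O'_def)
 have Oinc: "O' m \<subseteq> O' n" if "m \<le> n" for m n unfolding O'_def by (intro interior_mono inc that)
 have Occ: "O' n \<Subset> \<Omega>" for n
 proof -
  have "closure (O' n) \<subseteq> C n"
   unfolding O'_def by (intro closure_minimal interior_subset compact_imp_closed) (use C(1) in blast)
  moreover have "compact (closure (O' n))"
   using calculation C(1) by (meson bounded_subset closed_closure compact_eq_bounded_closed)
  ultimately show ?thesis using C(2) by (auto simp: compactly_contained_def)
 qed
 obtain g where g: "!!n. has_weak_grad (O' n) v (g n)" using loc[OF O'(1) Occ] by metis
 have gm: "(\<lambda>x. indicator (O' n) x *\<^sub>R g n x) \<in> borel_measurable lebesgue" for n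
  using g[of n] by (intro locally_integrable_measurable(1) O'(1)) (auto simp: has_weak_grad_def)
 \<comment> \<open>At almost every point of the domain the sequence is eventually constant; defining
   the glued gradient as a limit gives its measurability directly.\<close>
 define G where "G x = lim (\<lambda>n. indicator (O' n) x *\<^sub>R g n x)" for x
 have Gm: "G \<in> borel_measurable lebesgue" unfolding G_def[abs_def] by (rule borel_measurable_lim_metric[OF gm])
 have agree: "AE x in lebesgue. x \<in> O' m --> g n x = g m x" if "m \<le> n" for m n
 proof -
  have "has_weak_grad (O' m) v (g n)" by (rule has_weak_grad_subset[OF g Oinc[OF that] O'(2) O'(2)])
  from has_weak_grad_unique[OF O'(1) this g[of m]] show ?thesis
   using O'(2) by (subst (asm) AE_restrict_space_iff) auto
 qed
 have GO: "AE x in lebesgue. x \<in> O' m --> G x = g m x" for m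
 proof -
  have "AE x in lebesgue. m \<le> n --> x \<in> O' m --> g n x = g m x" for n
  proof (cases "m \<le> n")
   case True
   then show ?thesis using agree[OF True] by simp
  qed simp
  then have "AE x in lebesgue. \<forall>n. m \<le> n --> x \<in> O' m --> g n x = g m x"
   unfolding AE_all_countable by (rule allI)
  then show ?thesis
  proof eventually_elim
   case (elim x)
   show ?case
   proof
    assume x: "x \<in> O' m"
    have "\<forall>\<^sub>F n in sequentially. indicator (O' n) x *\<^sub>R g n x = g m x"
    proof (rule eventually_mono[OF eventually_ge_at_top[of m]])
     fix n assume n: "m \<le> n"
     have "g n x = g m x" "x \<in> O' n" using elim x n Oinc[OF n] by blast+
     then show "indicator (O' n) x *\<^sub>R g n x = g m x" by simp
    qed
    then have "(\<lambda>n. indicator (O' n) x *\<^sub>R g n x) \<longlonglongrightarrow> g m x" by (rule tendsto_eventually)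
    then show "G x = g m x" unfolding G_def by (rule limI)
   qed
  qed
 qed
 have cover: "\<exists>n. K \<subseteq> O' n" if K: "compact K" "K \<subseteq> \<Omega>" for K
 proof -
  obtain N where "\<forall>n\<ge>N. K \<subseteq> C n" using C(5) K by blast
  then have "K \<subseteq> O' (Suc N)" using C(3) unfolding O'_def by blast
  then show ?thesis by blast
 qed
 have GK: "AE x in lebesgue_on (O' n). G x = g n x" for n
  using GO[of n] O'(2)[of n] by (subst AE_restrict_space_iff) auto
 have "has_weak_grad \<Omega> v G"
  unfolding has_weak_grad_def
 proof (intro conjI ballI allI)
  show "locally_integrable \<Omega> v"
   unfolding locally_integrable_def
  proof (intro allI impI)
   fix K assume K: "compact K \<and> K \<subseteq> \<Omega>"
   then obtain n where n: "K \<subseteq> O' n" using cover by blast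
   then show "integrable (lebesgue_on K) v" using K g[of n] by (auto simp: has_weak_grad_def locally_integrable_def)
  qed
  show "locally_integrable \<Omega> G"
   unfolding locally_integrable_def
  proof (intro allI impI)
   fix K assume K: "compact K \<and> K \<subseteq> \<Omega>"
   then obtain n where n: "K \<subseteq> O' n" using cover by blast
   have Km: "K \<in> sets lebesgue" using K by (simp add: compact_imp_closed)
   show "integrable (lebesgue_on K) G"
   proof (rule integrable_on_cong_AE)
    show "integrable (lebesgue_on K) (g n)" using n K g[of n] by (auto simp: has_weak_grad_def locally_integrable_def)
    show "G \<in> Lmeas K" by (rule measurable_restrict_space1[OF Gm])
    have "AE x in lebesgue_on K. G x = g n x" by (rule AE_lebesgue_on_subset[OF GK n Km O'(2)])
    then show "AE x in lebesgue_on K. g n x = G x" by eventually_elim simp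
   qed
  qed
  fix psi i assume psi: "psi \<in> Cc_inf \<Omega>"
  note psi' = Cc1_D[OF Cc_inf_imp_Cc1[OF psi]]
  obtain n where n: "closure {x. psi x \<noteq> 0} \<subseteq> O' n" using cover psi'(5,6) by blast
  have psin: "psi \<in> Cc_inf (O' n)" using psi n by (auto simp: Cc_inf_def compactly_contained_def)
  have r: "(LINT x|lebesgue_on (O' n). F x) = (LINT x|lebesgue_on \<Omega>. F x)" if "!!x. x \<notin> O' n ==> F x = 0" for F :: "real^'n => real"
  proof -
   have "(LINT x|lebesgue_on (O' n). F x) = (LINT x|lebesgue. indicator (O' n) x *\<^sub>R F x)"
    using O' by (intro integral_restrict_space) auto
   also have "\<dots> = (LINT x|lebesgue. indicator \<Omega> x *\<^sub>R F x)"
    by (rule B_integral_cong) (use that O'(3)[of n] in \<open>auto simp: indicator_def\<close>)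
   also have "\<dots> = (LINT x|lebesgue_on \<Omega>. F x)" using op by (intro integral_restrict_space[symmetric]) auto
   finally show ?thesis .
  qed
  have out: "psi x = 0" "partial_deriv i psi x = 0" if "x \<notin> O' n" for x
   using Cc1_outside[OF Cc_inf_imp_Cc1[OF psin] that] by auto
  have "(LINT x|lebesgue_on \<Omega>. v x * partial_deriv i psi x) = (LINT x|lebesgue_on (O' n). v x * partial_deriv i psi x)"
   using out by (simp add: r)
  also have "\<dots> = - (LINT x|lebesgue_on (O' n). g n x $ i * psi x)"
   using g[of n] psin by (auto simp: has_weak_grad_def)
  also have "(LINT x|lebesgue_on (O' n). g n x $ i * psi x) = (LINT x|lebesgue_on (O' n). G x $ i * psi x)"
  proof (rule integral_cong_AE)
   have psim: "psi \<in> Lmeas ((O' n))"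
    by (intro measurable_restrict_space1 borel_measurable_lebesgue_continuous psi')
   have "g n \<in> Lmeas ((O' n))"
    using g[of n] by (intro locally_integrable_measurable(2) O'(1)) (auto simp: has_weak_grad_def)
   then show "(\<lambda>x. g n x $ i * psi x) \<in> Lmeas ((O' n))"
    by (intro borel_measurable_times psim measurable_vec_nth)
   show "(\<lambda>x. G x $ i * psi x) \<in> Lmeas ((O' n))"
    by (intro borel_measurable_times psim measurable_vec_nth measurable_restrict_space1[OF Gm])
   show "AE x in lebesgue_on (O' n). g n x $ i * psi x = G x $ i * psi x"
    using GK[of n] by eventually_elim simp
  qed
  also have "\<dots> = (LINT x|lebesgue_on \<Omega>. G x $ i * psi x)" using out by (simp add: r)
  finally show "(LINT x|lebesgue_on \<Omega>. v x * partial_deriv i psi x) = - (LINT x|lebesgue_on \<Omega>. G x $ i * psi x)" .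
 qed
 then show ?thesis by blast
qed

section \<open>The weighted Poincare inequality\<close>

text \<open>Jensen's inequality for a finite mean, by adding the tangent inequalities at the mean;
  the deviations from it sum to zero.\<close>

lemma powr_mean_le:
 fixes a :: "nat => real"
 assumes p: "1 < p" and n: "0 < n" and a: "!!k. 0 \<le> a k"
 shows "((\<Sum>k<n. a k) / real n) powr p \<le> (\<Sum>k<n. a k powr p) / real n"
proof -
 define c where "c = (\<Sum>k<n. a k) / real n"
 have c: "0 \<le> c" using a by (simp add: c_def sum_nonneg)
 have "real n * c powr p = (\<Sum>k<n. c powr p + p * c powr (p - 1) * (a k - c))"
  using n by (simp add: sum.distrib sum_subtractf c_def flip: sum_distrib_left)
 also have "\<dots> \<le> (\<Sum>k<n. a k powr p)" by (intro sum_mono powr_tangent p c a)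
 finally show ?thesis using n by (simp add: c_def field_simps)
qed

lemma integral_ball_affine:
 fixes g :: "'a::euclidean_space => real"
 assumes g: "continuous_on UNIV g" and s: "0 < s"
 shows "(LINT z|lebesgue_on (ball x (s * r)). g z) = s ^ DIM('a) * (LINT y|lebesgue_on (ball 0 r). g (x + s *\<^sub>R y))"
proof -
 define F where "F z = indicator (ball x (s * r)) z * g z" for z
 have gb: "g \<in> borel_measurable borel" by (rule borel_measurable_continuous_onI[OF g])
 have Fb: "F \<in> borel_measurable borel" unfolding F_def by (intro borel_measurable_times borel_measurable_indicator gb) simp
 have T: "(\<lambda>y. x + s *\<^sub>R y) \<in> borel_measurable (borel :: 'a measure)"
  by (rule borel_measurable_continuous_onI) (intro continuous_intros)
 have F': "F (x + s *\<^sub>R y) = indicator (ball 0 r) y * g (x + s *\<^sub>R y)" for y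
  using s by (simp add: F_def indicator_def dist_norm)
 have "(LINT z|lebesgue_on (ball x (s * r)). g z) = (LINT z|lebesgue. F z)"
  by (simp add: integral_restrict_space F_def)
 also have "\<dots> = (LINT z|lborel. F z)" using Fb by (simp add: integral_completion)
 also have "\<dots> = (LINT z|density (distr lborel borel (\<lambda>y. x + s *\<^sub>R y)) (\<lambda>_. ennreal (\<bar>s\<bar> ^ DIM('a))). F z)"
  using s by (subst lborel_affine[of s x]) auto
 also have "\<dots> = (LINT z|distr lborel borel (\<lambda>y. x + s *\<^sub>R y). \<bar>s\<bar> ^ DIM('a) *\<^sub>R F z)"
  using Fb by (intro integral_density) auto
 also have "\<dots> = (LINT y|lborel. \<bar>s\<bar> ^ DIM('a) *\<^sub>R F (x + s *\<^sub>R y))"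
  using Fb T by (intro integral_distr) auto
 also have "\<dots> = s ^ DIM('a) * (LINT y|lborel. F (x + s *\<^sub>R y))" using s by simp
 also have "(LINT y|lborel. F (x + s *\<^sub>R y)) = (LINT y|lebesgue. F (x + s *\<^sub>R y))"
  using measurable_compose[OF T Fb] by (simp add: integral_completion)
 also have "\<dots> = (LINT y|lebesgue_on (ball 0 r). g (x + s *\<^sub>R y))"
  by (simp add: F' integral_restrict_space)
 finally show ?thesis .
qed

context muckenhoupt_vec
begin

lemma Cc1_Lp_UNIV:
 assumes "phi \<in> Cc1 \<Omega>"
 shows "phi \<in> Lp p (wmeasure UNIV)" "grad phi \<in> Lp p (wmeasure UNIV)"
proof -
 note c = Cc1_D[OF assms]
 have S: "bounded (closure {x. phi x \<noteq> 0})" "closure {x. phi x \<noteq> 0} \<in> sets lebesgue"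
  using c(5) by (auto simp: compact_imp_bounded)
 obtain L where L: "!!x. norm (phi x) \<le> L" using continuous_compact_support_bounded[OF c(4,5,7)] by blast
 show "phi \<in> Lp p (wmeasure UNIV)"
  by (rule Lp_wmeasure_bounded(1)[OF borel_measurable_lebesgue_continuous[OF c(4)] L S c(7)])
 obtain L' where L': "!!x. norm (grad phi x) \<le> L'" using continuous_compact_support_bounded[OF c(3,5,8)] by blast
 show "grad phi \<in> Lp p (wmeasure UNIV)"
  by (rule Lp_wmeasure_bounded(1)[OF borel_measurable_lebesgue_continuous[OF c(3)] L' S c(8)])
qed

lemma Cc1_Lp:
 assumes "phi \<in> Cc1 \<Omega>" "S \<in> sets lebesgue"
 shows "phi \<in> Lp p (wmeasure S)" "grad phi \<in> Lp p (wmeasure S)"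
 using Cc1_Lp_UNIV[OF assms(1)] by (auto intro: Lp_wmeasure_mono(1)[of S UNIV] assms(2))

text \<open>Substitution turns the integral over \<open>y\<close> into one over a ball of radius
  \<open>3 * s\<close> around \<open>x\<close>. The Jacobian of the substitution cancels against the
  volume in the averaging bound, so the constant does not depend on the scale
  \<open>s\<close>.\<close>

lemma weighted_average_bound:
 obtains C where "0 < C" "\<forall>g s. continuous_on UNIV g --> (\<forall>x. 0 \<le> g x) -->
   integrable lebesgue (\<lambda>x. g x powr p * w x) --> 0 < s -->
  integrable lebesgue (\<lambda>x. w x * (LINT y|lebesgue_on (ball (0::real^'n) 3). g (x + s *\<^sub>R y)) powr p) \<and>
  (LINT x|lebesgue. w x * (LINT y|lebesgue_on (ball 0 3). g (x + s *\<^sub>R y)) powr p)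
    \<le> C * (LINT x|lebesgue. g x powr p * w x)"
proof -
 obtain C where C: "0 < C" "\<forall>h r. (\<forall>x. 0 \<le> h x) --> integrable lebesgue (\<lambda>x. h x powr p * w x) -->
  h \<in> borel_measurable lebesgue --> 0 < r -->
  (\<integral>\<^sup>+x. ennreal (w x) * ennreal ((LINT y|lebesgue_on (ball x r). h y) powr p) \<partial>lebesgue)
   \<le> ennreal (C * measure lebesgue (ball (0::real^'n) r) powr p * (LINT x|lebesgue. h x powr p * w x))"
  by (rule ball_average_bound)
 define K where "K = C * measure lebesgue (ball (0::real^'n) 3) powr p"
 have K: "0 < K" using C(1) by (simp add: K_def content_ball_pos)
 have main: "integrable lebesgue (\<lambda>x. w x * (LINT y|lebesgue_on (ball (0::real^'n) 3). g (x + s *\<^sub>R y)) powr p) \<and>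
  (LINT x|lebesgue. w x * (LINT y|lebesgue_on (ball 0 3). g (x + s *\<^sub>R y)) powr p) \<le> K * (LINT x|lebesgue. g x powr p * w x)"
  if g: "continuous_on UNIV g" "\<forall>x. 0 \<le> g x" "integrable lebesgue (\<lambda>x. g x powr p * w x)" and s: "0 < s" for g s
 proof -
  define H where "H x = (LINT y|lebesgue_on (ball x (s * 3)). g y)" for x :: "real^'n"
  define m where "m x = (LINT y|lebesgue_on (ball (0::real^'n) 3). g (x + s *\<^sub>R y))" for x
  define I where "I = (LINT x|lebesgue. g x powr p * w x)"
  define c where "c = s ^ CARD('n)"
  have c: "0 < c" using s by (simp add: c_def)
  have gm: "g \<in> borel_measurable lebesgue" by (rule borel_measurable_lebesgue_continuous[OF g(1)])
  have Hm[measurable]: "H \<in> borel_measurable lebesgue" unfolding H_def by (rule borel_measurable_integral_ball[OF gm])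
  have mH: "m x = H x / c" for x
   using integral_ball_affine[OF g(1) s, of x 3] c s by (simp add: H_def m_def c_def)
  have H0: "0 \<le> H x" for x unfolding H_def using g(2) by (intro integral_nonneg_AE) auto
  have V: "measure lebesgue (ball (0::real^'n) (s * 3)) = c * measure lebesgue (ball (0::real^'n) 3)"
   using s by (simp add: content_ball c_def power_mult_distrib)
  have mp: "w x * m x powr p = (w x * H x powr p) / c powr p" for x
   using H0[of x] c by (simp add: mH powr_divide)
  have nonneg: "AE x in lebesgue. 0 \<le> w x * H x powr p" using weight_pos by eventually_elim auto
  have "(\<integral>\<^sup>+x. ennreal (w x * H x powr p) \<partial>lebesgue) = (\<integral>\<^sup>+x. ennreal (w x) * ennreal (H x powr p) \<partial>lebesgue)"
   by (intro nn_integral_cong ennreal_mult'') simp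
  also have "\<dots> \<le> ennreal (C * measure lebesgue (ball (0::real^'n) (s * 3)) powr p * I)"
   unfolding H_def I_def by (rule C(2)[rule_format]) (use g gm s in auto)
  also have "C * measure lebesgue (ball (0::real^'n) (s * 3)) powr p * I = c powr p * (K * I)"
   unfolding V using c by (simp add: K_def powr_mult)
  finally have nn: "(\<integral>\<^sup>+x. ennreal (w x * H x powr p) \<partial>lebesgue) \<le> ennreal (c powr p * (K * I))" .
  have iH: "integrable lebesgue (\<lambda>x. w x * H x powr p)"
   by (rule integrableI_nonneg[OF _ nonneg]) (use nn in \<open>auto simp: order.strict_trans1\<close>)
  have I0: "0 \<le> I" unfolding I_def using weight_pos by (intro integral_nonneg_AE) (auto elim!: eventually_mono)
  have "ennreal (LINT x|lebesgue. w x * H x powr p) \<le> ennreal (c powr p * (K * I))"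
   using nn_integral_eq_integral[OF iH nonneg] nn by simp
  then have "(LINT x|lebesgue. w x * H x powr p) \<le> c powr p * (K * I)"
   using K I0 by (subst (asm) ennreal_le_iff) auto
  moreover have "(LINT x|lebesgue. w x * m x powr p) = (LINT x|lebesgue. w x * H x powr p) / c powr p"
   unfolding mp by simp
  moreover have "integrable lebesgue (\<lambda>x. w x * m x powr p)" unfolding mp using iH by auto
  ultimately show ?thesis using c unfolding m_def I_def by (simp add: divide_le_eq mult.commute)
 qed
 show thesis by (rule that[OF K]) (rule allI, rule allI, (rule impI)+, rule main)
qed

end

locale weighted_domain = muckenhoupt_vec p w for p :: real and w :: "real^'n::finite => real" +
 fixes \<Omega> :: "(real^'n) set"
 assumes open_dom: "open \<Omega>" and bounded_dom: "bounded \<Omega>"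
begin

abbreviation dom_measure :: "(real^'n) measure" ("\<L>") where "\<L> \<equiv> lebesgue_on \<Omega>"


lemma dom_sets: "\<Omega> \<in> sets lebesgue" using open_dom by simp

lemma norm_powr_integral_outside:
 fixes F :: "real^'n => 'c::euclidean_space"
 assumes F: "F \<in> borel_measurable lebesgue" and out: "!!x. x \<notin> \<Omega> ==> F x = 0"
 shows "Lp_int p (wmeasure \<Omega>) F = (LINT x|lebesgue. norm (F x) powr p * w x)"
proof -
 have "Lp_int p (wmeasure \<Omega>) F = (LINT x|\<L>. norm (F x) powr p * w x)"
  using F by (intro norm_powr_integral_wmeasure dom_sets measurable_restrict_space1)
 also have "\<dots> = (LINT x|lebesgue. indicator \<Omega> x *\<^sub>R (norm (F x) powr p * w x))"
  using dom_sets by (intro integral_restrict_space) auto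
 also have "\<dots> = (LINT x|lebesgue. norm (F x) powr p * w x)"
  by (rule B_integral_cong) (use out in \<open>auto simp: indicator_def\<close>)
 finally show ?thesis .
qed

text \<open>Joining \<open>x\<close> to points outside \<open>\<Omega>\<close> by the segments \<open>x + t d y\<close>, with \<open>y\<close> ranging over
 a ball that avoids the origin, bounds \<open>phi x\<close> by averages of the gradient over balls around
 \<open>x\<close>; the segments are discretized to avoid integrals in \<open>t\<close>.\<close>

theorem poincare:
 obtains C where "0 < C" "\<forall>phi\<in>Cc1 \<Omega>. (Lp_int p (wmeasure \<Omega>) phi) \<le> C * Lp_int p (wmeasure \<Omega>) (grad phi)"
proof -
 from bounded_subset_ballD[OF bounded_dom, of 0] obtain r where r: "0 < r" "\<Omega> \<subseteq> ball 0 r" by (elim exE conjE)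
 obtain C where C: "0 < C" "\<forall>g s. continuous_on UNIV g --> (\<forall>x. 0 \<le> g x) -->
   integrable lebesgue (\<lambda>x. g x powr p * w x) --> 0 < s -->
  integrable lebesgue (\<lambda>x. w x * (LINT y|lebesgue_on (ball (0::real^'n) 3). g (x + s *\<^sub>R y)) powr p) \<and>
  (LINT x|lebesgue. w x * (LINT y|lebesgue_on (ball 0 3). g (x + s *\<^sub>R y)) powr p)
    \<le> C * (LINT x|lebesgue. g x powr p * w x)"
  by (rule weighted_average_bound)
 \<comment> \<open>Points of the domain have norm below \<open>r\<close> and the directions used
   have norm above 1, so \<open>x + d *\<^sub>R y\<close> has norm above \<open>r\<close> and lies
   outside the domain.\<close>
 define d where "d = 2 * r"
 have d: "0 < d" using r by (simp add: d_def)
 \<comment> \<open>A centre of norm 2: every \<open>y\<close> in \<open>ball a 1\<close> satisfies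
   \<open>1 < norm y\<close> and \<open>norm y < 3\<close>, which fits the ball of radius 3 in the
   averaging bound.\<close>
 define a :: "real^'n" where "a = 2 *\<^sub>R axis undefined 1"
 have na: "norm a = 2" by (simp add: a_def)
 define V1 where "V1 = measure lebesgue (ball a 1)"
 define V3 where "V3 = measure lebesgue (ball (0::real^'n) 3)"
 have V1: "0 < V1" and V3: "0 < V3" by (simp_all add: V1_def V3_def content_ball_pos)
 define K1 where "K1 = (3 * d / V1) powr p * 2 powr p"
 have K1: "0 < K1" using d V1 by (simp add: K1_def)
 define W where "W = (LINT x|\<L>. w x)"
 have W0: "0 \<le> W" unfolding W_def using weight_pos_on[OF dom_sets] by (intro integral_nonneg_AE) (auto elim!: eventually_mono)
 have iw: "integrable lebesgue (\<lambda>x. indicator \<Omega> x * w x)"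
  using weight_integrable_bounded[OF bounded_dom dom_sets] dom_sets by (simp add: integrable_lebesgue_on_iff)
 have Wi: "(LINT x|lebesgue. indicator \<Omega> x * w x) = W" unfolding W_def using dom_sets by (simp add: integral_restrict_space)
 have "Lp_int p (wmeasure \<Omega>) phi \<le> (K1 * C) * Lp_int p (wmeasure \<Omega>) (grad phi)"
  if phi: "phi \<in> Cc1 \<Omega>" for phi
 proof -
  note c = Cc1_D[OF phi]
  define g where "g x = norm (grad phi x)" for x
  have gc: "continuous_on UNIV g" unfolding g_def by (intro continuous_on_norm c)
  have gm: "phi \<in> borel_measurable lebesgue" "grad phi \<in> borel_measurable lebesgue"
   by (intro borel_measurable_lebesgue_continuous c)+
  have gI: "integrable lebesgue (\<lambda>x. g x powr p * w x)"
   using Cc1_Lp_UNIV(2)[OF phi] by (simp add: Lp_wmeasure_iff lebesgue_on_UNIV_eq g_def)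
  define I where "I = (LINT x|lebesgue. g x powr p * w x)"
  have I: "Lp_int p (wmeasure \<Omega>) (grad phi) = I"
   unfolding I_def g_def by (rule norm_powr_integral_outside[OF gm(2) Cc1_outside(2)[OF phi]])
  define X where "X = Lp_int p (wmeasure \<Omega>) phi"
  have Xi: "integrable lebesgue (\<lambda>x. norm (phi x) powr p * w x)"
   using Cc1_Lp_UNIV(1)[OF phi] by (simp add: Lp_wmeasure_iff lebesgue_on_UNIV_eq)
  have X: "X = (LINT x|lebesgue. norm (phi x) powr p * w x)"
   unfolding X_def by (rule norm_powr_integral_outside[OF gm(1) Cc1_outside(1)[OF phi]])
  \<comment> \<open>The term with \<open>eps\<close> pays for the discretization: on each short
    piece of the segment the gradient is replaced by its value at an end point.\<close>
  have est: "X \<le> K1 * C * I + K1 * (eps * V3) powr p * W" if eps: "0 < eps" for eps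
  proof -
   \<comment> \<open>All segments stay in this ball, since \<open>norm x < r\<close> and
     \<open>norm (t *\<^sub>R y) \<le> 2 * r * 3\<close>.\<close>
   have "uniformly_continuous_on (cball 0 (7 * r)) (grad phi)"
    by (intro compact_uniformly_continuous c) auto
   then obtain delta where delta: "0 < delta" "!!x y. x \<in> cball 0 (7 * r) ==> y \<in> cball 0 (7 * r) ==> dist y x < delta ==> dist (grad phi y) (grad phi x) < eps"
    using eps unfolding uniformly_continuous_on_def by metis
   obtain N :: nat where N: "3 * d / delta < real N" using reals_Archimedean2 by blast
   define n where "n = Suc N"
   have n: "0 < n" "3 * d / real n < delta"
   proof -
    have "3 * d / delta < real n" using N by (simp add: n_def)
    then show "3 * d / real n < delta" using delta(1) by (simp add: field_simps n_def)
   qed (simp add: n_def)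
   \<comment> \<open>The nodes on the segment. Gradients are sampled at the far ends
     \<open>s (Suc k)\<close>, which are positive scales as the averaging bound demands.\<close>
   define s where "s k = d * (real k / real n)" for k
   define m where "m k x = (LINT y|lebesgue_on (ball (0::real^'n) 3). g (x + s k *\<^sub>R y))" for k x
   have spos: "0 < s (Suc k)" for k using d n by (simp add: s_def)
   have m0: "0 \<le> m k x" for k x unfolding m_def g_def by (intro integral_nonneg_AE) auto
   have Cm: "integrable lebesgue (\<lambda>x. w x * m (Suc k) x powr p)" "(LINT x|lebesgue. w x * m (Suc k) x powr p) \<le> C * I" for k
    using C(2)[rule_format, OF gc _ gI spos[of k]] unfolding m_def I_def by (auto simp: g_def)
   have segment: "\<bar>phi x\<bar> \<le> (3 * d / real n) * (\<Sum>k<n. g (x + s (Suc k) *\<^sub>R y) + eps)"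
    if x: "x \<in> \<Omega>" and y: "y \<in> ball a 1" for x y
   proof -
    have y13: "1 < norm y" "norm y < 3"
     using y na norm_triangle_ineq2[of a "a - y"] norm_triangle_ineq4[of a "a - y"] by (auto simp: dist_norm)
    have xr: "norm x < r" using x r by auto
    have "phi (x + s n *\<^sub>R y) = 0"
    proof (rule Cc1_outside(1)[OF phi])
     have sn: "s n = d" using n by (simp add: s_def)
     have "d * 1 < norm (d *\<^sub>R y)" using y13 d by simp
     then have "r < norm (x + d *\<^sub>R y)" using norm_triangle_ineq2[of "d *\<^sub>R y" "- x"] xr by (simp add: d_def add.commute)
     then show "x + s n *\<^sub>R y \<notin> \<Omega>" using r sn by auto
    qed
    then have "phi x = (\<Sum>k<n. phi (x + s k *\<^sub>R y) - phi (x + s (Suc k) *\<^sub>R y))"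
     using sum_lessThan_telescope'[of "\<lambda>k. phi (x + s k *\<^sub>R y)" n] by (simp add: s_def)
    also have "\<bar>\<dots>\<bar> \<le> (\<Sum>k<n. \<bar>phi (x + s k *\<^sub>R y) - phi (x + s (Suc k) *\<^sub>R y)\<bar>)" by (rule sum_abs)
    also have "\<dots> \<le> (\<Sum>k<n. (3 * d / real n) * (g (x + s (Suc k) *\<^sub>R y) + eps))"
    proof (rule sum_mono)
     fix k assume "k \<in> {..<n}"
     then have k: "Suc k \<le> n" by simp
     let ?u = "x + s k *\<^sub>R y" and ?v = "x + s (Suc k) *\<^sub>R y"
     have sk: "0 \<le> s k" "s k \<le> s (Suc k)" "s (Suc k) \<le> d" "s (Suc k) - s k = d / real n"
     proof -
      show "0 \<le> s k" using d by (simp add: s_def)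
      have "s (Suc k) - s k = d * (real (Suc k) / real n - real k / real n)" by (simp only: s_def right_diff_distrib)
      also have "real (Suc k) / real n - real k / real n = 1 / real n" by (simp add: diff_divide_distrib[symmetric])
      finally show 1: "s (Suc k) - s k = d / real n" by simp
      show "s k \<le> s (Suc k)" using 1 d by (smt (verit) divide_nonneg_nonneg of_nat_0_le_iff)
      have "real (Suc k) / real n \<le> 1" using k n by simp
      then have "d * (real (Suc k) / real n) \<le> d * 1" using d by (intro mult_left_mono) auto
      then show "s (Suc k) \<le> d" by (simp add: s_def)
     qed
     have uv: "norm (?u - ?v) \<le> 3 * d / real n"
     proof -
      have "?u - ?v = - ((d / real n) *\<^sub>R y)" using sk(4) by (simp add: scaleR_left_diff_distrib[symmetric] algebra_simps)
      then have "norm (?u - ?v) = (d / real n) * norm y" using d by simp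
      also have "\<dots> \<le> (d / real n) * 3" using y13 d by (intro mult_left_mono) auto
      also have "(d / real n) * 3 = 3 * d / real n" by simp
      finally show ?thesis .
     qed
     have inball: "norm (x + t *\<^sub>R y) \<le> 7 * r" if "0 \<le> t" "t \<le> d" for t
     proof -
      have "norm (x + t *\<^sub>R y) \<le> norm x + t * norm y" using norm_triangle_ineq[of x "t *\<^sub>R y"] that by simp
      also have "t * norm y \<le> d * 3" using that y13 d by (intro mult_mono) auto
      finally show ?thesis using xr by (simp add: d_def)
     qed
     have "norm (phi ?u - phi ?v) \<le> (g ?v + eps) * norm (?u - ?v)"
     proof (rule differentiable_bound[where S = "closed_segment ?v ?u" and f' = "\<lambda>x z. z \<bullet> grad phi x"])
      fix z assume z: "z \<in> closed_segment ?v ?u"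
      show "(phi has_derivative (\<lambda>h. h \<bullet> grad phi z)) (at z within closed_segment ?v ?u)"
       by (rule has_derivative_at_withinI[OF has_derivative_grad[OF c(1)]])
      have dz: "dist z ?v \<le> norm (?u - ?v)" using z segment_bound1[of z ?v ?u] by (simp add: dist_norm)
      have "closed_segment ?v ?u \<subseteq> cball 0 (7 * r)"
       using inball[of "s k"] inball[of "s (Suc k)"] sk by (intro closed_segment_subset) auto
      then have zb: "z \<in> cball 0 (7 * r)" using z by blast
      have "dist (grad phi z) (grad phi ?v) < eps"
       using dz uv n(2) zb inball[of "s (Suc k)"] sk by (intro delta(2)) auto
      then have "norm (grad phi z) \<le> g ?v + eps"
       using norm_triangle_sub[of "grad phi z" "grad phi ?v"] by (simp add: g_def dist_norm)
      then have "norm (h \<bullet> grad phi z) \<le> (g ?v + eps) * norm h" for h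
       using Cauchy_Schwarz_ineq2[of h "grad phi z"] mult_left_mono[of "norm (grad phi z)" "g ?v + eps" "norm h"] by (simp add: mult.commute)
      then show "onorm (\<lambda>h. h \<bullet> grad phi z) \<le> g ?v + eps" by (rule onorm_le)
     qed auto
     also have "\<dots> \<le> (g ?v + eps) * (3 * d / real n)" using uv eps by (intro mult_left_mono) (auto simp: g_def)
     finally show "\<bar>phi ?u - phi ?v\<bar> \<le> (3 * d / real n) * (g ?v + eps)" by (simp add: mult.commute)
    qed
    finally show ?thesis by (simp add: sum_distrib_left)
   qed
   have pt: "norm (phi x) powr p \<le> K1 * ((\<Sum>k<n. m (Suc k) x powr p) / real n) + K1 * (eps * V3) powr p" if x: "x \<in> \<Omega>" for x
   proof -
    have gi: "integrable (lebesgue_on (ball 0 3)) (\<lambda>y. g (x + t *\<^sub>R y))" for t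
    proof -
     have cc: "continuous_on UNIV (\<lambda>y. g (x + t *\<^sub>R y))"
      by (rule continuous_on_compose2[OF gc]) (auto intro!: continuous_intros)
     have "integrable (lebesgue_on (cball 0 3)) (\<lambda>y. g (x + t *\<^sub>R y))"
      using continuous_locally_integrable[OF cc, of "cball 0 3"] by (simp add: locally_integrable_def)
     then show ?thesis by (rule integrable_lebesgue_on_subset) auto
    qed
    have fin1: "integrable (lebesgue_on (ball a 1)) (\<lambda>_. e)" "integrable (lebesgue_on (ball (0::real^'n) 3)) (\<lambda>_. e)" for e :: real
     by (auto simp: integrable_lebesgue_on_iff intro!: integrable_mult_left integrable_real_indicator emeasure_bounded_finite[unfolded infinity_ennreal_def])
    define f where "f y = (3 * d / real n) * (\<Sum>k<n. g (x + s (Suc k) *\<^sub>R y) + eps)" for y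
    have fi: "integrable (lebesgue_on (ball 0 3)) f"
     unfolding f_def by (intro integrable_mult_right B_integrable_sum B_integrable_add gi fin1)
    have f0: "0 \<le> f y" for y unfolding f_def g_def using d eps by (intro mult_nonneg_nonneg sum_nonneg) auto
    have sub: "ball a 1 \<subseteq> ball 0 3"
    proof
     fix y assume "y \<in> ball a 1"
     then show "y \<in> ball 0 3" using na norm_triangle_ineq4[of a "a - y"] by (auto simp: dist_norm)
    qed
    have fi1: "integrable (lebesgue_on (ball a 1)) f" by (rule integrable_lebesgue_on_subset[OF fi sub]) auto
    \<comment> \<open>The segment estimate is integrated over the directions in
      \<open>ball a 1\<close>; the left side is constant in \<open>y\<close>, the right side becomes
      a sum of averages of the gradient.\<close>
    have "V1 * \<bar>phi x\<bar> = (LINT y|lebesgue_on (ball a 1). \<bar>phi x\<bar>)"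
     by (simp add: V1_def measure_restrict_space)
    also have "\<dots> \<le> (LINT y|lebesgue_on (ball a 1). f y)"
     by (rule integral_mono_AE[OF fin1(1) fi1]) (use segment[OF x] in \<open>auto simp: f_def intro!: AE_I2\<close>)
    also have "\<dots> \<le> (LINT y|lebesgue_on (ball 0 3). f y)"
    proof -
     have "(LINT y|lebesgue. indicator (ball a 1) y *\<^sub>R f y) \<le> (LINT y|lebesgue. indicator (ball 0 3) y *\<^sub>R f y)"
      by (rule integral_mono) (use fi fi1 sub f0 in \<open>auto simp: integrable_lebesgue_on_iff indicator_def\<close>)
     then show ?thesis by (simp add: integral_restrict_space)
    qed
    also have "\<dots> = (3 * d / real n) * (\<Sum>k<n. m (Suc k) x + eps * V3)"
     unfolding f_def m_def V3_def using gi fin1(2)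
     by (simp add: B_integral_sum measure_restrict_space mult.commute)
    finally have V1q: "V1 * \<bar>phi x\<bar> \<le> 3 * d * ((\<Sum>k<n. m (Suc k) x + eps * V3) / real n)" by simp
    have "t \<le> (3 * d / V1) * q" if "V1 * t \<le> 3 * d * q" for t q :: real using that V1 by (simp add: field_simps)
    from this[OF V1q] have "\<bar>phi x\<bar> \<le> (3 * d / V1) * ((\<Sum>k<n. m (Suc k) x + eps * V3) / real n)" .
    then have "norm (phi x) powr p \<le> ((3 * d / V1) * ((\<Sum>k<n. m (Suc k) x + eps * V3) / real n)) powr p"
     using p0 by (intro powr_mono2) auto
    also have "\<dots> = (3 * d / V1) powr p * ((\<Sum>k<n. m (Suc k) x + eps * V3) / real n) powr p"
     using d V1 m0 eps V3 by (intro powr_mult)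
    also have "\<dots> \<le> (3 * d / V1) powr p * ((\<Sum>k<n. (m (Suc k) x + eps * V3) powr p) / real n)"
     using m0 eps V3 n by (intro mult_left_mono powr_mean_le p) auto
    also have "\<dots> \<le> (3 * d / V1) powr p * ((\<Sum>k<n. 2 powr p * (m (Suc k) x powr p + (eps * V3) powr p)) / real n)"
     using m0 eps V3 p0 by (intro mult_left_mono divide_right_mono sum_mono powr_add_le) auto
    also have "\<dots> = K1 * ((\<Sum>k<n. m (Suc k) x powr p) / real n) + K1 * (eps * V3) powr p"
     using n by (simp add: K1_def sum.distrib add_divide_distrib distrib_left flip: sum_distrib_left)
    finally show ?thesis .
   qed
   have "X \<le> (LINT x|lebesgue. K1 * ((\<Sum>k<n. w x * m (Suc k) x powr p) / real n) + K1 * (eps * V3) powr p * (indicator \<Omega> x * w x))"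
    unfolding X
   proof (rule integral_mono_AE[OF Xi])
    show "integrable lebesgue (\<lambda>x. K1 * ((\<Sum>k<n. w x * m (Suc k) x powr p) / real n) + K1 * (eps * V3) powr p * (indicator \<Omega> x * w x))"
     by (intro B_integrable_add integrable_mult_right integrable_divide B_integrable_sum Cm iw)
    show "AE x in lebesgue. norm (phi x) powr p * w x
      \<le> K1 * ((\<Sum>k<n. w x * m (Suc k) x powr p) / real n) + K1 * (eps * V3) powr p * (indicator \<Omega> x * w x)"
     using weight_pos
    proof eventually_elim
     case (elim x)
     show ?case
     proof (cases "x \<in> \<Omega>")
      case True
      have "norm (phi x) powr p * w x \<le> (K1 * ((\<Sum>k<n. m (Suc k) x powr p) / real n) + K1 * (eps * V3) powr p) * w x"
       using elim by (intro mult_right_mono pt True) auto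
      also have "\<dots> = K1 * ((\<Sum>k<n. w x * m (Suc k) x powr p) / real n) + K1 * (eps * V3) powr p * (indicator \<Omega> x * w x)"
      proof -
       have alg: "(K1 * (S / real n) + E) * w x = K1 * (w x * S / real n) + E * (1 * w x)" for S E :: real
        by (simp add: algebra_simps)
       show ?thesis using True by (simp only: alg indicator_simps(1) sum_distrib_left)
      qed
      finally show ?thesis .
     next
      case False
      have "0 \<le> K1 * ((\<Sum>k<n. w x * m (Suc k) x powr p) / real n)"
       using K1 elim by (intro mult_nonneg_nonneg divide_nonneg_nonneg sum_nonneg) auto
      then show ?thesis using False Cc1_outside(1)[OF phi False] p0 by simp
     qed
    qed
   qed
   also have "\<dots> = K1 * ((\<Sum>k<n. LINT x|lebesgue. w x * m (Suc k) x powr p) / real n) + K1 * (eps * V3) powr p * W"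
    using Cm(1) iw Wi by (simp add: B_integral_sum)
   also have "\<dots> \<le> K1 * ((\<Sum>k<n. C * I) / real n) + K1 * (eps * V3) powr p * W"
    using K1 by (intro add_right_mono mult_left_mono divide_right_mono sum_mono Cm) auto
   also have "\<dots> = K1 * C * I + K1 * (eps * V3) powr p * W" using n by simp
   finally show ?thesis .
  qed
  have "X \<le> K1 * C * I"
  proof (rule field_le_epsilon)
   fix e :: real assume e: "0 < e"
   \<comment> \<open>Makes \<open>(eps * V3) powr p\<close> equal to
     \<open>e / (K1 * W + 1)\<close>, so that the whole discretization error is at most
     \<open>e\<close>.\<close>
   define eps where "eps = (e / (K1 * W + 1)) powr (1 / p) / V3"
   have D: "0 < K1 * W + 1" using K1 W0 by (smt (verit) mult_nonneg_nonneg)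
   have eps: "0 < eps" using e D V3 by (simp add: eps_def)
   have "(eps * V3) powr p = e / (K1 * W + 1)" using e D V3 p0 by (simp add: eps_def powr_powr)
   then have "K1 * (eps * V3) powr p * W = e * (K1 * W / (K1 * W + 1))" by simp
   also have "\<dots> \<le> e * 1" using e D K1 W0 by (intro mult_left_mono) (auto simp: divide_le_eq)
   finally show "X \<le> K1 * C * I + e" using est[OF eps] by linarith
  qed
  then show ?thesis by (simp add: I X_def)
 qed
 then show thesis using that[of "K1 * C"] K1 C(1) by simp
qed

end

section \<open>Limits of test functions\<close>

definition jet :: "(real^'n::finite => real) => real^'n => real \<times> (real^'n)" where
 "jet phi x = (phi x, grad phi x)"

definition Lp_closure :: "real => 'a measure => ('a => 'b::euclidean_space) set => ('a => 'b) set" where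
 "Lp_closure p M D = {U \<in> Lp p M. \<forall>e>0. \<exists>V\<in>D. Lp_dist p M V U < e}"

lemma eventually_sequentially_ex: "eventually P sequentially ==> \<exists>n::nat. P n"
 by (auto dest: eventually_happens)

lemma Lp_closure_sequence:
 assumes "U \<in> Lp_closure p M D"
 obtains V where "\<forall>n::nat. V n \<in> D" "Lp_lim p M V U"
proof -
 have "\<exists>V\<in>D. Lp_dist p M V U < 1 / real (Suc n)" for n using assms by (simp add: Lp_closure_def)
 then obtain V where V: "!!n. V n \<in> D" "!!n. Lp_dist p M (V n) U < 1 / real (Suc n)" by metis
 have lim: "(\<lambda>n. 1 / real (Suc n)) \<longlonglongrightarrow> 0" by (rule lim_inverse_Suc)
 have l: "Lp_lim p M V U"
  by (rule tendsto_sandwich[OF _ _ tendsto_const lim])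
   (use V(2) in \<open>auto simp: Lp_dist_nonneg intro!: always_eventually less_imp_le\<close>)
 show thesis by (rule that[of V, OF _ l]) (simp add: V(1))
qed

lemma Lp_closureI:
 assumes "U \<in> Lp p M" "!!n. V n \<in> D" "Lp_lim p M V U"
 shows "U \<in> Lp_closure p M D"
proof -
 have "\<exists>W\<in>D. Lp_dist p M W U < e" if "0 < e" for e
 proof -
  have "eventually (\<lambda>n. Lp_dist p M (V n) U < e) sequentially" by (rule order_tendstoD(2)[OF assms(3) that])
  then obtain n where "Lp_dist p M (V n) U < e" using eventually_sequentially_ex by blast
  then show ?thesis using assms(2) by blast
 qed
 then show ?thesis using assms(1) by (simp add: Lp_closure_def)
qed

lemma Lp_closure_closed:
 assumes p: "0 < p" and D: "D \<subseteq> Lp p M" and U: "U \<in> Lp p M" "!!n. V n \<in> Lp_closure p M D" "Lp_lim p M V U"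
 shows "U \<in> Lp_closure p M D"
proof -
 have "\<exists>W\<in>D. Lp_dist p M W U < e" if e: "0 < e" for e
 proof -
  define d where "d = e / (2 * 2 powr p)"
  have d: "0 < d" using e by (simp add: d_def)
  have "eventually (\<lambda>n. Lp_dist p M (V n) U < d) sequentially" by (rule order_tendstoD(2)[OF U(3) d])
  then obtain n where n: "Lp_dist p M (V n) U < d" using eventually_sequentially_ex by blast
  obtain W where W: "W \<in> D" "Lp_dist p M W (V n) < d" using U(2)[of n] d by (auto simp: Lp_closure_def)
  have "Lp_dist p M W U \<le> 2 powr p * (Lp_dist p M W (V n) + Lp_dist p M (V n) U)"
   by (rule Lp_dist_triangle[OF p]) (use W D U in \<open>auto simp: Lp_closure_def\<close>)
  also have "\<dots> < 2 powr p * (d + d)" using n W(2) by (intro mult_strict_left_mono) auto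
  also have "\<dots> = e" by (simp add: d_def)
  finally show ?thesis using W(1) by blast
 qed
 then show ?thesis using U(1) by (simp add: Lp_closure_def)
qed

lemma Lp_fst_snd:
 assumes "0 < p" "U \<in> Lp p M"
 shows "(\<lambda>x. fst (U x)) \<in> Lp p M" "(\<lambda>x. snd (U x)) \<in> Lp p M"
proof -
 have m: "(\<lambda>x. fst (U x)) \<in> borel_measurable M" "(\<lambda>x. snd (U x)) \<in> borel_measurable M"
  by (rule measurable_fst_snd[OF Lp_measurable[OF assms(2)]])+
 have b: "norm (fst (U x)) powr p \<le> norm (U x) powr p" "norm (snd (U x)) powr p \<le> norm (U x) powr p" for x
  using assms(1) norm_fst_le[of "fst (U x)" "snd (U x)"] norm_snd_le[of "snd (U x)" "fst (U x)"]
  by (auto intro!: powr_mono2)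
 show "(\<lambda>x. fst (U x)) \<in> Lp p M" "(\<lambda>x. snd (U x)) \<in> Lp p M"
  by (rule LpI_bound[OF _ Lp_integrable[OF assms(2)]]; use m b in simp)+
qed

lemma Lp_dist_fst_snd:
 assumes "0 < p" "U \<in> Lp p M" "V \<in> Lp p M"
 shows "Lp_dist p M (\<lambda>x. fst (U x)) (\<lambda>x. fst (V x)) \<le> Lp_dist p M U V"
  "Lp_dist p M (\<lambda>x. snd (U x)) (\<lambda>x. snd (V x)) \<le> Lp_dist p M U V"
proof -
 have b: "norm (fst (U x) - fst (V x)) powr p \<le> norm (U x - V x) powr p"
  "norm (snd (U x) - snd (V x)) powr p \<le> norm (U x - V x) powr p" for x
 proof -
  have e: "(fst (U x) - fst (V x), snd (U x) - snd (V x)) = U x - V x" by (simp add: prod_eq_iff)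
  show "norm (fst (U x) - fst (V x)) powr p \<le> norm (U x - V x) powr p"
   "norm (snd (U x) - snd (V x)) powr p \<le> norm (U x - V x) powr p"
   using assms(1) norm_fst_le[of "fst (U x) - fst (V x)" "snd (U x) - snd (V x)"]
    norm_snd_le[of "snd (U x) - snd (V x)" "fst (U x) - fst (V x)"]
   unfolding e by (auto intro!: powr_mono2)
 qed
 note i = Lp_fst_snd[OF assms(1,2)] Lp_fst_snd[OF assms(1,3)]
 show "Lp_dist p M (\<lambda>x. fst (U x)) (\<lambda>x. fst (V x)) \<le> Lp_dist p M U V"
  by (rule integral_mono[OF Lp_diff_integrable[OF assms(1) i(1,3)] Lp_diff_integrable[OF assms] b(1)])
 show "Lp_dist p M (\<lambda>x. snd (U x)) (\<lambda>x. snd (V x)) \<le> Lp_dist p M U V"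
  by (rule integral_mono[OF Lp_diff_integrable[OF assms(1) i(2,4)] Lp_diff_integrable[OF assms] b(2)])
qed

lemma Lp_tendsto_fst_snd:
 assumes "0 < p" "!!n. U n \<in> Lp p M" "V \<in> Lp p M" "Lp_lim p M U V"
 shows "(\<lambda>n. Lp_dist p M (\<lambda>x. fst (U n x)) (\<lambda>x. fst (V x))) \<longlonglongrightarrow> 0"
  "(\<lambda>n. Lp_dist p M (\<lambda>x. snd (U n x)) (\<lambda>x. snd (V x))) \<longlonglongrightarrow> 0"
 by (rule tendsto_sandwich[OF _ _ tendsto_const assms(4)];
   use Lp_dist_fst_snd[OF assms(1) assms(2) assms(3)] in \<open>simp add: Lp_dist_nonneg\<close>)+

context weighted_domain
begin

abbreviation M :: "(real^'n) measure" where "M \<equiv> wmeasure \<Omega>"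

lemma Lp_M_measurable: "f \<in> Lp p M ==> f \<in> borel_measurable \<L>"
 using Lp_measurable[of f p M] measurable_wmeasure by blast

lemma Lp_M_integrable:
 fixes f :: "real^'n => 'c::euclidean_space"
 shows "f \<in> Lp p M ==> integrable \<L> f"
 by (rule Lp_wmeasure_integrable_on_bounded[OF dom_sets bounded_dom])

text \<open>The flux is integrated against \<open>w dx\<close> but the source against
  \<open>dx\<close>. Division by the weight brings both under the one measure on which the abstract
  operator lives.\<close>

lemma divide_weight:
 fixes f :: "real^'n => real"
 assumes f: "integrable \<L> f"
 shows "integrable M (\<lambda>x. f x / w x)" "(LINT x|M. f x / w x) = (LINT x|\<L>. f x)"
proof -
 have m: "(\<lambda>x. f x / w x) \<in> borel_measurable \<L>"
  by (intro borel_measurable_divide borel_measurable_integrable[OF f] weight_measurable_on)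
 have mw: "(\<lambda>x. w x *\<^sub>R (f x / w x)) \<in> borel_measurable \<L>"
  by (intro borel_measurable_scaleR weight_measurable_on m)
 have eq: "AE x in \<L>. f x = w x *\<^sub>R (f x / w x)"
  using weight_pos_on[OF dom_sets] by eventually_elim simp
 show "integrable M (\<lambda>x. f x / w x)"
  unfolding integrable_wmeasure[OF dom_sets m] by (rule integrable_on_cong_AE[OF f mw eq])
 show "(LINT x|M. f x / w x) = (LINT x|\<L>. f x)" unfolding integral_wmeasure[OF dom_sets m]
  by (rule integral_cong_AE[OF mw borel_measurable_integrable[OF f]], rule eventually_mono[OF eq], erule sym)
qed

lemma AE_M: "(AE x in M. P x) \<longleftrightarrow> (AE x in \<L>. P x)"
 by (rule AE_wmeasure[OF dom_sets])

lemma jet_Lp: "phi \<in> Cc1 \<Omega>' ==> jet phi \<in> Lp p M"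
 unfolding jet_def[abs_def] by (intro Lp_Pair p0 Cc1_Lp dom_sets)

text \<open>Hoelder with the dual weight turns convergence in the weighted space into convergence in
  unweighted \<open>L^1\<close>, which tolerates bounded multipliers.\<close>

lemma Lp_tendsto_integral_mult:
 fixes F :: "nat => real^'n => 'c::euclidean_space"
 assumes F: "!!n. F n \<in> Lp p M" "f \<in> Lp p M" "Lp_lim p M F f"
  and b: "b \<in> borel_measurable \<L>" "!!x. \<bar>b x\<bar> \<le> (L::real)"
 shows "(\<lambda>n. LINT x|\<L>. b x *\<^sub>R F n x) \<longlonglongrightarrow> (LINT x|\<L>. b x *\<^sub>R f x)"
proof -
 define T where "T = (LINT x|\<L>. dual_weight x)"
 define D where "D n = (LINT x|\<L>. norm (F n x - f x))" for n
 have d: "(\<lambda>x. F n x - f x) \<in> Lp p M" for n by (rule Lp_diff[OF p0 F(1,2)])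
 have D0: "0 \<le> D n" for n unfolding D_def by (intro integral_nonneg_AE) auto
 have Dp: "D n powr p \<le> 2 powr p * Lp_dist p M (F n) f * T powr (p - 1)" for n
 proof -
  have "(LINT x|\<L>. norm (F n x - f x)) powr p
   \<le> 2 powr p * (LINT x|\<L>. norm (F n x - f x) powr p * w x) * (LINT x|\<L>. dual_weight x) powr (p - 1)"
  proof (rule weighted_holder(2)[OF p _ _ weight_pos_on[OF dom_sets]])
   show "(\<lambda>x. norm (F n x - f x)) \<in> borel_measurable \<L>"
    by (rule measurable_compose[OF Lp_M_measurable[OF d] borel_measurable_norm])
   show "integrable \<L> (\<lambda>x. norm (F n x - f x) powr p * w x)"
    using d[of n] by (simp add: Lp_wmeasure_iff[OF dom_sets])
  qed (use dual_weight_integrable_bounded[OF bounded_dom dom_sets] in auto)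
  then show ?thesis
   unfolding D_def T_def norm_powr_integral_wmeasure[OF dom_sets Lp_M_measurable[OF d]] .
 qed
 have "(\<lambda>n. D n powr p) \<longlonglongrightarrow> 0"
 proof (rule tendsto_sandwich[OF _ _ tendsto_const])
  have "(\<lambda>n. 2 powr p * Lp_dist p M (F n) f * T powr (p - 1)) \<longlonglongrightarrow> 2 powr p * 0 * T powr (p - 1)"
   by (intro tendsto_mult F(3) tendsto_const)
  then show "(\<lambda>n. 2 powr p * Lp_dist p M (F n) f * T powr (p - 1)) \<longlonglongrightarrow> 0" by simp
 qed (use Dp in auto)
 then have "(\<lambda>n. (D n powr p) powr (1 / p)) \<longlonglongrightarrow> 0 powr (1 / p)"
  using p0 by (intro tendsto_powr' tendsto_const) auto
 then have Dlim: "(\<lambda>n. D n) \<longlonglongrightarrow> 0" using p0 D0 by (simp add: powr_powr)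
 have iF': "integrable \<L> (\<lambda>x. b x *\<^sub>R h x)" if "h \<in> Lp p M" for h :: "real^'n => 'c"
  by (rule integrable_mult_bounded[OF Lp_M_integrable[OF that] b(1), of L]) (use b(2) in simp)
 note iF = iF'[OF F(1)] iF'[OF F(2)]
 have bd: "norm ((LINT x|\<L>. b x *\<^sub>R F n x) - (LINT x|\<L>. b x *\<^sub>R f x)) \<le> L * D n" for n
 proof -
  have "(LINT x|\<L>. b x *\<^sub>R F n x) - (LINT x|\<L>. b x *\<^sub>R f x) = (LINT x|\<L>. b x *\<^sub>R (F n x - f x))"
   unfolding scaleR_diff_right by (rule B_integral_diff[symmetric, OF iF])
  also have "norm \<dots> \<le> (LINT x|\<L>. L * norm (F n x - f x))"
  proof (rule B_integral_norm_bound_integral)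
   show "integrable \<L> (\<lambda>x. b x *\<^sub>R (F n x - f x))"
    unfolding scaleR_diff_right by (rule B_integrable_diff[OF iF])
   show "integrable \<L> (\<lambda>x. L * norm (F n x - f x))"
    by (intro integrable_mult_right integrable_norm Lp_M_integrable d)
   show "norm (b x *\<^sub>R (F n x - f x)) \<le> L * norm (F n x - f x)" for x
    using b(2)[of x] by (simp add: mult_right_mono)
  qed
  also have "\<dots> = L * D n" by (simp add: D_def)
  finally show ?thesis .
 qed
 have "(\<lambda>n. L * D n) \<longlonglongrightarrow> 0" using tendsto_mult_right_zero[OF Dlim] .
 then have "(\<lambda>n. (LINT x|\<L>. b x *\<^sub>R F n x) - (LINT x|\<L>. b x *\<^sub>R f x)) \<longlonglongrightarrow> 0"
  by (rule Lim_null_comparison[rotated]) (use bd in \<open>simp add: always_eventually\<close>)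
 then show ?thesis by (rule LIM_zero_cancel)
qed

lemma Lp_tendsto_nth:
 assumes F: "!!n. F n \<in> Lp p M" "(f :: real^'n => real^'n) \<in> Lp p M" "Lp_lim p M F f"
 shows "!!n. (\<lambda>x. F n x $ i) \<in> Lp p M" "(\<lambda>x. f x $ i) \<in> Lp p M" "(\<lambda>n. Lp_dist p M (\<lambda>x. F n x $ i) (\<lambda>x. f x $ i)) \<longlonglongrightarrow> 0"
proof -
 have L: "(\<lambda>x. h x $ i) \<in> Lp p M" if "h \<in> Lp p M" for h :: "real^'n => real^'n"
  by (rule LpI_bound[OF measurable_vec_nth[OF Lp_measurable[OF that]] Lp_integrable[OF that]])
   (use p0 in \<open>auto intro!: AE_I2 powr_mono2 component_le_norm_cart\<close>)
 show 1: "(\<lambda>x. F n x $ i) \<in> Lp p M" for n by (rule L[OF F(1)])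
 show 2: "(\<lambda>x. f x $ i) \<in> Lp p M" by (rule L[OF F(2)])
 show "(\<lambda>n. Lp_dist p M (\<lambda>x. F n x $ i) (\<lambda>x. f x $ i)) \<longlonglongrightarrow> 0"
 proof (rule tendsto_sandwich[OF _ _ tendsto_const F(3)])
  have "Lp_dist p M (\<lambda>x. F n x $ i) (\<lambda>x. f x $ i) \<le> Lp_dist p M (F n) f" for n
  proof (rule integral_mono[OF Lp_diff_integrable[OF p0 1 2] Lp_diff_integrable[OF p0 F(1,2)]])
   fix x show "norm (F n x $ i - f x $ i) powr p \<le> norm (F n x - f x) powr p"
    using component_le_norm_cart[of "F n x - f x" i] p0 by (intro powr_mono2) auto
  qed
  then show "\<forall>\<^sub>F n in sequentially. Lp_dist p M (\<lambda>x. F n x $ i) (\<lambda>x. f x $ i) \<le> Lp_dist p M (F n) f" by simp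
 qed (simp add: Lp_dist_nonneg)
qed

lemma Lp_M_locally_integrable:
 fixes f :: "real^'n => 'c::euclidean_space"
 assumes "f \<in> Lp p M" shows "locally_integrable \<Omega> f"
 unfolding locally_integrable_def
 by (intro allI impI integrable_lebesgue_on_subset[OF Lp_M_integrable[OF assms]])
  (auto simp: dom_sets compact_imp_closed)

text \<open>Integration by parts holds for each test function and survives the limit because a test
  function and its partial derivatives are bounded multipliers.\<close>

lemma has_weak_grad_limit:
 assumes V: "!!n. phi n \<in> Cc1 \<Omega>" and U: "U \<in> Lp p M" and lim: "(\<lambda>n. Lp_dist p M (jet (phi n)) U) \<longlonglongrightarrow> 0"
 shows "has_weak_grad \<Omega> (\<lambda>x. fst (U x)) (\<lambda>x. snd (U x))"
proof -
 note jl = jet_Lp[OF V]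
 have l1: "(\<lambda>n. Lp_dist p M (phi n) (\<lambda>x. fst (U x))) \<longlonglongrightarrow> 0"
  using Lp_tendsto_fst_snd(1)[OF p0 jl U lim] by (simp add: jet_def)
 have l2: "(\<lambda>n. Lp_dist p M (grad (phi n)) (\<lambda>x. snd (U x))) \<longlonglongrightarrow> 0"
  using Lp_tendsto_fst_snd(2)[OF p0 jl U lim] by (simp add: jet_def)
 note c1 = Cc1_Lp[OF V dom_sets] and c2 = Lp_fst_snd[OF p0 U]
 show ?thesis
  unfolding has_weak_grad_def
 proof (intro conjI ballI allI)
  show "locally_integrable \<Omega> (\<lambda>x. fst (U x))" "locally_integrable \<Omega> (\<lambda>x. snd (U x))"
   by (intro Lp_M_locally_integrable c2)+
  fix psi i assume psi: "psi \<in> Cc_inf \<Omega>"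
  note c = Cc1_D[OF Cc_inf_imp_Cc1[OF psi]]
  obtain L where L: "!!x. norm (psi x) \<le> L" using continuous_compact_support_bounded[OF c(4,5,7)] by blast
  obtain L' where L': "!!x. norm (grad psi x) \<le> L'" using continuous_compact_support_bounded[OF c(3,5,8)] by blast
  have L'': "\<bar>partial_deriv i psi x\<bar> \<le> L'" for x
   using component_le_norm_cart[of "grad psi x" i] L'[of x] by (simp add: grad_nth)
  have m: "psi \<in> borel_measurable \<L>" "partial_deriv i psi \<in> borel_measurable \<L>"
   by (intro measurable_restrict_space1 borel_measurable_lebesgue_continuous c)+
  have "(\<lambda>n. LINT x|\<L>. partial_deriv i psi x *\<^sub>R phi n x) \<longlonglongrightarrow> (LINT x|\<L>. partial_deriv i psi x *\<^sub>R fst (U x))"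
   by (rule Lp_tendsto_integral_mult[OF c1(1) c2(1) l1 m(2) L''])
  moreover have "(\<lambda>n. LINT x|\<L>. psi x *\<^sub>R (grad (phi n) x $ i)) \<longlonglongrightarrow> (LINT x|\<L>. psi x *\<^sub>R (snd (U x) $ i))"
   by (rule Lp_tendsto_integral_mult[OF Lp_tendsto_nth[OF c1(2) c2(2) l2] m(1) L[unfolded real_norm_def]])
  then have "(\<lambda>n. - (LINT x|\<L>. psi x *\<^sub>R (grad (phi n) x $ i))) \<longlonglongrightarrow> - (LINT x|\<L>. psi x *\<^sub>R (snd (U x) $ i))"
   by (rule tendsto_minus)
  moreover have "(LINT x|\<L>. partial_deriv i psi x *\<^sub>R phi n x) = - (LINT x|\<L>. psi x *\<^sub>R (grad (phi n) x $ i))" for n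
   using has_weak_grad_Cc1[OF V dom_sets, of n] psi by (simp add: has_weak_grad_def mult.commute)
  ultimately have "(LINT x|\<L>. partial_deriv i psi x *\<^sub>R fst (U x)) = - (LINT x|\<L>. psi x *\<^sub>R (snd (U x) $ i))"
   using LIMSEQ_unique by simp
  then show "(LINT x|\<L>. fst (U x) * partial_deriv i psi x) = - (LINT x|\<L>. snd (U x) $ i * psi x)"
   by (simp add: mult.commute)
 qed
qed

lemma grad_mollify_Cc1:
 assumes "phi \<in> Cc1 \<Omega>'"
 shows "grad (mollify n phi) x = mollify n (grad phi) x"
proof -
 note c = Cc1_D[OF assms]
 have "integrable lebesgue phi" by (rule continuous_compact_support_integrable[OF c(4,5,7)])
 moreover have "integrable lebesgue (grad phi)" by (rule continuous_compact_support_integrable[OF c(3,5,8)])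
 ultimately show ?thesis
  using mollify_weak_grad[OF has_weak_grad_Cc1[OF assms, of UNIV], of x n UNIV] by simp
qed

text \<open>The space \<open>W1p_0\<close> is defined by smooth functions, whereas the truncations
  used for comparison are only \<open>C^1\<close>. Mollification bridges the two, and it commutes
  with the gradient.\<close>

lemma Cc_inf_approx:
 assumes phi: "phi \<in> Cc1 \<Omega>" and e: "0 < e"
 shows "\<exists>psi\<in>Cc_inf \<Omega>. Lp_dist p M psi phi < e \<and> Lp_dist p M (grad psi) (grad phi) < e"
proof -
 note c = Cc1_D[OF phi]
 let ?S = "closure {x. phi x \<noteq> 0}"
 have bS: "bounded ?S" by (rule compact_imp_bounded[OF c(5)])
 obtain d where d: "0 < d" "(\<Union>x\<in>?S. cball x d) \<subseteq> \<Omega>" "compact (\<Union>x\<in>?S. cball x d)"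
  by (rule compact_neighbourhood[OF c(5) open_dom c(6)])
 have i: "integrable lebesgue phi" by (rule continuous_compact_support_integrable[OF c(4,5,7)])
 have m1: "mollify n phi \<in> Lp p (wmeasure UNIV)" "(\<lambda>n. Lp_dist p (wmeasure UNIV) (mollify n phi) phi) \<longlonglongrightarrow> 0" for n
  by (rule mollify_tendsto[OF Cc1_Lp_UNIV(1)[OF phi] bS c(7)]; assumption)+
 have m2: "mollify n (grad phi) \<in> Lp p (wmeasure UNIV)"
  "(\<lambda>n. Lp_dist p (wmeasure UNIV) (mollify n (grad phi)) (grad phi)) \<longlonglongrightarrow> 0" for n
  by (rule mollify_tendsto[OF Cc1_Lp_UNIV(2)[OF phi] bS c(8)]; assumption)+
 from order_tendstoD(2)[OF lim_inverse_Suc d(1)] order_tendstoD(2)[OF m1(2) e] order_tendstoD(2)[OF m2(2) e]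
 have "\<forall>\<^sub>F n in sequentially. 1 / real (Suc n) < d \<and> Lp_dist p (wmeasure UNIV) (mollify n phi) phi < e
   \<and> Lp_dist p (wmeasure UNIV) (mollify n (grad phi)) (grad phi) < e" by eventually_elim simp
 then obtain n where n: "1 / real (Suc n) < d" "Lp_dist p (wmeasure UNIV) (mollify n phi) phi < e"
  "Lp_dist p (wmeasure UNIV) (mollify n (grad phi)) (grad phi) < e"
  using eventually_sequentially_ex by blast
 have "mollify n phi \<in> Cc_inf \<Omega>" by (rule mollify_Cc_inf(1)[OF i c(7) d(2,3) less_imp_le[OF n(1)]])
 moreover have "Lp_dist p M (mollify n phi) phi < e"
  by (rule le_less_trans[OF Lp_wmeasure_mono(2)[OF _ dom_sets _ Lp_diff[OF p0 m1(1) Cc1_Lp_UNIV(1)[OF phi]]] n(2)]) auto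
 moreover have "Lp_dist p M (grad (mollify n phi)) (grad phi) < e"
  unfolding grad_mollify_Cc1[OF phi]
  by (rule le_less_trans[OF Lp_wmeasure_mono(2)[OF _ dom_sets _ Lp_diff[OF p0 m2(1) Cc1_Lp_UNIV(2)[OF phi]]] n(3)]) auto
 ultimately show ?thesis by blast
qed

lemma W1p_norm_eq:
 assumes wg: "has_weak_grad \<Omega> u G" and u: "u \<in> Lp p M" and G: "G \<in> Lp p M"
 shows "u \<in> W1p p w \<Omega>"
  "W1p_norm p w \<Omega> u = Lp_int p M u powr (1 / p) + Lp_int p M G powr (1 / p)"
proof -
 have eq: "AE x in \<L>. weak_grad \<Omega> u x = G x" by (rule weak_grad_AE_eq[OF open_dom wg])
 have wm: "weak_grad \<Omega> u \<in> borel_measurable \<L>"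
  using has_weak_grad_weak_grad[OF wg] by (intro locally_integrable_measurable(2) open_dom) (simp add: has_weak_grad_def)
 have "weak_grad \<Omega> u \<in> Lp p M"
  by (rule LpI_bound[OF _ Lp_integrable[OF G]]) (use wm eq in \<open>auto simp: measurable_wmeasure AE_M elim!: eventually_mono\<close>)
 then show "u \<in> W1p p w \<Omega>" using wg u unfolding W1p_def by (auto simp: Lp_wmeasure_iff[OF dom_sets])
 have "(LINT x|M. norm (weak_grad \<Omega> u x) powr p) = Lp_int p M G"
  by (rule integral_cong_AE)
   (use eq norm_powr_measurable_on[OF wm] norm_powr_measurable_on[OF Lp_M_measurable[OF G]] in \<open>auto simp: measurable_wmeasure AE_M elim!: eventually_mono\<close>)
 then have e2: "(LINT x|\<L>. norm (weak_grad \<Omega> u x) powr p * w x) = Lp_int p M G"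
  by (simp only: norm_powr_integral_wmeasure[OF dom_sets wm])
 have e1: "(LINT x|\<L>. \<bar>u x\<bar> powr p * w x) = Lp_int p M u"
  using norm_powr_integral_wmeasure[OF dom_sets Lp_M_measurable[OF u]] by simp
 show "W1p_norm p w \<Omega> u = Lp_int p M u powr (1 / p) + Lp_int p M G powr (1 / p)"
  unfolding W1p_norm_def e1 e2 by (rule refl)
qed

text \<open>Returns from limits of jets to the official space: the second component is a weak
  gradient, hence agrees almost everywhere with the chosen one.\<close>

lemma W1p_0_limit:
 assumes U: "U \<in> Lp_closure p M (jet ` Cc1 \<Omega>)"
 shows "(\<lambda>x. fst (U x)) \<in> W1p_0 p w \<Omega>" "AE x in \<L>. weak_grad \<Omega> (\<lambda>x. fst (U x)) x = snd (U x)"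
proof -
 have UL: "U \<in> Lp p M" using U by (simp add: Lp_closure_def)
 obtain V where V: "\<forall>n::nat. V n \<in> jet ` Cc1 \<Omega>" "Lp_lim p M V U"
  by (rule Lp_closure_sequence[OF U])
 have "\<exists>phi. phi \<in> Cc1 \<Omega> \<and> V n = jet phi" for n using V(1) by auto
 then obtain phi where phi: "!!n. phi n \<in> Cc1 \<Omega>" "!!n. V n = jet (phi n)" by metis
 have lim: "(\<lambda>n. Lp_dist p M (jet (phi n)) U) \<longlonglongrightarrow> 0" using V(2) by (simp add: phi(2))
 note wg = has_weak_grad_limit[OF phi(1) UL lim]
 note c2 = Lp_fst_snd[OF p0 UL]
 show "AE x in \<L>. weak_grad \<Omega> (\<lambda>x. fst (U x)) x = snd (U x)" by (rule weak_grad_AE_eq[OF open_dom wg])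
 have "\<exists>psi\<in>Cc_inf \<Omega>. W1p_norm p w \<Omega> (\<lambda>x. fst (U x) - psi x) < eps" if eps: "0 < eps" for eps
 proof -
  \<comment> \<open>Two errors of size \<open>e\<close>, enlarged by the triangle factor
    \<open>2 powr p\<close>, add up to \<open>(eps / 3) powr p\<close>; after taking roots, function
    and gradient contribute \<open>eps / 3\<close> each.\<close>
  define e where "e = (eps / 3) powr p / (2 * 2 powr p)"
  have e: "0 < e" using eps by (simp add: e_def)
  have "eventually (\<lambda>n. Lp_dist p M (jet (phi n)) U < e) sequentially" by (rule order_tendstoD(2)[OF lim e])
  then obtain n where n: "Lp_dist p M (jet (phi n)) U < e" using eventually_sequentially_ex by blast
  obtain psi where psi: "psi \<in> Cc_inf \<Omega>" "Lp_dist p M psi (phi n) < e" "Lp_dist p M (grad psi) (grad (phi n)) < e"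
   using Cc_inf_approx[OF phi(1)[of n] e] by blast
  note psi1 = Cc_inf_imp_Cc1[OF psi(1)]
  note Lpsi = Cc1_Lp[OF psi1 dom_sets] and Lphi = Cc1_Lp[OF phi(1)[of n] dom_sets]
  have n1: "Lp_dist p M (phi n) (\<lambda>x. fst (U x)) < e" "Lp_dist p M (grad (phi n)) (\<lambda>x. snd (U x)) < e"
   using Lp_dist_fst_snd[OF p0 jet_Lp[OF phi(1)[of n]] UL] n by (auto simp: jet_def)
  have "Lp_dist p M psi (\<lambda>x. fst (U x)) \<le> 2 powr p * (Lp_dist p M psi (phi n) + Lp_dist p M (phi n) (\<lambda>x. fst (U x)))"
   by (rule Lp_dist_triangle[OF p0 Lpsi(1) Lphi(1) c2(1)])
  also have "\<dots> \<le> 2 powr p * (e + e)" using psi n1 by (intro mult_left_mono) auto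
  also have "\<dots> = (eps / 3) powr p" by (simp add: e_def)
  finally have 1: "Lp_dist p M (\<lambda>x. fst (U x)) psi \<le> (eps / 3) powr p" by (subst Lp_dist_commute)
  have "Lp_dist p M (grad psi) (\<lambda>x. snd (U x)) \<le> 2 powr p * (Lp_dist p M (grad psi) (grad (phi n)) + Lp_dist p M (grad (phi n)) (\<lambda>x. snd (U x)))"
   by (rule Lp_dist_triangle[OF p0 Lpsi(2) Lphi(2) c2(2)])
  also have "\<dots> \<le> 2 powr p * (e + e)" using psi n1 by (intro mult_left_mono) auto
  also have "\<dots> = (eps / 3) powr p" by (simp add: e_def)
  finally have 2: "Lp_dist p M (\<lambda>x. snd (U x)) (grad psi) \<le> (eps / 3) powr p" by (subst Lp_dist_commute)
  have r: "t powr (1 / p) \<le> eps / 3" if "0 \<le> t" "t \<le> (eps / 3) powr p" for t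
  proof -
   have "t powr (1 / p) \<le> ((eps / 3) powr p) powr (1 / p)" using that p0 by (intro powr_mono2) auto
   then show ?thesis using p0 eps by (simp add: powr_powr)
  qed
  have "W1p_norm p w \<Omega> (\<lambda>x. fst (U x) - psi x)
    = Lp_dist p M (\<lambda>x. fst (U x)) psi powr (1 / p) + Lp_dist p M (\<lambda>x. snd (U x)) (grad psi) powr (1 / p)"
   by (rule W1p_norm_eq(2)[OF has_weak_grad_diff[OF dom_sets wg has_weak_grad_Cc1[OF psi1 dom_sets]]
      Lp_diff[OF p0 c2(1) Lpsi(1)] Lp_diff[OF p0 c2(2) Lpsi(2)]])
  also have "\<dots> \<le> eps / 3 + eps / 3" by (intro add_mono r 1 2 Lp_dist_nonneg)
  also have "\<dots> < eps" using eps by simp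
  finally show ?thesis using psi(1) by blast
 qed
 then show "(\<lambda>x. fst (U x)) \<in> W1p_0 p w \<Omega>"
  unfolding W1p_0_def using W1p_norm_eq(1)[OF wg c2] by blast
qed

text \<open>Membership in the local space gives a weak gradient on each subdomain separately, while
  the inequality for \<open>v\<close> mentions the gradient on all of the domain. Gluing shows that
  the latter exists, and uniqueness transfers the local integrability to it.\<close>

lemma W1p_loc_D:
 assumes v: "v \<in> W1p_loc p w \<Omega>"
 shows "has_weak_grad \<Omega> v (weak_grad \<Omega> v)"
  "!!K. compact K ==> K \<subseteq> \<Omega> ==> v \<in> Lp p (wmeasure K) \<and> weak_grad \<Omega> v \<in> Lp p (wmeasure K)"
proof -
 have "\<exists>g. has_weak_grad \<Omega>' v g" if "open \<Omega>'" "\<Omega>' \<Subset> \<Omega>" for \<Omega>'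
  using v that by (auto simp: W1p_loc_def W1p_def)
 then obtain g where "has_weak_grad \<Omega> v g" using has_weak_grad_glue[OF open_dom] by blast
 then show wg: "has_weak_grad \<Omega> v (weak_grad \<Omega> v)" by (rule has_weak_grad_weak_grad)
 fix K assume K: "compact K" "K \<subseteq> \<Omega>"
 obtain d where d: "0 < d" "(\<Union>x\<in>K. cball x d) \<subseteq> \<Omega>" "compact (\<Union>x\<in>K. cball x d)"
  by (rule compact_neighbourhood[OF K(1) open_dom K(2)])
 define O' where "O' = (\<Union>x\<in>K. ball x d)"
 have oO': "open O'" by (auto simp: O'_def)
 then have O': "open O'" "O' \<in> sets lebesgue" "K \<subseteq> O'" using d(1) by (simp_all, auto simp: O'_def)
 have Oc: "O' \<subseteq> (\<Union>x\<in>K. cball x d)" by (auto simp: O'_def)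
 then have cl: "closure O' \<subseteq> (\<Union>x\<in>K. cball x d)" by (rule closure_minimal) (rule compact_imp_closed[OF d(3)])
 have "compact (closure O')" using cl d(3) by (meson bounded_subset closed_closure compact_eq_bounded_closed)
 then have "O' \<Subset> \<Omega>" using cl d(2) by (auto simp: compactly_contained_def)
 then have vW: "v \<in> W1p p w O'" using v O'(1) by (simp add: W1p_loc_def)
 then obtain g where g: "has_weak_grad O' v g" by (auto simp: W1p_def)
 have OO: "O' \<subseteq> \<Omega>" by (rule subset_trans[OF Oc d(2)])
 have eq: "AE x in lebesgue_on O'. weak_grad O' v x = weak_grad \<Omega> v x"
  by (rule has_weak_grad_unique[OF O'(1) has_weak_grad_weak_grad[OF g] has_weak_grad_subset[OF wg OO dom_sets O'(2)]])
 have vm: "v \<in> Lmeas (O')"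
  using g by (intro locally_integrable_measurable(2) O'(1)) (simp add: has_weak_grad_def)
 have gm: "weak_grad O' v \<in> Lmeas (O')"
  using has_weak_grad_weak_grad[OF g] by (intro locally_integrable_measurable(2) O'(1)) (simp add: has_weak_grad_def)
 have gm': "weak_grad \<Omega> v \<in> Lmeas (O')"
  using has_weak_grad_subset[OF wg OO dom_sets O'(2)] by (intro locally_integrable_measurable(2) O'(1)) (simp add: has_weak_grad_def)
 have vL: "v \<in> Lp p (wmeasure O')" using vW vm by (simp add: Lp_wmeasure_iff[OF O'(2)] W1p_def)
 have gL: "weak_grad O' v \<in> Lp p (wmeasure O')" using vW gm by (simp add: Lp_wmeasure_iff[OF O'(2)] W1p_def)
 have gL': "weak_grad \<Omega> v \<in> Lp p (wmeasure O')"
  by (rule LpI_bound[OF _ Lp_integrable[OF gL]]) (use gm' eq in \<open>auto simp: measurable_wmeasure AE_wmeasure[OF O'(2)] elim!: eventually_mono\<close>)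
 have Km: "K \<in> sets lebesgue" using K(1) by (simp add: compact_imp_closed)
 show "v \<in> Lp p (wmeasure K) \<and> weak_grad \<Omega> v \<in> Lp p (wmeasure K)"
  by (intro conjI Lp_wmeasure_mono(1)[OF O'(3) Km O'(2) vL] Lp_wmeasure_mono(1)[OF O'(3) Km O'(2) gL'])
qed

lemma W1p_loc_measurable:
 assumes "v \<in> W1p_loc p w \<Omega>"
 shows "v \<in> borel_measurable \<L>" "weak_grad \<Omega> v \<in> borel_measurable \<L>"
 using W1p_loc_D(1)[OF assms] by (auto intro!: locally_integrable_measurable(2) open_dom simp: has_weak_grad_def)

end

section \<open>The operator\<close>

text \<open>A simple function takes finitely many values, where measurability for a fixed second
  argument suffices; continuity in that argument passes to the limit.\<close>

lemma caratheodory_composition_measurable: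
 fixes a :: "'a => 'b::euclidean_space => 'c::euclidean_space"
 assumes meas: "!!zeta. (\<lambda>x. a x zeta) \<in> borel_measurable N" and cont: "!!x. continuous_on UNIV (a x)"
  and W: "W \<in> borel_measurable N"
 shows "(\<lambda>x. a x (W x)) \<in> borel_measurable N"
proof -
 have "\<exists>F. (\<forall>i. simple_function N (F i)) \<and> (\<forall>x\<in>space N. (\<lambda>i. F i x) \<longlonglongrightarrow> W x)"
  using borel_measurable_implies_sequence_metric[OF W, of 0] by blast
 then obtain F where F: "!!i. simple_function N (F i)" "!!x. x \<in> space N ==> (\<lambda>i. F i x) \<longlonglongrightarrow> W x" by blast
 have m: "(\<lambda>x. a x (F i x)) \<in> borel_measurable N" for i
 proof (rule measurable_compose_countable'[where f = "\<lambda>zeta x. a x zeta" and g = "F i" and I = "F i ` space N"])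
  show "F i \<in> measurable N (count_space (F i ` space N))"
   using F(1)[of i] by (auto simp: simple_function_def measurable_count_space_eq2)
  show "countable (F i ` space N)" using F(1)[of i] by (auto simp: simple_function_def intro: countable_finite)
 qed (rule meas)
 show ?thesis
 proof (rule borel_measurable_LIMSEQ_metric[OF m])
  fix x assume "x \<in> space N"
  then show "(\<lambda>i. a x (F i x)) \<longlonglongrightarrow> a x (W x)"
   using cont[of x] F(2) by (intro isCont_tendsto_compose[where g = "a x"]) (auto simp: continuous_on_eq_continuous_at)
 qed
qed

text \<open>Here \<open>a\<close> is \<open>\<A> / w\<close>, redefined as \<open>0\<close> on a null set so that continuity and growth hold
 everywhere.\<close>

locale flux = weighted_domain p w \<Omega> for p :: real and w :: "real^'n::finite => real" and \<Omega> +
 fixes a :: "real^'n => real^'n => real^'n" and c :: real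
 assumes flux_measurable: "!!zeta. (\<lambda>x. a x zeta) \<in> borel_measurable \<L>"
  and flux_continuous: "!!x. continuous_on UNIV (a x)"
  and flux_growth: "!!x zeta. norm (a x zeta) \<le> norm zeta powr (p - 1)"
  and flux_coercive: "AE x in \<L>. \<forall>zeta. norm zeta powr p \<le> a x zeta \<bullet> zeta"
  and c: "0 < c"
  and flux_strongly_monotone: "AE x in \<L>. \<forall>zeta eta. zeta \<noteq> eta -->
   c * norm (zeta - eta) powr (max p 2) * (norm zeta powr p + norm eta powr p) powr (1 - max p 2 / p) \<le> (a x zeta - a x eta) \<bullet> (zeta - eta)"
begin

lemma flux_compose_measurable: "W \<in> borel_measurable \<L> ==> (\<lambda>x. a x (W x)) \<in> borel_measurable \<L>"
 by (rule caratheodory_composition_measurable[OF flux_measurable flux_continuous])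

lemma flux_monotone: "AE x in \<L>. \<forall>zeta eta. 0 \<le> (a x zeta - a x eta) \<bullet> (zeta - eta)"
 using flux_strongly_monotone
proof eventually_elim
 case (elim x)
 show ?case
 proof (intro allI)
  fix zeta eta
  show "0 \<le> (a x zeta - a x eta) \<bullet> (zeta - eta)"
  proof (cases "zeta = eta")
   case False
   have "0 \<le> c * norm (zeta - eta) powr (max p 2) * (norm zeta powr p + norm eta powr p) powr (1 - max p 2 / p)"
    using c by (intro mult_nonneg_nonneg) auto
   then show ?thesis using elim False by (meson order_trans)
  qed simp
 qed
qed

lemma flux_growth_mult: "norm (a x zeta) * norm eta \<le> norm zeta powr p + norm eta powr p"
proof -
 have "norm (a x zeta) * norm eta \<le> norm zeta powr (p - 1) * norm eta" by (intro mult_right_mono flux_growth) auto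
 also have "\<dots> \<le> norm zeta powr p + norm eta powr p" by (intro powr_young p) auto
 finally show ?thesis .
qed

text \<open>A common form of strong monotonicity for both ranges of \<open>p\<close>. For
  \<open>p \<ge> 2\<close> the power of the sum is trivial. For \<open>p < 2\<close> either the
  difference is already small against the sum, or the sum is at most \<open>1 / e\<close> times the
  difference to the power \<open>p\<close>, and its negative power is bounded below
  accordingly.\<close>

lemma monotone_powr:
 assumes e: "0 < e"
 obtains K where "0 \<le> K" "AE x in \<L>. \<forall>zeta eta. norm (zeta - eta) powr p
  \<le> e * (norm zeta powr p + norm eta powr p) + K * ((a x zeta - a x eta) \<bullet> (zeta - eta))"
proof -
 \<comment> \<open>The factor left over when the sum is replaced by \<open>d powr p / e\<close> in
   the power with exponent \<open>1 - 2 / p\<close>.\<close>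
 define r where "r = e powr (2 / p - 1)"
 have r: "0 < r" using e by (simp add: r_def)
 define K where "K = 1 / c + 1 / (c * r)"
 have K: "0 \<le> K" "1 / c \<le> K" "1 / (c * r) \<le> K" using c r by (auto simp: K_def)
 have "AE x in \<L>. \<forall>zeta eta. norm (zeta - eta) powr p
  \<le> e * (norm zeta powr p + norm eta powr p) + K * ((a x zeta - a x eta) \<bullet> (zeta - eta))"
  using flux_strongly_monotone flux_monotone
 proof eventually_elim
  case (elim x)
  show ?case
  proof (intro allI)
   fix zeta eta :: "real^'n"
   define S where "S = norm zeta powr p + norm eta powr p"
   define d where "d = norm (zeta - eta)"
   define X where "X = (a x zeta - a x eta) \<bullet> (zeta - eta)"
   have X0: "0 \<le> X" using elim(2) by (simp add: X_def)
   have S0: "0 \<le> S" by (simp add: S_def)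
   have "d powr p \<le> e * S + K * X"
   proof (cases "zeta = eta")
    case True then show ?thesis using X0 S0 K e p by (simp add: d_def)
   next
    case False
    then have d: "0 < d" by (simp add: d_def)
    have S: "0 < S"
    proof (cases "zeta = 0")
     case True then have "eta \<noteq> 0" using False by auto
     then show ?thesis by (simp add: S_def add_nonneg_pos)
    qed (simp add: S_def add_pos_nonneg)
    have m: "c * d powr (max p 2) * S powr (1 - max p 2 / p) \<le> X"
     using elim(1) False by (simp add: d_def S_def X_def)
    show ?thesis
    proof (cases "2 \<le> p")
     case True
     then have "c * d powr p \<le> X" using m p S by (simp add: max_def split: if_splits)
     then have "d powr p \<le> 1 / c * X" using c by (simp add: field_simps)
     also have "\<dots> \<le> K * X" by (rule mult_right_mono[OF K(2) X0])
     finally show ?thesis using mult_nonneg_nonneg[OF less_imp_le[OF e] S0] by linarith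
    next
     case False
     then have m: "c * d powr 2 * S powr (1 - 2 / p) \<le> X" using m by (simp add: max_def)
     show ?thesis
     proof (cases "d powr p \<le> e * S")
      case True then show ?thesis using mult_nonneg_nonneg[OF K(1) X0] by linarith
     next
      case F: False
      then have le: "S \<le> d powr p / e" using e by (simp add: field_simps)
      have ex: "p * (1 - 2 / p) = p - 2" using p by (simp add: right_diff_distrib)
      have "(d powr p / e) powr (1 - 2 / p) \<le> S powr (1 - 2 / p)"
       using False p S le by (intro powr_mono2') auto
      moreover have "(d powr p / e) powr (1 - 2 / p) = d powr (p - 2) * r"
      proof -
       have "(d powr p / e) powr (1 - 2 / p) = d powr (p - 2) / e powr (1 - 2 / p)"
        using e d by (simp add: powr_divide powr_powr ex)
       also have "\<dots> = d powr (p - 2) * e powr (- (1 - 2 / p))" by (simp only: powr_minus_divide) simp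
       finally show ?thesis by (simp add: r_def)
      qed
      ultimately have "d powr (p - 2) * r \<le> S powr (1 - 2 / p)" by simp
      then have "c * d powr 2 * (d powr (p - 2) * r) \<le> c * d powr 2 * S powr (1 - 2 / p)"
       using c by (intro mult_left_mono) auto
      moreover have "c * d powr 2 * (d powr (p - 2) * r) = (c * r) * d powr p"
      proof -
       have "d powr 2 * d powr (p - 2) = d powr p" by (simp flip: powr_add)
       then show ?thesis by (metis mult.assoc mult.commute)
      qed
      ultimately have "(c * r) * d powr p \<le> X" using m by linarith
      then have "d powr p \<le> 1 / (c * r) * X" using c r by (simp add: pos_le_divide_eq mult.commute)
      also have "\<dots> \<le> K * X" by (rule mult_right_mono[OF K(3) X0])
      finally show ?thesis using mult_nonneg_nonneg[OF less_imp_le[OF e] S0] by linarith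
     qed
    qed
   qed
   then show "norm (zeta - eta) powr p \<le> e * (norm zeta powr p + norm eta powr p) + K * ((a x zeta - a x eta) \<bullet> (zeta - eta))"
    by (simp add: d_def S_def X_def)
  qed
 qed
 then show thesis by (rule that[OF K(1)])
qed

text \<open>Made for the comparison with \<open>v\<close>: there \<open>xi\<close> is the gradient
  of a test function, \<open>zeta\<close> that of the solution it approximates, and
  \<open>eta\<close> that of \<open>v\<close>. The flux is taken at \<open>zeta\<close>, but the
  difference is tested with \<open>xi - eta\<close>. No power of \<open>eta\<close> may remain on
  the right, since the gradient of \<open>v\<close> is only locally integrable; it is bounded
  through \<open>zeta - eta\<close> and absorbed.\<close>

lemma monotone_powr_perturbed:
 assumes th: "0 < theta"
 obtains K K' where "0 \<le> K" "0 \<le> K'" "AE x in \<L>. \<forall>zeta xi eta. norm (xi - eta) powr p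
  \<le> theta * norm zeta powr p + K * ((a x zeta - a x eta) \<bullet> (xi - eta)) + K' * norm (xi - zeta) powr p"
proof -
 define P where "P = 2 powr p"
 have P: "1 \<le> P" using p by (simp add: P_def ge_one_powr_ge_zero)
 \<comment> \<open>The first bound allows half of \<open>norm (zeta - eta) powr p\<close> to be
   absorbed; the second makes the final coefficient of \<open>norm zeta powr p\<close> at most
   \<open>theta\<close>.\<close>
 define e where "e = min (1 / (4 * P)) (theta / (4 * P * (1 + P)))"
 have e: "0 < e" "e * P \<le> 1 / 4" "4 * e * P * (1 + P) \<le> theta"
 proof -
  show "0 < e" using P th by (simp add: e_def)
  have "e * P \<le> 1 / (4 * P) * P" unfolding e_def using P by (intro mult_right_mono) auto
  then show "e * P \<le> 1 / 4" using P by simp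
  have "e * (4 * P * (1 + P)) \<le> theta / (4 * P * (1 + P)) * (4 * P * (1 + P))"
   unfolding e_def using P by (intro mult_right_mono) auto
  also have "\<dots> = theta" using P by (intro nonzero_eq_divide_eq[THEN iffD1]) auto
  finally show "4 * e * P * (1 + P) \<le> theta" by (simp add: mult_ac)
 qed
 obtain K where K: "0 \<le> K" "AE x in \<L>. \<forall>zeta eta. norm (zeta - eta) powr p
  \<le> e * (norm zeta powr p + norm eta powr p) + K * ((a x zeta - a x eta) \<bullet> (zeta - eta))"
  by (rule monotone_powr[OF e(1)])
 \<comment> \<open>The Young parameter: with \<open>K * t \<le> e\<close> the correction for testing
   with \<open>xi\<close> instead of \<open>zeta\<close> costs no more than the term with
   \<open>e\<close>.\<close>
 define t where "t = e / (K + 1)"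
 have t: "0 < t" "K * t \<le> e" using e K(1) by (auto simp: t_def field_simps)
 define T where "T = t powr (1 - p)"
 have T: "0 \<le> T" by (simp add: T_def)
 have "AE x in \<L>. \<forall>zeta xi eta. norm (xi - eta) powr p
  \<le> theta * norm zeta powr p + 2 * P * K * ((a x zeta - a x eta) \<bullet> (xi - eta)) + P * (1 + 4 * K * T) * norm (xi - zeta) powr p"
  using K(2) flux_monotone
 proof eventually_elim
  case (elim x)
  show ?case
  proof (intro allI)
   fix zeta xi eta :: "real^'n"
   define z y d q n m where "z = norm zeta powr p" "y = norm eta powr p" "d = norm (zeta - eta) powr p" "q = norm (xi - zeta) powr p"
    "n = (a x zeta - a x eta) \<bullet> (xi - eta)" "m = (a x zeta - a x eta) \<bullet> (zeta - eta)"
   note defs = this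
   have nn: "0 \<le> z" "0 \<le> y" "0 \<le> d" "0 \<le> q" "0 \<le> m" using elim(2) by (auto simp: defs)
   have 1: "d \<le> e * (z + y) + K * m" using elim(1) by (simp add: defs)
   have 2: "y \<le> P * (z + d)" using norm_diff_powr_le[of p zeta "zeta - eta"] p by (simp add: defs P_def)
   have "\<bar>(a x zeta - a x eta) \<bullet> (xi - zeta)\<bar> \<le> norm (a x zeta - a x eta) * norm (xi - zeta)" by (rule Cauchy_Schwarz_ineq2)
   also have "\<dots> \<le> (norm (a x zeta) + norm (a x eta)) * norm (xi - zeta)" by (intro mult_right_mono norm_triangle_ineq4) auto
   also have "\<dots> \<le> (norm zeta powr (p - 1) + norm eta powr (p - 1)) * norm (xi - zeta)" by (intro mult_right_mono add_mono flux_growth) auto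
   also have "\<dots> = norm zeta powr (p - 1) * norm (xi - zeta) + norm eta powr (p - 1) * norm (xi - zeta)" by (rule distrib_right)
   also have "\<dots> \<le> (t * z + T * q) + (t * y + T * q)"
    unfolding defs T_def by (intro add_mono powr_young_eps p t) auto
   finally have 3: "\<bar>(a x zeta - a x eta) \<bullet> (xi - zeta)\<bar> \<le> t * (z + y) + 2 * T * q" by (simp add: algebra_simps)
   have "n = m + (a x zeta - a x eta) \<bullet> (xi - zeta)" by (simp add: defs flip: inner_add_right)
   with 3 have 4: "m \<le> n + t * (z + y) + 2 * T * q" by linarith
   have "K * m \<le> K * (n + t * (z + y) + 2 * T * q)" by (rule mult_left_mono[OF 4 K(1)])
   also have "\<dots> = K * n + (K * t) * (z + y) + 2 * K * T * q" by (simp add: algebra_simps)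
   also have "\<dots> \<le> K * n + e * (z + y) + 2 * K * T * q" using mult_right_mono[OF t(2), of "z + y"] nn by simp
   finally have 5: "d \<le> 2 * e * (z + y) + K * n + 2 * K * T * q" using 1 by linarith
   have "2 * e * (z + y) \<le> 2 * e * (z + P * (z + d))" using 2 e by (intro mult_left_mono) auto
   also have "\<dots> = 2 * e * (1 + P) * z + 2 * (e * P) * d" by (simp add: algebra_simps)
   also have "\<dots> \<le> 2 * e * (1 + P) * z + 2 * (1 / 4) * d" using e(2) nn by (intro add_left_mono mult_right_mono mult_left_mono) auto
   finally have 6: "d \<le> 4 * e * (1 + P) * z + 2 * K * n + 4 * K * T * q" using 5 by simp
   have "norm (xi - eta) powr p \<le> P * (q + d)"
    using norm_add_powr_le[of p "xi - zeta" "zeta - eta"] p by (simp add: defs P_def)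
   also have "\<dots> \<le> P * (q + (4 * e * (1 + P) * z + 2 * K * n + 4 * K * T * q))" using 6 P by (intro mult_left_mono) auto
   also have "\<dots> = (4 * e * P * (1 + P)) * z + 2 * P * K * n + P * (1 + 4 * K * T) * q" by (simp add: algebra_simps)
   also have "\<dots> \<le> theta * z + 2 * P * K * n + P * (1 + 4 * K * T) * q" using mult_right_mono[OF e(3) nn(1)] by simp
   finally show "norm (xi - eta) powr p \<le> theta * norm zeta powr p + 2 * P * K * ((a x zeta - a x eta) \<bullet> (xi - eta)) + P * (1 + 4 * K * T) * norm (xi - zeta) powr p"
    by (simp add: defs)
  qed
 qed
 then show thesis by (rule that[rotated 2]) (use P K T in auto)
qed

end

text \<open>The properties through which the truncated singular term acts. Antitonicity makes its
  negative monotone, the bound \<open>k\<close> keeps pairings finite, and the bound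
  \<open>L\<close> on \<open>t * g t\<close> makes energies depend on the source only through its
  integral.\<close>

locale flux_source = flux p w \<Omega> a c for p :: real and w :: "real^'n::finite => real" and \<Omega> a c +
 fixes g :: "real => real" and k L :: real
 assumes source_continuous: "continuous_on UNIV g" and source_antimono: "!!s t. s \<le> t ==> g t \<le> g s"
  and source_nonneg: "!!t. 0 \<le> g t" and source_le: "!!t. g t \<le> k" and source_mult: "!!t. 0 \<le> t ==> t * g t \<le> L"
begin

text \<open>The first component is divided by \<open>w\<close>, and the flux is already normalized
  by \<open>w\<close>, because the pairing is integrated against \<open>w dx\<close>. The minus sign
  makes the antitone source a monotone contribution.\<close>

definition operator :: "(real^'n => real) => real^'n => real \<times> (real^'n) => real \<times> (real^'n)" where
 "operator h x = (\<lambda>(t, zeta). (- (h x * g t) / w x, a x zeta))"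

lemma operator_inner: "operator h x xi \<bullet> eta = a x (snd xi) \<bullet> snd eta - h x * g (fst xi) * fst eta / w x"
 by (cases xi; cases eta) (simp add: operator_def)

lemma k_nonneg: "0 \<le> k" using source_nonneg source_le order_trans by blast

lemma L_nonneg: "0 \<le> L" using source_mult[of 0] by simp

lemma source_diff_le: "\<bar>g s - g t\<bar> \<le> k"
 using source_nonneg[of s] source_nonneg[of t] source_le[of s] source_le[of t] by linarith

lemma source_measurable: "u \<in> borel_measurable N ==> (\<lambda>x. g (u x)) \<in> borel_measurable N"
 by (rule borel_measurable_continuous_on[OF source_continuous])

lemma integrable_dual_weight_M: "integrable M (\<lambda>x. dual_weight x / w x)"
 by (rule divide_weight(1)[OF dual_weight_integrable_bounded[OF bounded_dom dom_sets]])

lemma operator_monotone: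
 assumes h: "!!x. 0 \<le> h x"
 shows "AE x in \<L>. \<forall>xi eta. 0 \<le> (operator h x xi - operator h x eta) \<bullet> (xi - eta)"
 using flux_monotone weight_pos_on[OF dom_sets]
proof eventually_elim
 case (elim x)
 show ?case
 proof (intro allI)
  fix xi eta :: "real \<times> (real^'n)"
  have "(g (fst xi) - g (fst eta)) * (fst xi - fst eta) \<le> 0"
   using source_antimono[of "fst xi" "fst eta"] source_antimono[of "fst eta" "fst xi"]
   by (cases "fst xi \<le> fst eta") (auto simp: mult_le_0_iff)
  then have "0 \<le> (h x / w x) * - ((g (fst xi) - g (fst eta)) * (fst xi - fst eta))"
   using h[of x] elim(2) by (intro mult_nonneg_nonneg) auto
  moreover have "0 \<le> (a x (snd xi) - a x (snd eta)) \<bullet> (snd xi - snd eta)" using elim(1) by blast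
  moreover have "(operator h x xi - operator h x eta) \<bullet> (xi - eta) = (a x (snd xi) - a x (snd eta)) \<bullet> (snd xi - snd eta)
   + (h x / w x) * - ((g (fst xi) - g (fst eta)) * (fst xi - fst eta))"
   using elim(2) unfolding inner_diff_left[of "operator h x xi"] operator_inner inner_diff_left[of "a x _"] fst_diff snd_diff
   by (simp add: field_simps)
  ultimately show "0 \<le> (operator h x xi - operator h x eta) \<bullet> (xi - eta)" by linarith
 qed
qed

text \<open>For a bounded source factor the first component is controlled by
  \<open>weight_young\<close> with parameter 1: after division by the weight, \<open>t\<close> is at
  most its \<open>p\<close>-th power plus \<open>dual_weight x / w x\<close>, and the latter is
  integrable against \<open>w dx\<close>.\<close>

lemma monotone_operator_operator:
 assumes h: "!!x. 0 \<le> h x" "!!x. h x \<le> J" "h \<in> borel_measurable \<L>"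
 shows "monotone_operator M p (operator h) (1 + J * k) (\<lambda>x. J * k * (dual_weight x / w x))"
proof
 have J: "0 \<le> J" using h(1,2) order_trans by blast
 show "0 \<le> 1 + J * k" using J k_nonneg by simp
 show "integrable M (\<lambda>x. J * k * (dual_weight x / w x))" by (intro integrable_mult_right integrable_dual_weight_M)
 show "AE x in M. \<forall>xi eta. 0 \<le> (operator h x xi - operator h x eta) \<bullet> (xi - eta)"
  unfolding AE_M by (rule operator_monotone[OF h(1)])
 show "AE x in M. continuous_on UNIV (operator h x)"
 proof (intro AE_I2)
  fix x
  have "continuous_on UNIV (\<lambda>xi. (- (h x * g (fst xi)) * inverse (w x), a x (snd xi)))"
   by (intro continuous_intros continuous_on_compose2[OF source_continuous] continuous_on_compose2[OF flux_continuous]) auto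
  then show "continuous_on UNIV (operator h x)" by (simp add: operator_def case_prod_unfold divide_inverse)
 qed
 show "(\<lambda>x. operator h x (W x)) \<in> borel_measurable M" if "W \<in> borel_measurable M" for W
 proof -
  have W: "W \<in> borel_measurable \<L>" using that measurable_wmeasure by blast
  have W1: "(\<lambda>x. fst (W x)) \<in> borel_measurable \<L>"
   by (rule measurable_fst_snd[OF W])
  have W2: "(\<lambda>x. snd (W x)) \<in> borel_measurable \<L>"
   by (rule measurable_fst_snd[OF W])
  have "(\<lambda>x. (- (h x * g (fst (W x))) / w x, a x (snd (W x)))) \<in> borel_measurable \<L>"
   by (intro borel_measurable_Pair borel_measurable_divide borel_measurable_uminus borel_measurable_times h(3)
     source_measurable[OF W1] flux_compose_measurable[OF W2] weight_measurable_on)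
  then show ?thesis by (simp add: operator_def case_prod_unfold measurable_wmeasure)
 qed
 show "AE x in M. \<forall>xi eta. \<bar>operator h x xi \<bullet> eta\<bar> \<le> (1 + J * k) * (norm xi powr p + norm eta powr p) + J * k * (dual_weight x / w x)"
  unfolding AE_M using weight_pos_on[OF dom_sets]
 proof eventually_elim
  case (elim x)
  show ?case
  proof (intro allI)
   fix xi eta :: "real \<times> (real^'n)"
   have n: "norm (snd xi) powr p \<le> norm xi powr p" "norm (snd eta) powr p \<le> norm eta powr p" "\<bar>fst eta\<bar> powr p \<le> norm eta powr p"
    using p norm_snd_le[of "snd xi" "fst xi"] norm_snd_le[of "snd eta" "fst eta"] norm_fst_le[of "fst eta" "snd eta"]
    by (auto intro!: powr_mono2)
   have "\<bar>a x (snd xi) \<bullet> snd eta\<bar> \<le> norm (snd xi) powr p + norm (snd eta) powr p"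
    using Cauchy_Schwarz_ineq2[of "a x (snd xi)" "snd eta"] flux_growth_mult[of x "snd xi" "snd eta"] by linarith
   then have 1: "\<bar>a x (snd xi) \<bullet> snd eta\<bar> \<le> norm xi powr p + norm eta powr p" using n by linarith
   have "\<bar>fst eta\<bar> \<le> \<bar>fst eta\<bar> powr p * w x + dual_weight x"
    using weight_young[OF p _ elim, of "\<bar>fst eta\<bar>" 1] by simp
   also have "\<dots> \<le> norm eta powr p * w x + dual_weight x" using n elim by (intro add_right_mono mult_right_mono) auto
   finally have "\<bar>fst eta\<bar> / w x \<le> (norm eta powr p * w x + dual_weight x) / w x" using elim by (intro divide_right_mono) auto
   also have "\<dots> = norm eta powr p + dual_weight x / w x" using elim by (simp add: add_divide_distrib)
   finally have 2: "\<bar>fst eta\<bar> / w x \<le> norm eta powr p + dual_weight x / w x" .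
   have "\<bar>h x * g (fst xi) * fst eta / w x\<bar> = (h x * g (fst xi)) * (\<bar>fst eta\<bar> / w x)"
    using h(1)[of x] source_nonneg[of "fst xi"] elim by (simp add: abs_mult)
   also have "\<dots> \<le> (J * k) * (norm eta powr p + dual_weight x / w x)"
    using h source_nonneg source_le J k_nonneg elim by (intro mult_mono 2 mult_nonneg_nonneg) auto
   also have "\<dots> \<le> J * k * (norm xi powr p + norm eta powr p) + J * k * (dual_weight x / w x)"
    using mult_nonneg_nonneg[OF mult_nonneg_nonneg[OF J k_nonneg], of "norm xi powr p"] by (simp add: distrib_left)
   finally have 3: "\<bar>h x * g (fst xi) * fst eta / w x\<bar> \<le> J * k * (norm xi powr p + norm eta powr p) + J * k * (dual_weight x / w x)" .
   show "\<bar>operator h x xi \<bullet> eta\<bar> \<le> (1 + J * k) * (norm xi powr p + norm eta powr p) + J * k * (dual_weight x / w x)"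
    unfolding operator_inner distrib_right mult_1_left
    using order.trans[OF abs_triangle_ineq4 add_mono[OF 1 3]] by (simp add: add.assoc)
  qed
 qed
qed (rule p)

end

text \<open>\<open>k powr (- 1 / delta)\<close> is the point where the two branches of the minimum
  meet. Written as one power of a maximum that stays away from zero, the function is visibly
  continuous and antitone, also across \<open>t = 0\<close>.\<close>

lemma g_trunc_eq:
 assumes "1 < delta" "0 < k"
 shows "g_trunc delta k t = max t (k powr (- 1 / delta)) powr (- delta)"
proof -
 define s where "s = k powr (- 1 / delta)"
 have s: "0 < s" "s powr (- delta) = k" using assms by (auto simp: s_def powr_powr)
 have "g_trunc delta k t = max t s powr (- delta)"
 proof (cases "s \<le> t")
  case True
  then have "t powr (- delta) \<le> k" using s assms unfolding s(2)[symmetric] by (intro powr_mono2') auto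
  then show ?thesis using True s by (simp add: g_trunc_def max_def)
 next
  case False
  then have "t > 0 ==> k \<le> t powr (- delta)" using s assms unfolding s(2)[symmetric] by (intro powr_mono2') auto
  then show ?thesis using False s by (simp add: g_trunc_def max_def)
 qed
 then show ?thesis by (simp only: s_def)
qed

lemma g_trunc:
 assumes "1 < delta" "0 < k"
 shows "continuous_on UNIV (g_trunc delta k)" "s \<le> t ==> g_trunc delta k t \<le> g_trunc delta k s" "0 \<le> g_trunc delta k t" "g_trunc delta k t \<le> k"
  "0 \<le> t ==> t * g_trunc delta k t \<le> k + 1" "0 < t ==> g_trunc delta k t \<le> 1 / t powr delta"
proof -
 have s: "0 < k powr (- 1 / delta)" using assms by simp
 show "continuous_on UNIV (g_trunc delta k)"
  unfolding g_trunc_eq[OF assms, abs_def] using s by (intro continuous_intros) (auto simp: max_def)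
 show "s \<le> t ==> g_trunc delta k t \<le> g_trunc delta k s"
  unfolding g_trunc_eq[OF assms] using s assms by (intro powr_mono2') (simp_all add: less_max_iff_disj, linarith?)
 show n: "0 \<le> g_trunc delta k t" "g_trunc delta k t \<le> k" using assms by (auto simp: g_trunc_def)
 show i: "0 < t ==> g_trunc delta k t \<le> 1 / t powr delta" for t by (simp add: g_trunc_def powr_minus_divide)
 show "t * g_trunc delta k t \<le> k + 1" if t: "0 \<le> t"
 proof (cases "t \<le> 1")
  case True
  have "t * g_trunc delta k t \<le> 1 * k" using True t n by (intro mult_mono) auto
  then show ?thesis by simp
 next
  case False
  have "t powr 1 \<le> t powr delta" using False assms by (intro powr_mono) auto
  then have "t * (1 / t powr delta) \<le> 1" using False by (simp add: divide_le_eq)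
  moreover have "t * g_trunc delta k t \<le> t * (1 / t powr delta)" using False i[of t] by (intro mult_left_mono) auto
  ultimately show ?thesis using assms by linarith
 qed
qed

text \<open>The \<open>L^1\<close> result is applied to the \<open>p\<close>-th power of the
  distance to the limit, which again has growth \<open>p\<close> and vanishes at the limit
  function.\<close>

lemma Lp_nemytskii_tendsto_Lp:
 fixes \<Phi> :: "'a => 'b::euclidean_space => 'c::euclidean_space"
 assumes p: "0 < p" and U: "!!n. U n \<in> Lp p M" and V: "V \<in> Lp p M"
  and lim: "Lp_lim p M U V"
  and meas: "!!W. W \<in> borel_measurable M ==> (\<lambda>x. \<Phi> x (W x)) \<in> borel_measurable M"
  and cont: "AE x in M. continuous_on UNIV (\<Phi> x)"
  and bd: "AE x in M. \<forall>xi. norm (\<Phi> x xi) powr p \<le> C * norm xi powr p + h x" and h: "integrable M h" and C: "0 \<le> C"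
 shows "!!W. W \<in> Lp p M ==> (\<lambda>x. \<Phi> x (W x)) \<in> Lp p M"
  "(\<lambda>n. Lp_dist p M (\<lambda>x. \<Phi> x (U n x)) (\<lambda>x. \<Phi> x (V x))) \<longlonglongrightarrow> 0"
proof -
 show L: "(\<lambda>x. \<Phi> x (W x)) \<in> Lp p M" if W: "W \<in> Lp p M" for W
 proof (rule LpI_bound[OF meas[OF Lp_measurable[OF W]]])
  show "integrable M (\<lambda>x. C * norm (W x) powr p + h x)"
   by (intro B_integrable_add integrable_mult_right Lp_integrable W h)
  show "AE x in M. norm (\<Phi> x (W x)) powr p \<le> C * norm (W x) powr p + h x" using bd by eventually_elim blast
 qed
 define F where "F x xi = norm (\<Phi> x xi - \<Phi> x (V x)) powr p" for x xi
 have "(\<lambda>n. LINT x|M. F x (U n x)) \<longlonglongrightarrow> (LINT x|M. F x (V x))"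
 proof (rule Lp_nemytskii_tendsto[OF p U V lim])
  show "(\<lambda>x. F x (W x)) \<in> borel_measurable M" if W: "W \<in> borel_measurable M" for W
  proof -
   have [measurable]: "(\<lambda>x. \<Phi> x (W x)) \<in> borel_measurable M" "(\<lambda>x. \<Phi> x (V x)) \<in> borel_measurable M"
    by (intro meas W Lp_measurable[OF V])+
   show ?thesis unfolding F_def by measurable
  qed
  show "AE x in M. continuous_on UNIV (F x)"
   using cont
  proof eventually_elim
   case (elim x)
   have "continuous_on UNIV (\<lambda>xi. norm (\<Phi> x xi - \<Phi> x (V x)))" by (intro continuous_intros elim)
   then show ?case unfolding F_def[abs_def] using p by (intro continuous_on_powr') (auto intro: continuous_on_const)
  qed
  show "AE x in M. \<forall>xi. norm (F x xi) \<le> (2 powr p * C) * norm xi powr p + 2 powr p * (h x + norm (\<Phi> x (V x)) powr p)"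
   using bd
  proof eventually_elim
   case (elim x)
   show ?case
   proof
    fix xi
    have "norm (F x xi) \<le> 2 powr p * (norm (\<Phi> x xi) powr p + norm (\<Phi> x (V x)) powr p)"
     using norm_diff_powr_le[of p "\<Phi> x xi" "\<Phi> x (V x)"] p by (simp add: F_def)
    also have "\<dots> \<le> 2 powr p * ((C * norm xi powr p + h x) + norm (\<Phi> x (V x)) powr p)"
     using elim by (intro mult_left_mono add_right_mono) auto
    finally show "norm (F x xi) \<le> (2 powr p * C) * norm xi powr p + 2 powr p * (h x + norm (\<Phi> x (V x)) powr p)"
     by (simp add: algebra_simps)
   qed
  qed
  show "integrable M (\<lambda>x. 2 powr p * (h x + norm (\<Phi> x (V x)) powr p))"
   by (intro B_integrable_add integrable_mult_right h Lp_integrable[OF L[OF V]])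
  show "0 \<le> 2 powr p * C" using C by simp
 qed
 then show "(\<lambda>n. Lp_dist p M (\<lambda>x. \<Phi> x (U n x)) (\<lambda>x. \<Phi> x (V x))) \<longlonglongrightarrow> 0" by (simp add: F_def)
qed

section \<open>A \<open>C^1\<close> regularization of the positive part\<close>

definition soft_pos :: "real => real => real" where
 "soft_pos tau t = (max t 0)\<^sup>2 / (max t 0 + tau)"

definition soft_step :: "real => real => real" where
 "soft_step tau t = 1 - tau\<^sup>2 / (max t 0 + tau)\<^sup>2"

text \<open>The regularization stays between 0 and the positive part itself. Hence
  \<open>soft_pos\<close> of \<open>phi - m\<close> with \<open>m \<ge> 0\<close> and
  \<open>phi \<ge> 0\<close> lies between 0 and \<open>phi\<close>, the order relation that the
  comparison needs.\<close>

lemma soft_pos_bounds: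
 assumes "0 < tau"
 shows "0 \<le> soft_pos tau t" "soft_pos tau t \<le> max t 0" "t \<le> 0 ==> soft_pos tau t = 0"
proof -
 have "(max t 0)\<^sup>2 \<le> max t 0 * (max t 0 + tau)" using assms by (auto simp: power2_eq_square distrib_left)
 moreover have "0 < max t 0 + tau" using assms by simp
 ultimately show "soft_pos tau t \<le> max t 0" unfolding soft_pos_def by (simp add: divide_le_eq)
qed (use assms in \<open>auto simp: soft_pos_def\<close>)

lemma soft_step_bounds:
 assumes "0 < tau"
 shows "0 \<le> soft_step tau t" "soft_step tau t \<le> 1" "t \<le> 0 ==> soft_step tau t = 0"
proof -
 have "tau\<^sup>2 \<le> (max t 0 + tau)\<^sup>2" using assms by (intro power_mono) auto
 then show "0 \<le> soft_step tau t" using assms unfolding soft_step_def by (auto simp: divide_le_eq)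
qed (use assms in \<open>auto simp: soft_step_def max_def\<close>)

lemma continuous_soft:
 assumes "0 < tau"
 shows "continuous_on S (soft_pos tau)" "continuous_on S (soft_step tau)"
proof -
 have "max t 0 + tau \<noteq> 0" for t using assms by (simp add: max_def)
 then show "continuous_on S (soft_pos tau)" "continuous_on S (soft_step tau)"
  unfolding soft_pos_def[abs_def] soft_step_def[abs_def] by (auto intro!: continuous_intros)
qed

lemma soft_pos_has_derivative:
 assumes tau: "0 < tau"
 shows "(soft_pos tau has_real_derivative soft_step tau t) (at t)"
proof -
 consider "t < 0" | "t = 0" | "0 < t" by linarith
 then show ?thesis
 proof cases
  case 1
  have "((\<lambda>_. 0) has_real_derivative 0) (at t)" by simp
  moreover have "eventually (\<lambda>s. 0 = soft_pos tau s) (nhds t)"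
   using eventually_nhds_in_open[of "{..<0}" t] 1 by (auto elim!: eventually_mono simp: soft_pos_def)
  ultimately have "(soft_pos tau has_real_derivative 0) (at t)" by (subst (asm) DERIV_cong_ev[OF refl _ refl])
  then show ?thesis using 1 soft_step_bounds(3)[OF tau, of t] by simp
 next
  case 3
  have "((\<lambda>s. s\<^sup>2 / (s + tau)) has_real_derivative soft_step tau t) (at t)"
  proof (rule DERIV_cong)
   show "((\<lambda>s. s\<^sup>2 / (s + tau)) has_real_derivative (2 * t * (t + tau) - t\<^sup>2) / ((t + tau) * (t + tau))) (at t)"
    using 3 tau by (auto intro!: derivative_eq_intros)
   show "(2 * t * (t + tau) - t\<^sup>2) / ((t + tau) * (t + tau)) = soft_step tau t"
    using 3 tau by (simp add: soft_step_def divide_simps) (simp add: power2_eq_square algebra_simps)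
  qed
  moreover have "eventually (\<lambda>s. s\<^sup>2 / (s + tau) = soft_pos tau s) (nhds t)"
   using eventually_nhds_in_open[of "{0<..}" t] 3 by (auto elim!: eventually_mono simp: soft_pos_def)
  ultimately show ?thesis by (subst (asm) DERIV_cong_ev[OF refl _ refl])
 next
  case 2
  have b: "\<bar>soft_pos tau h / h\<bar> \<le> \<bar>h\<bar> / tau" for h
  proof (cases "0 < h")
   case True
   have "soft_pos tau h / h = h / (h + tau)" using True tau by (simp add: soft_pos_def power2_eq_square)
   also have "\<dots> \<le> h / tau" using True tau by (intro divide_left_mono) auto
   finally show ?thesis using True soft_pos_bounds(1)[OF tau, of h] by simp
  next
   case False
   then have "soft_pos tau h = 0" by (intro soft_pos_bounds(3) tau) simp
   then show ?thesis using tau divide_nonneg_pos[of "\<bar>h\<bar>" tau] by simp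
  qed
  have "((\<lambda>h. soft_pos tau h / h) \<longlongrightarrow> 0) (at 0)"
  proof (rule Lim_null_comparison)
   show "eventually (\<lambda>h. norm (soft_pos tau h / h) \<le> \<bar>h\<bar> / tau) (at 0)" using b by simp
   have "((\<lambda>h. \<bar>h\<bar> / tau) \<longlongrightarrow> \<bar>0\<bar> / tau) (at 0)" using tau by (intro tendsto_intros) auto
   then show "((\<lambda>h. \<bar>h\<bar> / tau) \<longlongrightarrow> 0) (at 0)" by simp
  qed
  then show ?thesis using 2 soft_step_bounds(3)[OF tau, of t] by (simp add: DERIV_def soft_pos_def)
 qed
qed

lemma soft_tendsto:
 assumes "!!n. 0 < tau n" "tau \<longlonglongrightarrow> 0"
 shows "(\<lambda>n. soft_pos (tau n) t) \<longlonglongrightarrow> (if 0 < t then t else 0)" "(\<lambda>n. soft_step (tau n) t) \<longlonglongrightarrow> (if 0 < t then 1 else 0)"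
proof -
 have "(\<lambda>n. t\<^sup>2 / (t + tau n)) \<longlonglongrightarrow> t\<^sup>2 / (t + 0)" if "0 < t" using that by (intro tendsto_intros assms) auto
 then show "(\<lambda>n. soft_pos (tau n) t) \<longlonglongrightarrow> (if 0 < t then t else 0)"
  by (auto simp: soft_pos_def power2_eq_square)
 have "(\<lambda>n. 1 - (tau n)\<^sup>2 / (t + tau n)\<^sup>2) \<longlonglongrightarrow> 1 - 0\<^sup>2 / (t + 0)\<^sup>2" if "0 < t" using that by (intro tendsto_intros assms) auto
 then have "(\<lambda>n. soft_step (tau n) t) \<longlonglongrightarrow> 1" if "0 < t" using that by (simp add: soft_step_def)
 moreover have "(\<lambda>n. soft_step (tau n) t) \<longlonglongrightarrow> 0" if "\<not> 0 < t" using that by (simp add: soft_step_bounds(3) assms(1))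
 ultimately show "(\<lambda>n. soft_step (tau n) t) \<longlonglongrightarrow> (if 0 < t then 1 else 0)" by auto
qed

text \<open>Nonnegativity of \<open>m\<close> confines the support: where \<open>phi\<close>
  vanishes the argument is at most 0, and so is mapped to 0.\<close>

lemma soft_pos_Cc1:
 assumes tau: "0 < tau" and phi: "phi \<in> Cc1 \<Omega>" and m: "Ck 1 m" "!!x. 0 \<le> m x"
 shows "(\<lambda>x. soft_pos tau (phi x - m x)) \<in> Cc1 \<Omega>"
  "grad (\<lambda>x. soft_pos tau (phi x - m x)) x = soft_step tau (phi x - m x) *\<^sub>R (grad phi x - grad m x)"
proof -
 note a = Cc1_D[OF phi]
 have md: "m differentiable (at x)" "continuous_on UNIV (partial_deriv i m)" for x i using m(1) by auto
 have mc: "continuous_on UNIV m" using md(1) differentiable_imp_continuous_within by (auto simp: continuous_on_eq_continuous_at)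
 have D: "((\<lambda>x. soft_pos tau (phi x - m x)) has_derivative (\<lambda>z. z \<bullet> (soft_step tau (phi x - m x) *\<^sub>R (grad phi x - grad m x)))) (at x)" for x
 proof -
  have "((\<lambda>x. phi x - m x) has_derivative (\<lambda>z. z \<bullet> grad phi x - z \<bullet> grad m x)) (at x)"
   by (intro has_derivative_diff has_derivative_grad a(1) md(1))
  from has_derivative_compose[OF this soft_pos_has_derivative[OF tau, unfolded has_field_derivative_def]]
  show ?thesis by (rule has_derivative_eq_rhs) (simp add: inner_diff_right)
 qed
 show "grad (\<lambda>x. soft_pos tau (phi x - m x)) x = soft_step tau (phi x - m x) *\<^sub>R (grad phi x - grad m x)" by (rule grad_eq(1)[OF D])
 have gm: "continuous_on UNIV (grad m)" unfolding grad_def[abs_def] by (intro continuous_on_vec_lambda md)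
 show "(\<lambda>x. soft_pos tau (phi x - m x)) \<in> Cc1 \<Omega>"
 proof (rule Cc1I[OF D _ a(5,6)])
  show "continuous_on UNIV (\<lambda>x. soft_step tau (phi x - m x) *\<^sub>R (grad phi x - grad m x))"
   by (intro continuous_on_scaleR continuous_on_diff continuous_on_compose2[OF continuous_soft(2)[OF tau, of UNIV]] a(3,4) gm mc) auto
  show "soft_pos tau (phi x - m x) = 0" if "x \<notin> closure {x. phi x \<noteq> 0}" for x
   using a(7)[OF that] m(2)[of x] by (intro soft_pos_bounds(3) tau) simp
 qed
qed

context weighted_domain
begin

text \<open>Puts \<open>(phi - v)_+\<close> into the closure although \<open>v\<close> itself is
  only local. First \<open>v\<close>, cut off near the support of \<open>phi\<close>, is mollified
  inside a fixed soft positive part, which yields \<open>C^1\<close> functions between 0 and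
  \<open>phi\<close>; then the regularization parameter tends to zero. Mollified \<open>v\<close>
  stays nonnegative, so the order bounds hold throughout.\<close>

lemma truncated_difference_closure:
 assumes phi: "phi \<in> Cc1 \<Omega>" "!!x. 0 \<le> phi x" and v: "v \<in> W1p_loc p w \<Omega>" "AE x in \<L>. 0 < v x"
 shows "(\<lambda>x. if v x < phi x then jet phi x - (v x, weak_grad \<Omega> v x) else 0)
  \<in> Lp_closure p M (jet ` {q \<in> Cc1 \<Omega>. \<forall>x. 0 \<le> q x \<and> q x \<le> phi x})" (is "?T \<in> Lp_closure p M ?D")
proof -
 note c = Cc1_D[OF phi(1)]
 let ?S = "closure {x. phi x \<noteq> 0}"
 obtain d where d: "0 < d" "(\<Union>x\<in>?S. cball x d) \<subseteq> \<Omega>" "compact (\<Union>x\<in>?S. cball x d)"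
  by (rule compact_neighbourhood[OF c(5) open_dom c(6)])
 \<comment> \<open>A neighbourhood of the support: at points of the support the mollifying balls
   stay inside \<open>K\<close>, where mollification commutes with the weak gradient of
   \<open>v\<close>.\<close>
 define K where "K = (\<Union>x\<in>?S. cball x d)"
 have K: "compact K" "K \<subseteq> \<Omega>" "K \<in> sets lebesgue" "bounded K" using d by (auto simp: K_def compact_imp_closed compact_imp_bounded)
 have SK: "?S \<subseteq> K" using d(1) by (auto simp: K_def intro: less_imp_le)
 define vK where "vK x = indicator K x *\<^sub>R v x" for x
 define gK where "gK x = indicator K x *\<^sub>R weak_grad \<Omega> v x" for x
 note wg = W1p_loc_D(1)[OF v(1)] and vL = W1p_loc_D(2)[OF v(1) K(1,2)]
 have vKL: "vK \<in> Lp p (wmeasure UNIV)" unfolding vK_def[abs_def] by (rule Lp_wmeasure_extend[OF K(3)]) (use vL in blast)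
 have gKL: "gK \<in> Lp p (wmeasure UNIV)" unfolding gK_def[abs_def] by (rule Lp_wmeasure_extend[OF K(3)]) (use vL in blast)
 have out: "vK x = 0" "gK x = 0" if "x \<notin> K" for x using that by (auto simp: vK_def gK_def)
 have vKi: "integrable lebesgue vK" by (rule Lp_bounded_support_integrable[OF vKL K(4) out(1)])
 have gKi: "integrable lebesgue gK" by (rule Lp_bounded_support_integrable[OF gKL K(4) out(2)])
 have mv: "mollify n vK \<in> Lp p (wmeasure UNIV)" "(\<lambda>n. Lp_dist p (wmeasure UNIV) (mollify n vK) vK) \<longlonglongrightarrow> 0" for n
  by (rule mollify_tendsto[OF vKL K(4) out(1)]; assumption)+
 have mg: "mollify n gK \<in> Lp p (wmeasure UNIV)" "(\<lambda>n. Lp_dist p (wmeasure UNIV) (mollify n gK) gK) \<longlonglongrightarrow> 0" for n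
  by (rule mollify_tendsto[OF gKL K(4) out(2)]; assumption)+
 have toM: "F \<in> Lp p M" if "F \<in> Lp p (wmeasure UNIV)" for F :: "real^'n => 'c::euclidean_space"
  by (rule Lp_wmeasure_mono(1)[OF _ dom_sets _ that]) auto
 have distM: "Lp_lim p M F f"
  if F: "!!n. F n \<in> Lp p (wmeasure UNIV)" "f \<in> Lp p (wmeasure UNIV)" "Lp_lim p (wmeasure UNIV) F f"
  for F :: "nat => real^'n => 'c::euclidean_space" and f
 proof (rule tendsto_sandwich[OF _ _ tendsto_const F(3)])
  have "Lp_dist p M (F n) f \<le> Lp_dist p (wmeasure UNIV) (F n) f" for n
   by (rule Lp_wmeasure_mono(2)[OF _ dom_sets _ Lp_diff[OF p0 F(1,2)]]) auto
  then show "\<forall>\<^sub>F n in sequentially. Lp_dist p M (F n) f \<le> Lp_dist p (wmeasure UNIV) (F n) f" by simp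
 qed (simp add: Lp_dist_nonneg)
 have "AE x in lebesgue. x \<in> \<Omega> --> 0 < v x" using v(2) dom_sets by (subst (asm) AE_restrict_space_iff) auto
 then have vK0: "AE x in lebesgue. 0 \<le> vK x" by eventually_elim (use K(2) in \<open>auto simp: vK_def indicator_def\<close>)
 have m0: "0 \<le> mollify n vK x" for n x
  unfolding convolution_def
  by (rule integral_nonneg_AE, rule eventually_mono[OF vK0]) (simp add: mollifier_nonneg)
 have mC: "Ck 1 (mollify n vK)" for n using smooth_mollify[OF vKi] by (simp only: smooth_def)
 define W where "W n x = (mollify n vK x, mollify n gK x)" for n x
 define V where "V x = (vK x, gK x)" for x
 have WL: "W n \<in> Lp p M" for n unfolding W_def by (intro Lp_Pair p0 toM mv mg)
 have VL: "V \<in> Lp p M" unfolding V_def by (intro Lp_Pair p0 toM vKL gKL)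
 have Wlim: "Lp_lim p M W V" unfolding W_def V_def
  by (intro Lp_tendsto_Pair p0 toM vKL gKL mv(1) mg(1) distM[OF mv(1) vKL mv(2)] distM[OF mg(1) gKL mg(2)])
 \<comment> \<open>The regularized truncation as a superposition operator in the jet of
   \<open>v\<close>. The indicator discards points outside the support of \<open>phi\<close>, where
   the cut-off may spoil the gradient but the truncation vanishes anyway.\<close>
 define \<Phi> where "\<Phi> tau x xi = indicator ?S x *\<^sub>R (soft_pos tau (phi x - fst xi), soft_step tau (phi x - fst xi) *\<^sub>R (grad phi x - snd xi))"
  for tau :: real and x and xi :: "real \<times> (real^'n)"
 have pL: "jet phi \<in> Lp p M" by (rule jet_Lp[OF phi(1)])
 have phim: "phi \<in> borel_measurable \<L>" "grad phi \<in> borel_measurable \<L>"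
  by (intro measurable_restrict_space1 borel_measurable_lebesgue_continuous c)+
 have \<Phi>bd: "norm (\<Phi> tau x xi) \<le> norm (jet phi x - xi)" if tau: "0 < tau" for tau x xi
 proof -
  have "\<bar>soft_pos tau (phi x - fst xi)\<bar> \<le> \<bar>phi x - fst xi\<bar>"
   using soft_pos_bounds(1,2)[OF tau, of "phi x - fst xi"] by linarith
  moreover have "norm (soft_step tau (phi x - fst xi) *\<^sub>R (grad phi x - snd xi)) \<le> norm (grad phi x - snd xi)"
   using soft_step_bounds(1,2)[OF tau, of "phi x - fst xi"] by (simp add: mult_left_le_one_le)
  ultimately have "norm (soft_pos tau (phi x - fst xi), soft_step tau (phi x - fst xi) *\<^sub>R (grad phi x - snd xi)) \<le> norm (phi x - fst xi, grad phi x - snd xi)"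
   unfolding norm_Pair by (intro real_sqrt_le_mono add_mono power_mono) auto
  moreover have "(phi x - fst xi, grad phi x - snd xi) = jet phi x - xi" by (simp add: jet_def prod_eq_iff)
  ultimately show ?thesis by (auto simp: \<Phi>_def indicator_def)
 qed
 have \<Phi>m: "(\<lambda>x. \<Phi> tau x (F x)) \<in> borel_measurable M" if tau: "0 < tau" and F: "F \<in> borel_measurable M" for tau F
 proof -
  have F: "F \<in> borel_measurable \<L>" using F measurable_wmeasure by blast
  have F1: "(\<lambda>x. fst (F x)) \<in> borel_measurable \<L>" by (rule measurable_fst_snd[OF F])
  have F2: "(\<lambda>x. snd (F x)) \<in> borel_measurable \<L>" by (rule measurable_fst_snd[OF F])
  have iS: "(indicator ?S :: _ => real) \<in> borel_measurable \<L>"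
   by (intro measurable_restrict_space1 borel_measurable_indicator) (use c(5) in \<open>auto simp: compact_imp_closed\<close>)
  have "(\<lambda>x. phi x - fst (F x)) \<in> borel_measurable \<L>" by (intro borel_measurable_diff phim F1)
  then have s: "(\<lambda>x. soft_pos tau (phi x - fst (F x))) \<in> borel_measurable \<L>" "(\<lambda>x. soft_step tau (phi x - fst (F x))) \<in> borel_measurable \<L>"
   by (auto intro: borel_measurable_continuous_on[OF continuous_soft(1)[OF tau]] borel_measurable_continuous_on[OF continuous_soft(2)[OF tau]])
  show ?thesis unfolding \<Phi>_def measurable_wmeasure
   by (intro borel_measurable_scaleR iS borel_measurable_Pair s borel_measurable_diff phim F2)
 qed
 have step: "(\<lambda>x. \<Phi> tau x (V x)) \<in> Lp_closure p M ?D" if tau: "0 < tau" for tau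
 proof -
  have cont: "AE x in M. continuous_on UNIV (\<Phi> tau x)" unfolding \<Phi>_def[abs_def]
   by (intro AE_I2 continuous_on_scaleR continuous_on_Pair continuous_on_const continuous_on_diff continuous_on_fst continuous_on_snd continuous_on_id
     continuous_on_compose2[OF continuous_soft(1)[OF tau, of UNIV]] continuous_on_compose2[OF continuous_soft(2)[OF tau, of UNIV]]) auto
  have bd: "AE x in M. \<forall>xi. norm (\<Phi> tau x xi) powr p \<le> 2 powr p * norm xi powr p + 2 powr p * norm (jet phi x) powr p"
  proof (intro AE_I2 allI)
   fix x xi
   have "norm (\<Phi> tau x xi) powr p \<le> norm (jet phi x - xi) powr p" using p0 by (intro powr_mono2 \<Phi>bd tau) auto
   also have "\<dots> \<le> 2 powr p * (norm (jet phi x) powr p + norm xi powr p)" using p0 by (intro norm_diff_powr_le) auto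
   finally show "norm (\<Phi> tau x xi) powr p \<le> 2 powr p * norm xi powr p + 2 powr p * norm (jet phi x) powr p" by (simp add: algebra_simps)
  qed
  have hi: "integrable M (\<lambda>x. 2 powr p * norm (jet phi x) powr p)" by (intro integrable_mult_right Lp_integrable pL)
  note nem = Lp_nemytskii_tendsto_Lp[OF p0 WL VL Wlim \<Phi>m[OF tau] cont bd hi]
  have lim: "(\<lambda>n. Lp_dist p M (\<lambda>x. \<Phi> tau x (W n x)) (\<lambda>x. \<Phi> tau x (V x))) \<longlonglongrightarrow> 0" by (rule nem(2)) auto
  have L: "(\<lambda>x. \<Phi> tau x (V x)) \<in> Lp p M" by (rule nem(1)[OF _ _ VL]) auto
  have "eventually (\<lambda>n. 1 / real (Suc n) < d) sequentially" by (rule order_tendstoD(2)[OF lim_inverse_Suc d(1)])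
  then obtain N where N: "!!n. N \<le> n ==> 1 / real (Suc n) < d" unfolding eventually_sequentially by blast
  have mem: "(\<lambda>x. \<Phi> tau x (W (n + N) x)) \<in> ?D" for n
  proof -
   let ?n = "n + N"
   define q where "q x = soft_pos tau (phi x - mollify ?n vK x)" for x
   note sq = soft_pos_Cc1[OF tau phi(1) mC[of ?n] m0[of ?n]]
   have "q \<in> Cc1 \<Omega>" unfolding q_def[abs_def] by (rule sq(1))
   moreover have "0 \<le> q x \<and> q x \<le> phi x" for x
    using soft_pos_bounds(1,2)[OF tau, of "phi x - mollify ?n vK x"] m0[of ?n x] phi(2)[of x] by (auto simp: q_def)
   moreover have "\<Phi> tau x (W ?n x) = jet q x" for x
   proof (cases "x \<in> ?S")
    case True
    have "cball x (1 / real (Suc ?n)) \<subseteq> cball x d" by (rule subset_cball) (rule less_imp_le, rule N, simp)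
    also have "\<dots> \<subseteq> K" using True by (auto simp: K_def)
    finally have "grad (mollify ?n (\<lambda>y. indicator K y *\<^sub>R v y)) x = mollify ?n (\<lambda>y. indicator K y *\<^sub>R weak_grad \<Omega> v y) x"
     by (rule mollify_weak_grad[OF wg _ K(2,3) dom_sets vKi[unfolded vK_def[abs_def]] gKi[unfolded gK_def[abs_def]]])
    then have "grad (mollify ?n vK) x = mollify ?n gK x" by (simp add: vK_def[abs_def] gK_def[abs_def])
    then show ?thesis using True sq(2)[of x] by (simp add: \<Phi>_def jet_def q_def[abs_def] W_def)
   next
    case False
    have le: "phi x - mollify ?n vK x \<le> 0" using c(7)[OF False] m0[of ?n x] by simp
    have "jet q x = 0" using sq(2)[of x] soft_pos_bounds(3)[OF tau le] soft_step_bounds(3)[OF tau le]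
     by (simp add: jet_def q_def[abs_def] zero_prod_def)
    then show ?thesis using False by (simp add: \<Phi>_def zero_prod_def)
   qed
   ultimately show ?thesis by (intro image_eqI[where x = q]) auto
  qed
  show ?thesis by (rule Lp_closureI[OF L mem LIMSEQ_ignore_initial_segment[OF lim]])
 qed
 define tau where "tau n = 1 / real (Suc n)" for n
 have tau: "0 < tau n" "tau \<longlonglongrightarrow> 0" for n
  unfolding tau_def[abs_def] using lim_inverse_Suc by simp_all
 note vm = W1p_loc_measurable[OF v(1)]
 have Tm: "?T \<in> borel_measurable M" unfolding measurable_wmeasure jet_def
  by (intro measurable_If borel_measurable_diff borel_measurable_Pair phim vm borel_measurable_const borel_measurable_less)
 have Hi: "integrable M (\<lambda>x. norm (jet phi x - V x) powr p)" by (rule Lp_diff_integrable[OF p0 pL VL])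
 have TV: "AE x in M. ?T x = (if fst (V x) < phi x \<and> x \<in> ?S then jet phi x - V x else 0)" unfolding AE_M using v(2)
 proof eventually_elim
  case (elim x)
  show ?case using elim c(7)[of x] SK by (cases "x \<in> ?S") (auto simp: V_def vK_def gK_def)
 qed
 have TL: "?T \<in> Lp p M"
  by (rule LpI_bound[OF Tm Hi]) (use TV in \<open>auto elim!: eventually_mono\<close>)
 have lim: "(\<lambda>n. Lp_dist p M (\<lambda>x. \<Phi> (tau n) x (V x)) ?T) \<longlonglongrightarrow> 0"
 proof (rule Lp_dist_tendsto_dominated[OF p0 \<Phi>m[OF tau(1) Lp_measurable[OF VL]] Tm])
  show "AE x in M. (\<lambda>n. \<Phi> (tau n) x (V x)) \<longlonglongrightarrow> ?T x" using TV
  proof eventually_elim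
   case (elim x)
   \<comment> \<open>Where \<open>v\<close> equals \<open>phi\<close> the soft step is 0 for every
     parameter. This matches the strict inequality in the limit, so the gradients need not be
     compared on the coincidence set.\<close>
   have "(\<lambda>n. \<Phi> (tau n) x (V x)) \<longlonglongrightarrow> indicator ?S x *\<^sub>R ((if 0 < phi x - fst (V x) then phi x - fst (V x) else 0),
     (if 0 < phi x - fst (V x) then 1 else 0) *\<^sub>R (grad phi x - snd (V x)))"
    unfolding \<Phi>_def by (intro tendsto_intros soft_tendsto tau)
   also have "indicator ?S x *\<^sub>R ((if 0 < phi x - fst (V x) then phi x - fst (V x) else 0),
     (if 0 < phi x - fst (V x) then 1 else 0) *\<^sub>R (grad phi x - snd (V x))) = ?T x"
    unfolding elim by (cases "V x") (auto simp: jet_def indicator_def zero_prod_def)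
   finally show ?case .
  qed
  show "AE x in M. norm (\<Phi> (tau n) x (V x) - ?T x) powr p \<le> 2 powr p * (norm (jet phi x - V x) powr p + norm (jet phi x - V x) powr p)" for n
   using TV
  proof eventually_elim
   case (elim x)
   have "norm (\<Phi> (tau n) x (V x) - ?T x) powr p \<le> 2 powr p * (norm (\<Phi> (tau n) x (V x)) powr p + norm (?T x) powr p)"
    using p0 by (intro norm_diff_powr_le) auto
   also have "\<dots> \<le> 2 powr p * (norm (jet phi x - V x) powr p + norm (jet phi x - V x) powr p)"
    using p0 elim by (intro mult_left_mono add_mono powr_mono2 \<Phi>bd tau) auto
   finally show ?case .
  qed
  show "integrable M (\<lambda>x. 2 powr p * (norm (jet phi x - V x) powr p + norm (jet phi x - V x) powr p))"
   by (intro integrable_mult_right B_integrable_add Hi)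
 qed
 show ?thesis
 proof (rule Lp_closure_closed[OF p0 _ TL step[OF tau(1)] lim])
  show "?D \<subseteq> Lp p M" using jet_Lp by auto
 qed
qed

end

section \<open>The cone of nonnegative test functions and its closure\<close>

lemma Lp_closure_mono: "D \<subseteq> D' ==> Lp_closure p M D \<subseteq> Lp_closure p M D'"
 by (auto simp: Lp_closure_def) blast

lemma Lp_closure_Lp: "U \<in> Lp_closure p M D ==> U \<in> Lp p M"
 by (simp add: Lp_closure_def)

lemma Lp_closure_mem: "0 < p ==> D \<subseteq> Lp p M ==> U \<in> D ==> U \<in> Lp_closure p M D"
 by (auto simp: Lp_closure_def intro!: bexI[of _ U])

lemma Lp_norm_tendsto:
 fixes U :: "nat => 'a => 'b::euclidean_space"
 assumes p: "0 < p" and U: "!!n. U n \<in> Lp p M" "V \<in> Lp p M" "Lp_lim p M U V"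
 shows "(\<lambda>n. Lp_int p M (U n)) \<longlonglongrightarrow> Lp_int p M V"
proof (rule Lp_nemytskii_tendsto[OF p U, where C = 1 and h = "\<lambda>_. 0"])
 show "(\<lambda>x. norm (W x) powr p) \<in> borel_measurable M" if [measurable]: "W \<in> borel_measurable M" for W :: "'a => 'b" by measurable
 show "AE x in M. continuous_on UNIV (\<lambda>xi::'b. norm xi powr p)"
  using p by (intro AE_I2 continuous_on_powr' continuous_intros) auto
qed auto

lemma Lp_norm_zero_AE:
 fixes f :: "'a => 'b::euclidean_space"
 assumes "f \<in> Lp p M" "Lp_int p M f \<le> 0"
 shows "AE x in M. f x = 0"
proof -
 have "Lp_int p M f = 0" using assms(2) by (intro antisym) auto
 then have "AE x in M. norm (f x) powr p = 0"
  using integral_nonneg_eq_0_iff_AE[OF Lp_integrable[OF assms(1)]] by simp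
 then show ?thesis by eventually_elim simp
qed

lemma Cc1_linear:
 assumes phi: "phi \<in> Cc1 \<Omega>" and psi: "psi \<in> Cc1 \<Omega>"
 shows "(\<lambda>x. s * phi x + t * psi x) \<in> Cc1 \<Omega>"
  "jet (\<lambda>x. s * phi x + t * psi x) x = s *\<^sub>R jet phi x + t *\<^sub>R jet psi x"
proof -
 note a = Cc1_D[OF phi] and b = Cc1_D[OF psi]
 have D: "((\<lambda>x. s * phi x + t * psi x) has_derivative (\<lambda>z. z \<bullet> (s *\<^sub>R grad phi x + t *\<^sub>R grad psi x))) (at x)" for x
  by (rule has_derivative_eq_rhs, rule has_derivative_add[OF has_derivative_mult_right[OF has_derivative_grad[OF a(1)]] has_derivative_mult_right[OF has_derivative_grad[OF b(1)]]]) (simp add: inner_add_right)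
 show "jet (\<lambda>x. s * phi x + t * psi x) x = s *\<^sub>R jet phi x + t *\<^sub>R jet psi x" by (simp add: jet_def grad_eq(1)[OF D])
 show "(\<lambda>x. s * phi x + t * psi x) \<in> Cc1 \<Omega>"
 proof (rule Cc1I[OF D _ compact_Un[OF a(5) b(5)] Un_least[OF a(6) b(6)]])
  show "continuous_on UNIV (\<lambda>x. s *\<^sub>R grad phi x + t *\<^sub>R grad psi x)"
   by (intro continuous_on_add continuous_on_scaleR continuous_on_const a(3) b(3))
  show "s * phi x + t * psi x = 0" if "x \<notin> closure {x. phi x \<noteq> 0} \<union> closure {x. psi x \<noteq> 0}" for x
   using a(7)[of x] b(7)[of x] that by simp
 qed
qed

lemma zero_Cc1:
 fixes x :: "real^'n::finite"
 shows "(\<lambda>_ :: real^'n. 0) \<in> Cc1 \<Omega>" "jet (\<lambda>_. 0) x = 0"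
proof -
 have D: "((\<lambda>_. 0 :: real) has_derivative (\<lambda>z. z \<bullet> 0)) (at x)" for x :: "real^'n" by simp
 have pd: "partial_deriv i (\<lambda>_ :: real^'n. 0) = (\<lambda>_. 0)" for i using grad_eq(2)[OF D] by auto
 show "(\<lambda>_ :: real^'n. 0) \<in> Cc1 \<Omega>" by (simp add: Cc1_def pd compactly_contained_def)
 show "jet (\<lambda>_ :: real^'n. 0) x = 0" by (simp add: jet_def grad_eq(1)[OF D] zero_prod_def)
qed

context weighted_domain
begin

definition nonneg_jets :: "(real^'n => real \<times> (real^'n)) set" where
 "nonneg_jets = jet ` {phi \<in> Cc1 \<Omega>. \<forall>x. 0 \<le> phi x}"

lemma nonneg_jets_Lp: "nonneg_jets \<subseteq> Lp p M"
 using jet_Lp by (auto simp: nonneg_jets_def)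

lemma nonneg_jets_comb:
 assumes "U \<in> nonneg_jets" "V \<in> nonneg_jets" "0 \<le> s" "0 \<le> t"
 shows "(\<lambda>x. s *\<^sub>R U x + t *\<^sub>R V x) \<in> nonneg_jets"
proof -
 obtain phi psi where e: "phi \<in> Cc1 \<Omega>" "psi \<in> Cc1 \<Omega>" "\<forall>x. 0 \<le> phi x" "\<forall>x. 0 \<le> psi x" "U = jet phi" "V = jet psi"
  using assms(1,2) by (auto simp: nonneg_jets_def)
 show ?thesis unfolding nonneg_jets_def
 proof (rule image_eqI[where x = "\<lambda>x. s * phi x + t * psi x"])
  show "(\<lambda>x. s *\<^sub>R U x + t *\<^sub>R V x) = jet (\<lambda>x. s * phi x + t * psi x)"
   by (rule ext) (simp only: e Cc1_linear(2)[OF e(1,2)])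
  show "(\<lambda>x. s * phi x + t * psi x) \<in> {phi \<in> Cc1 \<Omega>. \<forall>x. 0 \<le> phi x}"
   using Cc1_linear(1)[OF e(1,2)] e(3,4) assms(3,4) by auto
 qed
qed

lemma zero_nonneg_jets: "(\<lambda>_. 0) \<in> nonneg_jets"
 unfolding nonneg_jets_def by (rule image_eqI[where x = "\<lambda>_. 0"]) (auto simp: zero_Cc1)

text \<open>Both integrals are continuous under strong convergence, so the inequality extends from
  test functions to limits. The whole pair is bounded, which makes control of gradients alone
  sufficient for Cauchy estimates.\<close>

lemma poincare_closure:
 obtains C where "0 < C" "\<forall>U\<in>Lp_closure p M (jet ` Cc1 \<Omega>). (Lp_int p M U) \<le> C * (LINT x|M. norm (snd (U x)) powr p)"
proof -
 obtain C where C: "0 < C" "\<forall>phi\<in>Cc1 \<Omega>. (Lp_int p M phi) \<le> C * Lp_int p M (grad phi)"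
  by (rule poincare)
 define C' where "C' = 2 powr p * (C + 1)"
 have C': "0 < C'" using C(1) by (simp add: C'_def)
 have jets: "Lp_int p M (jet phi) \<le> C' * (LINT x|M. norm (snd (jet phi x)) powr p)" if phi: "phi \<in> Cc1 \<Omega>" for phi
 proof -
  note L = Lp_integrable[OF Cc1_Lp(1)[OF phi dom_sets]] Lp_integrable[OF Cc1_Lp(2)[OF phi dom_sets]]
  have "Lp_int p M (jet phi) \<le> (LINT x|M. 2 powr p * (norm (phi x) powr p + norm (grad phi x) powr p))"
  proof (rule integral_mono)
   show "integrable M (\<lambda>x. norm (jet phi x) powr p)" by (rule Lp_integrable[OF jet_Lp[OF phi]])
   show "norm (jet phi x) powr p \<le> 2 powr p * (norm (phi x) powr p + norm (grad phi x) powr p)" for x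
    unfolding jet_def using p0 by (intro norm_Pair_powr_le) simp
  qed (intro integrable_mult_right B_integrable_add L)
  also have "\<dots> = 2 powr p * ((Lp_int p M phi) + Lp_int p M (grad phi))"
   by (simp only: integral_mult_right_zero B_integral_add[OF L])
  also have "\<dots> \<le> 2 powr p * (C * Lp_int p M (grad phi) + Lp_int p M (grad phi))"
   using bspec[OF C(2) phi] by (intro mult_left_mono add_right_mono) auto
  also have "\<dots> = C' * (LINT x|M. norm (snd (jet phi x)) powr p)" by (simp add: C'_def jet_def algebra_simps)
  finally show ?thesis .
 qed
 have "Lp_int p M U \<le> C' * (LINT x|M. norm (snd (U x)) powr p)" if U: "U \<in> Lp_closure p M (jet ` Cc1 \<Omega>)" for U
 proof -
  note UL = Lp_closure_Lp[OF U]
  obtain V where V: "\<forall>n::nat. V n \<in> jet ` Cc1 \<Omega>" "Lp_lim p M V U" by (rule Lp_closure_sequence[OF U])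
  have VL: "V n \<in> Lp p M" for n
  proof -
   obtain phi where "phi \<in> Cc1 \<Omega>" "V n = jet phi" using V(1) by (auto simp: image_iff)
   then show ?thesis using jet_Lp by simp
  qed
  have l1: "(\<lambda>n. Lp_int p M (V n)) \<longlonglongrightarrow> Lp_int p M U" by (rule Lp_norm_tendsto[OF p0 VL UL V(2)])
  have l2: "(\<lambda>n. LINT x|M. norm (snd (V n x)) powr p) \<longlonglongrightarrow> (LINT x|M. norm (snd (U x)) powr p)"
   by (rule Lp_norm_tendsto[OF p0 Lp_fst_snd(2)[OF p0 VL] Lp_fst_snd(2)[OF p0 UL] Lp_tendsto_fst_snd(2)[OF p0 VL UL V(2)]])
  have le: "Lp_int p M (V n) \<le> C' * (LINT x|M. norm (snd (V n x)) powr p)" for n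
  proof -
   obtain phi where "phi \<in> Cc1 \<Omega>" "V n = jet phi" using V(1) by blast
   then show ?thesis using jets by simp
  qed
  show ?thesis by (rule LIMSEQ_le[OF l1 tendsto_mult_left[OF l2]]) (use le in auto)
 qed
 then show thesis using that[OF C'] by blast
qed

lemma nonneg_closure_jet_closure: "U \<in> Lp_closure p M nonneg_jets ==> U \<in> Lp_closure p M (jet ` Cc1 \<Omega>)"
 using Lp_closure_mono[of nonneg_jets "jet ` Cc1 \<Omega>"] by (auto simp: nonneg_jets_def)

text \<open>The negative part of the limit is pointwise at most its distance to any nonnegative
  approximant, so its integral vanishes.\<close>

lemma nonneg_closure_AE:
 assumes U: "U \<in> Lp_closure p M nonneg_jets"
 shows "AE x in \<L>. 0 \<le> fst (U x)"
proof -
 note UL = Lp_closure_Lp[OF U]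
 obtain V where V: "\<forall>n::nat. V n \<in> nonneg_jets" "Lp_lim p M V U" by (rule Lp_closure_sequence[OF U])
 have VL: "V n \<in> Lp p M" for n using V(1) nonneg_jets_Lp by blast
 have m: "(\<lambda>x. min (fst (U x)) 0) \<in> borel_measurable M"
  by (intro borel_measurable_min borel_measurable_const Lp_measurable[OF Lp_fst_snd(1)[OF p0 UL]])
 have L: "(\<lambda>x. min (fst (U x)) 0) \<in> Lp p M"
  by (rule LpI_bound[OF m Lp_integrable[OF Lp_fst_snd(1)[OF p0 UL]]]) (use p0 in \<open>auto intro!: AE_I2 powr_mono2\<close>)
 have le: "(LINT x|M. norm (min (fst (U x)) 0) powr p) \<le> Lp_dist p M (V n) U" for n
 proof (rule integral_mono[OF Lp_integrable[OF L] Lp_diff_integrable[OF p0 VL UL]])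
  fix x
  obtain phi where "\<forall>x. 0 \<le> phi x" "V n = jet phi" using V(1) by (auto simp: nonneg_jets_def image_iff)
  then have "0 \<le> fst (V n x)" by (simp add: jet_def)
  then have "norm (min (fst (U x)) 0) \<le> norm (fst (V n x - U x))" by auto
  also have "\<dots> \<le> norm (V n x - U x)" by (metis norm_fst_le prod.collapse)
  finally show "norm (min (fst (U x)) 0) powr p \<le> norm (V n x - U x) powr p" using p0 by (intro powr_mono2) auto
 qed
 have "(LINT x|M. norm (min (fst (U x)) 0) powr p) \<le> 0" by (rule LIMSEQ_le_const[OF V(2)]) (use le in auto)
 from Lp_norm_zero_AE[OF L this] show ?thesis unfolding AE_M by eventually_elim auto
qed

end

context flux_source
begin

lemma flux_pairing_integrable:
 assumes "F \<in> Lp p M" "G \<in> Lp p M"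
 shows "integrable M (\<lambda>x. a x (F x) \<bullet> G x)"
proof (rule B_integrable_bound)
 show "integrable M (\<lambda>x. norm (F x) powr p + norm (G x) powr p)"
  by (intro B_integrable_add Lp_integrable assms)
 show "(\<lambda>x. a x (F x) \<bullet> G x) \<in> borel_measurable M" unfolding measurable_wmeasure
  by (intro borel_measurable_inner flux_compose_measurable Lp_M_measurable assms)
 show "AE x in M. norm (a x (F x) \<bullet> G x) \<le> norm (norm (F x) powr p + norm (G x) powr p)"
 proof (intro AE_I2)
  fix x
  show "norm (a x (F x) \<bullet> G x) \<le> norm (norm (F x) powr p + norm (G x) powr p)"
   using order.trans[OF Cauchy_Schwarz_ineq2 flux_growth_mult, of x "F x" "G x"] by simp
 qed
qed

lemma source_pairing:
 assumes h: "h \<in> borel_measurable \<L>" "!!x. \<bar>h x\<bar> \<le> J" and u: "u \<in> borel_measurable \<L>"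
  and t: "t \<in> Lp p M"
 shows "integrable \<L> (\<lambda>x. h x * g (u x) * t x)" "integrable M (\<lambda>x. h x * g (u x) * t x / w x)"
  "(LINT x|M. h x * g (u x) * t x / w x) = (LINT x|\<L>. h x * g (u x) * t x)"
proof -
 have m: "(\<lambda>x. h x * g (u x)) \<in> borel_measurable \<L>" by (intro borel_measurable_times h source_measurable u)
 have "\<bar>h x * g (u x)\<bar> \<le> J * k" for x
  unfolding abs_mult using h(2) source_nonneg source_le by (intro mult_mono) (auto intro: order.trans[OF abs_ge_zero])
 then show i: "integrable \<L> (\<lambda>x. h x * g (u x) * t x)"
  using integrable_mult_bounded[OF Lp_M_integrable[OF t] m, of "J * k"] by simp
 show "integrable M (\<lambda>x. h x * g (u x) * t x / w x)"
  "(LINT x|M. h x * g (u x) * t x / w x) = (LINT x|\<L>. h x * g (u x) * t x)"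
  by (rule divide_weight[OF i])+
qed

lemma operator_pairing:
 assumes h: "h \<in> borel_measurable \<L>" "!!x. \<bar>h x\<bar> \<le> J" and U: "U \<in> Lp p M" and V: "V \<in> Lp p M"
 shows "(LINT x|M. operator h x (U x) \<bullet> V x)
  = (LINT x|M. a x (snd (U x)) \<bullet> snd (V x)) - (LINT x|\<L>. h x * g (fst (U x)) * fst (V x))"
proof -
 note U' = Lp_fst_snd[OF p0 U] and V' = Lp_fst_snd[OF p0 V]
 note s = source_pairing[OF h Lp_M_measurable[OF U'(1)] V'(1)]
 show ?thesis unfolding operator_inner s(3)[symmetric]
  by (rule B_integral_diff[OF flux_pairing_integrable[OF U'(2) V'(2)] s(2)])
qed

lemma source_integral_le:
 assumes h: "h \<in> borel_measurable \<L>" "!!x. 0 \<le> h x" "integrable \<L> h"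
  and u: "AE x in \<L>. 0 \<le> u x"
 shows "(LINT x|\<L>. h x * g (u x) * u x) \<le> L * (LINT x|\<L>. h x)"
proof -
 have le: "AE x in \<L>. h x * g (u x) * u x \<le> L * h x"
  using u
 proof eventually_elim
  case (elim x)
  have "h x * (u x * g (u x)) \<le> h x * L" by (intro mult_left_mono source_mult elim h)
  then show ?case by (simp add: mult_ac)
 qed
 \<comment> \<open>Only the larger side needs to be integrable: a Bochner integral that fails to
   exist has the value 0, and \<open>L * h\<close> is nonnegative.\<close>
 have "(LINT x|\<L>. h x * g (u x) * u x) \<le> (LINT x|\<L>. L * h x)"
 proof (rule integral_mono_AE')
  show "AE x in \<L>. 0 \<le> L * h x" using h(2) L_nonneg by simp
 qed (use h(3) le in auto)
 then show ?thesis by simp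
qed

lemma solution_energy:
 assumes h: "h \<in> borel_measurable \<L>" "!!x. 0 \<le> h x" "!!x. h x \<le> J" "integrable \<L> h" 
  and Uc: "U \<in> Lp_closure p M nonneg_jets" and z: "0 \<le> (LINT x|M. operator h x (U x) \<bullet> (0 - U x))"
 shows "(LINT x|M. norm (snd (U x)) powr p) \<le> L * (LINT x|\<L>. h x)"
proof -
 have hJ: "\<bar>h x\<bar> \<le> J" for x using h(2,3) by simp
 note UL = Lp_closure_Lp[OF Uc]
 have GL: "(\<lambda>x. snd (U x)) \<in> Lp p M" by (rule Lp_fst_snd(2)[OF p0 UL])
 have "(LINT x|M. norm (snd (U x)) powr p) \<le> (LINT x|M. a x (snd (U x)) \<bullet> snd (U x))"
  by (rule integral_mono_AE[OF Lp_integrable[OF GL] flux_pairing_integrable[OF GL GL]])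
   (use flux_coercive in \<open>simp only: AE_M, elim eventually_mono, blast\<close>)
 also have "\<dots> \<le> (LINT x|\<L>. h x * g (fst (U x)) * fst (U x))"
  using z operator_pairing[OF h(1) hJ UL UL] by simp
 also have "\<dots> \<le> L * (LINT x|\<L>. h x)" by (rule source_integral_le[OF h(1,2,4) nonneg_closure_AE[OF Uc]])
 finally show ?thesis .
qed

section \<open>The variational inequality over the cone, and comparison\<close>

definition solution :: "(real^'n => real) => (real^'n => real \<times> (real^'n)) => bool" where
 "solution h U \<longleftrightarrow> U \<in> Lp_closure p M nonneg_jets \<and>
  (\<forall>V\<in>Lp_closure p M nonneg_jets. 0 \<le> (LINT x|M. operator h x (U x) \<bullet> (V x - U x)))"

text \<open>The abstract theorem needs a bounded set, so it is applied to the part of the cone below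
  a level strictly above the a priori bound. Since 0 is admissible there, the energy estimate shows
  that the level is not reached; the inequality then extends along segments to the whole cone, and
  by continuity to its closure.\<close>

theorem solution_exists:
 assumes h: "h \<in> borel_measurable \<L>" "!!x. 0 \<le> h x" "!!x. h x \<le> J"
 shows "\<exists>U. solution h U"
proof -
 interpret B: monotone_operator M p "operator h" "1 + J * k" "\<lambda>x. J * k * (dual_weight x / w x)"
  by (rule monotone_operator_operator[OF h(2,3,1)])
 have hJ: "\<bar>h x\<bar> \<le> J" for x using h(2,3) by simp
 have hi: "integrable \<L> h"
 proof (rule B_integrable_bound[where f = "\<lambda>_. J"])
  have "\<Omega> \<in> lmeasurable" using bounded_dom dom_sets by (rule bounded_set_imp_lmeasurable)
  then show "integrable \<L> (\<lambda>_. J)"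
   by (simp add: integrable_lebesgue_on_iff dom_sets lmeasurable_iff_integrable)
  show "AE x in \<L>. norm (h x) \<le> norm J" using hJ by (auto intro!: AE_I2 order.trans[OF _ abs_ge_self])
 qed (rule h(1))
 obtain C where C: "0 < C" "\<forall>U\<in>Lp_closure p M (jet ` Cc1 \<Omega>). (Lp_int p M U) \<le> C * (LINT x|M. norm (snd (U x)) powr p)"
  by (rule poincare_closure)
 define R where "R = C * (L * (LINT x|\<L>. h x))"
 have "0 \<le> (LINT x|\<L>. h x)" using h by (intro integral_nonneg_AE) auto
 then have R: "0 \<le> R" using C(1) L_nonneg by (simp add: R_def)
 \<comment> \<open>The solution has energy at most \<open>R\<close>. One unit of the margin covers
   the approximants of the solution, the other a small step towards an arbitrary element of the
   cone.\<close>
 define D where "D = {U \<in> nonneg_jets. (Lp_int p M U) \<le> R + 2}"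
 have DN: "D \<subseteq> nonneg_jets" by (auto simp: D_def)
 have DL: "D \<subseteq> Lp p M" using nonneg_jets_Lp DN by blast
 have z: "(\<lambda>_. 0) \<in> D" using zero_nonneg_jets R p0 by (simp add: D_def)
 have comb: "(LINT x|M. norm ((1 - t) *\<^sub>R U x + t *\<^sub>R V x) powr p) \<le> (1 - t) * Lp_int p M U + t * Lp_int p M V"
  if "U \<in> Lp p M" "V \<in> Lp p M" "0 \<le> t" "t \<le> 1" for U V :: "real^'n => real \<times> (real^'n)" and t
 proof -
  have "(LINT x|M. norm ((1 - t) *\<^sub>R U x + t *\<^sub>R V x) powr p) \<le> (LINT x|M. (1 - t) * norm (U x) powr p + t * norm (V x) powr p)"
   by (rule integral_mono) (use that p0 in \<open>auto intro!: Lp_integrable Lp_add Lp_scaleR norm_powr_convex_comb p B_integrable_add integrable_mult_right\<close>)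
  also have "\<dots> = (1 - t) * Lp_int p M U + t * Lp_int p M V"
   using Lp_integrable[OF that(1)] Lp_integrable[OF that(2)] by simp
  finally show ?thesis .
 qed
 have conv: "(\<lambda>x. (1 - t) *\<^sub>R U x + t *\<^sub>R V x) \<in> D" if "U \<in> D" "V \<in> D" "0 \<le> t" "t \<le> 1" for U V t
 proof -
  have UV: "Lp_int p M U \<le> R + 2" "Lp_int p M V \<le> R + 2" using that by (auto simp: D_def)
  have "(LINT x|M. norm ((1 - t) *\<^sub>R U x + t *\<^sub>R V x) powr p) \<le> (1 - t) * Lp_int p M U + t * Lp_int p M V"
   by (rule comb) (use that DL in auto)
  also have "\<dots> \<le> (1 - t) * (R + 2) + t * (R + 2)" using that UV by (intro add_mono mult_left_mono) auto
  also have "\<dots> = R + 2" by (simp add: algebra_simps)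
  finally show ?thesis using nonneg_jets_comb[of U V "1 - t" t] that by (auto simp: D_def)
 qed
 obtain Us U where Us: "!!n. Us n \<in> D" and UL: "U \<in> Lp p M" and lim: "Lp_lim p M Us U"
  and VI: "!!V. V \<in> D ==> 0 \<le> (LINT x|M. operator h x (U x) \<bullet> (V x - U x))"
 proof (rule B.variational_inequality_exists[of D "R + 2"])
  show "D \<noteq> {}" using z by blast
 qed (use DL conv in \<open>auto simp: D_def\<close>)
 have UsL: "Us n \<in> Lp p M" for n using Us DL by blast
 have Uc: "U \<in> Lp_closure p M nonneg_jets" by (rule Lp_closureI[OF UL subsetD[OF DN Us] lim])
 have tend: "(\<lambda>n. LINT x|M. operator h x (U x) \<bullet> W n x) \<longlonglongrightarrow> (LINT x|M. operator h x (U x) \<bullet> W0 x)"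
  if "!!n. W n \<in> Lp p M" "W0 \<in> Lp p M" "Lp_lim p M W W0" for W W0
  by (rule B.pairing_tendsto) (use UL that p0 in auto)
 have "(LINT x|M. norm (snd (U x)) powr p) \<le> L * (LINT x|\<L>. h x)"
  by (rule solution_energy[OF h hi Uc VI[OF z]])
 then have UR: "Lp_int p M U \<le> R"
  using bspec[OF C(2) nonneg_closure_jet_closure[OF Uc]] C(1) unfolding R_def by (smt (verit) mult_left_mono)
 have cone: "0 \<le> (LINT x|M. operator h x (U x) \<bullet> (V x - U x))" if V: "V \<in> nonneg_jets" for V
 proof -
  have VL: "V \<in> Lp p M" using V nonneg_jets_Lp by blast
  have V0: "0 \<le> Lp_int p M V" by simp
  obtain I where I: "I = Lp_int p M V" by blast
  \<comment> \<open>A step so short that the fraction \<open>s\<close> of the energy of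
    \<open>V\<close> is at most 1; the mixtures with late approximants then remain in
    \<open>D\<close>.\<close>
  define s where "s = 1 / (1 + I)"
  have s: "0 < s" "s \<le> 1" "s * Lp_int p M V \<le> 1"
   using V0 unfolding I[symmetric] by (auto simp: s_def divide_le_eq)
  have "eventually (\<lambda>n. (Lp_int p M (Us n)) < R + 1) sequentially"
   by (rule order_tendstoD(2)[OF Lp_norm_tendsto[OF p0 UsL UL lim]]) (use UR in simp)
  then obtain N where N: "!!n. N \<le> n ==> Lp_int p M (Us n) < R + 1" unfolding eventually_sequentially by blast
  define W where "W n x = (1 - s) *\<^sub>R Us (n + N) x + s *\<^sub>R V x" for n x
  have WD: "W n \<in> D" for n
  proof -
   have "Lp_int p M (W n) \<le> (1 - s) * (LINT x|M. norm (Us (n + N) x) powr p) + s * Lp_int p M V"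
    unfolding W_def by (rule comb[OF UsL VL]) (use s in auto)
   also have "\<dots> \<le> 1 * (R + 1) + 1" using s N[of "n + N"] R by (intro add_mono mult_mono) auto
   finally show ?thesis using nonneg_jets_comb[of "Us (n + N)" V "1 - s" s] s V Us[of "n + N"] DN by (auto simp: D_def W_def[abs_def])
  qed
  have "(\<lambda>n. Lp_dist p M (W n) (\<lambda>x. (1 - s) *\<^sub>R U x + s *\<^sub>R V x)) \<longlonglongrightarrow> 0"
   unfolding W_def using LIMSEQ_ignore_initial_segment[OF lim, of N]
   by (intro Lp_tendsto_add Lp_tendsto_scaleR Lp_scaleR p0 UsL UL VL) auto
  then have "(\<lambda>n. Lp_dist p M (\<lambda>x. W n x + (-1) *\<^sub>R U x) (\<lambda>x. ((1 - s) *\<^sub>R U x + s *\<^sub>R V x) + (-1) *\<^sub>R U x)) \<longlonglongrightarrow> 0"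
   by (intro Lp_tendsto_add Lp_tendsto_scaleR Lp_scaleR Lp_add p0 subsetD[OF DL WD] UL VL) auto
  then have "(\<lambda>n. LINT x|M. operator h x (U x) \<bullet> (W n x + (-1) *\<^sub>R U x)) \<longlonglongrightarrow> (LINT x|M. operator h x (U x) \<bullet> (((1 - s) *\<^sub>R U x + s *\<^sub>R V x) + (-1) *\<^sub>R U x))"
   by (intro tend Lp_scaleR Lp_add p0 subsetD[OF DL WD] UL VL)
  moreover have "0 \<le> (LINT x|M. operator h x (U x) \<bullet> (W n x + (-1) *\<^sub>R U x))" for n using VI[OF WD[of n]] by simp
  ultimately have "0 \<le> (LINT x|M. operator h x (U x) \<bullet> (((1 - s) *\<^sub>R U x + s *\<^sub>R V x) + (-1) *\<^sub>R U x))"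
   by (intro LIMSEQ_le_const) auto
  moreover have "((1 - s) *\<^sub>R U x + s *\<^sub>R V x) + (-1) *\<^sub>R U x = s *\<^sub>R (V x - U x)" for x by (simp add: algebra_simps)
  ultimately have "0 \<le> s * (LINT x|M. operator h x (U x) \<bullet> (V x - U x))" by simp
  then show ?thesis using s by (simp add: zero_le_mult_iff)
 qed
 have "0 \<le> (LINT x|M. operator h x (U x) \<bullet> (V x - U x))" if V: "V \<in> Lp_closure p M nonneg_jets" for V
 proof -
  note VL = Lp_closure_Lp[OF V]
  obtain Vs where Vs: "\<forall>n::nat. Vs n \<in> nonneg_jets" "Lp_lim p M Vs V" by (rule Lp_closure_sequence[OF V])
  have VsL: "Vs n \<in> Lp p M" for n using Vs(1) nonneg_jets_Lp by blast
  have "(\<lambda>n. Lp_dist p M (\<lambda>x. Vs n x + (-1) *\<^sub>R U x) (\<lambda>x. V x + (-1) *\<^sub>R U x)) \<longlonglongrightarrow> 0"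
   by (intro Lp_tendsto_add Lp_scaleR p0 VsL UL VL Vs(2)) simp
  then have "(\<lambda>n. LINT x|M. operator h x (U x) \<bullet> (Vs n x + (-1) *\<^sub>R U x)) \<longlonglongrightarrow> (LINT x|M. operator h x (U x) \<bullet> (V x + (-1) *\<^sub>R U x))"
   by (intro tend Lp_add Lp_scaleR p0 VsL UL VL)
  moreover have "0 \<le> (LINT x|M. operator h x (U x) \<bullet> (Vs n x + (-1) *\<^sub>R U x))" for n using cone Vs(1) by simp
  ultimately have "0 \<le> (LINT x|M. operator h x (U x) \<bullet> (V x + (-1) *\<^sub>R U x))" by (intro LIMSEQ_le_const) auto
  then show ?thesis by simp
 qed
 then show ?thesis using Uc by (auto simp: solution_def)
qed

end

context flux_source
begin

lemma closure_pairing_le: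
 assumes h: "h \<in> borel_measurable \<L>" "!!x. 0 \<le> h x" "!!x. h x \<le> J"
  and U: "U \<in> Lp p M" and D: "D \<subseteq> Lp p M" and V: "V \<in> Lp_closure p M D"
  and le: "!!W. W \<in> D ==> (LINT x|M. operator h x (U x) \<bullet> W x) \<le> b"
 shows "(LINT x|M. operator h x (U x) \<bullet> V x) \<le> b"
proof -
 interpret B: monotone_operator M p "operator h" "1 + J * k" "\<lambda>x. J * k * (dual_weight x / w x)"
  by (rule monotone_operator_operator[OF h(2,3,1)])
 obtain Vs where Vs: "\<forall>n::nat. Vs n \<in> D" "Lp_lim p M Vs V" by (rule Lp_closure_sequence[OF V])
 have "(\<lambda>n. LINT x|M. operator h x (U x) \<bullet> Vs n x) \<longlonglongrightarrow> (LINT x|M. operator h x (U x) \<bullet> V x)"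
  by (rule B.pairing_tendsto) (use U Vs D Lp_closure_Lp[OF V] p0 in auto)
 then show ?thesis by (rule LIMSEQ_le_const2) (use le Vs(1) in auto)
qed

lemma operator_pairing_diff:
 assumes h: "h \<in> borel_measurable \<L>" "!!x. 0 \<le> h x" "!!x. h x \<le> J"
  and L: "U \<in> Lp p M" "V \<in> Lp p M" "W \<in> Lp p M"
 shows "(LINT x|M. operator h x (U x) \<bullet> (V x - W x))
  = (LINT x|M. operator h x (U x) \<bullet> V x) - (LINT x|M. operator h x (U x) \<bullet> W x)"
proof -
 interpret B: monotone_operator M p "operator h" "1 + J * k" "\<lambda>x. J * k * (dual_weight x / w x)"
  by (rule monotone_operator_operator[OF h(2,3,1)])
 show ?thesis unfolding inner_diff_right
  by (intro B_integral_diff B.pairing_integrable L)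
qed

lemma solution_jet_closure_add:
 assumes U: "U \<in> Lp_closure p M nonneg_jets" and V: "V \<in> nonneg_jets"
 shows "(\<lambda>x. U x + V x) \<in> Lp_closure p M nonneg_jets"
proof -
 note UL = Lp_closure_Lp[OF U]
 have VL: "V \<in> Lp p M" using V nonneg_jets_Lp by blast
 obtain Us where Us: "\<forall>n::nat. Us n \<in> nonneg_jets" "Lp_lim p M Us U" by (rule Lp_closure_sequence[OF U])
 have mem: "(\<lambda>x. Us n x + V x) \<in> nonneg_jets" for n
  using nonneg_jets_comb[OF spec[OF Us(1), of n] V, of 1 1] by simp
 show ?thesis
  by (rule Lp_closureI[OF Lp_add[OF p0 UL VL] mem]) (use Us(2) in simp)
qed

text \<open>The cone is closed under addition, so the solution plus a nonnegative test function is
  admissible and the solution itself cancels.\<close>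

lemma solution_super:
 assumes h: "h \<in> borel_measurable \<L>" "!!x. 0 \<le> h x" "!!x. h x \<le> J" and U: "solution h U"
  and phi: "phi \<in> Cc1 \<Omega>" "!!x. 0 \<le> phi x"
 shows "(LINT x|\<L>. h x * g (fst (U x)) * phi x) \<le> (LINT x|M. a x (snd (U x)) \<bullet> grad phi x)"
proof -
 have hJ: "\<bar>h x\<bar> \<le> J" for x using h(2,3) by simp
 have Uc: "U \<in> Lp_closure p M nonneg_jets" using U by (simp add: solution_def)
 have j: "jet phi \<in> nonneg_jets" using phi by (auto simp: nonneg_jets_def)
 have "0 \<le> (LINT x|M. operator h x (U x) \<bullet> ((U x + jet phi x) - U x))"
  by (rule bspec[OF conjunct2[OF U[unfolded solution_def]] solution_jet_closure_add[OF Uc j]])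
 then show ?thesis
  using operator_pairing[OF h(1) hJ Lp_closure_Lp[OF Uc] jet_Lp[OF phi(1)]] by (simp add: jet_def)
qed

text \<open>With \<open>phi n\<close> tending to \<open>u\<close>, the truncation \<open>T n\<close>
  of \<open>phi n - v\<close> is tested in both inequalities. Their difference controls the gradient
  of \<open>T n\<close> by strong monotonicity, up to errors from \<open>phi n - u\<close> that
  vanish in the limit and a term with the free parameter \<open>theta\<close>. The Poincare
  inequality then leaves nothing of \<open>(u - v)_+\<close>.\<close>

theorem solution_le_supersolution:
 assumes h: "h \<in> borel_measurable \<L>" "!!x. 0 \<le> h x" "!!x. h x \<le> J" and U: "solution h U"
  and v: "v \<in> W1p_loc p w \<Omega>" "AE x in \<L>. 0 < v x"
  and super: "!!q. q \<in> Cc1 \<Omega> ==> (!!x. 0 \<le> q x) ==>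
   (LINT x|\<L>. h x * g (v x) * q x) \<le> (LINT x|M. a x (weak_grad \<Omega> v x) \<bullet> grad q x)"
 shows "AE x in \<L>. fst (U x) \<le> v x"
proof -
 interpret B: monotone_operator M p "operator h" "1 + J * k" "\<lambda>x. J * k * (dual_weight x / w x)"
  by (rule monotone_operator_operator[OF h(2,3,1)])
 have J: "0 \<le> J" using h(2,3) order_trans by blast
 have hJ: "\<bar>h x\<bar> \<le> J" for x using h(2,3) by simp
 have Uc: "U \<in> Lp_closure p M nonneg_jets"
  and VI: "!!V. V \<in> Lp_closure p M nonneg_jets ==> 0 \<le> (LINT x|M. operator h x (U x) \<bullet> (V x - U x))"
  using U by (auto simp: solution_def)
 note UL = Lp_closure_Lp[OF Uc]
 note uL = Lp_fst_snd(1)[OF p0 UL] and GL = Lp_fst_snd(2)[OF p0 UL]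
 obtain Us where Us: "\<forall>n::nat. Us n \<in> nonneg_jets" "Lp_lim p M Us U" by (rule Lp_closure_sequence[OF Uc])
 have "\<exists>phi. phi \<in> Cc1 \<Omega> \<and> (\<forall>x. 0 \<le> phi x) \<and> Us n = jet phi" for n using spec[OF Us(1), of n] by (auto simp: nonneg_jets_def)
 then obtain phi where phi: "!!n. phi n \<in> Cc1 \<Omega>" "!!n x. 0 \<le> phi n x" "!!n. Us n = jet (phi n)" by metis
 have lim: "(\<lambda>n. Lp_dist p M (jet (phi n)) U) \<longlonglongrightarrow> 0" using Us(2) by (simp add: phi(3))
 have jL: "jet (phi n) \<in> Lp p M" for n by (rule jet_Lp[OF phi(1)])
 define V where "V x = (v x, weak_grad \<Omega> v x)" for x
 define T where "T n x = (if v x < phi n x then jet (phi n) x - V x else 0)" for n x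
 have Tc: "T n \<in> Lp_closure p M (jet ` {q \<in> Cc1 \<Omega>. \<forall>x. 0 \<le> q x \<and> q x \<le> phi n x})" for n
  unfolding T_def V_def by (rule truncated_difference_closure[OF phi(1,2) v])
 note TL = Lp_closure_Lp[OF Tc]
 \<comment> \<open>The jet of \<open>v\<close> need not be in \<open>L^p\<close> on the whole
   domain, so it is cut off to the support of \<open>phi n\<close>, outside which \<open>T n\<close>
   vanishes.\<close>
 define VK where "VK n x = indicator (closure {x. phi n x \<noteq> 0}) x *\<^sub>R V x" for n x
 have VKL: "VK n \<in> Lp p M" for n
 proof -
  note c = Cc1_D(5,6)[OF phi(1)[of n]]
  have s: "closure {x. phi n x \<noteq> 0} \<in> sets lebesgue" using c(1) by (auto simp: compact_imp_closed)
  have "V \<in> Lp p (wmeasure (closure {x. phi n x \<noteq> 0}))" unfolding V_def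
   using W1p_loc_D(2)[OF v(1) c] by (intro Lp_Pair p0) auto
  from Lp_wmeasure_extend[OF s this] show ?thesis unfolding VK_def
   by (rule Lp_wmeasure_mono(1)[OF _ dom_sets, of UNIV, rotated 2]) auto
 qed
 define eps where "eps n = (LINT x|M. operator h x (U x) \<bullet> (jet (phi n) x - U x))" for n
 \<comment> \<open>For \<open>0 \<le> q \<le> phi n\<close> the difference \<open>phi n - q\<close>
   is in the cone. The solution tested with it bounds the pairing with \<open>q\<close> by
   \<open>eps n\<close>, which would be 0 if \<open>phi n\<close> were the solution itself.\<close>
 have A: "(LINT x|M. operator h x (U x) \<bullet> T n x) \<le> eps n" for n
 proof (rule closure_pairing_le[OF h UL _ Tc[of n]])
  show "jet ` {q \<in> Cc1 \<Omega>. \<forall>x. 0 \<le> q x \<and> q x \<le> phi n x} \<subseteq> Lp p M" using jet_Lp by auto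
  fix W assume "W \<in> jet ` {q \<in> Cc1 \<Omega>. \<forall>x. 0 \<le> q x \<and> q x \<le> phi n x}"
  then obtain q where q: "q \<in> Cc1 \<Omega>" "\<forall>x. 0 \<le> q x \<and> q x \<le> phi n x" "W = jet q" by auto
  have e: "jet (\<lambda>x. 1 * phi n x + (- 1) * q x) = (\<lambda>x. jet (phi n) x - W x)"
   by (rule ext) (simp only: Cc1_linear(2)[OF phi(1) q(1)] q(3), simp)
  have "(\<lambda>x. 1 * phi n x + (- 1) * q x) \<in> {phi \<in> Cc1 \<Omega>. \<forall>x. 0 \<le> phi x}" using Cc1_linear(1)[OF phi(1)[of n] q(1), of 1 "- 1"] q(2) by auto
  then have "(\<lambda>x. jet (phi n) x - W x) \<in> nonneg_jets" unfolding nonneg_jets_def e[symmetric] by (rule imageI)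
  from VI[OF Lp_closure_mem[OF p0 nonneg_jets_Lp this]]
  have "0 \<le> (LINT x|M. operator h x (U x) \<bullet> ((jet (phi n) x - U x) - W x))" by (simp add: algebra_simps)
  also have "\<dots> = eps n - (LINT x|M. operator h x (U x) \<bullet> W x)"
   unfolding eps_def by (rule operator_pairing_diff[OF h UL Lp_diff[OF p0 jL UL]]) (simp add: q jet_Lp[OF q(1)])
  finally show "(LINT x|M. operator h x (U x) \<bullet> W x) \<le> eps n" by simp
 qed
 \<comment> \<open>The inequality for \<open>v\<close> is known only for nonnegative test functions;
   it reaches \<open>T n\<close> through the approximating functions \<open>q\<close>, whose
   supports lie in that of \<open>phi n\<close>, where \<open>VK n\<close> is the jet of
   \<open>v\<close>.\<close>
 have Bn: "0 \<le> (LINT x|M. operator h x (VK n x) \<bullet> T n x)" for n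
 proof -
  let ?S = "closure {x. phi n x \<noteq> 0}"
  obtain Q where Q: "\<forall>m::nat. Q m \<in> jet ` {q \<in> Cc1 \<Omega>. \<forall>x. 0 \<le> q x \<and> q x \<le> phi n x}" "(\<lambda>m. Lp_dist p M (Q m) (T n)) \<longlonglongrightarrow> 0"
   by (rule Lp_closure_sequence[OF Tc])
  have QL: "Q m \<in> Lp p M" for m using spec[OF Q(1), of m] jet_Lp by auto
  have t: "(\<lambda>m. LINT x|M. operator h x (VK n x) \<bullet> Q m x) \<longlonglongrightarrow> (LINT x|M. operator h x (VK n x) \<bullet> T n x)"
   by (rule B.pairing_tendsto) (use VKL QL TL Q(2) p0 in auto)
  have "0 \<le> (LINT x|M. operator h x (VK n x) \<bullet> Q m x)" for m
  proof -
   obtain q where q: "q \<in> Cc1 \<Omega>" "\<forall>x. 0 \<le> q x \<and> q x \<le> phi n x" "Q m = jet q" using spec[OF Q(1), of m] by auto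
   have off: "q x = 0" "grad q x = 0" if "x \<notin> ?S" for x
   proof -
    have "q y = 0" if "phi n y = 0" for y using q(2)[rule_format, of y] that by auto
    then have "closure {x. q x \<noteq> 0} \<subseteq> ?S" by (intro closure_mono) blast
    then show "q x = 0" "grad q x = 0" using Cc1_D(7,8)[OF q(1), of x] that by auto
   qed
   have "(LINT x|M. operator h x (VK n x) \<bullet> Q m x)
     = (LINT x|M. a x (snd (VK n x)) \<bullet> grad q x) - (LINT x|\<L>. h x * g (fst (VK n x)) * q x)"
    unfolding operator_pairing[OF h(1) hJ VKL QL] by (simp add: q(3) jet_def)
   also have "(LINT x|M. a x (snd (VK n x)) \<bullet> grad q x) = (LINT x|M. a x (weak_grad \<Omega> v x) \<bullet> grad q x)"
    by (rule B_integral_cong) (use off in \<open>auto simp: VK_def V_def indicator_def\<close>)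
   also have "(LINT x|\<L>. h x * g (fst (VK n x)) * q x) = (LINT x|\<L>. h x * g (v x) * q x)"
    by (rule B_integral_cong) (use off in \<open>auto simp: VK_def V_def indicator_def\<close>)
   finally show ?thesis using super[OF q(1)] q(2) by simp
  qed
  then show ?thesis by (intro LIMSEQ_le_const[OF t]) auto
 qed
 define t where "t n = (LINT x|\<L>. \<bar>phi n x - fst (U x)\<bar>)" for n
 have dL: "(\<lambda>x. phi n x - fst (U x)) \<in> Lp p M" for n by (rule Lp_diff[OF p0 Cc1_Lp(1)[OF phi(1) dom_sets] uL])
 have adL: "(\<lambda>x. \<bar>phi n x - fst (U x)\<bar>) \<in> Lp p M" for n
  by (rule LpI_bound[OF borel_measurable_abs[OF Lp_measurable[OF dL]] Lp_integrable[OF dL]]) auto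
 note di = divide_weight(1)[OF Lp_M_integrable[OF adL]]
 have dt: "(LINT x|M. \<bar>phi n x - fst (U x)\<bar> / w x) = t n" for n
  unfolding t_def by (rule divide_weight(2)[OF Lp_M_integrable[OF adL]])
 have t0: "t \<longlonglongrightarrow> 0"
 proof -
  have l1: "(\<lambda>n. Lp_dist p M (phi n) (\<lambda>x. fst (U x))) \<longlonglongrightarrow> 0"
   using Lp_tendsto_fst_snd(1)[OF p0 jL UL lim] by (simp add: jet_def)
  have "(\<lambda>n. LINT x|\<L>. 1 *\<^sub>R \<bar>phi n x - fst (U x)\<bar>) \<longlonglongrightarrow> (LINT x|\<L>. 1 *\<^sub>R 0)"
   by (rule Lp_tendsto_integral_mult[where L = 1, OF adL Lp_zero]) (use l1 in auto)
  then show ?thesis by (simp add: t_def[abs_def])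
 qed
 have eps0: "eps \<longlonglongrightarrow> 0"
 proof -
  have "(\<lambda>n. LINT x|M. operator h x (U x) \<bullet> (jet (phi n) x - U x)) \<longlonglongrightarrow> (LINT x|M. operator h x (U x) \<bullet> 0)"
   by (rule B.pairing_tendsto[OF UL UL Lp_diff[OF p0 jL UL] Lp_zero]) (use lim p0 in auto)
  then show ?thesis by (simp add: eps_def[abs_def])
 qed
 obtain C where C: "0 < C" "\<forall>U\<in>Lp_closure p M (jet ` Cc1 \<Omega>). (Lp_int p M U) \<le> C * (LINT x|M. norm (snd (U x)) powr p)"
  by (rule poincare_closure)
 define I where "I = (LINT x|M. norm (snd (U x)) powr p)"
 have I0: "0 \<le> I" by (simp add: I_def)
 \<comment> \<open>The excess of the solution over \<open>v\<close>. It is bounded by the solution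
   because both are compared where \<open>v\<close> is positive, hence it lies in \<open>L^p\<close>
   although \<open>v\<close> may not.\<close>
 define P where "P x = max (fst (U x) - v x) 0" for x
 note vm = W1p_loc_measurable(1)[OF v(1)]
 have Pm: "P \<in> borel_measurable M" unfolding P_def measurable_wmeasure
  by (intro borel_measurable_max borel_measurable_diff Lp_M_measurable[OF uL] vm borel_measurable_const)
 have PL: "P \<in> Lp p M"
 proof (rule LpI_bound[OF Pm Lp_integrable[OF uL]])
  show "AE x in M. norm (P x) powr p \<le> norm (fst (U x)) powr p" unfolding AE_M using v(2)
   by eventually_elim (use p0 in \<open>auto simp: P_def intro!: powr_mono2\<close>)
 qed
 have main: "Lp_int p M P \<le> 2 powr p * C * theta * I" if theta: "0 < theta" for theta
 proof -
  obtain K K' where K: "0 \<le> K" "0 \<le> K'" "AE x in \<L>. \<forall>zeta xi eta. norm (xi - eta) powr p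
   \<le> theta * norm zeta powr p + K * ((a x zeta - a x eta) \<bullet> (xi - eta)) + K' * norm (xi - zeta) powr p"
   by (rule monotone_powr_perturbed[OF theta])
  \<comment> \<open>On the set where \<open>phi n\<close> exceeds \<open>v\<close> the perturbed
    monotonicity inequality is integrated; elsewhere the left side is 0 and the right side
    nonnegative.\<close>
  have st: "(LINT x|M. norm (snd (T n x)) powr p) \<le> theta * I + K * (eps n + J * k * t n) + K' * Lp_dist p M (jet (phi n)) U" for n
  proof -
   define N where "N x = operator h x (U x) \<bullet> T n x - operator h x (VK n x) \<bullet> T n x" for x
   have i1: "integrable M (\<lambda>x. operator h x (U x) \<bullet> T n x)" "integrable M (\<lambda>x. operator h x (VK n x) \<bullet> T n x)"
    by (intro B.pairing_integrable UL VKL TL)+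
   have Ni: "integrable M N" unfolding N_def by (intro B_integrable_diff i1)
   have NI: "(LINT x|M. N x) \<le> eps n"
    unfolding N_def B_integral_diff[OF i1] using A[of n] Bn[of n] by simp
   have di': "integrable M (\<lambda>x. norm (jet (phi n) x - U x) powr p)" by (rule Lp_diff_integrable[OF p0 jL UL])
   have Gi: "integrable M (\<lambda>x. norm (snd (U x)) powr p)" by (rule Lp_integrable[OF GL])
   have "(LINT x|M. norm (snd (T n x)) powr p) \<le> (LINT x|M. (theta * norm (snd (U x)) powr p
     + K * (N x + J * k * (\<bar>phi n x - fst (U x)\<bar> / w x))) + K' * norm (jet (phi n) x - U x) powr p)"
   proof (rule integral_mono_AE)
    show "AE x in M. norm (snd (T n x)) powr p \<le> (theta * norm (snd (U x)) powr p
     + K * (N x + J * k * (\<bar>phi n x - fst (U x)\<bar> / w x))) + K' * norm (jet (phi n) x - U x) powr p"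
     unfolding AE_M using K(3) v(2) weight_pos_on[OF dom_sets]
    proof eventually_elim
     case (elim x)
     have e0: "0 \<le> J * k * (\<bar>phi n x - fst (U x)\<bar> / w x)" using J k_nonneg elim(3) by simp
     show ?case
     proof (cases "v x < phi n x")
      case False
      have "0 \<le> K * (J * k * (\<bar>phi n x - fst (U x)\<bar> / w x))" by (rule mult_nonneg_nonneg[OF K(1) e0])
      then show ?thesis using False theta K(2) by (simp add: T_def N_def)
     next
      case True
      then have "phi n x \<noteq> 0" using elim(2) by simp
      then have "x \<in> closure {x. phi n x \<noteq> 0}" using closure_subset[of "{x. phi n x \<noteq> 0}"] by blast
      then have VKx: "VK n x = V x" by (simp add: VK_def)
      have Tx: "fst (T n x) = phi n x - v x" "snd (T n x) = grad (phi n) x - weak_grad \<Omega> v x" using True by (auto simp: T_def V_def jet_def)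
      let ?u = "fst (U x)" and ?m = "(a x (snd (U x)) - a x (weak_grad \<Omega> v x)) \<bullet> (grad (phi n) x - weak_grad \<Omega> v x)"
      have Nx: "N x = ?m - h x * ((g ?u - g (v x)) * (phi n x - v x)) / w x"
       unfolding N_def operator_inner VKx Tx using elim(3) by (simp add: V_def inner_diff_left field_simps)
      have "(g ?u - g (v x)) * (?u - v x) \<le> 0"
       using source_antimono[of ?u "v x"] source_antimono[of "v x" ?u] by (cases "?u \<le> v x") (auto simp: mult_le_0_iff)
      \<comment> \<open>The source terms have the right sign for \<open>u - v\<close> but are tested
        with \<open>phi n - v\<close>. The discrepancy is of the size of \<open>phi n - u\<close>,
        with factor \<open>k\<close> since the values of \<open>g\<close> lie between 0 and
        \<open>k\<close>.\<close>
      moreover have "(g ?u - g (v x)) * (phi n x - ?u) \<le> k * \<bar>phi n x - ?u\<bar>"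
       using mult_right_mono[OF source_diff_le, of "\<bar>phi n x - ?u\<bar>" ?u "v x"] by (simp flip: abs_mult)
      ultimately have gk: "(g ?u - g (v x)) * (phi n x - v x) \<le> k * \<bar>phi n x - ?u\<bar>" by (simp add: algebra_simps)
      have "h x * ((g ?u - g (v x)) * (phi n x - v x)) \<le> h x * (k * \<bar>phi n x - ?u\<bar>)" by (rule mult_left_mono[OF gk h(2)])
      also have "\<dots> \<le> J * (k * \<bar>phi n x - ?u\<bar>)" using h(3)[of x] k_nonneg by (intro mult_right_mono) auto
      finally have "h x * ((g ?u - g (v x)) * (phi n x - v x)) / w x \<le> J * (k * \<bar>phi n x - ?u\<bar>) / w x" using elim(3) by (intro divide_right_mono) auto
      then have "?m \<le> N x + J * k * (\<bar>phi n x - ?u\<bar> / w x)" unfolding Nx by (simp add: mult.assoc)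
      then have Km: "K * ?m \<le> K * (N x + J * k * (\<bar>phi n x - ?u\<bar> / w x))" by (rule mult_left_mono[OF _ K(1)])
      have "norm (grad (phi n) x - snd (U x)) \<le> norm (jet (phi n) x - U x)"
       using norm_snd_le[of "snd (jet (phi n) x - U x)" "fst (jet (phi n) x - U x)"] by (simp only: prod.collapse) (simp add: jet_def)
      then have "norm (grad (phi n) x - snd (U x)) powr p \<le> norm (jet (phi n) x - U x) powr p" using p0 by (intro powr_mono2) auto
      then have "K' * norm (grad (phi n) x - snd (U x)) powr p \<le> K' * norm (jet (phi n) x - U x) powr p" by (rule mult_left_mono[OF _ K(2)])
      then show ?thesis using elim(1)[rule_format, of "grad (phi n) x" "weak_grad \<Omega> v x" "snd (U x)"] Km unfolding Tx by linarith
     qed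
    qed
   qed (intro Lp_integrable Lp_fst_snd(2)[OF p0 TL] B_integrable_add integrable_mult_right Gi Ni di di')+
   also have "\<dots> = theta * I + K * ((LINT x|M. N x) + J * k * t n) + K' * Lp_dist p M (jet (phi n)) U"
    using Gi Ni di[of n] di' by (simp add: I_def dt flip: times_divide_eq_right)
   also have "\<dots> \<le> theta * I + K * (eps n + J * k * t n) + K' * Lp_dist p M (jet (phi n)) U"
    using NI by (intro add_right_mono add_left_mono mult_left_mono K(1)) auto
   finally show ?thesis .
  qed
  have bound: "Lp_int p M P \<le> 2 powr p * (Lp_dist p M (jet (phi n)) U
    + C * (theta * I + K * (eps n + J * k * t n) + K' * Lp_dist p M (jet (phi n)) U))" for n
  proof -
   have "Lp_int p M P \<le> (LINT x|M. 2 powr p * (norm (jet (phi n) x - U x) powr p + norm (T n x) powr p))"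
   proof (rule integral_mono[OF Lp_integrable[OF PL]])
    show "integrable M (\<lambda>x. 2 powr p * (norm (jet (phi n) x - U x) powr p + norm (T n x) powr p))"
     by (intro integrable_mult_right B_integrable_add Lp_diff_integrable p0 jL UL Lp_integrable TL)
    fix x
    have 1: "norm (phi n x - fst (U x)) \<le> norm (jet (phi n) x - U x)"
     using norm_fst_le[of "fst (jet (phi n) x - U x)" "snd (jet (phi n) x - U x)"] by (simp only: prod.collapse) (simp add: jet_def)
    have 2: "norm (fst (T n x)) \<le> norm (T n x)" by (metis norm_fst_le prod.collapse)
    have "max (phi n x - v x) 0 = fst (T n x)" by (auto simp: T_def V_def jet_def)
    then have "norm (P x) \<le> norm (jet (phi n) x - U x) + norm (T n x)" using 1 2 norm_ge_zero[of "T n x"] norm_ge_zero[of "jet (phi n) x - U x"]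
     by (auto simp: P_def max_def simp del: norm_ge_zero split: if_splits)
    then have "norm (P x) powr p \<le> (norm (jet (phi n) x - U x) + norm (T n x)) powr p" using p0 by (intro powr_mono2) auto
    also have "\<dots> \<le> 2 powr p * (norm (jet (phi n) x - U x) powr p + norm (T n x) powr p)" using p0 by (intro powr_add_le) auto
    finally show "norm (P x) powr p \<le> 2 powr p * (norm (jet (phi n) x - U x) powr p + norm (T n x) powr p)" .
   qed
   also have "\<dots> = 2 powr p * (Lp_dist p M (jet (phi n)) U + Lp_int p M (T n))"
    using Lp_diff_integrable[OF p0 jL UL, of n] Lp_integrable[OF TL, of n] by simp
   also have "\<dots> \<le> 2 powr p * (Lp_dist p M (jet (phi n)) U + C * (LINT x|M. norm (snd (T n x)) powr p))"
   proof -
    have "T n \<in> Lp_closure p M (jet ` Cc1 \<Omega>)" using Tc[of n] by (rule subsetD[OF Lp_closure_mono, rotated]) auto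
    then show ?thesis using C(2) by (intro mult_left_mono add_left_mono) auto
   qed
   also have "\<dots> \<le> 2 powr p * (Lp_dist p M (jet (phi n)) U
    + C * (theta * I + K * (eps n + J * k * t n) + K' * Lp_dist p M (jet (phi n)) U))"
    using st[of n] C(1) by (intro mult_left_mono add_left_mono) auto
   finally show ?thesis .
  qed
  have "(\<lambda>n. 2 powr p * (Lp_dist p M (jet (phi n)) U
    + C * (theta * I + K * (eps n + J * k * t n) + K' * Lp_dist p M (jet (phi n)) U)))
   \<longlonglongrightarrow> 2 powr p * (0 + C * (theta * I + K * (0 + J * k * 0) + K' * 0))"
   by (intro tendsto_intros lim t0 eps0)
  from LIMSEQ_le_const[OF this, of "Lp_int p M P"] bound show ?thesis by (auto simp: mult.assoc)
 qed
 have "Lp_int p M P \<le> 0"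
 proof (rule field_le_epsilon)
  fix e :: real assume e: "0 < e"
  define Q where "Q = 2 powr p * C * I"
  have Q: "0 \<le> Q" using C(1) I0 by (simp add: Q_def)
  have "Lp_int p M P \<le> 2 powr p * C * (e / (Q + 1)) * I" by (rule main) (use e Q in simp)
  also have "\<dots> = e * (Q / (Q + 1))" by (simp add: Q_def)
  also have "\<dots> \<le> e * 1" using e Q by (intro mult_left_mono) auto
  finally show "Lp_int p M P \<le> 0 + e" by simp
 qed
 from Lp_norm_zero_AE[OF PL this] show ?thesis unfolding AE_M by eventually_elim (simp add: P_def max_def split: if_splits)
qed

end

section \<open>Removal of the truncation of the source\<close>

context weighted_domain
begin

lemma jet_closure_diff:
 assumes U: "U \<in> Lp_closure p M (jet ` Cc1 \<Omega>)" and V: "V \<in> Lp_closure p M (jet ` Cc1 \<Omega>)"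
 shows "(\<lambda>x. U x - V x) \<in> Lp_closure p M (jet ` Cc1 \<Omega>)"
proof -
 note UL = Lp_closure_Lp[OF U] and VL = Lp_closure_Lp[OF V]
 obtain Us where Us: "\<forall>n::nat. Us n \<in> jet ` Cc1 \<Omega>" "Lp_lim p M Us U" by (rule Lp_closure_sequence[OF U])
 obtain Vs where Vs: "\<forall>n::nat. Vs n \<in> jet ` Cc1 \<Omega>" "Lp_lim p M Vs V" by (rule Lp_closure_sequence[OF V])
 have L: "Us n \<in> Lp p M" "Vs n \<in> Lp p M" for n using spec[OF Us(1), of n] spec[OF Vs(1), of n] jet_Lp by auto
 have mem: "(\<lambda>x. Us n x + (-1) *\<^sub>R Vs n x) \<in> jet ` Cc1 \<Omega>" for n
 proof -
  obtain phi psi where e: "phi \<in> Cc1 \<Omega>" "psi \<in> Cc1 \<Omega>" "Us n = jet phi" "Vs n = jet psi"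
   using spec[OF Us(1), of n] spec[OF Vs(1), of n] by auto
  have "(\<lambda>x. Us n x + (-1) *\<^sub>R Vs n x) = jet (\<lambda>x. 1 * phi x + (-1) * psi x)"
   by (rule ext) (simp only: e Cc1_linear(2)[OF e(1,2)] scaleR_one)
  then show ?thesis using Cc1_linear(1)[OF e(1,2)] by blast
 qed
 have "(\<lambda>n. Lp_dist p M (\<lambda>x. Us n x + (-1) *\<^sub>R Vs n x) (\<lambda>x. U x + (-1) *\<^sub>R V x)) \<longlonglongrightarrow> 0"
  by (intro Lp_tendsto_add Lp_tendsto_scaleR Lp_scaleR p0 L UL VL Us(2) Vs(2))
 then have "(\<lambda>x. U x + (-1) *\<^sub>R V x) \<in> Lp_closure p M (jet ` Cc1 \<Omega>)"
  by (rule Lp_closureI[OF Lp_add[OF p0 UL Lp_scaleR[OF VL]] mem])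
 then show ?thesis by simp
qed

text \<open>The excess of the limit over \<open>v\<close> is pointwise at most the distance to each
  approximant; \<open>v\<close> itself need not belong to \<open>L^p\<close>.\<close>

lemma AE_le_Lp_limit:
 fixes U :: "nat => real^'n => real \<times> (real^'n)" and v :: "real^'n => real"
 assumes U: "!!n. U n \<in> Lp p M" "Z \<in> Lp p M" "Lp_lim p M U Z"
  and v: "v \<in> borel_measurable \<L>" "!!n. AE x in \<L>. fst (U n x) \<le> v x"
 shows "AE x in \<L>. fst (Z x) \<le> v x"
proof -
 define P where "P x = max (fst (Z x) - v x) 0" for x
 have Pm: "P \<in> borel_measurable M" unfolding P_def measurable_wmeasure
  by (intro borel_measurable_max borel_measurable_diff Lp_M_measurable[OF Lp_fst_snd(1)[OF p0 U(2)]] v(1) borel_measurable_const)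
 have le: "AE x in M. norm (P x) powr p \<le> norm (U n x - Z x) powr p" for n
  unfolding AE_M using v(2)[of n]
 proof eventually_elim
  case (elim x)
  have "norm (fst (U n x) - fst (Z x)) \<le> norm (U n x - Z x)" by (metis fst_diff norm_fst_le prod.collapse)
  then have "norm (P x) \<le> norm (U n x - Z x)" using elim norm_ge_zero[of "U n x - Z x"]
   by (auto simp: P_def max_def simp del: norm_ge_zero)
  then show ?case using p0 by (intro powr_mono2) auto
 qed
 have PL: "P \<in> Lp p M" by (rule LpI_bound[OF Pm Lp_diff_integrable[OF p0 U(1,2)] le])
 have "Lp_int p M P \<le> Lp_dist p M (U n) Z" for n
  by (rule integral_mono_AE[OF Lp_integrable[OF PL] Lp_diff_integrable[OF p0 U(1,2)] le])
 then have "Lp_int p M P \<le> 0" by (intro LIMSEQ_le_const[OF U(3)]) auto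
 from Lp_norm_zero_AE[OF PL this] show ?thesis unfolding AE_M by eventually_elim (simp add: P_def max_def split: if_splits)
qed

end

context flux_source
begin

text \<open>Each solution is tested with the other. The part of the source difference that carries
  the smaller factor \<open>h\<close> has a sign by antitonicity and is dropped; the rest is
  \<open>(h' - h) * g u' * (u' - u)\<close>, at most \<open>L * (h' - h)\<close> because
  \<open>u\<close> is nonnegative and \<open>u' * g u'\<close> is bounded by
  \<open>L\<close>.\<close>

lemma solution_diff:
 assumes h: "h \<in> borel_measurable \<L>" "!!x. 0 \<le> h x" "!!x. h x \<le> J" "integrable \<L> h" and U: "solution h U"
  and h': "h' \<in> borel_measurable \<L>" "!!x. h x \<le> h' x" "!!x. h' x \<le> J'" "integrable \<L> h'" and U': "solution h' U'"
 shows "integrable M (\<lambda>x. (a x (snd (U' x)) - a x (snd (U x))) \<bullet> (snd (U' x) - snd (U x)))"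
  "(LINT x|M. (a x (snd (U' x)) - a x (snd (U x))) \<bullet> (snd (U' x) - snd (U x)))
   \<le> L * ((LINT x|\<L>. h' x) - (LINT x|\<L>. h x))"
proof -
 have h'0: "0 \<le> h' x" for x using h(2) h'(2) order_trans by blast
 have hJ: "\<bar>h x\<bar> \<le> J" "\<bar>h' x\<bar> \<le> J'" for x using h(2,3) h'0 h'(3) by simp_all
 have Uc: "U \<in> Lp_closure p M nonneg_jets" "U' \<in> Lp_closure p M nonneg_jets" using U U' by (simp_all add: solution_def)
 note UL = Lp_closure_Lp[OF Uc(1)] Lp_closure_Lp[OF Uc(2)]
 note GL = Lp_fst_snd(2)[OF p0 UL(1)] Lp_fst_snd(2)[OF p0 UL(2)]
 note uL = Lp_fst_snd(1)[OF p0 UL(1)] Lp_fst_snd(1)[OF p0 UL(2)]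
 define D where "D x = U' x - U x" for x
 have DL: "D \<in> Lp p M" unfolding D_def by (rule Lp_diff[OF p0 UL(2,1)])
 note dL = Lp_fst_snd[OF p0 DL]
 have D: "fst (D x) = fst (U' x) - fst (U x)" "snd (D x) = snd (U' x) - snd (U x)" for x by (auto simp: D_def)
 note fi = flux_pairing_integrable[OF GL(2) dL(2)] flux_pairing_integrable[OF GL(1) dL(2)]
 show "integrable M (\<lambda>x. (a x (snd (U' x)) - a x (snd (U x))) \<bullet> (snd (U' x) - snd (U x)))"
  unfolding inner_diff_left D(2)[symmetric] by (rule B_integrable_diff[OF fi])
 have 1: "0 \<le> (LINT x|M. operator h x (U x) \<bullet> D x)" unfolding D_def
  by (rule bspec[OF conjunct2[OF U[unfolded solution_def]] Uc(2)])
 have "0 \<le> (LINT x|M. operator h' x (U' x) \<bullet> (U x - U' x))"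
  by (rule bspec[OF conjunct2[OF U'[unfolded solution_def]] Uc(1)])
 also have "\<dots> = (LINT x|M. - (operator h' x (U' x) \<bullet> D x))" by (simp add: D_def inner_diff_right)
 finally have 2: "(LINT x|M. operator h' x (U' x) \<bullet> D x) \<le> 0" by simp
 note s = source_pairing(1)[OF h'(1) hJ(2) Lp_M_measurable[OF uL(2)] dL(1)] source_pairing(1)[OF h(1) hJ(1) Lp_M_measurable[OF uL(1)] dL(1)]
 have "(LINT x|M. (a x (snd (U' x)) - a x (snd (U x))) \<bullet> (snd (U' x) - snd (U x)))
   = (LINT x|M. a x (snd (U' x)) \<bullet> snd (D x)) - (LINT x|M. a x (snd (U x)) \<bullet> snd (D x))"
  unfolding inner_diff_left D(2)[symmetric] by (rule B_integral_diff[OF fi])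
 also have "\<dots> \<le> (LINT x|\<L>. h' x * g (fst (U' x)) * fst (D x)) - (LINT x|\<L>. h x * g (fst (U x)) * fst (D x))"
  using 1 2 unfolding operator_pairing[OF h(1) hJ(1) UL(1) DL] operator_pairing[OF h'(1) hJ(2) UL(2) DL] by linarith
 also have "\<dots> = (LINT x|\<L>. h' x * g (fst (U' x)) * fst (D x) - h x * g (fst (U x)) * fst (D x))"
  by (rule B_integral_diff[symmetric, OF s])
 also have "\<dots> \<le> (LINT x|\<L>. L * (h' x - h x))"
 proof (rule integral_mono_AE)
  show "AE x in \<L>. h' x * g (fst (U' x)) * fst (D x) - h x * g (fst (U x)) * fst (D x) \<le> L * (h' x - h x)"
   using nonneg_closure_AE[OF Uc(1)] nonneg_closure_AE[OF Uc(2)]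
  proof eventually_elim
   case (elim x)
   let ?u = "fst (U x)" and ?u' = "fst (U' x)"
   have "(g ?u' - g ?u) * (?u' - ?u) \<le> 0"
    using source_antimono[of ?u "?u'"] source_antimono[of "?u'" ?u] by (cases "?u \<le> ?u'") (auto simp: mult_le_0_iff)
   then have 1: "h x * ((g ?u' - g ?u) * (?u' - ?u)) \<le> 0" using h(2)[of x] by (simp add: mult_le_0_iff)
   have "g ?u' * (?u' - ?u) \<le> ?u' * g ?u'" using source_nonneg[of ?u'] elim(1) by (simp add: algebra_simps)
   also have "\<dots> \<le> L" by (rule source_mult[OF elim(2)])
   finally have "(h' x - h x) * (g ?u' * (?u' - ?u)) \<le> (h' x - h x) * L" using h'(2)[of x] by (intro mult_left_mono) auto
   with 1 show ?case by (simp add: D algebra_simps)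
  qed
 qed (intro B_integrable_diff integrable_mult_right s h(4) h'(4))+
 also have "\<dots> = L * ((LINT x|\<L>. h' x) - (LINT x|\<L>. h x))" using h(4) h'(4) by simp
 finally show "(LINT x|M. (a x (snd (U' x)) - a x (snd (U x))) \<bullet> (snd (U' x) - snd (U x)))
   \<le> L * ((LINT x|\<L>. h' x) - (LINT x|\<L>. h x))" .
qed

lemma integrable_source_test:
 assumes f: "integrable \<L> f" and u: "u \<in> borel_measurable \<L>" and phi: "phi \<in> Cc1 \<Omega>'"
 shows "integrable \<L> (\<lambda>x. f x * g (u x) * phi x)"
proof -
 note c = Cc1_D[OF phi]
 obtain B where B: "!!x. norm (phi x) \<le> B" using continuous_compact_support_bounded[OF c(4,5,7)] by blast
 have "(\<lambda>x. g (u x) * phi x) \<in> borel_measurable \<L>"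
  by (intro borel_measurable_times source_measurable u measurable_restrict_space1 borel_measurable_lebesgue_continuous c)
 moreover have "\<bar>g (u x) * phi x\<bar> \<le> k * B" for x
  unfolding abs_mult using B[of x] source_nonneg[of "u x"] source_le[of "u x"] k_nonneg by (intro mult_mono) auto
 ultimately have "integrable \<L> (\<lambda>x. (g (u x) * phi x) *\<^sub>R f x)" by (intro integrable_mult_bounded[OF f]) auto
 then show ?thesis by (simp add: mult_ac)
qed

text \<open>Truncation only decreases the source, so \<open>v\<close> is a supersolution for each
  truncated problem. The integrals of the truncated sources converge, which turns the distance
  estimate for solutions into a Cauchy property.\<close>

theorem solution_below_supersolution:
 assumes f: "integrable \<L> f" "!!x. 0 \<le> f x"
  and v: "v \<in> W1p_loc p w \<Omega>" "AE x in \<L>. 0 < v x"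
  and super: "!!q. q \<in> Cc1 \<Omega> ==> (!!x. 0 \<le> q x) ==>
   (LINT x|\<L>. f x * g (v x) * q x) \<le> (LINT x|M. a x (weak_grad \<Omega> v x) \<bullet> grad q x)"
 obtains Z where "Z \<in> Lp_closure p M nonneg_jets" "AE x in \<L>. fst (Z x) \<le> v x"
  "\<forall>phi\<in>Cc1 \<Omega>. (\<forall>x. 0 \<le> phi x) -->
   (LINT x|\<L>. f x * g (fst (Z x)) * phi x) \<le> (LINT x|M. a x (snd (Z x)) \<bullet> grad phi x)"
proof -
 have fm: "f \<in> borel_measurable \<L>" by (rule borel_measurable_integrable[OF f(1)])
 note vm = W1p_loc_measurable(1)[OF v(1)]
 define F where "F j x = min (f x) (real j)" for j :: nat and x
 have F: "F j \<in> borel_measurable \<L>" "!!x. 0 \<le> F j x" "!!x. F j x \<le> real j" "!!x. F j x \<le> f x" for j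
  using f(2) fm by (auto simp: F_def[abs_def] intro!: borel_measurable_min)
 have Fi: "integrable \<L> (F j)" for j
  by (rule B_integrable_bound[OF f(1) F(1)]) (use F(2,4) f(2) in auto)
 have Flim: "(\<lambda>j. F j x) \<longlonglongrightarrow> f x" for x
 proof (rule tendsto_eventually)
  obtain m :: nat where "f x \<le> real m" using real_arch_simple by blast
  then show "\<forall>\<^sub>F j in sequentially. F j x = f x"
   by (intro eventually_mono[OF eventually_ge_at_top[of m]]) (simp add: F_def min_def)
 qed
 define S where "S j = (LINT x|\<L>. F j x)" for j
 define S' where "S' = (LINT x|\<L>. f x)"
 have SS: "S j \<le> S'" for j unfolding S_def S'_def by (rule integral_mono[OF Fi f(1) F(4)])
 have S'0: "0 \<le> S'" unfolding S'_def using f(2) by (intro integral_nonneg_AE) auto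
 have Slim: "S \<longlonglongrightarrow> S'" unfolding S_def S'_def
  by (rule integral_dominated_convergence[where w = f]) (use f F Flim fm in auto)
 have "\<exists>U. solution (F j) U" for j by (rule solution_exists[OF F(1-3)])
 then obtain U where U: "!!j. solution (F j) (U j)" by metis
 have Uc: "U j \<in> Lp_closure p M nonneg_jets" for j using U[of j] by (simp add: solution_def)
 note UL = Lp_closure_Lp[OF Uc]
 note GL = Lp_fst_snd(2)[OF p0 UL]
 have Uv: "AE x in \<L>. fst (U j x) \<le> v x" for j
 proof (rule solution_le_supersolution[OF F(1-3) U v])
  fix q assume q: "q \<in> Cc1 \<Omega>" "!!x. (0::real) \<le> q x"
  have "(LINT x|\<L>. F j x * g (v x) * q x) \<le> (LINT x|\<L>. f x * g (v x) * q x)"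
   by (rule integral_mono[OF integrable_source_test[OF Fi vm q(1)] integrable_source_test[OF f(1) vm q(1)]])
    (intro mult_right_mono F source_nonneg q)
  also have "\<dots> \<le> (LINT x|M. a x (weak_grad \<Omega> v x) \<bullet> grad q x)" by (rule super[OF q])
  finally show "(LINT x|\<L>. F j x * g (v x) * q x) \<le> (LINT x|M. a x (weak_grad \<Omega> v x) \<bullet> grad q x)" .
 qed
 have en: "(LINT x|M. norm (snd (U j x)) powr p) \<le> L * S'" for j
  using solution_energy[OF F(1-3) Fi Uc bspec[OF conjunct2[OF U[unfolded solution_def]] Lp_closure_mem[OF p0 nonneg_jets_Lp zero_nonneg_jets]], of j] SS[of j] L_nonneg unfolding S_def by (meson mult_left_mono order_trans)
 obtain C where C: "0 < C" "\<forall>U\<in>Lp_closure p M (jet ` Cc1 \<Omega>). (Lp_int p M U) \<le> C * (LINT x|M. norm (snd (U x)) powr p)"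
  by (rule poincare_closure)
 have cauchy: "\<exists>N. \<forall>m\<ge>N. \<forall>n\<ge>N. Lp_dist p M (U m) (U n) < e" if e: "0 < e" for e
 proof -
  \<comment> \<open>Two gradients have total energy at most \<open>2 * L * S'\<close>; with this
    \<open>eps\<close> their share, after the Poincare constant, is at most
    \<open>e / 2\<close>.\<close>
  define eps where "eps = e / (4 * C * (L * S' + 1))"
  have LS: "0 \<le> L * S'" using L_nonneg S'0 by simp
  have eps: "0 < eps" using e C(1) LS by (simp add: eps_def)
  have eps2: "C * (eps * (L * S' + L * S')) \<le> e / 2"
  proof -
   have "C * (eps * (L * S' + L * S')) = (e / 2) * ((L * S') / (L * S' + 1))" using C(1) by (simp add: eps_def)
   also have "\<dots> \<le> (e / 2) * 1" using LS e by (intro mult_left_mono) auto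
   finally show ?thesis by simp
  qed
  obtain K where K: "0 \<le> K" "AE x in \<L>. \<forall>zeta eta. norm (zeta - eta) powr p
   \<le> eps * (norm zeta powr p + norm eta powr p) + K * ((a x zeta - a x eta) \<bullet> (zeta - eta))"
   by (rule monotone_powr[OF eps])
  \<comment> \<open>The admissible defect of the truncated integrals. It depends on
    \<open>K\<close>, which in turn depends on \<open>eps\<close>; after multiplication by
    \<open>C * K * L\<close> it stays below \<open>e / 2\<close>.\<close>
  define eta where "eta = e / (4 * C * (K * L + 1))"
  have KL: "0 \<le> K * L" using K(1) L_nonneg by simp
  have eta: "0 < eta" using e C(1) KL by (simp add: eta_def)
  have eta2: "C * (K * (L * eta)) < e / 2"
  proof -
   have "C * (K * (L * eta)) = (e / 4) * ((K * L) / (K * L + 1))" using C(1) by (simp add: eta_def)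
   also have "\<dots> \<le> (e / 4) * 1" using KL e by (intro mult_left_mono) auto
   finally show ?thesis using e by simp
  qed
  have "eventually (\<lambda>j. S' - eta < S j) sequentially" by (rule order_tendstoD(1)[OF Slim]) (use eta in simp)
  then obtain N where N: "!!j. N \<le> j ==> S' - eta < S j" unfolding eventually_sequentially by blast
  have le: "Lp_dist p M (U n) (U m) < e" if mn: "N \<le> m" "m \<le> n" for m n
  proof -
   have Fmn: "F m x \<le> F n x" for x using mn by (auto simp: F_def)
   note sd = solution_diff[OF F(1-3) Fi U F(1) Fmn F(3) Fi U]
   define X where "X x = (a x (snd (U n x)) - a x (snd (U m x))) \<bullet> (snd (U n x) - snd (U m x))" for x
   have X: "integrable M X" "(LINT x|M. X x) \<le> L * eta"
   proof -
    show "integrable M X" unfolding X_def by (rule sd(1))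
    have "(LINT x|M. X x) \<le> L * (S n - S m)" unfolding X_def S_def by (rule sd(2))
    also have "\<dots> \<le> L * eta" using SS[of n] N[OF mn(1)] L_nonneg by (intro mult_left_mono) auto
    finally show "(LINT x|M. X x) \<le> L * eta" .
   qed
   have d: "(\<lambda>x. U n x - U m x) \<in> Lp_closure p M (jet ` Cc1 \<Omega>)"
    by (intro jet_closure_diff nonneg_closure_jet_closure Uc)
   have gi: "integrable M (\<lambda>x. norm (snd (U n x)) powr p)" "integrable M (\<lambda>x. norm (snd (U m x)) powr p)" by (intro Lp_integrable GL)+
   have "(LINT x|M. norm (snd (U n x - U m x)) powr p) \<le> (LINT x|M. eps * (norm (snd (U n x)) powr p + norm (snd (U m x)) powr p) + K * X x)"
   proof (rule integral_mono_AE)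
    show "integrable M (\<lambda>x. norm (snd (U n x - U m x)) powr p)" by (rule Lp_integrable[OF Lp_fst_snd(2)[OF p0 Lp_closure_Lp[OF d]]])
    show "AE x in M. norm (snd (U n x - U m x)) powr p \<le> eps * (norm (snd (U n x)) powr p + norm (snd (U m x)) powr p) + K * X x"
     unfolding AE_M using K(2) by (rule eventually_mono) (simp add: X_def)
   qed (intro B_integrable_add integrable_mult_right gi X(1))
   also have "\<dots> = eps * ((LINT x|M. norm (snd (U n x)) powr p) + (LINT x|M. norm (snd (U m x)) powr p)) + K * (LINT x|M. X x)"
    using gi X(1) by simp
   also have "\<dots> \<le> eps * (L * S' + L * S') + K * (L * eta)"
    using en[of n] en[of m] X(2) eps K(1) by (intro add_mono mult_left_mono) auto
   finally have s: "(LINT x|M. norm (snd (U n x - U m x)) powr p) \<le> eps * (L * S' + L * S') + K * (L * eta)" .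
   have "Lp_dist p M (U n) (U m) \<le> C * (LINT x|M. norm (snd (U n x - U m x)) powr p)" by (rule bspec[OF C(2) d])
   also have "\<dots> \<le> C * (eps * (L * S' + L * S') + K * (L * eta))" using s C(1) by (intro mult_left_mono) auto
   also have "\<dots> < e" using eps2 eta2 unfolding distrib_left[of C] by linarith
   finally show ?thesis .
  qed
  have "Lp_dist p M (U m) (U n) < e" if "N \<le> m" "N \<le> n" for m n
  proof (cases "m \<le> n")
   case True
   have "Lp_dist p M (U n) (U m) < e" by (rule le[OF that(1) True])
   then show ?thesis by (subst Lp_dist_commute)
  next
   case False
   then show ?thesis by (intro le that) simp
  qed
  then show ?thesis by blast
 qed
 obtain Z where Z: "Z \<in> Lp p M" "Lp_lim p M U Z"
  by (rule Lp_complete[OF p0 UL cauchy])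
 have Zc: "Z \<in> Lp_closure p M nonneg_jets" by (rule Lp_closure_closed[OF p0 nonneg_jets_Lp Z(1) Uc Z(2)])
 have Zv: "AE x in \<L>. fst (Z x) \<le> v x" by (rule AE_le_Lp_limit[OF UL Z vm Uv])
 \<comment> \<open>With source factor 0 only the flux remains. Its pairing is continuous by the
   abstract result, while the source, whose bound grows with the truncation level, is treated by
   dominated convergence.\<close>
 interpret B: monotone_operator M p "operator (\<lambda>_. 0)" "1 + 0 * k" "\<lambda>x. 0 * k * (dual_weight x / w x)"
  by (rule monotone_operator_operator) auto
 \<comment> \<open>Almost everywhere convergence is wanted for the source term, since
   \<open>g\<close> is applied pointwise.\<close>
 obtain r H where r: "strict_mono (r :: nat => nat)" "integrable M H"
  "AE x in M. \<forall>n. norm (U (r n) x - Z x) powr p \<le> H x" "AE x in M. (\<lambda>n. U (r n) x) \<longlonglongrightarrow> Z x"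
  by (rule Lp_subseq_dominated[OF p0 UL Z])
 have "(LINT x|\<L>. f x * g (fst (Z x)) * phi x) \<le> (LINT x|M. a x (snd (Z x)) \<bullet> grad phi x)"
  if phi: "phi \<in> Cc1 \<Omega>" "!!x. 0 \<le> phi x" for phi
 proof -
  note c = Cc1_D[OF phi(1)]
  obtain b where b: "!!x. norm (phi x) \<le> b" using continuous_compact_support_bounded[OF c(4,5,7)] by blast
  have "(\<lambda>n. LINT x|M. operator (\<lambda>_. 0) x (U (r n) x) \<bullet> jet phi x) \<longlonglongrightarrow> (LINT x|M. operator (\<lambda>_. 0) x (Z x) \<bullet> jet phi x)"
   by (rule B.pairing_tendsto) (use UL Z jet_Lp[OF phi(1)] LIMSEQ_subseq_LIMSEQ[OF Z(2) r(1)] p0 in \<open>auto simp: o_def\<close>)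
  then have l1: "(\<lambda>n. LINT x|M. a x (snd (U (r n) x)) \<bullet> grad phi x) \<longlonglongrightarrow> (LINT x|M. a x (snd (Z x)) \<bullet> grad phi x)"
   by (simp add: operator_inner jet_def)
  note um = Lp_M_measurable[OF Lp_fst_snd(1)[OF p0 UL]] and zm = Lp_M_measurable[OF Lp_fst_snd(1)[OF p0 Z(1)]]
  have l2: "(\<lambda>n. LINT x|\<L>. F (r n) x * g (fst (U (r n) x)) * phi x) \<longlonglongrightarrow> (LINT x|\<L>. f x * g (fst (Z x)) * phi x)"
  proof (rule integral_dominated_convergence[where w = "\<lambda>x. f x * k * b"])
   show "(\<lambda>x. f x * g (fst (Z x)) * phi x) \<in> borel_measurable \<L>"
    by (rule borel_measurable_integrable[OF integrable_source_test[OF f(1) zm phi(1)]])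
   show "(\<lambda>x. F (r n) x * g (fst (U (r n) x)) * phi x) \<in> borel_measurable \<L>" for n
    by (rule borel_measurable_integrable[OF integrable_source_test[OF Fi um phi(1)]])
   show "integrable \<L> (\<lambda>x. f x * k * b)" using f(1) by simp
   show "AE x in \<L>. (\<lambda>n. F (r n) x * g (fst (U (r n) x)) * phi x) \<longlonglongrightarrow> f x * g (fst (Z x)) * phi x"
    using r(4) unfolding AE_M
   proof eventually_elim
    case (elim x)
    have "(\<lambda>n. F (r n) x) \<longlonglongrightarrow> f x" using LIMSEQ_subseq_LIMSEQ[OF Flim r(1)] by (simp add: o_def)
    moreover have "(\<lambda>n. g (fst (U (r n) x))) \<longlonglongrightarrow> g (fst (Z x))"
     using source_continuous by (intro isCont_tendsto_compose[where g = g] tendsto_fst elim) (simp add: continuous_on_eq_continuous_at)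
    ultimately show ?case by (intro tendsto_intros)
   qed
   show "AE x in \<L>. norm (F (r n) x * g (fst (U (r n) x)) * phi x) \<le> f x * k * b" for n
   proof (intro AE_I2)
    fix x
    have "\<bar>F (r n) x\<bar> \<le> f x" "\<bar>g (fst (U (r n) x))\<bar> \<le> k" "\<bar>phi x\<bar> \<le> b"
     using F(2,4) source_nonneg source_le b by (auto simp del: abs_of_nonneg simp: abs_of_nonneg)
    then show "norm (F (r n) x * g (fst (U (r n) x)) * phi x) \<le> f x * k * b"
     unfolding real_norm_def abs_mult using f(2)[of x] k_nonneg by (intro mult_mono mult_nonneg_nonneg) auto
   qed
  qed
  have "(LINT x|\<L>. F (r n) x * g (fst (U (r n) x)) * phi x) \<le> (LINT x|M. a x (snd (U (r n) x)) \<bullet> grad phi x)" for n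
   by (rule solution_super[OF F(1-3) U phi])
  then show ?thesis by (intro LIMSEQ_le[OF l2 l1]) auto
 qed
 then show thesis using that[OF Zc Zv] by blast
qed

end

section \<open>From the structural conditions to the abstract setting\<close>

lemma measurable_lebesgue_on_AE:
 fixes f g :: "'a::euclidean_space => 'b::euclidean_space"
 assumes S: "S \<in> sets lebesgue" and g: "g \<in> Lmeas S" and eq: "AE x in lebesgue_on S. f x = g x"
 shows "f \<in> Lmeas S"
proof (rule measurableI)
 fix B :: "'b set" assume B: "B \<in> sets borel"
 obtain N where N: "N \<in> null_sets (lebesgue_on S)" "{x \<in> space (lebesgue_on S). f x \<noteq> g x} \<subseteq> N"
  using eq unfolding eventually_ae_filter by auto
 have NS: "N \<subseteq> S" "N \<in> null_sets lebesgue" using N(1) S by (auto simp: null_sets_restrict_space)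
 have "f -` B \<inter> N \<in> null_sets lebesgue" by (rule null_sets_completion_subset[OF _ NS(2)]) auto
 then have 1: "f -` B \<inter> N \<in> sets (lebesgue_on S)" using S NS(1) by (auto simp: sets_restrict_space_iff)
 have 2: "(g -` B \<inter> space (lebesgue_on S)) - N \<in> sets (lebesgue_on S)"
  using measurable_sets[OF g B] N(1) by auto
 have "f -` B \<inter> space (lebesgue_on S) = ((g -` B \<inter> space (lebesgue_on S)) - N) \<union> (f -` B \<inter> N)"
  using N(2) NS(1) by auto
 then show "f -` B \<inter> space (lebesgue_on S) \<in> sets (lebesgue_on S)" using 1 2 by (metis sets.Un)
qed simp

text \<open>Growth and degeneracy with the same constant force
  \<open>A x zeta \<bullet> zeta = norm zeta powr p * w x\<close>. Hence \<open>A_bar\<close> is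
  exactly the sum of the two powers of norms, and strong monotonicity takes the form required of the
  normalized flux.\<close>

lemma flux_of_structural_conditions:
 fixes w :: "real^'n::finite => real"
 assumes W: "weighted_domain p w \<Omega>" and A: "structural_conditions p w \<Omega> A"
 obtains a c where "flux p w \<Omega> a c" "AE x in lebesgue_on \<Omega>. \<forall>zeta. A x zeta = w x *\<^sub>R a x zeta"
proof -
 interpret weighted_domain p w \<Omega> by (rule W)
 have m: "!!zeta. (\<lambda>x. A x zeta) \<in> Lmeas \<Omega>"
  and A1: "AE x in lebesgue_on \<Omega>. continuous_on UNIV (A x)"
  and A2: "AE x in lebesgue_on \<Omega>. \<forall>zeta. norm (A x zeta) \<le> norm zeta powr (p - 1) * w x"
  and A3: "AE x in lebesgue_on \<Omega>. \<forall>zeta. A x zeta \<bullet> zeta \<ge> norm zeta powr p * w x"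
  using A by (auto simp: structural_conditions_def caratheodory_def)
 have "\<exists>c>0. AE x in lebesgue_on \<Omega>. \<forall>zeta1 zeta2. zeta1 \<noteq> zeta2 --> (A x zeta1 - A x zeta2) \<bullet> (zeta1 - zeta2) \<ge>
   c * norm (zeta1 - zeta2) powr (max p 2) * A_bar w A x zeta1 zeta2 powr (1 - max p 2 / p) * w x"
  using A by (simp add: structural_conditions_def)
 then obtain c where c: "0 < c" and A4: "AE x in lebesgue_on \<Omega>. \<forall>zeta1 zeta2. zeta1 \<noteq> zeta2 --> (A x zeta1 - A x zeta2) \<bullet> (zeta1 - zeta2) \<ge>
   c * norm (zeta1 - zeta2) powr (max p 2) * A_bar w A x zeta1 zeta2 powr (1 - max p 2 / p) * w x" by blast
 have mono: "AE x in lebesgue_on \<Omega>. \<forall>zeta eta. zeta \<noteq> eta --> c * norm (zeta - eta) powr (max p 2) * (norm zeta powr p + norm eta powr p) powr (1 - max p 2 / p) * w x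
   \<le> (A x zeta - A x eta) \<bullet> (zeta - eta)"
  using A2 A3 A4 weight_pos_on[OF dom_sets]
 proof eventually_elim
  case (elim x)
  have eq: "A x zeta \<bullet> zeta = norm zeta powr p * w x" for zeta
  proof (rule antisym)
   have "A x zeta \<bullet> zeta \<le> norm (A x zeta) * norm zeta" by (rule norm_cauchy_schwarz)
   also have "\<dots> \<le> (norm zeta powr (p - 1) * w x) * norm zeta" using elim(1) by (intro mult_right_mono) auto
   also have "\<dots> = norm zeta powr p * w x" by (cases "zeta = 0") (auto simp: powr_diff)
   finally show "A x zeta \<bullet> zeta \<le> norm zeta powr p * w x" .
  qed (use elim(2) in auto)
  have "A_bar w A x zeta eta = norm zeta powr p + norm eta powr p" for zeta eta
   using elim(4) by (simp add: A_bar_def eq add_divide_distrib)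
  then show ?case using elim(3) by simp
 qed
 define good where "good x \<longleftrightarrow> 0 < w x \<and> continuous_on UNIV (A x) \<and> (\<forall>zeta. norm (A x zeta) \<le> norm zeta powr (p - 1) * w x)
  \<and> (\<forall>zeta. A x zeta \<bullet> zeta \<ge> norm zeta powr p * w x)
  \<and> (\<forall>zeta eta. zeta \<noteq> eta --> c * norm (zeta - eta) powr (max p 2) * (norm zeta powr p + norm eta powr p) powr (1 - max p 2 / p) * w x
   \<le> (A x zeta - A x eta) \<bullet> (zeta - eta))" for x
 have "AE x in lebesgue_on \<Omega>. good x"
  using A1 A2 A3 mono weight_pos_on[OF dom_sets] unfolding good_def by eventually_elim blast
 then obtain N where N: "N \<in> null_sets (lebesgue_on \<Omega>)" "{x \<in> space (lebesgue_on \<Omega>). \<not> good x} \<subseteq> N"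
  unfolding eventually_ae_filter by auto
 have good: "good x" if "x \<in> \<Omega> - N" for x using N(2) that by auto
 define a where "a x zeta = (if x \<in> \<Omega> - N then inverse (w x) *\<^sub>R A x zeta else 0)" for x zeta
 have "AE x in lebesgue_on \<Omega>. x \<notin> N" by (rule AE_not_in[OF N(1)])
 then have AEN: "AE x in lebesgue_on \<Omega>. x \<in> \<Omega> - N"
  using AE_space[of "lebesgue_on \<Omega>"] by eventually_elim simp
 have fl: "flux p w \<Omega> a c"
 proof (intro flux.intro W flux_axioms.intro c)
  show "(\<lambda>x. a x zeta) \<in> Lmeas \<Omega>" for zeta
   unfolding a_def
  proof (intro measurable_If borel_measurable_scaleR borel_measurable_inverse weight_measurable_on m borel_measurable_const)
   have "{x \<in> space (lebesgue_on \<Omega>). x \<in> \<Omega> - N} = space (lebesgue_on \<Omega>) - N" by auto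
   also have "\<dots> \<in> sets (lebesgue_on \<Omega>)" using N(1) by auto
   finally show "{x \<in> space (lebesgue_on \<Omega>). x \<in> \<Omega> - N} \<in> sets (lebesgue_on \<Omega>)" .
  qed
  show "continuous_on UNIV (a x)" for x
  proof (cases "x \<in> \<Omega> - N")
   case True
   have "continuous_on UNIV (\<lambda>zeta. inverse (w x) *\<^sub>R A x zeta)" using good[OF True] by (intro continuous_intros) (simp add: good_def)
   then show ?thesis using True by (simp add: a_def[abs_def])
  next
   case False then show ?thesis by (simp only: a_def[abs_def] if_False continuous_on_const)
  qed
  show "norm (a x zeta) \<le> norm zeta powr (p - 1)" for x zeta
  proof (cases "x \<in> \<Omega> - N")
   case True
   then have "0 < w x" "norm (A x zeta) \<le> norm zeta powr (p - 1) * w x" using good[OF True] by (simp_all add: good_def)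
   then show ?thesis using True by (simp add: a_def field_simps)
  next
   case False
   then have "a x zeta = 0" unfolding a_def by (rule if_not_P)
   then show ?thesis by simp
  qed
  show "AE x in lebesgue_on \<Omega>. \<forall>zeta. norm zeta powr p \<le> a x zeta \<bullet> zeta"
   using AEN
  proof (rule eventually_mono, intro allI)
   fix x zeta assume x: "x \<in> \<Omega> - N"
   then have "0 < w x" "norm zeta powr p * w x \<le> A x zeta \<bullet> zeta" using good[OF x] by (simp_all add: good_def)
   then show "norm zeta powr p \<le> a x zeta \<bullet> zeta" using x by (simp add: a_def field_simps)
  qed
  show "AE x in lebesgue_on \<Omega>. \<forall>zeta eta. zeta \<noteq> eta -->
   c * norm (zeta - eta) powr (max p 2) * (norm zeta powr p + norm eta powr p) powr (1 - max p 2 / p) \<le> (a x zeta - a x eta) \<bullet> (zeta - eta)"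
   using AEN
  proof (rule eventually_mono, intro allI impI)
   fix x and zeta eta :: "real^'n" assume x: "x \<in> \<Omega> - N" and ne: "zeta \<noteq> eta"
   let ?X = "c * norm (zeta - eta) powr (max p 2) * (norm zeta powr p + norm eta powr p) powr (1 - max p 2 / p)"
   have w: "0 < w x" "?X * w x \<le> (A x zeta - A x eta) \<bullet> (zeta - eta)" using good[OF x] ne by (simp_all add: good_def)
   then have "?X \<le> (A x zeta - A x eta) \<bullet> (zeta - eta) / w x" by (simp add: pos_le_divide_eq)
   also have "\<dots> = (a x zeta - a x eta) \<bullet> (zeta - eta)"
    using x by (simp add: a_def divide_inverse mult.commute flip: scaleR_diff_right)
   finally show "?X \<le> (a x zeta - a x eta) \<bullet> (zeta - eta)" .
  qed
 qed
 have "AE x in lebesgue_on \<Omega>. \<forall>zeta. A x zeta = w x *\<^sub>R a x zeta"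
  using AEN
 proof (rule eventually_mono, intro allI)
  fix x zeta assume x: "x \<in> \<Omega> - N"
  then have "0 < w x" using good[OF x] by (simp add: good_def)
  then show "A x zeta = w x *\<^sub>R a x zeta" using x by (simp add: a_def)
 qed
 with fl show thesis by (rule that)
qed

text \<open>\<open>A\<close> is well behaved only almost everywhere, so measurability of its
  composition is obtained from the corrected flux and completeness of Lebesgue measure.
  \<open>F'\<close> may be the gradient picked by the choice operator, known only up to null
  sets.\<close>

lemma (in flux) integral_flux:
 assumes A: "AE x in lebesgue_on \<Omega>. \<forall>zeta. A x zeta = w x *\<^sub>R a x zeta"
  and F: "F \<in> Lmeas \<Omega>" "AE x in lebesgue_on \<Omega>. F' x = F x" and G: "G \<in> Lmeas \<Omega>"
 shows "(LINT x|lebesgue_on \<Omega>. A x (F' x) \<bullet> G x) = (LINT x|M. a x (F x) \<bullet> G x)"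
proof -
 have m: "(\<lambda>x. a x (F x) \<bullet> G x) \<in> Lmeas \<Omega>"
  by (intro borel_measurable_inner flux_compose_measurable F G)
 have mw: "(\<lambda>x. w x *\<^sub>R (a x (F x) \<bullet> G x)) \<in> Lmeas \<Omega>"
  by (intro borel_measurable_scaleR weight_measurable_on m)
 have eq: "AE x in lebesgue_on \<Omega>. A x (F' x) \<bullet> G x = w x *\<^sub>R (a x (F x) \<bullet> G x)"
  using A F(2) by eventually_elim simp
 show ?thesis unfolding integral_wmeasure[OF dom_sets m]
  by (rule integral_cong_AE[OF measurable_lebesgue_on_AE[OF dom_sets mw eq] mw eq])
qed

text \<open>On a set of finite measure \<open>1 + \<bar>f x\<bar> powr r\<close> is an integrable
  majorant for every exponent \<open>r \<ge> 1\<close>.\<close>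

lemma Lspace_integrable:
 assumes f: "f \<in> Lspace r \<Omega>" and r: "1 \<le> r" and \<Omega>: "bounded \<Omega>" "\<Omega> \<in> sets lebesgue"
 shows "integrable (lebesgue_on \<Omega>) f"
proof (rule B_integrable_bound)
 have "\<Omega> \<in> lmeasurable" using \<Omega> by (rule bounded_set_imp_lmeasurable)
 then have "integrable (lebesgue_on \<Omega>) (\<lambda>_. 1 :: real)" by (simp add: integrable_lebesgue_on_iff \<Omega> lmeasurable_iff_integrable)
 then show "integrable (lebesgue_on \<Omega>) (\<lambda>x. 1 + \<bar>f x\<bar> powr r)" using f by (simp add: Lspace_def)
 have "\<bar>f x\<bar> \<le> 1 + \<bar>f x\<bar> powr r" for x
 proof (cases "\<bar>f x\<bar> \<le> 1")
  case True then show ?thesis using powr_ge_zero[of "\<bar>f x\<bar>" r] by linarith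
 next
  case False
  then have "\<bar>f x\<bar> powr 1 \<le> \<bar>f x\<bar> powr r" using r by (intro powr_mono) auto
  then show ?thesis by simp
 qed
 then show "AE x in lebesgue_on \<Omega>. norm (f x) \<le> norm (1 + \<bar>f x\<bar> powr r)" by (simp add: add_nonneg_nonneg)
qed (use f in \<open>simp add: Lspace_def\<close>)

theorem lemma4p6:
 fixes \<Omega> :: "(real^'n::finite) set"
  and p s \<delta> k :: real
  and w f v :: "real^'n \<Rightarrow> real"
  and A :: "real^'n \<Rightarrow> real^'n \<Rightarrow> real^'n"
 assumes "CARD('n) \<ge> 2"
  and "smooth_bounded_domain \<Omega>"
  and "1 < p"
  and "s \<ge> 1 / (p - 1)" and "s > real CARD('n) / p"
  and "As_weight p s \<Omega> w"
  and "structural_conditions p w \<Omega> A"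
  and "\<delta> > 1" and "k > 0"
  and "AE x in lebesgue_on \<Omega>. 0 \<le> f x"
  and "\<not> (AE x in lebesgue_on \<Omega>. f x = 0)"
  and "1 \<le> p_sub p s \<and> p_sub p s < real CARD('n) \<longrightarrow>
     f \<in> Lspace (conj_exp (sobolev_exp (real CARD('n)) (p_sub p s))) \<Omega>"
  and "p_sub p s = real CARD('n) \<longrightarrow> (\<exists>m>1. f \<in> Lspace m \<Omega>)"
  and "p_sub p s > real CARD('n) \<longrightarrow> f \<in> Lspace 1 \<Omega>"
  and "super_solution p \<delta> w \<Omega> A f v"
 shows "\<exists>z\<in>K_set p w \<Omega> v. \<forall>\<phi>\<in>Cc1 \<Omega>. (\<forall>x. 0 \<le> \<phi> x) \<longrightarrow>
     (\<integral>x. A x (weak_grad \<Omega> z x) \<bullet> grad \<phi> x \<partial>lebesgue_on \<Omega>) \<ge>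
     (\<integral>x. f x * g_trunc \<delta> k (z x) * \<phi> x \<partial>lebesgue_on \<Omega>)"
proof -
 have dom: "open \<Omega>" "bounded \<Omega>" using assms(2) by (simp_all add: smooth_bounded_domain_def)
 have W: "weighted_domain p w \<Omega>"
  by unfold_locales (use assms(3,6) dom in \<open>auto simp: As_weight_def\<close>)
 have f_int: "integrable (lebesgue_on \<Omega>) f"
 proof -
  define q N where "q = p_sub p s" and "N = real CARD('n)"
  have "0 < 1 / (p - 1)" using assms(3) by simp
  then have "0 < s" using assms(4) by linarith
  moreover have "1 \<le> s * (p - 1)" using assms(3,4) by (simp add: pos_divide_le_eq)
  \<comment> \<open>The second inequality is the lower bound 1 for \<open>p_sub p s\<close>, which
    is how \<open>s \<ge> 1 / (p - 1)\<close> enters.\<close>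
  ultimately have s: "0 < s" "s + 1 \<le> p * s" by (simp_all add: algebra_simps)
  then have q: "1 \<le> q" by (simp add: q_def p_sub_def)
  have "\<exists>r\<ge>1. f \<in> Lspace r \<Omega>"
  proof -
   consider "q < N" | "q = N" | "N < q" by linarith
   then show ?thesis
   proof cases
    case 1
    have "N * 1 \<le> N * q" using q 1 by (intro mult_left_mono) auto
    \<comment> \<open>This says that the Sobolev exponent exceeds 1, so its conjugate is a genuine
      exponent of at least 1.\<close>
    then have "N - q < N * q" using q by linarith
    then have t: "1 < sobolev_exp N q" using 1 by (simp add: sobolev_exp_def)
    then have "1 \<le> conj_exp (sobolev_exp N q)" by (simp add: conj_exp_def)
    moreover have "f \<in> Lspace (conj_exp (sobolev_exp N q)) \<Omega>" using assms(12) q 1 by (simp add: q_def N_def)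
    ultimately show ?thesis by blast
   next
    case 2 then show ?thesis using assms(13) less_imp_le by (auto simp: q_def N_def)
   next
    case 3 then show ?thesis using assms(14) by (auto simp: q_def N_def)
   qed
  qed
  then obtain r where "1 \<le> r" "f \<in> Lspace r \<Omega>" by blast
  then show ?thesis using dom by (intro Lspace_integrable[of f r]) auto
 qed
 obtain a c where fl: "flux p w \<Omega> a c" and Aa: "AE x in lebesgue_on \<Omega>. \<forall>zeta. A x zeta = w x *\<^sub>R a x zeta"
  by (rule flux_of_structural_conditions[OF W assms(7)])
 note gt = g_trunc[OF assms(8,9)]
 interpret flux_source p w \<Omega> a c "g_trunc \<delta> k" k "k + 1"
  by (intro flux_source.intro fl flux_source_axioms.intro gt)
 have v: "v \<in> W1p_loc p w \<Omega>" "AE x in lebesgue_on \<Omega>. 0 < v x"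
  and v_lower: "!!K. K \<Subset> \<Omega> ==> \<exists>c>0. AE x in lebesgue_on \<Omega>. x \<in> K --> c \<le> v x"
  and v_super: "!!phi. phi \<in> Cc1 \<Omega> ==> (\<forall>x. 0 \<le> phi x) ==>
    (LINT x|lebesgue_on \<Omega>. f x / v x powr \<delta> * phi x) \<le> (LINT x|lebesgue_on \<Omega>. A x (weak_grad \<Omega> v x) \<bullet> grad phi x)"
  using assms(15) by (simp_all add: super_solution_def)
 note vm = W1p_loc_measurable[OF v(1)]
 have grad_m: "phi \<in> Lmeas \<Omega>" "grad phi \<in> Lmeas \<Omega>" if "phi \<in> Cc1 \<Omega>" for phi
  by (intro measurable_restrict_space1 borel_measurable_lebesgue_continuous Cc1_D[OF that])+
 \<comment> \<open>\<open>f\<close> is nonnegative only almost everywhere, while the abstract part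
   asks for it at every point.\<close>
 define f' where "f' x = max (f x) 0" for x
 have f'_eq: "AE x in lebesgue_on \<Omega>. f' x = f x" using assms(10) by eventually_elim (simp add: f'_def)
 have f': "integrable (lebesgue_on \<Omega>) f'" "!!x. 0 \<le> f' x"
  unfolding f'_def by (auto intro: integrable_max f_int)
 have super: "(LINT x|lebesgue_on \<Omega>. f' x * g_trunc \<delta> k (v x) * q x) \<le> (LINT x|M. a x (weak_grad \<Omega> v x) \<bullet> grad q x)"
  if q: "q \<in> Cc1 \<Omega>" "!!x. 0 \<le> q x" for q
 proof -
  note cq = Cc1_D[OF q(1)]
  obtain B where B: "!!x. norm (q x) \<le> B" using continuous_compact_support_bounded[OF cq(4,5,7)] by blast
  have B0: "0 \<le> B" using B[of 0] norm_ge_zero order_trans by blast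
  have "{x. q x \<noteq> 0} \<Subset> \<Omega>" using q(1) by (simp add: Cc1_def)
  then obtain b where b: "0 < b" "AE x in lebesgue_on \<Omega>. x \<in> {x. q x \<noteq> 0} --> b \<le> v x" using v_lower by blast
  have m: "(\<lambda>x. q x / v x powr \<delta>) \<in> Lmeas \<Omega>"
  proof -
   note [measurable] = grad_m(1)[OF q(1)] vm(1)
   show ?thesis by measurable
  qed
  \<comment> \<open>Integrability has to be secured before the comparison, as otherwise the
    right-hand integral would have the default value 0. The lower bound of \<open>v\<close> on the
    support of \<open>q\<close> makes the factor of \<open>f\<close> bounded.\<close>
  have "integrable (lebesgue_on \<Omega>) (\<lambda>x. (q x / v x powr \<delta>) *\<^sub>R f x)"
  proof (rule integrable_mult_bounded[OF f_int m])
   show "AE x in lebesgue_on \<Omega>. \<bar>q x / v x powr \<delta>\<bar> \<le> B / b powr \<delta>"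
    using b(2)
   proof eventually_elim
    case (elim x)
    show ?case
    proof (cases "q x = 0")
     case True then show ?thesis using B0 by simp
    next
     case False
     then have "b powr \<delta> \<le> v x powr \<delta>" using elim b(1) assms(8) by (intro powr_mono2) auto
     then have "\<bar>q x\<bar> / v x powr \<delta> \<le> B / b powr \<delta>" using B[of x] B0 b(1) by (intro frac_le) auto
     then show ?thesis by simp
    qed
   qed
  qed
  then have i: "integrable (lebesgue_on \<Omega>) (\<lambda>x. f x / v x powr \<delta> * q x)" by (simp add: mult.commute)
  have "(LINT x|lebesgue_on \<Omega>. f' x * g_trunc \<delta> k (v x) * q x) \<le> (LINT x|lebesgue_on \<Omega>. f x / v x powr \<delta> * q x)"
  proof (rule integral_mono_AE[OF integrable_source_test[OF f'(1) vm(1) q(1)] i])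
   show "AE x in lebesgue_on \<Omega>. f' x * g_trunc \<delta> k (v x) * q x \<le> f x / v x powr \<delta> * q x"
    using f'_eq v(2)
   proof eventually_elim
    case (elim x)
    have "f' x * g_trunc \<delta> k (v x) \<le> f' x * (1 / v x powr \<delta>)" by (intro mult_left_mono gt(6) elim f'(2))
    then show ?case using elim q(2) by (intro mult_right_mono) auto
   qed
  qed
  also have "\<dots> \<le> (LINT x|lebesgue_on \<Omega>. A x (weak_grad \<Omega> v x) \<bullet> grad q x)" using v_super q by blast
  also have "\<dots> = (LINT x|M. a x (weak_grad \<Omega> v x) \<bullet> grad q x)"
   by (rule integral_flux[OF Aa vm(2) _ grad_m(2)[OF q(1)]]) simp
  finally show ?thesis .
 qed
 obtain Z where Z: "Z \<in> Lp_closure p M nonneg_jets" "AE x in lebesgue_on \<Omega>. fst (Z x) \<le> v x"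
  "\<forall>phi\<in>Cc1 \<Omega>. (\<forall>x. 0 \<le> phi x) -->
   (LINT x|lebesgue_on \<Omega>. f' x * g_trunc \<delta> k (fst (Z x)) * phi x) \<le> (LINT x|M. a x (snd (Z x)) \<bullet> grad phi x)"
  by (rule solution_below_supersolution[OF f' v super])
 note ZL = Lp_closure_Lp[OF Z(1)]
 note zm = Lp_M_measurable[OF Lp_fst_snd(1)[OF p0 ZL]] and Gm = Lp_M_measurable[OF Lp_fst_snd(2)[OF p0 ZL]]
 note W0 = W1p_0_limit[OF nonneg_closure_jet_closure[OF Z(1)]]
 show ?thesis
 proof (intro bexI[of _ "\<lambda>x. fst (Z x)"] ballI impI)
  have "AE x in lebesgue_on \<Omega>. 0 \<le> fst (Z x) \<and> fst (Z x) \<le> v x"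
   using nonneg_closure_AE[OF Z(1)] Z(2) by eventually_elim simp
  then show "(\<lambda>x. fst (Z x)) \<in> K_set p w \<Omega> v" using W0(1) by (simp add: K_set_def)
  fix phi assume phi: "phi \<in> Cc1 \<Omega>" "\<forall>x. 0 \<le> phi x"
  have "(LINT x|lebesgue_on \<Omega>. f x * g_trunc \<delta> k (fst (Z x)) * phi x) = (LINT x|lebesgue_on \<Omega>. f' x * g_trunc \<delta> k (fst (Z x)) * phi x)"
   by (rule integral_cong_AE[OF borel_measurable_integrable[OF integrable_source_test[OF f_int zm phi(1)]]
      borel_measurable_integrable[OF integrable_source_test[OF f'(1) zm phi(1)]]])
    (use f'_eq in eventually_elim, simp)
  also have "\<dots> \<le> (LINT x|M. a x (snd (Z x)) \<bullet> grad phi x)" using Z(3) phi by blast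
  also have "\<dots> = (LINT x|lebesgue_on \<Omega>. A x (weak_grad \<Omega> (\<lambda>x. fst (Z x)) x) \<bullet> grad phi x)"
   by (rule integral_flux[OF Aa Gm W0(2) grad_m(2)[OF phi(1)], symmetric])
  finally show "(LINT x|lebesgue_on \<Omega>. f x * g_trunc \<delta> k (fst (Z x)) * phi x) \<le>
   (LINT x|lebesgue_on \<Omega>. A x (weak_grad \<Omega> (\<lambda>x. fst (Z x)) x) \<bullet> grad phi x)" .
 qed
qed

end
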